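(* Let $k$ be a commutative unital ring, $\mathcal{C}$ an essentially small category, $T$ a Yoneda bifunctor for $\mathcal{C}$, and $F$ a $\mathcal{C}_T$-module of type $FP$. The following conditions are equivalent: (1) there exists an integer $n$ such that $F$ is an Eilenberg–Mac Lane functor of degree $n$; (2) there exists an integer $n$ such that $\operatorname{Ext}^i_{\mathcal{C}_T\text{-mod}}(F,T_x)=0$ for all $i\neq n$ and all objects $x$ of $\mathcal{C}$; (3) there exist an integer $n$ and a (natural) isomorphism $\operatorname{Ext}^i_{\mathcal{C}_T\text{-mod}}(F,-)\cong\operatorname{Tor}^{\mathcal{C}_T\text{-mod}}_{n-i}(D^n(F),-)$. The integer $n$ is the projective dimension of $F$ in the category $\mathcal{C}_T\text{-mod}$.
   Context: $\mathcal{C}\text{-mod}$ (resp. $\mathcal{C}^{op}\text{-mod}$) is the category of covariant functors from $\mathcal{C}$ (resp. $\mathcal{C}^{op}$) to $k$-modules. A Yoneda bifunctor for $\mathcal{C}$ is a functor $T:\mathcal{C}^{op}\times\mathcal{C}\to k\text{-mod}$ together with a surjective natural transformation $\mu$ from $(x,y)\mapsto k[\operatorname{Hom}_{\mathcal{C}}(x,y)]$ (free $k$-module on the Hom set) to $T$, such that, writing $T_a=T(a,-)$ and $T^a=T(-,a)$, the map $\operatorname{Hom}_{\mathcal{C}\text{-mod}}(T_b,T_a)\to T(a,b)$, $F\mapsto F_b(\mu_{b,b}(\mathbf{1}_b))$, is an isomorphism for all $a,b$. $\mathcal{C}_T\text{-mod}$ is the smallest full subcategory of $\mathcal{C}\text{-mod}$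 containing all $T_a$ and stable under limits and colimits; its objects are the $\mathcal{C}_T$-modules; $\mathcal{C}_{T^{op}}\text{-mod}$ is the analogous subcategory of $\mathcal{C}^{op}\text{-mod}$ containing the $T^a$. Both are abelian and the $T_a$ (resp. $T^a$), the $T$-standard projectives, form a system of projective generators. An object is of finite type if it is a quotient of a finite sum of $T$-standard projectives; it is of type $FP$ if it has a finite resolution by finite type projectives. For $F$ in $\mathcal{C}^{op}\text{-mod}$ and $G$ in $\mathcal{C}\text{-mod}$, $F\otimes_{\mathcal{C}}G$ is the quotient of $\bigoplus_{x}F(x)\otimes_kG(x)$ by the relations $F(f)a\otimes b=a\otimes G(f)b$ ($f:x\to y$, $a\in F(y)$, $b\in G(x)$); $\operatorname{Tor}^{\mathcal{C}_T\text{-mod}}_*$ denotes the left derived functors of $\otimes_{\mathcal{C}}$ on $\mathcal{C}_{T^{op}}\text{-mod}\times\mathcal{C}_T\text{-mod}$. $D:(\mathcal{C}_T\text{-mod})^{op}\to\mathcal{C}_{T^{op}}\text{-mod}$ is $DF(x)=\operatorname{Hom}_{\mathcal{C}\text{-mod}}(F,T_x)$, $RD$ its derived functor (apply $D$ to a projective resolution, with values in cochain complexes), and $D^i(F)=H^i(RD(F))$, so $D^i(F)(x)=\operatorname{Ext}^i_{\mathcal{C}_T\text{-mod}}(F,T_x)$. For an object $X$, $X[n]$ is the complex with $X$ in degree $n$ and $0$ in other degrees. $F$ is an Eilenberg–Mac Lane functor of degree $n$ if $RD(F)\cong D^n(F)[n]$ in $\mathcal{D}^+(\mathcal{C}_{T^{op}}\text{-mod})$.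 $F$ has projective dimension $n$ if $\operatorname{Ext}^m_{\mathcal{C}_T\text{-mod}}(F,G)=0$ for all $m>n$ and all $\mathcal{C}_T$-modules $G$, and $\operatorname{Ext}^n_{\mathcal{C}_T\text{-mod}}(F,G)\neq0$ for some $G$.
   Formalization: The final claim, that n is the projective dimension of F, is stated only for nonzero F: for F = 0 every integer n satisfies (1)–(3) while all Ext groups vanish, so no n is a projective dimension in the sense defined. The equivalence of (1)–(3) includes F = 0. *)

theory Defs
  imports "HOL-Algebra.Module" "HOL-Algebra.AbelCoset"
begin

section \<open>Categories and functors\<close>

text \<open>
  The sets \<open>arr C x y\<close> need not be disjoint, so identities and compositions carry their objects:
  \<open>cmp C x y z g f\<close> is the composite of \<open>f : x \<rightarrow> y\<close> and \<open>g : y \<rightarrow> z\<close>.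
\<close>

record ('o, 'a) category_data =
  obj :: "'o set"
  arr :: "'o \<Rightarrow> 'o \<Rightarrow> 'a set"
  idn :: "'o \<Rightarrow> 'a"
  cmp :: "'o \<Rightarrow> 'o \<Rightarrow> 'o \<Rightarrow> 'a \<Rightarrow> 'a \<Rightarrow> 'a"

locale category =
  fixes C :: "('o, 'a) category_data"
  assumes idn_closed: "x \<in> obj C \<Longrightarrow> idn C x \<in> arr C x x"
    and cmp_closed: "\<lbrakk>x \<in> obj C; y \<in> obj C; z \<in> obj C; f \<in> arr C x y; g \<in> arr C y z\<rbrakk>
      \<Longrightarrow> cmp C x y z g f \<in> arr C x z"
    and cmp_idn_right: "\<lbrakk>x \<in> obj C; y \<in> obj C; f \<in> arr C x y\<rbrakk> \<Longrightarrow> cmp C x x y f (idn C x) = f"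
    and cmp_idn_left: "\<lbrakk>x \<in> obj C; y \<in> obj C; f \<in> arr C x y\<rbrakk> \<Longrightarrow> cmp C x y y (idn C y) f = f"
    and cmp_assoc: "\<lbrakk>w \<in> obj C; x \<in> obj C; y \<in> obj C; z \<in> obj C;
        f \<in> arr C w x; g \<in> arr C x y; h \<in> arr C y z\<rbrakk>
      \<Longrightarrow> cmp C w x z (cmp C x y z h g) f = cmp C w y z h (cmp C w x y g f)"

definition op_cat :: "('o, 'a) category_data \<Rightarrow> ('o, 'a) category_data" where
  "op_cat C = \<lparr>obj = obj C, arr = (\<lambda>x y. arr C y x), idn = idn C,
     cmp = (\<lambda>x y z g f. cmp C z y x f g)\<rparr>"

definition prod_cat ::
  "('o, 'a) category_data \<Rightarrow> ('p, 'b) category_data \<Rightarrow> ('o \<times> 'p, 'a \<times> 'b) category_data" where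
  "prod_cat C D = \<lparr>obj = obj C \<times> obj D,
     arr = (\<lambda>x y. arr C (fst x) (fst y) \<times> arr D (snd x) (snd y)),
     idn = (\<lambda>x. (idn C (fst x), idn D (snd x))),
     cmp = (\<lambda>x y z g f. (cmp C (fst x) (fst y) (fst z) (fst g) (fst f),
                         cmp D (snd x) (snd y) (snd z) (snd g) (snd f)))\<rparr>"

definition full_subcat :: "('o, 'a) category_data \<Rightarrow> 'o set \<Rightarrow> ('o, 'a) category_data" where
  "full_subcat C X = C\<lparr>obj := obj C \<inter> X\<rparr>"

definition isomorphic :: "('o, 'a) category_data \<Rightarrow> 'o \<Rightarrow> 'o \<Rightarrow> bool" where
  "isomorphic C x y \<longleftrightarrow> x \<in> obj C \<and> y \<in> obj C \<and>
     (\<exists>f \<in> arr C x y. \<exists>g \<in> arr C y x.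
        cmp C x y x g f = idn C x \<and> cmp C y x y f g = idn C y)"

record ('o, 'a, 'p, 'b) functor_data =
  fob :: "'o \<Rightarrow> 'p"
  far :: "'o \<Rightarrow> 'o \<Rightarrow> 'a \<Rightarrow> 'b"

definition is_functor ::
  "('o, 'a) category_data \<Rightarrow> ('p, 'b) category_data \<Rightarrow> ('o, 'a, 'p, 'b) functor_data \<Rightarrow> bool" where
  "is_functor C D F \<longleftrightarrow>
     (\<forall>x \<in> obj C. fob F x \<in> obj D) \<and>
     (\<forall>x \<in> obj C. \<forall>y \<in> obj C. \<forall>f \<in> arr C x y. far F x y f \<in> arr D (fob F x) (fob F y)) \<and>
     (\<forall>x \<in> obj C. far F x x (idn C x) = idn D (fob F x)) \<and>
     (\<forall>x \<in> obj C. \<forall>y \<in> obj C. \<forall>z \<in> obj C. \<forall>f \<in> arr C x y. \<forall>g \<in> arr C y z.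
        far F x z (cmp C x y z g f) =
        cmp D (fob F x) (fob F y) (fob F z) (far F y z g) (far F x y f))"

definition op_fun :: "('o, 'a, 'p, 'b) functor_data \<Rightarrow> ('o, 'a, 'p, 'b) functor_data" where
  "op_fun F = \<lparr>fob = fob F, far = (\<lambda>x y. far F y x)\<rparr>"

definition is_cone where
  "is_cone D J Dg L l \<longleftrightarrow> L \<in> obj D \<and>
     (\<forall>j \<in> obj J. l j \<in> arr D L (fob Dg j)) \<and>
     (\<forall>i \<in> obj J. \<forall>j \<in> obj J. \<forall>f \<in> arr J i j.
        cmp D L (fob Dg i) (fob Dg j) (far Dg i j f) (l i) = l j)"

definition is_limit where
  "is_limit D J Dg L l \<longleftrightarrow> is_cone D J Dg L l \<and>
     (\<forall>L' l'. is_cone D J Dg L' l' \<longrightarrow>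
        (\<exists>!h. h \<in> arr D L' L \<and> (\<forall>j \<in> obj J. cmp D L' L (fob Dg j) (l j) h = l' j)))"

definition is_colimit where
  "is_colimit D J Dg L l \<longleftrightarrow> is_limit (op_cat D) (op_cat J) (op_fun Dg) L l"


section \<open>Modules over the base ring\<close>

text \<open>Maps are extensional (\<open>undefined\<close> off the carrier), so that equality of maps is HOL equality.\<close>

definition mod_hom ::
  "('k, 'r) ring_scheme \<Rightarrow> ('k, 'u, 'x) module_scheme \<Rightarrow> ('k, 'v, 'y) module_scheme \<Rightarrow> ('u \<Rightarrow> 'v) set"
where
  "mod_hom R M N = {f \<in> carrier M \<rightarrow>\<^sub>E carrier N.
     (\<forall>x \<in> carrier M. \<forall>y \<in> carrier M. f (x \<oplus>\<^bsub>M\<^esub> y) = f x \<oplus>\<^bsub>N\<^esub> f y) \<and>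
     (\<forall>r \<in> carrier R. \<forall>x \<in> carrier M. f (r \<odot>\<^bsub>M\<^esub> x) = r \<odot>\<^bsub>N\<^esub> f x)}"

definition mod_iso ::
  "('k, 'r) ring_scheme \<Rightarrow> ('k, 'u, 'x) module_scheme \<Rightarrow> ('k, 'v, 'y) module_scheme \<Rightarrow> ('u \<Rightarrow> 'v) set"
where
  "mod_iso R M N = {f \<in> mod_hom R M N. bij_betw f (carrier M) (carrier N)}"

text \<open>The category of modules with carrier in the type \<open>'u\<close>.\<close>

definition kmod :: "'k ring \<Rightarrow> (('k, 'u) module, 'u \<Rightarrow> 'u) category_data" where
  "kmod R = \<lparr>obj = {M. module R M}, arr = mod_hom R, idn = (\<lambda>M. \<lambda>u \<in> carrier M. u),
     cmp = (\<lambda>M N P g f. compose (carrier M) g f)\<rparr>"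

definition trivial_mod :: "('k, 'u, 'x) module_scheme \<Rightarrow> bool" where
  "trivial_mod M \<longleftrightarrow> carrier M = {\<zero>\<^bsub>M\<^esub>}"

definition free_mod :: "'k ring \<Rightarrow> 's set \<Rightarrow> ('k, 's \<Rightarrow> 'k) module" where
  "free_mod R S = \<lparr>
     carrier = {c. (\<forall>s. c s \<in> carrier R) \<and> (\<forall>s. s \<notin> S \<longrightarrow> c s = \<zero>\<^bsub>R\<^esub>) \<and> finite {s. c s \<noteq> \<zero>\<^bsub>R\<^esub>}},
     mult = undefined, one = undefined,
     zero = (\<lambda>s. \<zero>\<^bsub>R\<^esub>),
     add = (\<lambda>c d s. c s \<oplus>\<^bsub>R\<^esub> d s),
     smult = (\<lambda>r c s. r \<otimes>\<^bsub>R\<^esub> c s)\<rparr>"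

definition basis_elt :: "'k ring \<Rightarrow> 's \<Rightarrow> 's \<Rightarrow> 'k" where
  "basis_elt R s = (\<lambda>t. if t = s then \<one>\<^bsub>R\<^esub> else \<zero>\<^bsub>R\<^esub>)"

text \<open>The linear extension of a map \<open>h\<close> between bases.\<close>

definition free_map :: "'k ring \<Rightarrow> ('s \<Rightarrow> 't) \<Rightarrow> ('s \<Rightarrow> 'k) \<Rightarrow> 't \<Rightarrow> 'k" where
  "free_map R h c = (\<lambda>t. finsum R c {s. c s \<noteq> \<zero>\<^bsub>R\<^esub> \<and> h s = t})"

definition span_in :: "'k ring \<Rightarrow> ('k, 'u) module \<Rightarrow> 'u set \<Rightarrow> 'u set" where
  "span_in R M X = \<Inter>{N. submodule N R M \<and> X \<subseteq> N}"

text \<open>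
  The quotient \<open>M/N\<close> has as elements one chosen representative of each coset rather than the
  cosets themselves. It is thus a module over the same carrier type as \<open>M\<close>, and the subquotients of
  functors with values in a fixed type of modules again have values there. The canonical
  projection is \<open>coset_rep M N\<close>.
\<close>

definition coset_rep :: "('k, 'u) module \<Rightarrow> 'u set \<Rightarrow> 'u \<Rightarrow> 'u" where
  "coset_rep M N x = (SOME y. y \<in> N +>\<^bsub>M\<^esub> x)"

definition quot_mod :: "('k, 'u) module \<Rightarrow> 'u set \<Rightarrow> ('k, 'u) module" where
  "quot_mod M N = M\<lparr>
     carrier := coset_rep M N ` carrier M,
     zero := coset_rep M N \<zero>\<^bsub>M\<^esub>,
     add := (\<lambda>x y. coset_rep M N (x \<oplus>\<^bsub>M\<^esub> y)),
     smult := (\<lambda>r x. coset_rep M N (r \<odot>\<^bsub>M\<^esub> x))\<rparr>"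

definition ker_in :: "('k, 'u, 'x) module_scheme \<Rightarrow> ('u \<Rightarrow> 'v) \<Rightarrow> ('k, 'v, 'y) module_scheme \<Rightarrow> 'u set" where
  "ker_in M f N = {x \<in> carrier M. f x = \<zero>\<^bsub>N\<^esub>}"


section \<open>Cochain complexes of modules\<close>

text \<open>
  Complexes are indexed by all integers; \<open>chd K i\<close> is the differential from degree \<open>i\<close> to
  degree \<open>i + 1\<close>.
\<close>

record ('x, 'f) cochain =
  chob :: "int \<Rightarrow> 'x"
  chd :: "int \<Rightarrow> 'f"

definition cocycles :: "(('k, 'u) module, 'u \<Rightarrow> 'u) cochain \<Rightarrow> int \<Rightarrow> 'u set" where
  "cocycles K i = ker_in (chob K i) (chd K i) (chob K (i + 1))"

definition coboundaries :: "(('k, 'u) module, 'u \<Rightarrow> 'u) cochain \<Rightarrow> int \<Rightarrow> 'u set" where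
  "coboundaries K i = chd K (i - 1) ` carrier (chob K (i - 1))"

definition cohom :: "(('k, 'u) module, 'u \<Rightarrow> 'u) cochain \<Rightarrow> int \<Rightarrow> ('k, 'u) module" where
  "cohom K i = quot_mod ((chob K i)\<lparr>carrier := cocycles K i\<rparr>) (coboundaries K i)"

text \<open>The map induced in degree \<open>i\<close> by a chain map with component \<open>f\<close> in that degree.\<close>

definition cohom_map ::
  "(('k, 'u) module, 'u \<Rightarrow> 'u) cochain \<Rightarrow> (('k, 'v) module, 'v \<Rightarrow> 'v) cochain \<Rightarrow> int
     \<Rightarrow> ('u \<Rightarrow> 'v) \<Rightarrow> 'u \<Rightarrow> 'v" where
  "cohom_map K L i f = (\<lambda>u \<in> carrier (cohom K i).
     coset_rep ((chob L i)\<lparr>carrier := cocycles L i\<rparr>) (coboundaries L i) (f u))"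


section \<open>Functors with values in modules\<close>

type_synonym ('o, 'a, 'k, 'u) modfun = "('o, 'a, ('k, 'u) module, 'u \<Rightarrow> 'u) functor_data"

type_synonym ('o, 'u, 'v) nat_trans = "'o \<Rightarrow> 'u \<Rightarrow> 'v"

text \<open>Source and target may have values in different carrier types.\<close>

definition nat_hom ::
  "'k ring \<Rightarrow> ('o, 'a) category_data \<Rightarrow> ('o, 'a, 'k, 'u) modfun \<Rightarrow> ('o, 'a, 'k, 'v) modfun
     \<Rightarrow> ('o, 'u, 'v) nat_trans set" where
  "nat_hom R C F G = {e \<in> (\<Pi>\<^sub>E x \<in> obj C. mod_hom R (fob F x) (fob G x)).
     \<forall>x \<in> obj C. \<forall>y \<in> obj C. \<forall>f \<in> arr C x y. \<forall>u \<in> carrier (fob F x).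
       e y (far F x y f u) = far G x y f (e x u)}"

definition nat_id :: "('o, 'a) category_data \<Rightarrow> ('o, 'a, 'k, 'u) modfun \<Rightarrow> ('o, 'u, 'u) nat_trans" where
  "nat_id C F = (\<lambda>x \<in> obj C. \<lambda>u \<in> carrier (fob F x). u)"

definition nat_cmp ::
  "('o, 'a) category_data \<Rightarrow> ('o, 'a, 'k, 'u) modfun \<Rightarrow> ('o, 'v, 'w) nat_trans
     \<Rightarrow> ('o, 'u, 'v) nat_trans \<Rightarrow> ('o, 'u, 'w) nat_trans" where
  "nat_cmp C F h e = (\<lambda>x \<in> obj C. compose (carrier (fob F x)) (h x) (e x))"

definition nat_surj ::
  "('o, 'a) category_data \<Rightarrow> ('o, 'a, 'k, 'u) modfun \<Rightarrow> ('o, 'a, 'k, 'v) modfun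
     \<Rightarrow> ('o, 'u, 'v) nat_trans \<Rightarrow> bool" where
  "nat_surj C F G e \<longleftrightarrow> (\<forall>x \<in> obj C. e x ` carrier (fob F x) = carrier (fob G x))"

definition nat_isomorphic ::
  "'k ring \<Rightarrow> ('o, 'a) category_data \<Rightarrow> ('o, 'a, 'k, 'u) modfun \<Rightarrow> ('o, 'a, 'k, 'v) modfun \<Rightarrow> bool" where
  "nat_isomorphic R C F G \<longleftrightarrow>
     (\<exists>e \<in> nat_hom R C F G. \<forall>x \<in> obj C. e x \<in> mod_iso R (fob F x) (fob G x))"

definition hom_mod ::
  "'k ring \<Rightarrow> ('o, 'a) category_data \<Rightarrow> ('o, 'a, 'k, 'u) modfun \<Rightarrow> ('o, 'a, 'k, 'v) modfun
     \<Rightarrow> ('k, ('o, 'u, 'v) nat_trans) module" where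
  "hom_mod R C F G = \<lparr>
     carrier = nat_hom R C F G, mult = undefined, one = undefined,
     zero = (\<lambda>x \<in> obj C. \<lambda>u \<in> carrier (fob F x). \<zero>\<^bsub>fob G x\<^esub>),
     add = (\<lambda>e h. \<lambda>x \<in> obj C. \<lambda>u \<in> carrier (fob F x). e x u \<oplus>\<^bsub>fob G x\<^esub> h x u),
     smult = (\<lambda>r e. \<lambda>x \<in> obj C. \<lambda>u \<in> carrier (fob F x). r \<odot>\<^bsub>fob G x\<^esub> e x u)\<rparr>"

text \<open>\<open>C\<close>-mod, for modules with carrier in \<open>'u\<close>; apply to \<open>op_cat C\<close> for contravariant functors.\<close>

definition modcat ::
  "'k ring \<Rightarrow> ('o, 'a) category_data
     \<Rightarrow> (('o, 'a, 'k, 'u) modfun, ('o, 'u, 'u) nat_trans) category_data" where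
  "modcat R C = \<lparr>obj = {F. is_functor C (kmod R) F}, arr = nat_hom R C, idn = nat_id C,
     cmp = (\<lambda>F G H. nat_cmp C F)\<rparr>"

definition zero_functor :: "('o, 'a) category_data \<Rightarrow> ('o, 'a, 'k, 'u) modfun \<Rightarrow> bool" where
  "zero_functor C F \<longleftrightarrow> (\<forall>x \<in> obj C. trivial_mod (fob F x))"

definition direct_sum ::
  "('o, 'a, 'k, 'u) modfun list \<Rightarrow> ('o, 'a, 'k, nat \<Rightarrow> 'u) modfun" where
  "direct_sum Fs = \<lparr>
     fob = (\<lambda>x. \<lparr>
       carrier = (\<Pi>\<^sub>E i \<in> {..<length Fs}. carrier (fob (Fs ! i) x)), mult = undefined, one = undefined,
       zero = (\<lambda>i \<in> {..<length Fs}. \<zero>\<^bsub>fob (Fs ! i) x\<^esub>),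
       add = (\<lambda>u v. \<lambda>i \<in> {..<length Fs}. u i \<oplus>\<^bsub>fob (Fs ! i) x\<^esub> v i),
       smult = (\<lambda>r u. \<lambda>i \<in> {..<length Fs}. r \<odot>\<^bsub>fob (Fs ! i) x\<^esub> u i)\<rparr>),
     far = (\<lambda>x y f. \<lambda>u \<in> (\<Pi>\<^sub>E i \<in> {..<length Fs}. carrier (fob (Fs ! i) x)).
       \<lambda>i \<in> {..<length Fs}. far (Fs ! i) x y f (u i))\<rparr>"


section \<open>Yoneda bifunctors\<close>

text \<open>\<open>(x, y) \<mapsto> k[Hom(x, y)]\<close>.\<close>

definition free_hom ::
  "'k ring \<Rightarrow> ('o, 'a) category_data \<Rightarrow> ('o \<times> 'o, 'a \<times> 'a, 'k, 'a \<Rightarrow> 'k) modfun" where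
  "free_hom R C = \<lparr>
     fob = (\<lambda>(x, y). free_mod R (arr C x y)),
     far = (\<lambda>(x, y) (x', y') (f, g). \<lambda>c \<in> carrier (free_mod R (arr C x y)).
       free_map R (\<lambda>h. cmp C x' y y' g (cmp C x' x y h f)) c)\<rparr>"

text \<open>\<open>T\<^sub>a = T(a, -)\<close>, \<open>T\<^sup>a = T(-, a)\<close> and the transformation \<open>T\<^sub>f : T\<^sub>x \<rightarrow> T\<^sub>y\<close> of \<open>f : y \<rightarrow> x\<close>.\<close>

definition T_lower ::
  "('o, 'a) category_data \<Rightarrow> ('o \<times> 'o, 'a \<times> 'a, 'k, 'm) modfun \<Rightarrow> 'o \<Rightarrow> ('o, 'a, 'k, 'm) modfun" where
  "T_lower C T a = \<lparr>fob = (\<lambda>y. fob T (a, y)), far = (\<lambda>y y' g. far T (a, y) (a, y') (idn C a, g))\<rparr>"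

definition T_upper ::
  "('o, 'a) category_data \<Rightarrow> ('o \<times> 'o, 'a \<times> 'a, 'k, 'm) modfun \<Rightarrow> 'o \<Rightarrow> ('o, 'a, 'k, 'm) modfun" where
  "T_upper C T a = \<lparr>fob = (\<lambda>x. fob T (x, a)), far = (\<lambda>x x' f. far T (x, a) (x', a) (f, idn C a))\<rparr>"

definition T_lower_map ::
  "('o, 'a) category_data \<Rightarrow> ('o \<times> 'o, 'a \<times> 'a, 'k, 'm) modfun \<Rightarrow> 'o \<Rightarrow> 'o \<Rightarrow> 'a
     \<Rightarrow> ('o, 'm, 'm) nat_trans" where
  "T_lower_map C T x y f = (\<lambda>z \<in> obj C. far T (x, z) (y, z) (f, idn C z))"

definition yoneda_bifunctor ::
  "'k ring \<Rightarrow> ('o, 'a) category_data \<Rightarrow> ('o \<times> 'o, 'a \<times> 'a, 'k, 'm) modfun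
     \<Rightarrow> ('o \<times> 'o, 'a \<Rightarrow> 'k, 'm) nat_trans \<Rightarrow> bool" where
  "yoneda_bifunctor R C T \<mu> \<longleftrightarrow>
     is_functor (prod_cat (op_cat C) C) (kmod R) T \<and>
     \<mu> \<in> nat_hom R (prod_cat (op_cat C) C) (free_hom R C) T \<and>
     nat_surj (prod_cat (op_cat C) C) (free_hom R C) T \<mu> \<and>
     (\<forall>a \<in> obj C. \<forall>b \<in> obj C.
        (\<lambda>F \<in> nat_hom R C (T_lower C T b) (T_lower C T a). F b (\<mu> (b, b) (basis_elt R (idn C b))))
        \<in> mod_iso R (hom_mod R C (T_lower C T b) (T_lower C T a)) (fob T (a, b)))"


section \<open>The subcategory generated by standard objects\<close>

text \<open>
  HOL has no class of all sets: modules have their carriers in a type, which plays the role of the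
  universe. The smallness conditions say that the type \<open>'m\<close> is large enough: up to isomorphism
  the objects of \<open>C\<close>, the arrows between any two objects, and the base ring are no larger than \<open>'m\<close>.
\<close>

definition essentially_small :: "'m itself \<Rightarrow> ('o, 'a) category_data \<Rightarrow> bool" where
  "essentially_small (_ :: 'm itself) C \<longleftrightarrow>
     (\<exists>s :: 'o \<Rightarrow> 'm. \<forall>x \<in> obj C. \<forall>y \<in> obj C. s x = s y \<longrightarrow> isomorphic C x y) \<and>
     (\<forall>x \<in> obj C. \<forall>y \<in> obj C. \<exists>h :: 'a \<Rightarrow> 'm. inj_on h (arr C x y))"

definition large_type :: "'m itself \<Rightarrow> 'k ring \<Rightarrow> bool" where
  "large_type (_ :: 'm itself) R \<longleftrightarrow>
     infinite (UNIV :: 'm set) \<and> (\<exists>h :: 'k \<Rightarrow> 'm. inj_on h (carrier R))"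

text \<open>
  The smallest class of functors that contains the standard objects and is stable under
  limits and colimits of small diagrams formed in the category of all functors. The standard
  objects may come with another carrier type \<open>'t\<close>, hence the isomorphic copies; small means
  indexed by a category with objects and arrows in \<open>'u\<close>.
\<close>

inductive_set gen_mod ::
  "'k ring \<Rightarrow> ('o, 'a) category_data \<Rightarrow> ('o \<Rightarrow> ('o, 'a, 'k, 't) modfun)
     \<Rightarrow> ('o, 'a, 'k, 'u) modfun set"
  for R :: "'k ring" and C :: "('o, 'a) category_data" and S :: "'o \<Rightarrow> ('o, 'a, 'k, 't) modfun"
where
  standard: "\<lbrakk>F \<in> obj (modcat R C); a \<in> obj C; nat_isomorphic R C (S a) F\<rbrakk> \<Longrightarrow> F \<in> gen_mod R C S"
| limit: "\<lbrakk>category (J :: ('u, 'u) category_data); is_functor J (modcat R C) Dg;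
     \<forall>j \<in> obj J. fob Dg j \<in> gen_mod R C S; is_limit (modcat R C) J Dg L l\<rbrakk> \<Longrightarrow> L \<in> gen_mod R C S"
| colimit: "\<lbrakk>category (J :: ('u, 'u) category_data); is_functor J (modcat R C) Dg;
     \<forall>j \<in> obj J. fob Dg j \<in> gen_mod R C S; is_colimit (modcat R C) J Dg L l\<rbrakk> \<Longrightarrow> L \<in> gen_mod R C S"

definition gen_modcat ::
  "'k ring \<Rightarrow> ('o, 'a) category_data \<Rightarrow> ('o \<Rightarrow> ('o, 'a, 'k, 't) modfun)
     \<Rightarrow> (('o, 'a, 'k, 'u) modfun, ('o, 'u, 'u) nat_trans) category_data" where
  "gen_modcat R C S = full_subcat (modcat R C) (gen_mod R C S)"

text \<open>
  Stability under limits and colimits makes kernels and cokernels in the subcategory the pointwise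
  ones, so epimorphisms and exactness are expressed pointwise.
\<close>

definition projective_in ::
  "'k ring \<Rightarrow> ('o, 'a) category_data \<Rightarrow> ('o, 'a, 'k, 'u) modfun set \<Rightarrow> ('o, 'a, 'k, 'u) modfun \<Rightarrow> bool"
where
  "projective_in R C X P \<longleftrightarrow> P \<in> X \<and>
     (\<forall>G \<in> X. \<forall>H \<in> X. \<forall>e \<in> nat_hom R C G H. \<forall>f \<in> nat_hom R C P H.
        nat_surj C G H e \<longrightarrow> (\<exists>g \<in> nat_hom R C P G. nat_cmp C P e g = f))"

definition finite_type ::
  "'k ring \<Rightarrow> ('o, 'a) category_data \<Rightarrow> ('o \<Rightarrow> ('o, 'a, 'k, 't) modfun) \<Rightarrow> ('o, 'a, 'k, 'u) modfun \<Rightarrow> bool"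
where
  "finite_type R C S F \<longleftrightarrow>
     (\<exists>as. set as \<subseteq> obj C \<and>
        (\<exists>e \<in> nat_hom R C (direct_sum (map S as)) F. nat_surj C (direct_sum (map S as)) F e))"

type_synonym ('o, 'a, 'k, 'u) funcx = "(('o, 'a, 'k, 'u) modfun, ('o, 'u, 'u) nat_trans) cochain"

definition eval_cx ::
  "('o, 'a, 'k, 'u) funcx \<Rightarrow> 'o \<Rightarrow> (('k, 'u) module, 'u \<Rightarrow> 'u) cochain" where
  "eval_cx K x = \<lparr>chob = (\<lambda>i. fob (chob K i) x), chd = (\<lambda>i. chd K i x)\<rparr>"

definition is_complex ::
  "'k ring \<Rightarrow> ('o, 'a) category_data \<Rightarrow> ('o, 'a, 'k, 'u) modfun set \<Rightarrow> ('o, 'a, 'k, 'u) funcx \<Rightarrow> bool"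
where
  "is_complex R C X K \<longleftrightarrow>
     (\<forall>i. chob K i \<in> X) \<and>
     (\<forall>i. chd K i \<in> nat_hom R C (chob K i) (chob K (i + 1))) \<and>
     (\<forall>i. \<forall>x \<in> obj C. coboundaries (eval_cx K x) i \<subseteq> cocycles (eval_cx K x) i)"

definition cohom_fun ::
  "('o, 'a, 'k, 'u) funcx \<Rightarrow> int \<Rightarrow> ('o, 'a, 'k, 'u) modfun" where
  "cohom_fun K i = \<lparr>
     fob = (\<lambda>x. cohom (eval_cx K x) i),
     far = (\<lambda>x y f. cohom_map (eval_cx K x) (eval_cx K y) i (far (chob K i) x y f))\<rparr>"

text \<open>
  A projective resolution of \<open>F\<close> is a complex \<open>\<dots> \<rightarrow> P\<^sup>-\<^sup>1 \<rightarrow> P\<^sup>0\<close> in nonpositive degrees with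
  an augmentation \<open>e : P\<^sup>0 \<rightarrow> F\<close>.
\<close>

definition proj_resolution ::
  "'k ring \<Rightarrow> ('o, 'a) category_data \<Rightarrow> ('o, 'a, 'k, 'u) modfun set
     \<Rightarrow> ('o, 'a, 'k, 'u) funcx \<Rightarrow> ('o, 'u, 'u) nat_trans \<Rightarrow> ('o, 'a, 'k, 'u) modfun \<Rightarrow> bool" where
  "proj_resolution R C X P e F \<longleftrightarrow>
     is_complex R C X P \<and>
     (\<forall>i. projective_in R C X (chob P i)) \<and>
     (\<forall>i > 0. zero_functor C (chob P i)) \<and>
     (\<forall>i < 0. \<forall>x \<in> obj C. cocycles (eval_cx P x) i = coboundaries (eval_cx P x) i) \<and>
     e \<in> nat_hom R C (chob P 0) F \<and>
     nat_surj C (chob P 0) F e \<and>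
     (\<forall>x \<in> obj C. ker_in (fob (chob P 0) x) (e x) (fob F x) = coboundaries (eval_cx P x) 0)"

definition some_resolution ::
  "'k ring \<Rightarrow> ('o, 'a) category_data \<Rightarrow> ('o, 'a, 'k, 'u) modfun set
     \<Rightarrow> ('o, 'a, 'k, 'u) modfun \<Rightarrow> ('o, 'a, 'k, 'u) funcx" where
  "some_resolution R C X F = (SOME P. \<exists>e. proj_resolution R C X P e F)"

definition type_FP ::
  "'k ring \<Rightarrow> ('o, 'a) category_data \<Rightarrow> ('o \<Rightarrow> ('o, 'a, 'k, 't) modfun) \<Rightarrow> ('o, 'a, 'k, 'u) modfun \<Rightarrow> bool"
where
  "type_FP R C S F \<longleftrightarrow>
     (\<exists>P e. proj_resolution R C (gen_mod R C S) P e F \<and>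
        (\<forall>i. finite_type R C S (chob P i)) \<and>
        (\<exists>N. \<forall>i < N. zero_functor C (chob P i)))"


section \<open>Ext\<close>

definition hom_map ::
  "'k ring \<Rightarrow> ('o, 'a) category_data \<Rightarrow> ('o, 'a, 'k, 'u) modfun \<Rightarrow> ('o, 'a, 'k, 'u) modfun
     \<Rightarrow> ('o, 'a, 'k, 'v) modfun \<Rightarrow> ('o, 'u, 'u) nat_trans
     \<Rightarrow> ('o, 'u, 'v) nat_trans \<Rightarrow> ('o, 'u, 'v) nat_trans" where
  "hom_map R C P Q G d = (\<lambda>h \<in> nat_hom R C Q G. nat_cmp C P h d)"

text \<open>The complex with \<open>Hom(P\<^sup>-\<^sup>i, G)\<close> in degree \<open>i\<close>.\<close>

definition hom_cx ::
  "'k ring \<Rightarrow> ('o, 'a) category_data \<Rightarrow> ('o, 'a, 'k, 'u) funcx \<Rightarrow> ('o, 'a, 'k, 'v) modfun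
     \<Rightarrow> (('k, ('o, 'u, 'v) nat_trans) module, ('o, 'u, 'v) nat_trans \<Rightarrow> ('o, 'u, 'v) nat_trans) cochain"
where
  "hom_cx R C P G = \<lparr>
     chob = (\<lambda>i. hom_mod R C (chob P (- i)) G),
     chd = (\<lambda>i. hom_map R C (chob P (- i - 1)) (chob P (- i)) G (chd P (- i - 1)))\<rparr>"

text \<open>\<open>Ext\<^sup>i(F, -)\<close> on the subcategory with object class \<open>X\<close>.\<close>

definition Ext ::
  "'k ring \<Rightarrow> ('o, 'a) category_data \<Rightarrow> ('o, 'a, 'k, 'u) modfun set \<Rightarrow> int \<Rightarrow> ('o, 'a, 'k, 'u) modfun
     \<Rightarrow> (('o, 'a, 'k, 'u) modfun, ('o, 'u, 'u) nat_trans, 'k, ('o, 'u, 'u) nat_trans) modfun" where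
  "Ext R C X i F = (let P = some_resolution R C X F in \<lparr>
     fob = (\<lambda>G. cohom (hom_cx R C P G) i),
     far = (\<lambda>G G' p. cohom_map (hom_cx R C P G) (hom_cx R C P G') i
              (\<lambda>h. nat_cmp C (chob P (- i)) p h))\<rparr>)"

definition has_proj_dim ::
  "'k ring \<Rightarrow> ('o, 'a) category_data \<Rightarrow> ('o, 'a, 'k, 'u) modfun set \<Rightarrow> ('o, 'a, 'k, 'u) modfun
     \<Rightarrow> int \<Rightarrow> bool" where
  "has_proj_dim R C X F n \<longleftrightarrow>
     (\<forall>m > n. \<forall>G \<in> X. trivial_mod (fob (Ext R C X m F) G)) \<and>
     (\<exists>G \<in> X. \<not> trivial_mod (fob (Ext R C X n F) G))"


section \<open>Tensor product and Tor\<close>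

text \<open>
  The quotient of \<open>\<Oplus>\<^sub>x F(x) \<otimes> G(x)\<close> presented by generators \<open>(x, a, b)\<close>, standing for \<open>a \<otimes> b\<close>
  in the summand at \<open>x\<close>: the first four families of relations present \<open>F(x) \<otimes>\<^sub>k G(x)\<close>.
  Here \<open>F\<close> is a functor on \<open>op_cat C\<close> and \<open>G\<close> a functor on \<open>C\<close>.
\<close>

definition tensor_gens ::
  "('o, 'a) category_data \<Rightarrow> ('o, 'a, 'k, 'u) modfun \<Rightarrow> ('o, 'a, 'k, 'v) modfun \<Rightarrow> ('o \<times> 'u \<times> 'v) set" where
  "tensor_gens C F G = {(x, a, b). x \<in> obj C \<and> a \<in> carrier (fob F x) \<and> b \<in> carrier (fob G x)}"

definition tensor_rels ::
  "'k ring \<Rightarrow> ('o, 'a) category_data \<Rightarrow> ('o, 'a, 'k, 'u) modfun \<Rightarrow> ('o, 'a, 'k, 'v) modfun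
     \<Rightarrow> ('o \<times> 'u \<times> 'v \<Rightarrow> 'k) set" where
  "tensor_rels R C F G = (let M = free_mod R (tensor_gens C F G); \<beta> = basis_elt R in
     {\<beta> (x, a \<oplus>\<^bsub>fob F x\<^esub> a', b) \<ominus>\<^bsub>M\<^esub> (\<beta> (x, a, b) \<oplus>\<^bsub>M\<^esub> \<beta> (x, a', b)) | x a a' b.
        x \<in> obj C \<and> a \<in> carrier (fob F x) \<and> a' \<in> carrier (fob F x) \<and> b \<in> carrier (fob G x)} \<union>
     {\<beta> (x, a, b \<oplus>\<^bsub>fob G x\<^esub> b') \<ominus>\<^bsub>M\<^esub> (\<beta> (x, a, b) \<oplus>\<^bsub>M\<^esub> \<beta> (x, a, b')) | x a b b'.
        x \<in> obj C \<and> a \<in> carrier (fob F x) \<and> b \<in> carrier (fob G x) \<and> b' \<in> carrier (fob G x)} \<union>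
     {\<beta> (x, r \<odot>\<^bsub>fob F x\<^esub> a, b) \<ominus>\<^bsub>M\<^esub> (r \<odot>\<^bsub>M\<^esub> \<beta> (x, a, b)) | x r a b.
        x \<in> obj C \<and> r \<in> carrier R \<and> a \<in> carrier (fob F x) \<and> b \<in> carrier (fob G x)} \<union>
     {\<beta> (x, a, r \<odot>\<^bsub>fob G x\<^esub> b) \<ominus>\<^bsub>M\<^esub> (r \<odot>\<^bsub>M\<^esub> \<beta> (x, a, b)) | x r a b.
        x \<in> obj C \<and> r \<in> carrier R \<and> a \<in> carrier (fob F x) \<and> b \<in> carrier (fob G x)} \<union>
     {\<beta> (x, far F y x f a, b) \<ominus>\<^bsub>M\<^esub> \<beta> (y, a, far G x y f b) | x y f a b.
        x \<in> obj C \<and> y \<in> obj C \<and> f \<in> arr C x y \<and> a \<in> carrier (fob F y) \<and> b \<in> carrier (fob G x)})"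

definition tensor_proj ::
  "'k ring \<Rightarrow> ('o, 'a) category_data \<Rightarrow> ('o, 'a, 'k, 'u) modfun \<Rightarrow> ('o, 'a, 'k, 'v) modfun
     \<Rightarrow> ('o \<times> 'u \<times> 'v \<Rightarrow> 'k) \<Rightarrow> ('o \<times> 'u \<times> 'v \<Rightarrow> 'k)" where
  "tensor_proj R C F G = (let M = free_mod R (tensor_gens C F G) in
     coset_rep M (span_in R M (tensor_rels R C F G)))"

definition tensor ::
  "'k ring \<Rightarrow> ('o, 'a) category_data \<Rightarrow> ('o, 'a, 'k, 'u) modfun \<Rightarrow> ('o, 'a, 'k, 'v) modfun
     \<Rightarrow> ('k, 'o \<times> 'u \<times> 'v \<Rightarrow> 'k) module" where
  "tensor R C F G = (let M = free_mod R (tensor_gens C F G) in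
     quot_mod M (span_in R M (tensor_rels R C F G)))"

definition tensor_map ::
  "'k ring \<Rightarrow> ('o, 'a) category_data \<Rightarrow> ('o, 'a, 'k, 'u) modfun \<Rightarrow> ('o, 'a, 'k, 'v) modfun
     \<Rightarrow> ('o, 'a, 'k, 'u') modfun \<Rightarrow> ('o, 'a, 'k, 'v') modfun
     \<Rightarrow> ('o, 'u, 'u') nat_trans \<Rightarrow> ('o, 'v, 'v') nat_trans
     \<Rightarrow> ('o \<times> 'u \<times> 'v \<Rightarrow> 'k) \<Rightarrow> ('o \<times> 'u' \<times> 'v' \<Rightarrow> 'k)" where
  "tensor_map R C F G F' G' p q = (\<lambda>c \<in> carrier (tensor R C F G).
     tensor_proj R C F' G' (free_map R (\<lambda>(x, a, b). (x, p x a, q x b)) c))"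

definition tensor_cx ::
  "'k ring \<Rightarrow> ('o, 'a) category_data \<Rightarrow> ('o, 'a, 'k, 'u) funcx \<Rightarrow> ('o, 'a, 'k, 'v) modfun
     \<Rightarrow> (('k, 'o \<times> 'u \<times> 'v \<Rightarrow> 'k) module, ('o \<times> 'u \<times> 'v \<Rightarrow> 'k) \<Rightarrow> ('o \<times> 'u \<times> 'v \<Rightarrow> 'k)) cochain"
where
  "tensor_cx R C P G = \<lparr>
     chob = (\<lambda>i. tensor R C (chob P i) G),
     chd = (\<lambda>i. tensor_map R C (chob P i) G (chob P (i + 1)) G (chd P i) (nat_id C G))\<rparr>"

text \<open>
  \<open>Tor\<^sub>j(F, -)\<close>, computed from a projective resolution of \<open>F\<close> among the contravariant functors
  in \<open>X\<close>; homological degree \<open>j\<close> is cohomological degree \<open>-j\<close>.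
\<close>

definition Tor ::
  "'k ring \<Rightarrow> ('o, 'a) category_data \<Rightarrow> ('o, 'a, 'k, 'u) modfun set \<Rightarrow> int \<Rightarrow> ('o, 'a, 'k, 'u) modfun
     \<Rightarrow> (('o, 'a, 'k, 'v) modfun, ('o, 'v, 'v) nat_trans, 'k, 'o \<times> 'u \<times> 'v \<Rightarrow> 'k) modfun" where
  "Tor R C X j F = (let P = some_resolution R (op_cat C) X F in \<lparr>
     fob = (\<lambda>G. cohom (tensor_cx R C P G) (- j)),
     far = (\<lambda>G G' q. cohom_map (tensor_cx R C P G) (tensor_cx R C P G') (- j)
              (tensor_map R C (chob P (- j)) G (chob P (- j)) G' (nat_id C (chob P (- j))) q))\<rparr>)"


section \<open>Localization and the bounded below derived category\<close>

text \<open>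
  The localization of a category \<open>D\<close> at arrows \<open>W\<close>: its arrows are the classes of zigzags of
  arrows of \<open>D\<close> and formal inverses of arrows in \<open>W\<close>, modulo the congruence generated by the
  composition of \<open>D\<close> and the cancellation of formal inverses. Zigzags are read from source to target.
  In \<open>Fwd x f y\<close> the arrow is \<open>f : x \<rightarrow> y\<close>; in \<open>Bwd x s y\<close> it is \<open>s : y \<rightarrow> x\<close>.
\<close>

datatype ('x, 'f) step = Fwd 'x 'f 'x | Bwd 'x 'f 'x

inductive zigzag ::
  "('x, 'f) category_data \<Rightarrow> ('x \<Rightarrow> 'x \<Rightarrow> 'f set) \<Rightarrow> 'x \<Rightarrow> ('x, 'f) step list \<Rightarrow> 'x \<Rightarrow> bool"
  for D W where
  nil: "x \<in> obj D \<Longrightarrow> zigzag D W x [] x"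
| fwd: "\<lbrakk>x \<in> obj D; f \<in> arr D x y; zigzag D W y p z\<rbrakk> \<Longrightarrow> zigzag D W x (Fwd x f y # p) z"
| bwd: "\<lbrakk>x \<in> obj D; s \<in> W y x; zigzag D W y p z\<rbrakk> \<Longrightarrow> zigzag D W x (Bwd x s y # p) z"

inductive zigzag_eq ::
  "('x, 'f) category_data \<Rightarrow> ('x \<Rightarrow> 'x \<Rightarrow> 'f set) \<Rightarrow> 'x \<Rightarrow> 'x
     \<Rightarrow> ('x, 'f) step list \<Rightarrow> ('x, 'f) step list \<Rightarrow> bool"
  for D W where
  refl: "zigzag D W x p y \<Longrightarrow> zigzag_eq D W x y p p"
| sym: "zigzag_eq D W x y p q \<Longrightarrow> zigzag_eq D W x y q p"
| trans: "\<lbrakk>zigzag_eq D W x y p q; zigzag_eq D W x y q r\<rbrakk> \<Longrightarrow> zigzag_eq D W x y p r"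
| cong: "\<lbrakk>zigzag D W x u x'; zigzag_eq D W x' y' p q; zigzag D W y' v y\<rbrakk>
    \<Longrightarrow> zigzag_eq D W x y (u @ p @ v) (u @ q @ v)"
| idn: "x \<in> obj D \<Longrightarrow> zigzag_eq D W x x [Fwd x (idn D x) x] []"
| cmp: "\<lbrakk>x \<in> obj D; y \<in> obj D; z \<in> obj D; f \<in> arr D x y; g \<in> arr D y z\<rbrakk>
    \<Longrightarrow> zigzag_eq D W x z [Fwd x f y, Fwd y g z] [Fwd x (cmp D x y z g f) z]"
| inv_right: "\<lbrakk>x \<in> obj D; y \<in> obj D; s \<in> W x y\<rbrakk> \<Longrightarrow> zigzag_eq D W x x [Fwd x s y, Bwd y s x] []"
| inv_left: "\<lbrakk>x \<in> obj D; y \<in> obj D; s \<in> W x y\<rbrakk> \<Longrightarrow> zigzag_eq D W y y [Bwd y s x, Fwd x s y] []"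

definition localization ::
  "('x, 'f) category_data \<Rightarrow> ('x \<Rightarrow> 'x \<Rightarrow> 'f set) \<Rightarrow> ('x, ('x, 'f) step list set) category_data" where
  "localization D W = \<lparr>
     obj = obj D,
     arr = (\<lambda>x y. {p. zigzag D W x p y} // {(p, q). zigzag_eq D W x y p q}),
     idn = (\<lambda>x. {q. zigzag_eq D W x x [] q}),
     cmp = (\<lambda>x y z B A. {r. \<exists>p \<in> A. \<exists>q \<in> B. zigzag_eq D W x z (p @ q) r})\<rparr>"

definition chain_maps ::
  "'k ring \<Rightarrow> ('o, 'a) category_data \<Rightarrow> ('o, 'a, 'k, 'u) funcx \<Rightarrow> ('o, 'a, 'k, 'u) funcx
     \<Rightarrow> (int \<Rightarrow> ('o, 'u, 'u) nat_trans) set" where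
  "chain_maps R C K L = {p. \<forall>i. p i \<in> nat_hom R C (chob K i) (chob L i) \<and>
     nat_cmp C (chob K i) (chd L i) (p i) = nat_cmp C (chob K i) (p (i + 1)) (chd K i)}"

definition cx_plus ::
  "'k ring \<Rightarrow> ('o, 'a) category_data \<Rightarrow> ('o, 'a, 'k, 'u) modfun set
     \<Rightarrow> (('o, 'a, 'k, 'u) funcx, int \<Rightarrow> ('o, 'u, 'u) nat_trans) category_data" where
  "cx_plus R C X = \<lparr>
     obj = {K. is_complex R C X K \<and> (\<exists>N. \<forall>i < N. zero_functor C (chob K i))},
     arr = chain_maps R C,
     idn = (\<lambda>K i. nat_id C (chob K i)),
     cmp = (\<lambda>K L M q p i. nat_cmp C (chob K i) (q i) (p i))\<rparr>"

definition quasi_isos ::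
  "'k ring \<Rightarrow> ('o, 'a) category_data \<Rightarrow> ('o, 'a, 'k, 'u) funcx \<Rightarrow> ('o, 'a, 'k, 'u) funcx
     \<Rightarrow> (int \<Rightarrow> ('o, 'u, 'u) nat_trans) set" where
  "quasi_isos R C K L = {p \<in> chain_maps R C K L. \<forall>i. \<forall>x \<in> obj C.
     cohom_map (eval_cx K x) (eval_cx L x) i (p i x)
       \<in> mod_iso R (cohom (eval_cx K x) i) (cohom (eval_cx L x) i)}"

definition derived_plus ::
  "'k ring \<Rightarrow> ('o, 'a) category_data \<Rightarrow> ('o, 'a, 'k, 'u) modfun set
     \<Rightarrow> (('o, 'a, 'k, 'u) funcx,
         (('o, 'a, 'k, 'u) funcx, int \<Rightarrow> ('o, 'u, 'u) nat_trans) step list set) category_data" where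
  "derived_plus R C X = localization (cx_plus R C X) (quasi_isos R C)"

definition zero_fun :: "('o, 'a, 'k, 'u) modfun" where
  "zero_fun = \<lparr>
     fob = (\<lambda>x. \<lparr>carrier = {undefined}, mult = undefined, one = undefined, zero = undefined,
       add = (\<lambda>u v. undefined), smult = (\<lambda>r u. undefined)\<rparr>),
     far = (\<lambda>x y f. \<lambda>u \<in> {undefined}. undefined)\<rparr>"

text \<open>\<open>F[n]\<close>: the complex with \<open>F\<close> in degree \<open>n\<close> and zero in the other degrees.\<close>

definition concentrated ::
  "'k ring \<Rightarrow> ('o, 'a) category_data \<Rightarrow> ('o, 'a, 'k, 'u) modfun \<Rightarrow> int \<Rightarrow> ('o, 'a, 'k, 'u) funcx" where
  "concentrated R C F n = (let X = (\<lambda>i. if i = n then F else zero_fun) in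
     \<lparr>chob = X, chd = (\<lambda>i. zero (hom_mod R C (X i) (X (i + 1))))\<rparr>)"


section \<open>Modules over a Yoneda bifunctor and duality\<close>

text \<open>
  The values of \<open>D\<close> have natural transformations as elements, so contravariant functors are taken
  with carriers in \<open>'o \<Rightarrow> 'm \<Rightarrow> 'm\<close>, which is at least as large as \<open>'m\<close>.
\<close>

definition CT_mod ::
  "'k ring \<Rightarrow> ('o, 'a) category_data \<Rightarrow> ('o \<times> 'o, 'a \<times> 'a, 'k, 'm) modfun
     \<Rightarrow> ('o, 'a, 'k, 'm) modfun set" where
  "CT_mod R C T = gen_mod R C (T_lower C T)"

definition CTop_mod ::
  "'k ring \<Rightarrow> ('o, 'a) category_data \<Rightarrow> ('o \<times> 'o, 'a \<times> 'a, 'k, 'm) modfun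
     \<Rightarrow> ('o, 'a, 'k, ('o, 'm, 'm) nat_trans) modfun set" where
  "CTop_mod R C T = gen_mod R (op_cat C) (T_upper C T)"

definition dual ::
  "'k ring \<Rightarrow> ('o, 'a) category_data \<Rightarrow> ('o \<times> 'o, 'a \<times> 'a, 'k, 'm) modfun
     \<Rightarrow> ('o, 'a, 'k, 'm) modfun \<Rightarrow> ('o, 'a, 'k, ('o, 'm, 'm) nat_trans) modfun" where
  "dual R C T F = \<lparr>
     fob = (\<lambda>x. hom_mod R C F (T_lower C T x)),
     far = (\<lambda>x y f. \<lambda>h \<in> nat_hom R C F (T_lower C T x). nat_cmp C F (T_lower_map C T x y f) h)\<rparr>"

definition dual_map ::
  "'k ring \<Rightarrow> ('o, 'a) category_data \<Rightarrow> ('o \<times> 'o, 'a \<times> 'a, 'k, 'm) modfun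
     \<Rightarrow> ('o, 'a, 'k, 'm) modfun \<Rightarrow> ('o, 'a, 'k, 'm) modfun \<Rightarrow> ('o, 'm, 'm) nat_trans
     \<Rightarrow> ('o, ('o, 'm, 'm) nat_trans, ('o, 'm, 'm) nat_trans) nat_trans" where
  "dual_map R C T F G d = (\<lambda>x \<in> obj C. hom_map R C F G (T_lower C T x) d)"

definition RD ::
  "'k ring \<Rightarrow> ('o, 'a) category_data \<Rightarrow> ('o \<times> 'o, 'a \<times> 'a, 'k, 'm) modfun
     \<Rightarrow> ('o, 'a, 'k, 'm) modfun \<Rightarrow> ('o, 'a, 'k, ('o, 'm, 'm) nat_trans) funcx" where
  "RD R C T F = (let P = some_resolution R C (CT_mod R C T) F in \<lparr>
     chob = (\<lambda>i. dual R C T (chob P (- i))),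
     chd = (\<lambda>i. dual_map R C T (chob P (- i - 1)) (chob P (- i)) (chd P (- i - 1)))\<rparr>)"

definition Dn ::
  "'k ring \<Rightarrow> ('o, 'a) category_data \<Rightarrow> ('o \<times> 'o, 'a \<times> 'a, 'k, 'm) modfun \<Rightarrow> int
     \<Rightarrow> ('o, 'a, 'k, 'm) modfun \<Rightarrow> ('o, 'a, 'k, ('o, 'm, 'm) nat_trans) modfun" where
  "Dn R C T n F = cohom_fun (RD R C T F) n"

definition eilenberg_maclane ::
  "'k ring \<Rightarrow> ('o, 'a) category_data \<Rightarrow> ('o \<times> 'o, 'a \<times> 'a, 'k, 'm) modfun
     \<Rightarrow> ('o, 'a, 'k, 'm) modfun \<Rightarrow> int \<Rightarrow> bool" where
  "eilenberg_maclane R C T F n \<longleftrightarrow>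
     isomorphic (derived_plus R (op_cat C) (CTop_mod R C T))
       (RD R C T F) (concentrated R (op_cat C) (Dn R C T n F) n)"

definition Ext_T ::
  "'k ring \<Rightarrow> ('o, 'a) category_data \<Rightarrow> ('o \<times> 'o, 'a \<times> 'a, 'k, 'm) modfun \<Rightarrow> int
     \<Rightarrow> ('o, 'a, 'k, 'm) modfun
     \<Rightarrow> (('o, 'a, 'k, 'm) modfun, ('o, 'm, 'm) nat_trans, 'k, ('o, 'm, 'm) nat_trans) modfun" where
  "Ext_T R C T i F = Ext R C (CT_mod R C T) i F"

definition Tor_T ::
  "'k ring \<Rightarrow> ('o, 'a) category_data \<Rightarrow> ('o \<times> 'o, 'a \<times> 'a, 'k, 'm) modfun \<Rightarrow> int
     \<Rightarrow> ('o, 'a, 'k, ('o, 'm, 'm) nat_trans) modfun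
     \<Rightarrow> (('o, 'a, 'k, 'm) modfun, ('o, 'm, 'm) nat_trans, 'k,
         'o \<times> ('o, 'm, 'm) nat_trans \<times> 'm \<Rightarrow> 'k) modfun" where
  "Tor_T R C T j F = Tor R C (CTop_mod R C T) j F"

definition ext_vanishing ::
  "'k ring \<Rightarrow> ('o, 'a) category_data \<Rightarrow> ('o \<times> 'o, 'a \<times> 'a, 'k, 'm) modfun
     \<Rightarrow> ('o, 'a, 'k, 'm) modfun \<Rightarrow> int \<Rightarrow> bool" where
  "ext_vanishing R C T F n \<longleftrightarrow>
     (\<forall>i. i \<noteq> n \<longrightarrow> (\<forall>x \<in> obj C. trivial_mod (fob (Ext_T R C T i F) (T_lower C T x))))"

definition ext_tor_duality ::
  "'k ring \<Rightarrow> ('o, 'a) category_data \<Rightarrow> ('o \<times> 'o, 'a \<times> 'a, 'k, 'm) modfun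
     \<Rightarrow> ('o, 'a, 'k, 'm) modfun \<Rightarrow> int \<Rightarrow> bool" where
  "ext_tor_duality R C T F n \<longleftrightarrow>
     (\<forall>i. nat_isomorphic R (gen_modcat R C (T_lower C T))
            (Ext_T R C T i F) (Tor_T R C T (n - i) (Dn R C T n F)))"

end

theory Submission
  imports Defs
begin

text \<open>
  The values \<open>T(a, b)\<close> are the morphisms of a quotient of the \<open>k\<close>-linearization of \<open>C\<close>, and the
  \<open>C\<^sub>T\<close>-modules are the functors that factor through it. Hence there are enough projectives, and two
  complexes of projectives, each zero in large degrees, with the same cohomology in a single degree are
  homotopy equivalent. Let \<open>Q \<rightarrow> F\<close> be a finite resolution by projectives of finite type. Then
  \<open>DQ\<close> consists of projectives of finite type, and \<open>DQ \<otimes> G \<cong> Hom(Q, G)\<close>. Under (2), \<open>DQ\<close> has its only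
  cohomology \<open>D\<^sup>n(F)\<close> in degree \<open>n\<close>, so it is homotopy equivalent to a projective resolution of \<open>D\<^sup>n(F)\<close>
  shifted by \<open>n\<close>, which gives (3). Conversely \<open>- \<otimes> T\<^sub>x\<close> is evaluation at \<open>x\<close>, so \<open>Tor\<^sub>j(-, T\<^sub>x) = 0\<close> for
  \<open>j \<noteq> 0\<close>, and (3) gives (2). Cohomology is invariant under isomorphism in the derived category,
  so (1) implies (2); truncation gives the converse.
\<close>

text \<open>The composition of the quotient category is never written down: an element
  \<open>t\<close> of \<open>T(a, x)\<close> acts on a module \<open>G\<close> through the
  transformation \<open>T_a \<rightarrow> G\<close> that an element of \<open>G(a)\<close>
  determines, and associativity becomes uniqueness of such transformations. Two features of the
  definitions shape the rest. The resolution in \<open>RD\<close>, \<open>Ext\<close> and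
  \<open>Tor\<close> is an arbitrary choice, perhaps infinite and not of finite type, whereas
  \<open>DQ \<otimes> G \<cong> Hom(Q, G)\<close> rests on finite type; so everything is carried
  along a homotopy equivalence between the chosen resolution and \<open>Q\<close>. Homotopies matter
  because tensoring with \<open>G\<close> respects homotopy equivalences but in general not
  quasi-isomorphisms. Moreover the modules form a closure under limits and colimits among functors
  with carriers in one fixed type. Free functors on all elements of a given functor must fit into
  that type; they do since it is infinite and can code its own finite subsets, and since objects of
  \<open>C\<close> may be replaced by representatives of isomorphism classes.\<close>

abbreviation madd ("_ +[_] _" [65, 0, 66] 65) where "x +[M] y \<equiv> x \<oplus>\<^bsub>M\<^esub> y"
abbreviation mminus ("_ -[_] _" [65, 0, 66] 65) where "x -[M] y \<equiv> x \<ominus>\<^bsub>M\<^esub> y"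
abbreviation mscale ("_ *[_] _" [71, 0, 70] 70) where "r *[M] x \<equiv> r \<odot>\<^bsub>M\<^esub> x"
abbreviation mzero ("0[_]") where "0[M] \<equiv> \<zero>\<^bsub>M\<^esub>"

abbreviation el where "el F x \<equiv> carrier (fob F x)"
abbreviation modf where "modf R C \<equiv> is_functor C (kmod R)"

section \<open>Linear maps and quotients\<close>

text \<open>Unlike \<open>mod_hom\<close>, \<open>lin\<close> and later \<open>natl\<close> do not ask for extensionality.\<close>

definition lin ::
 "('k, 'r) ring_scheme => ('k, 'u, 'x) module_scheme => ('k, 'v, 'y) module_scheme => ('u => 'v) => bool"
where
 "lin R M N f \<longleftrightarrow> (\<forall>x \<in> carrier M. f x \<in> carrier N) \<and>
   (\<forall>x \<in> carrier M. \<forall>y \<in> carrier M. f (x +[M] y) = f x +[N] f y) \<and>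
   (\<forall>r \<in> carrier R. \<forall>x \<in> carrier M. f (r *[M] x) = r *[N] f x)"

lemma linI:
 assumes "!!x. x \<in> carrier M ==> f x \<in> carrier N"
  and "!!x y. x \<in> carrier M ==> y \<in> carrier M ==> f (x +[M] y) = f x +[N] f y"
  and "!!r x. r \<in> carrier R ==> x \<in> carrier M ==> f (r *[M] x) = r *[N] f x"
 shows "lin R M N f" using assms by (simp add: lin_def)

lemma lin_closed: "lin R M N f ==> x \<in> carrier M ==> f x \<in> carrier N"
 and lin_add: "lin R M N f ==> x \<in> carrier M ==> y \<in> carrier M ==> f (x +[M] y) = f x +[N] f y"
 and lin_smult: "lin R M N f ==> r \<in> carrier R ==> x \<in> carrier M ==> f (r *[M] x) = r *[N] f x"
 by (simp_all add: lin_def)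

lemma mod_hom_iff: "f \<in> mod_hom R M N \<longleftrightarrow> lin R M N f \<and> f \<in> extensional (carrier M)"
 by (auto simp: mod_hom_def lin_def PiE_def)

lemma lin_cong:
 "lin R M N f ==> module R M ==> (\<And>x. x \<in> carrier M ==> g x = f x) ==> lin R M N g"
proof -
 assume f: "lin R M N f" and M: "module R M" and g: "!!x. x \<in> carrier M ==> g x = f x"
 interpret M: module R M by (rule M)
 show ?thesis using f g by (simp add: lin_def)
qed

lemma restrict_mod_hom: "lin R M N f ==> module R M ==> restrict f (carrier M) \<in> mod_hom R M N"
 by (auto simp: mod_hom_iff intro: lin_cong)

lemma lin_compose: "lin R M N f ==> lin R N P g ==> lin R M P (\<lambda>x. g (f x))" by (simp add: lin_def)

lemma lin_id: "lin R M M (\<lambda>x. x)" by (simp add: lin_def)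

lemma minus_eq_zero_iff:
 assumes "module R M" "x \<in> carrier M" "y \<in> carrier M"
 shows "x -[M] y = 0[M] \<longleftrightarrow> x = y"
proof
 interpret M: module R M by fact
 show "x = y" if "x -[M] y = 0[M]"
 proof -
  have "x = (x -[M] y) +[M] y" using assms by (simp add: M.minus_eq M.a_assoc M.l_neg)
  then show ?thesis using that assms by simp
 qed
 show "x -[M] y = 0[M]" if "x = y" using that assms by (simp add: M.minus_eq M.r_neg)
qed

lemma add_minus_cancel:
 assumes "module R M" "x \<in> carrier M" "y \<in> carrier M"
 shows "(x +[M] y) -[M] y = x"
proof -
 interpret M: module R M by fact
 show ?thesis using assms by (simp add: M.minus_eq M.a_assoc M.r_neg)
qed

lemma lin_zero:
 assumes "module R M" "module R N" "lin R M N f"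
 shows "f 0[M] = 0[N]"
proof -
 interpret M: module R M by fact
 interpret N: module R N by fact
 have c: "f 0[M] \<in> carrier N" using assms(3) by (simp add: lin_closed)
 have "f 0[M] +[N] f 0[M] = f 0[M]" using lin_add[OF assms(3), of "0[M]" "0[M]"] by simp
 then show ?thesis using c N.add.l_cancel_one by simp
qed

lemma lin_neg:
 assumes "module R M" "module R N" "lin R M N f" "x \<in> carrier M"
 shows "f (\<ominus>\<^bsub>M\<^esub> x) = \<ominus>\<^bsub>N\<^esub> f x"
proof -
 interpret M: module R M by fact
 interpret N: module R N by fact
 have "f (\<ominus>\<^bsub>M\<^esub> x) +[N] f x = f (\<ominus>\<^bsub>M\<^esub> x +[M] x)" using assms by (simp add: lin_add)
 also have "\<dots> = 0[N]" using assms by (simp add: M.l_neg lin_zero)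
 finally show ?thesis using assms by (intro N.minus_equality[symmetric]) (auto simp: lin_closed)
qed

lemma lin_minus:
 assumes "module R M" "module R N" "lin R M N f" "x \<in> carrier M" "y \<in> carrier M"
 shows "f (x -[M] y) = f x -[N] f y"
proof -
 interpret M: module R M by fact
 show ?thesis using assms by (simp add: a_minus_def lin_add lin_neg lin_closed)
qed

lemma lin_const_zero: "module R N ==> lin R M N (\<lambda>x. 0[N])"
proof -
 assume "module R N"
 then interpret N: module R N .
 show ?thesis by (simp add: lin_def)
qed

lemma lin_pointwise_add:
 assumes "module R N" "lin R M N f" "lin R M N g"
 shows "lin R M N (\<lambda>x. f x +[N] g x)"
proof -
 interpret N: module R N by fact
 show ?thesis using assms(2,3) by (auto simp: lin_def N.smult_r_distr N.a_ac)
qed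

lemma lin_pointwise_smult:
 assumes "module R N" "lin R M N f" "r \<in> carrier R"
 shows "lin R M N (\<lambda>x. r *[N] f x)"
proof -
 interpret N: module R N by fact
 show ?thesis using assms(2,3) by (auto simp: lin_def N.smult_r_distr simp flip: N.smult_assoc1 simp: N.R.m_comm)
qed

lemma lin_pointwise_neg:
 assumes "module R N" "lin R M N f"
 shows "lin R M N (\<lambda>x. \<ominus>\<^bsub>N\<^esub> f x)"
proof -
 interpret N: module R N by fact
 show ?thesis using assms(2) by (auto simp: lin_def N.smult_r_minus N.minus_add)
qed

lemma lin_pointwise_minus:
 assumes "module R N" "lin R M N f" "lin R M N g"
 shows "lin R M N (\<lambda>x. f x -[N] g x)" unfolding a_minus_def by (intro lin_pointwise_add lin_pointwise_neg assms)

lemma lin_inverse: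
 assumes "module R M" "lin R M N f" "bij_betw f (carrier M) (carrier N)"
  and g: "!!x. x \<in> carrier M ==> g (f x) = x"
 shows "lin R N M g"
proof (rule linI)
 interpret M: module R M by fact
 have s: "\<exists>x \<in> carrier M. f x = y" if "y \<in> carrier N" for y
  using assms(3) that unfolding bij_betw_def by (metis imageE)
 show "g y \<in> carrier M" if "y \<in> carrier N" for y using s[OF that] g by auto
 show "g (y +[N] z) = g y +[M] g z" if "y \<in> carrier N" "z \<in> carrier N" for y z
  using s[OF that(1)] s[OF that(2)] g assms(2) by (auto simp: lin_add[symmetric])
 show "g (r *[N] y) = r *[M] g y" if "r \<in> carrier R" "y \<in> carrier N" for r y
  using s[OF that(2)] g assms(2) that(1) by (auto simp: lin_smult[symmetric])
qed

lemma mod_isoI: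
 assumes "f \<in> mod_hom R M N" "inj_on f (carrier M)" "carrier N \<subseteq> f ` carrier M"
 shows "f \<in> mod_iso R M N" using assms by (auto simp: mod_iso_def bij_betw_def mod_hom_iff lin_closed)

lemma lin_inj_onI:
 assumes M: "module R M" and N: "module R N" and f: "lin R M N f"
  and k: "!!x. x \<in> carrier M ==> f x = 0[N] ==> x = 0[M]"
 shows "inj_on f (carrier M)"
proof (rule inj_onI)
 interpret M: module R M by (rule M)
 interpret N: module R N by (rule N)
 fix x y assume h: "x \<in> carrier M" "y \<in> carrier M" "f x = f y"
 have "f (x -[M] y) = 0[N]" using h by (simp add: lin_minus[OF M N f] lin_closed[OF f] minus_eq_zero_iff[OF N])
 then show "x = y" using k[of "x -[M] y"] h minus_eq_zero_iff[OF M] by simp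
qed

text \<open>The module laws are equations, so they pass to the image of any surjection that respects
  the operations; \<open>N\<close> is not assumed to be a module beforehand. Quotients, transported
  structures and free modules obtain their module laws from this.\<close>

lemma module_surj:
 assumes M: "module R M" and f: "lin R M N f" and s: "carrier N \<subseteq> f ` carrier M" and z: "f 0[M] = 0[N]"
 shows "module R N"
proof -
 interpret M: module R M by (rule M)
 have p: "\<exists>x \<in> carrier M. u = f x" if "u \<in> carrier N" for u using s that by auto
 note a = lin_add[OF f, symmetric] and t = lin_smult[OF f, symmetric] and c = lin_closed[OF f]
 show ?thesis
 proof (rule moduleI[OF M.R.is_cring])
  show "abelian_group N"
  proof (rule abelian_groupI)
   show "0[N] \<in> carrier N" using c[of "0[M]"] z by simp
   fix u v assume "u \<in> carrier N" "v \<in> carrier N"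
   then obtain x y where x: "x \<in> carrier M" "u = f x" and y: "y \<in> carrier M" "v = f y" using p by metis
   show "u +[N] v \<in> carrier N" using x y by (simp add: a c)
   show "u +[N] v = v +[N] u" using x y by (simp add: a M.a_comm)
   show "0[N] +[N] u = u" using x by (simp add: a z[symmetric])
   show "\<exists>v \<in> carrier N. v +[N] u = 0[N]"
    using x by (intro bexI[of _ "f (\<ominus>\<^bsub>M\<^esub> x)"]) (simp_all add: a c z[symmetric] M.l_neg)
   fix w assume "w \<in> carrier N"
   then obtain t where t: "t \<in> carrier M" "w = f t" using p by metis
   show "(u +[N] v) +[N] w = u +[N] (v +[N] w)" using x y t by (simp add: a M.a_assoc)
  qed
 next
  fix r r' u v assume r: "r \<in> carrier R" and r': "r' \<in> carrier R" and "u \<in> carrier N" "v \<in> carrier N"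
  then obtain x y where x: "x \<in> carrier M" "u = f x" and y: "y \<in> carrier M" "v = f y" using p by metis
  show "r *[N] u \<in> carrier N" using x r by (simp add: t c)
  show "(r +[R] r') *[N] u = r *[N] u +[N] r' *[N] u" using x r r' by (simp add: t a M.smult_l_distr)
  show "r *[N] (u +[N] v) = r *[N] u +[N] r *[N] v" using x y r by (simp add: t a M.smult_r_distr)
  show "(r \<otimes>\<^bsub>R\<^esub> r') *[N] u = r *[N] (r' *[N] u)" using x r r' by (simp add: t M.smult_assoc1)
 next
  show "\<one>\<^bsub>R\<^esub> *[N] u = u" if "u \<in> carrier N" for u using p[OF that] by (auto simp: t)
 qed
qed

text \<open>Negation is scalar multiplication by -1, so closure under it follows from the other
  conditions.\<close>

lemma submoduleI':
 assumes "module R M" "N \<subseteq> carrier M" "0[M] \<in> N"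
  and add: "!!a b. a \<in> N ==> b \<in> N ==> a +[M] b \<in> N"
  and smult: "!!r a. r \<in> carrier R ==> a \<in> N ==> r *[M] a \<in> N"
 shows "submodule N R M"
proof -
 interpret M: module R M by fact
 have "\<ominus>\<^bsub>M\<^esub> a \<in> N" if "a \<in> N" for a
 proof -
  have "\<ominus>\<^bsub>M\<^esub> a = (\<ominus>\<^bsub>R\<^esub> \<one>\<^bsub>R\<^esub>) *[M] a" using that assms(2) by (auto simp: M.smult_l_minus)
  then show ?thesis using smult[of "\<ominus>\<^bsub>R\<^esub> \<one>\<^bsub>R\<^esub>" a] that by simp
 qed
 then show ?thesis using assms(2-) by (intro M.submoduleI) auto
qed

lemma submoduleD:
 assumes "module R M" "submodule N R M"
 shows "N \<subseteq> carrier M" "0[M] \<in> N"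
  "a \<in> N ==> b \<in> N ==> a +[M] b \<in> N" "a \<in> N ==> b \<in> N ==> a -[M] b \<in> N"
  "r \<in> carrier R ==> a \<in> N ==> r *[M] a \<in> N" "a \<in> N ==> \<ominus>\<^bsub>M\<^esub> a \<in> N"
proof -
 interpret M: module R M by fact
 note E = M.submoduleE[OF assms(2)]
 show "N \<subseteq> carrier M" "a \<in> N ==> b \<in> N ==> a +[M] b \<in> N"
  "r \<in> carrier R ==> a \<in> N ==> r *[M] a \<in> N" "a \<in> N ==> \<ominus>\<^bsub>M\<^esub> a \<in> N" using E by blast+
 show "0[M] \<in> N" using assms(2) by (meson additive_subgroup.zero_closed additive_subgroupI submodule_def)
 show "a \<in> N ==> b \<in> N ==> a -[M] b \<in> N" using E(3,5) by (auto simp: a_minus_def)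
qed

lemma submodule_module: "module R M ==> submodule N R M ==> module R (M\<lparr>carrier := N\<rparr>)"
 by (rule submodule.submodule_is_module)

text \<open>Zero, addition and scalars of the restricted record are those of \<open>M\<close> by
  definition. Negation is a definite description over the carrier, so for it an argument is
  required.\<close>

lemma a_inv_restrict:
 assumes M: "module R M" and N: "submodule N R M" and a: "a \<in> N"
 shows "\<ominus>\<^bsub>M\<lparr>carrier := N\<rparr>\<^esub> a = \<ominus>\<^bsub>M\<^esub> a"
proof -
 interpret M: module R M by (rule M)
 interpret N: module R "M\<lparr>carrier := N\<rparr>" by (rule submodule_module[OF M N])
 note D = submoduleD[OF M N]
 have "\<ominus>\<^bsub>M\<^esub> a +[M\<lparr>carrier := N\<rparr>] a = 0[M\<lparr>carrier := N\<rparr>]" using a D(1) by (auto simp: M.l_neg)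
 then show ?thesis using a D(6) by (intro N.minus_equality) auto
qed

lemma minus_restrict:
 assumes "module R M" "submodule N R M" "b \<in> N"
 shows "a -[M\<lparr>carrier := N\<rparr>] b = a -[M] b" using assms by (simp add: a_minus_def a_inv_restrict)

lemma ker_submodule:
 assumes M: "module R M" and N: "module R N" and f: "lin R M N f"
 shows "submodule (ker_in M f N) R M"
proof -
 interpret M: module R M by fact
 interpret N: module R N by fact
 show ?thesis by (rule submoduleI'[OF M]) (auto simp: ker_in_def lin_add[OF f] lin_smult[OF f] lin_zero[OF M N f])
qed

lemma image_submodule:
 assumes M: "module R M" and N: "module R N" and f: "lin R M N f"
 shows "submodule (f ` carrier M) R N"
proof -
 interpret M: module R M by fact
 interpret N: module R N by fact
 show ?thesis
 proof (rule submoduleI'[OF N])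
  show "f ` carrier M \<subseteq> carrier N" using f by (auto simp: lin_closed)
  show "0[N] \<in> f ` carrier M" using lin_zero[OF M N f] by (metis M.zero_closed imageI)
 qed (auto simp: lin_add[OF f, symmetric] lin_smult[OF f, symmetric])
qed

lemma sub_submodule:
 assumes M: "module R M" and N: "submodule N R M" and B: "submodule B R M" "B \<subseteq> N"
 shows "submodule B R (M\<lparr>carrier := N\<rparr>)"
 using submoduleD[OF M B(1)] B(2) by (intro submoduleI' submodule_module M N) auto

locale module_quotient =
 fixes R :: "('k, 'r) ring_scheme" and M :: "('k, 'u) module" and N :: "'u set"
 assumes M: "module R M" and N: "submodule N R M"
begin

interpretation M: module R M by (rule M)

lemma coset_rep_in: "x \<in> carrier M ==> \<exists>h \<in> N. coset_rep M N x = h +[M] x"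
proof -
 assume x: "x \<in> carrier M"
 have "0[M] +[M] x \<in> N +>\<^bsub>M\<^esub> x" using submoduleD(2)[OF M N] by (auto simp: a_r_coset_def')
 then have "coset_rep M N x \<in> N +>\<^bsub>M\<^esub> x" unfolding coset_rep_def by (rule someI)
 then show ?thesis by (auto simp: a_r_coset_def')
qed

lemma coset_rep_closed: "x \<in> carrier M ==> coset_rep M N x \<in> carrier M"
 using coset_rep_in submoduleD(1)[OF M N] by (metis M.a_closed subsetD)

lemma coset_rep_minus: "x \<in> carrier M ==> coset_rep M N x -[M] x \<in> N"
proof -
 assume x: "x \<in> carrier M"
 from coset_rep_in[OF x] obtain h where h: "h \<in> N" "coset_rep M N x = h +[M] x" by auto
 have "h \<in> carrier M" using h submoduleD(1)[OF M N] by auto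
 then have "coset_rep M N x -[M] x = h" using h x by (simp add: M.minus_eq M.a_assoc M.r_neg)
 then show ?thesis using h by simp
qed

lemma coset_rep_eq_iff:
 assumes x: "x \<in> carrier M" and y: "y \<in> carrier M"
 shows "coset_rep M N x = coset_rep M N y \<longleftrightarrow> x -[M] y \<in> N"
proof
 assume e: "coset_rep M N x = coset_rep M N y"
 let ?c = "coset_rep M N x"
 have c: "?c \<in> carrier M" using x by (rule coset_rep_closed)
 have "(?c -[M] y) -[M] (?c -[M] x) \<in> N"
  using coset_rep_minus[OF x] coset_rep_minus[OF y] e submoduleD(4)[OF M N] by simp
 also have "(?c -[M] y) -[M] (?c -[M] x) = x -[M] y"
  using x y c by (simp add: M.minus_eq M.minus_add M.a_ac M.r_neg M.r_neg1 M.r_neg2)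
 finally show "x -[M] y \<in> N" .
next
 assume d: "x -[M] y \<in> N"
 \<comment> \<open>The representative is chosen from the coset as a set, so equality of the two sets
   suffices.\<close>
 have "N +>\<^bsub>M\<^esub> x = N +>\<^bsub>M\<^esub> y"
 proof (rule Set.set_eqI)
  fix z
  have "(\<exists>h \<in> N. z = h +[M] x) \<longleftrightarrow> (\<exists>h \<in> N. z = h +[M] y)"
  proof
   assume "\<exists>h \<in> N. z = h +[M] x"
   then obtain h where h: "h \<in> N" "z = h +[M] x" by auto
   have hM: "h \<in> carrier M" using h submoduleD(1)[OF M N] by auto
   have "z = (h +[M] (x -[M] y)) +[M] y" using hM x y h by (simp add: M.minus_eq M.a_assoc M.l_neg)
   then show "\<exists>h \<in> N. z = h +[M] y" using h d submoduleD(3)[OF M N] by blast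
  next
   assume "\<exists>h \<in> N. z = h +[M] y"
   then obtain h where h: "h \<in> N" "z = h +[M] y" by auto
   have hM: "h \<in> carrier M" using h submoduleD(1)[OF M N] by auto
   have "z = (h -[M] (x -[M] y)) +[M] x"
    proof -
    have "(h -[M] (x -[M] y)) +[M] x = (h +[M] y) +[M] (x +[M] \<ominus>\<^bsub>M\<^esub> x)"
     using hM x y by (simp add: M.minus_eq M.minus_add M.a_ac del: M.r_neg)
    then show ?thesis using hM y h x by (simp add: M.r_neg)
   qed
   then show "\<exists>h \<in> N. z = h +[M] x" using h d submoduleD(4)[OF M N] by blast
  qed
  then show "z \<in> N +>\<^bsub>M\<^esub> x \<longleftrightarrow> z \<in> N +>\<^bsub>M\<^esub> y" by (auto simp: a_r_coset_def')
 qed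
 then show "coset_rep M N x = coset_rep M N y" by (simp add: coset_rep_def)
qed

lemma coset_rep_eqI:
 "x \<in> carrier M ==> y \<in> carrier M ==> x -[M] y \<in> N ==> coset_rep M N x = coset_rep M N y"
 by (simp add: coset_rep_eq_iff)

lemma coset_rep_idem: "x \<in> carrier M ==> coset_rep M N (coset_rep M N x) = coset_rep M N x"
 by (intro coset_rep_eqI coset_rep_closed coset_rep_minus)

lemma coset_rep_fixed: "u \<in> carrier (quot_mod M N) ==> coset_rep M N u = u"
 by (auto simp: quot_mod_def coset_rep_idem)

lemma quot_carrier_subset: "u \<in> carrier (quot_mod M N) ==> u \<in> carrier M"
 by (auto simp: quot_mod_def coset_rep_closed)

lemma coset_rep_in_quot: "x \<in> carrier M ==> coset_rep M N x \<in> carrier (quot_mod M N)" by (auto simp: quot_mod_def)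

lemma coset_rep_add:
 assumes x: "x \<in> carrier M" and y: "y \<in> carrier M"
 shows "coset_rep M N (coset_rep M N x +[M] coset_rep M N y) = coset_rep M N (x +[M] y)"
proof (rule coset_rep_eqI)
 let ?x = "coset_rep M N x" and ?y = "coset_rep M N y"
 have c: "?x \<in> carrier M" "?y \<in> carrier M" using x y by (auto intro: coset_rep_closed)
 have "(?x +[M] ?y) -[M] (x +[M] y) = (?x -[M] x) +[M] (?y -[M] y)"
  using x y c by (simp add: M.minus_eq M.minus_add M.a_ac)
 then show "(?x +[M] ?y) -[M] (x +[M] y) \<in> N"
  using coset_rep_minus[OF x] coset_rep_minus[OF y] submoduleD(3)[OF M N] by simp
qed (use x y coset_rep_closed in auto)

lemma coset_rep_smult:
 assumes r: "r \<in> carrier R" and x: "x \<in> carrier M"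
 shows "coset_rep M N (r *[M] coset_rep M N x) = coset_rep M N (r *[M] x)"
proof (rule coset_rep_eqI)
 let ?x = "coset_rep M N x"
 have c: "?x \<in> carrier M" using x by (auto intro: coset_rep_closed)
 have "r *[M] ?x -[M] r *[M] x = r *[M] (?x -[M] x)"
  using r x c by (simp add: M.minus_eq M.smult_r_distr M.smult_r_minus)
 then show "r *[M] ?x -[M] r *[M] x \<in> N" using coset_rep_minus[OF x] r submoduleD(5)[OF M N] by simp
qed (use r x coset_rep_closed in auto)

lemma coset_rep_lin: "lin R M (quot_mod M N) (coset_rep M N)"
 by (rule linI) (auto simp: quot_mod_def coset_rep_add coset_rep_smult)

lemma quot_module: "module R (quot_mod M N)" by (rule module_surj[OF M coset_rep_lin]) (auto simp: quot_mod_def)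

lemma coset_rep_zero_iff:
 assumes x: "x \<in> carrier M"
 shows "coset_rep M N x = 0[quot_mod M N] \<longleftrightarrow> x \<in> N"
proof -
 have "\<ominus>\<^bsub>M\<^esub> 0[M] = 0[M]" by (rule M.minus_equality) simp_all
 then have "x -[M] 0[M] = x" using x by (simp only: M.minus_eq M.r_zero)
 then show ?thesis using coset_rep_eq_iff[OF x, of "0[M]"] by (simp add: quot_mod_def)
qed

lemma quot_zero_iff: "u \<in> carrier (quot_mod M N) ==> u = 0[quot_mod M N] \<longleftrightarrow> u \<in> N"
 using coset_rep_zero_iff[of u] coset_rep_fixed quot_carrier_subset by metis

lemma trivial_quot_iff: "trivial_mod (quot_mod M N) \<longleftrightarrow> carrier M \<subseteq> N"
proof
 assume t: "trivial_mod (quot_mod M N)"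
 show "carrier M \<subseteq> N"
 proof
  fix x assume x: "x \<in> carrier M"
  then have "coset_rep M N x = 0[quot_mod M N]" using t coset_rep_in_quot[OF x] by (auto simp: trivial_mod_def)
  then show "x \<in> N" using x coset_rep_zero_iff by blast
 qed
next
 assume n: "carrier M \<subseteq> N"
 interpret Q: module R "quot_mod M N" by (rule quot_module)
 show "trivial_mod (quot_mod M N)" unfolding trivial_mod_def
 proof
  show "carrier (quot_mod M N) \<subseteq> {0[quot_mod M N]}" using n quot_zero_iff quot_carrier_subset by blast
 qed auto
qed

text \<open>Since the elements of the quotient are representatives, a map that kills \<open>N\<close> induces itself.\<close>

lemma
 assumes P: "module R P" and f: "lin R M P f" and z: "!!x. x \<in> N ==> f x = 0[P]"
 shows quot_lift_lin: "lin R (quot_mod M N) P f"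
  and quot_lift_rep: "!!x. x \<in> carrier M ==> f (coset_rep M N x) = f x"
proof -
 interpret P: module R P by (rule P)
 have rep: "f (coset_rep M N x) = f x" if x: "x \<in> carrier M" for x
 proof -
  have c: "coset_rep M N x \<in> carrier M" using x by (rule coset_rep_closed)
  have "f (coset_rep M N x) -[P] f x = 0[P]" using z[OF coset_rep_minus[OF x]] lin_minus[OF M P f c x] by simp
  then show ?thesis using lin_closed[OF f] c x minus_eq_zero_iff[OF P] by blast
 qed
 then show "!!x. x \<in> carrier M ==> f (coset_rep M N x) = f x" .
 show "lin R (quot_mod M N) P f"
 proof (rule linI)
  show "!!u. u \<in> carrier (quot_mod M N) ==> f u \<in> carrier P" using quot_carrier_subset f by (simp add: lin_closed)
 next
  fix u v assume u: "u \<in> carrier (quot_mod M N)" and v: "v \<in> carrier (quot_mod M N)"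
  show "f (u +[quot_mod M N] v) = f u +[P] f v"
   using quot_carrier_subset[OF u] quot_carrier_subset[OF v] rep f by (simp add: quot_mod_def lin_add)
 next
  fix r u assume "r \<in> carrier R" and u: "u \<in> carrier (quot_mod M N)"
  then show "f (r *[quot_mod M N] u) = r *[P] f u"
   using quot_carrier_subset[OF u] rep f by (simp add: quot_mod_def lin_smult)
 qed
qed

end

section \<open>Cohomology of complexes of modules\<close>

definition mcx :: "('k, 'r) ring_scheme => (('k, 'u) module, 'u => 'u) cochain => bool" where
 "mcx R K \<longleftrightarrow> (\<forall>i. module R (chob K i)) \<and> (\<forall>i. lin R (chob K i) (chob K (i + 1)) (chd K i)) \<and>
   (\<forall>i. \<forall>u \<in> carrier (chob K i). chd K (i + 1) (chd K i u) = 0[chob K (i + 1 + 1)])"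

lemma mcxD:
 assumes "mcx R K"
 shows "module R (chob K i)" "lin R (chob K i) (chob K (i + 1)) (chd K i)"
  "lin R (chob K (i - 1)) (chob K i) (chd K (i - 1))"
  "u \<in> carrier (chob K (i - 1)) ==> chd K i (chd K (i - 1) u) = 0[chob K (i + 1)]"
proof -
 show "module R (chob K i)" "lin R (chob K i) (chob K (i + 1)) (chd K i)" using assms by (simp_all add: mcx_def)
 have "lin R (chob K (i - 1)) (chob K (i - 1 + 1)) (chd K (i - 1))" using assms unfolding mcx_def by blast
 then show "lin R (chob K (i - 1)) (chob K i) (chd K (i - 1))" by simp
 assume "u \<in> carrier (chob K (i - 1))"
 then have "chd K (i - 1 + 1) (chd K (i - 1) u) = 0[chob K (i - 1 + 1 + 1)]" using assms unfolding mcx_def by blast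
 then show "chd K i (chd K (i - 1) u) = 0[chob K (i + 1)]" by simp
qed

lemma cocycles_submodule: "mcx R K ==> submodule (cocycles K i) R (chob K i)"
 unfolding cocycles_def by (intro ker_submodule mcxD)

lemma coboundaries_submodule: "mcx R K ==> submodule (coboundaries K i) R (chob K i)"
 unfolding coboundaries_def by (intro image_submodule mcxD)

lemma coboundaries_cocycles: "mcx R K ==> coboundaries K i \<subseteq> cocycles K i"
 by (auto simp: coboundaries_def cocycles_def ker_in_def mcxD(4) lin_closed[OF mcxD(3)])

lemma coboundariesI: "w \<in> carrier (chob K (i - 1)) ==> u = chd K (i - 1) w ==> u \<in> coboundaries K i"
 by (simp add: coboundaries_def)

lemma cocycles_carrier: "u \<in> cocycles K i ==> u \<in> carrier (chob K i)" by (simp add: cocycles_def ker_in_def)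

abbreviation Zmod :: "(('k, 'u) module, 'u => 'u) cochain => int => ('k, 'u) module" where
 "Zmod K i \<equiv> (chob K i)\<lparr>carrier := cocycles K i\<rparr>"

lemma cohom_quotient: "mcx R K ==> module_quotient R (Zmod K i) (coboundaries K i)"
 by (intro module_quotient.intro submodule_module sub_submodule mcxD cocycles_submodule
   coboundaries_submodule coboundaries_cocycles)

lemma cohom_module: "mcx R K ==> module R (cohom K i)"
 unfolding cohom_def by (intro module_quotient.quot_module cohom_quotient)

lemma trivial_cohom_iff: "mcx R K ==> trivial_mod (cohom K i) \<longleftrightarrow> cocycles K i \<subseteq> coboundaries K i"
 unfolding cohom_def by (subst module_quotient.trivial_quot_iff[OF cohom_quotient]) auto

lemma trivial_cohom: "mcx R K ==> trivial_mod (chob K i) ==> trivial_mod (cohom K i)"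
proof -
 assume K: "mcx R K" and t: "trivial_mod (chob K i)"
 have "cocycles K i \<subseteq> {0[chob K i]}" using t cocycles_carrier[of _ K i] by (auto simp: trivial_mod_def)
 also have "\<dots> \<subseteq> coboundaries K i" using submoduleD(2)[OF mcxD(1)[OF K] coboundaries_submodule[OF K]] by simp
 finally show ?thesis using trivial_cohom_iff[OF K] by blast
qed

abbreviation crep :: "(('k, 'u) module, 'u => 'u) cochain => int => 'u => 'u" where
 "crep K i \<equiv> coset_rep (Zmod K i) (coboundaries K i)"

lemma crep_lin: "mcx R K ==> lin R (Zmod K i) (cohom K i) (crep K i)"
 unfolding cohom_def by (rule module_quotient.coset_rep_lin[OF cohom_quotient])

lemma crep_closed: "mcx R K ==> u \<in> cocycles K i ==> crep K i u \<in> carrier (cohom K i)"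
 unfolding cohom_def using module_quotient.coset_rep_in_quot[OF cohom_quotient, of R K u i] by simp

lemma crep_eq_iff:
 assumes K: "mcx R K" and u: "u \<in> cocycles K i" and v: "v \<in> cocycles K i"
 shows "crep K i u = crep K i v \<longleftrightarrow> u -[chob K i] v \<in> coboundaries K i"
 using module_quotient.coset_rep_eq_iff[OF cohom_quotient[OF K], of u i v] u v
  minus_restrict[OF mcxD(1)[OF K] cocycles_submodule[OF K] v] by simp

lemma crep_fixed: "mcx R K ==> u \<in> carrier (cohom K i) ==> crep K i u = u"
 unfolding cohom_def by (rule module_quotient.coset_rep_fixed[OF cohom_quotient])

lemma cohom_carrier: "mcx R K ==> u \<in> carrier (cohom K i) ==> u \<in> cocycles K i"
 unfolding cohom_def by (drule module_quotient.quot_carrier_subset[OF cohom_quotient]) auto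

lemma crep_cocycle: "mcx R K ==> u \<in> cocycles K i ==> crep K i u \<in> cocycles K i"
 by (rule cohom_carrier[OF _ crep_closed])

lemma crep_minus:
 assumes K: "mcx R K" and u: "u \<in> cocycles K i"
 shows "crep K i u -[chob K i] u \<in> coboundaries K i"
 using crep_eq_iff[OF K crep_cocycle[OF K u] u] crep_fixed[OF K crep_closed[OF K u]] by simp

lemma crep_zero_iff: "mcx R K ==> u \<in> cocycles K i ==> crep K i u = 0[cohom K i] \<longleftrightarrow> u \<in> coboundaries K i"
 unfolding cohom_def by (rule module_quotient.coset_rep_zero_iff[OF cohom_quotient]) auto

text \<open>The data at one spot that make \<open>f\<close> induce a map (resp. an isomorphism) on cohomology.\<close>

definition coh_map_at where
 "coh_map_at R K L i f \<longleftrightarrow> lin R (Zmod K i) (Zmod L i) f \<and>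
   (\<forall>u \<in> coboundaries K i. f u \<in> coboundaries L i)"

definition coh_iso_at where
 "coh_iso_at R K L i f \<longleftrightarrow> coh_map_at R K L i f \<and>
   (\<forall>u \<in> cocycles K i. f u \<in> coboundaries L i \<longrightarrow> u \<in> coboundaries K i) \<and>
   (\<forall>v \<in> cocycles L i. \<exists>u \<in> cocycles K i. v -[chob L i] f u \<in> coboundaries L i)"

lemma chain_map_coh_map_at:
 assumes K: "mcx R K" and L: "mcx R L"
  and f: "!!i. lin R (chob K i) (chob L i) (f i)"
  and c: "!!i u. u \<in> carrier (chob K i) ==> chd L i (f i u) = f (i + 1) (chd K i u)"
 shows "coh_map_at R K L i (f i)"
 unfolding coh_map_at_def
proof (intro conjI ballI)
 have fz: "f i u \<in> cocycles L i" if "u \<in> cocycles K i" for u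
  using that c[of u i] lin_zero[OF mcxD(1)[OF K] mcxD(1)[OF L] f[of "i + 1"]] lin_closed[OF f]
  by (auto simp: cocycles_def ker_in_def)
 show "lin R (Zmod K i) (Zmod L i) (f i)" using f[of i] fz cocycles_carrier[of _ K i] by (auto simp: lin_def)
 show "f i u \<in> coboundaries L i" if u: "u \<in> coboundaries K i" for u
 proof -
  from u obtain w where w: "w \<in> carrier (chob K (i - 1))" "u = chd K (i - 1) w" by (auto simp: coboundaries_def)
  then have "f i u = chd L (i - 1) (f (i - 1) w)" using c[OF w(1)] by simp
  then show ?thesis using lin_closed[OF f w(1)] by (auto simp: coboundaries_def)
 qed
qed

lemma cohom_map_apply:
 "u \<in> carrier (cohom K i) ==> cohom_map K L i f u = crep L i (f u)" by (simp add: cohom_map_def)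

text \<open>A chosen representative differs from \<open>u\<close> by a coboundary, which
  \<open>f\<close> sends to a coboundary. Hence \<open>f\<close> need not commute with the choice,
  only with passing to classes.\<close>

lemma coh_map_crep:
 assumes K: "mcx R K" and L: "mcx R L" and f: "coh_map_at R K L i f" and u: "u \<in> cocycles K i"
 shows "crep L i (f (crep K i u)) = crep L i (f u)"
proof -
 have l: "lin R (Zmod K i) (Zmod L i) f" using f by (simp add: coh_map_at_def)
 have fz: "!!u. u \<in> cocycles K i ==> f u \<in> cocycles L i" using lin_closed[OF l] by simp
 have mK: "module R (Zmod K i)" and mL: "module R (Zmod L i)"
  using submodule_module[OF mcxD(1) cocycles_submodule] K L by blast+
 have c: "crep K i u \<in> cocycles K i" using K u by (rule crep_cocycle)
 have "f (crep K i u -[chob K i] u) = f (crep K i u) -[chob L i] f u"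
  using lin_minus[OF mK mL l, of "crep K i u" u] u c
   minus_restrict[OF mcxD(1)[OF K] cocycles_submodule[OF K] u]
   minus_restrict[OF mcxD(1)[OF L] cocycles_submodule[OF L] fz[OF u]] by simp
 then show ?thesis using crep_minus[OF K u] f crep_eq_iff[OF L fz[OF c] fz[OF u]] unfolding coh_map_at_def by metis
qed

lemma cohom_map_crep:
 assumes K: "mcx R K" and L: "mcx R L" and f: "coh_map_at R K L i f" and u: "u \<in> cocycles K i"
 shows "cohom_map K L i f (crep K i u) = crep L i (f u)"
 by (simp add: cohom_map_apply crep_closed[OF K u] coh_map_crep[OF assms])

lemma cohom_map_hom:
 assumes K: "mcx R K" and L: "mcx R L" and f: "coh_map_at R K L i f"
 shows "cohom_map K L i f \<in> mod_hom R (cohom K i) (cohom L i)"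
 unfolding mod_hom_iff
proof
 have l: "lin R (Zmod K i) (Zmod L i) f" and fB: "!!u. u \<in> coboundaries K i ==> f u \<in> coboundaries L i"
  using f by (auto simp: coh_map_at_def)
 have "lin R (cohom K i) (cohom L i) (\<lambda>u. crep L i (f u))"
  unfolding cohom_def[of K]
 proof (rule module_quotient.quot_lift_lin[OF cohom_quotient[OF K]])
  show "module R (cohom L i)" using L by (rule cohom_module)
  show "lin R (Zmod K i) (cohom L i) (\<lambda>u. crep L i (f u))" by (rule lin_compose[OF l crep_lin[OF L]])
  show "crep L i (f u) = 0[cohom L i]" if "u \<in> coboundaries K i" for u
   using crep_zero_iff[OF L] fB[OF that] coboundaries_cocycles[OF L] by blast
 qed
 then show "lin R (cohom K i) (cohom L i) (cohom_map K L i f)"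
  by (rule lin_cong[OF _ cohom_module[OF K]]) (simp add: cohom_map_apply)
 show "cohom_map K L i f \<in> extensional (carrier (cohom K i))" by (simp add: cohom_map_def)
qed

lemma cohom_map_iso:
 assumes K: "mcx R K" and L: "mcx R L" and f: "coh_iso_at R K L i f"
 shows "cohom_map K L i f \<in> mod_iso R (cohom K i) (cohom L i)"
proof (rule mod_isoI)
 have m: "coh_map_at R K L i f" using f by (simp add: coh_iso_at_def)
 then have l: "lin R (Zmod K i) (Zmod L i) f" by (simp add: coh_map_at_def)
 have fz: "!!u. u \<in> cocycles K i ==> f u \<in> cocycles L i" using lin_closed[OF l] by simp
 show h: "cohom_map K L i f \<in> mod_hom R (cohom K i) (cohom L i)" using K L m by (rule cohom_map_hom)
 show "inj_on (cohom_map K L i f) (carrier (cohom K i))"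
 proof (rule lin_inj_onI[OF cohom_module[OF K] cohom_module[OF L]])
  show "lin R (cohom K i) (cohom L i) (cohom_map K L i f)" using h by (simp add: mod_hom_iff)
  fix u assume u: "u \<in> carrier (cohom K i)" and z: "cohom_map K L i f u = 0[cohom L i]"
  have uz: "u \<in> cocycles K i" using K u by (rule cohom_carrier)
  have "f u \<in> coboundaries L i" using z u crep_zero_iff[OF L fz[OF uz]] by (simp add: cohom_map_apply)
  then have "u \<in> coboundaries K i" using f uz by (simp add: coh_iso_at_def)
  then show "u = 0[cohom K i]" using crep_zero_iff[OF K uz] crep_fixed[OF K u] by simp
 qed
 show "carrier (cohom L i) \<subseteq> cohom_map K L i f ` carrier (cohom K i)"
 proof
  fix v assume v: "v \<in> carrier (cohom L i)"
  have vz: "v \<in> cocycles L i" using L v by (rule cohom_carrier)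
  then obtain u where u: "u \<in> cocycles K i" "v -[chob L i] f u \<in> coboundaries L i"
   using f by (auto simp: coh_iso_at_def)
  have "v = crep L i (f u)" using crep_eq_iff[OF L vz fz[OF u(1)]] u(2) crep_fixed[OF L v] by simp
  also have "\<dots> = cohom_map K L i f (crep K i u)" using cohom_map_crep[OF K L m u(1)] by simp
  finally show "v \<in> cohom_map K L i f ` carrier (cohom K i)" using crep_closed[OF K u(1)] by blast
 qed
qed

lemma homotopy_at_cocycle:
 assumes M: "mcx R M" and s: "!!i. lin R (chob M i) (chob M (i - 1)) (s i)" and u: "u \<in> cocycles M i"
 shows "chd M (i - 1) (s i u) +[chob M i] s (i + 1) (chd M i u) = chd M (i - 1) (s i u)"
proof -
 interpret M: module R "chob M i" by (rule mcxD(1)[OF M])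
 have "lin R (chob M (i + 1)) (chob M i) (s (i + 1))" using s[of "i + 1"] by simp
 then have "s (i + 1) (chd M i u) = 0[chob M i]"
  using u lin_zero[OF mcxD(1)[OF M] mcxD(1)[OF M]] by (simp add: cocycles_def ker_in_def)
 then show ?thesis using lin_closed[OF mcxD(3)[OF M] lin_closed[OF s[of i]]] u by (simp add: cocycles_carrier)
qed

text \<open>On a cocycle the term \<open>h (d u)\<close> drops out and the homotopy identity reads
  \<open>g (f u) + d (h u) = u\<close>. If \<open>f u\<close> is a coboundary, so is
  \<open>g (f u)\<close>, hence \<open>u\<close>; on the other side \<open>g v\<close> is the
  required preimage, with error \<open>d (k v)\<close>.\<close>

lemma homotopy_equivalence_coh_iso_at:
 assumes K: "mcx R K" and L: "mcx R L"
  and f: "!!i. lin R (chob K i) (chob L i) (f i)"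
  and cf: "!!i u. u \<in> carrier (chob K i) ==> chd L i (f i u) = f (i + 1) (chd K i u)"
  and g: "!!i. lin R (chob L i) (chob K i) (g i)"
  and cg: "!!i u. u \<in> carrier (chob L i) ==> chd K i (g i u) = g (i + 1) (chd L i u)"
  and h: "!!i. lin R (chob K i) (chob K (i - 1)) (h i)"
  and hh: "!!i u. u \<in> carrier (chob K i) ==>
    g i (f i u) +[chob K i] (chd K (i - 1) (h i u) +[chob K i] h (i + 1) (chd K i u)) = u"
  and k: "!!i. lin R (chob L i) (chob L (i - 1)) (k i)"
  and kk: "!!i u. u \<in> carrier (chob L i) ==>
    f i (g i u) +[chob L i] (chd L (i - 1) (k i u) +[chob L i] k (i + 1) (chd L i u)) = u"
 shows "coh_iso_at R K L i (f i)"
 unfolding coh_iso_at_def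
proof (intro conjI ballI impI)
 interpret K: module R "chob K i" by (rule mcxD(1)[OF K])
 interpret L: module R "chob L i" by (rule mcxD(1)[OF L])
 show "coh_map_at R K L i (f i)" by (rule chain_map_coh_map_at[OF K L f cf])
 note z = homotopy_at_cocycle
 show "u \<in> coboundaries K i" if u: "u \<in> cocycles K i" and fu: "f i u \<in> coboundaries L i" for u
 proof -
  from fu obtain w where w: "w \<in> carrier (chob L (i - 1))" "f i u = chd L (i - 1) w" by (auto simp: coboundaries_def)
  have "g i (f i u) \<in> coboundaries K i"
  proof (rule coboundariesI)
   show "g (i - 1) w \<in> carrier (chob K (i - 1))" by (rule lin_closed[OF g w(1)])
   show "g i (f i u) = chd K (i - 1) (g (i - 1) w)" using cg[OF w(1)] unfolding w(2) diff_add_cancel by (rule HOL.sym)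
  qed
  moreover have "chd K (i - 1) (h i u) \<in> coboundaries K i"
   using lin_closed[OF h cocycles_carrier[OF u]] by (auto simp: coboundaries_def)
  ultimately have "g i (f i u) +[chob K i] chd K (i - 1) (h i u) \<in> coboundaries K i"
   using submoduleD(3)[OF mcxD(1)[OF K] coboundaries_submodule[OF K]] by blast
  then show ?thesis using hh[OF cocycles_carrier[OF u]] unfolding z[OF K h u] by simp
 qed
 show "\<exists>u \<in> cocycles K i. v -[chob L i] f i u \<in> coboundaries L i" if v: "v \<in> cocycles L i" for v
 proof
  have gm: "coh_map_at R L K i (g i)" by (rule chain_map_coh_map_at[OF L K g cg])
  then show gv: "g i v \<in> cocycles K i" using v by (auto simp: coh_map_at_def dest: lin_closed)
  let ?a = "f i (g i v)" and ?b = "chd L (i - 1) (k i v)"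
  have a: "?a \<in> carrier (chob L i)" by (rule lin_closed[OF f lin_closed[OF g cocycles_carrier[OF v]]])
  have bB: "?b \<in> coboundaries L i" using lin_closed[OF k cocycles_carrier[OF v]] by (auto simp: coboundaries_def)
  then have b: "?b \<in> carrier (chob L i)" using submoduleD(1)[OF mcxD(1)[OF L] coboundaries_submodule[OF L]] by blast
  have e: "?a +[chob L i] ?b = v" using kk[OF cocycles_carrier[OF v]] unfolding z[OF L k v] .
  have "(?b +[chob L i] ?a) -[chob L i] ?a = ?b" using a b by (simp add: L.minus_eq L.a_assoc L.r_neg)
  then have "v -[chob L i] ?a = ?b" using e L.a_comm[OF a b] by simp
  then show "v -[chob L i] ?a \<in> coboundaries L i" using bB by simp
 qed
qed

section \<open>Functors with values in modules\<close>

context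
 fixes R :: "'k ring" and C :: "('o, 'a) category_data" and F :: "('o, 'a, 'k, 'u) modfun"
 assumes F: "modf R C F"
begin

lemma mf_mod: "x \<in> obj C ==> module R (fob F x)" using F by (auto simp: is_functor_def kmod_def)

lemma mf_hom: "x \<in> obj C ==> y \<in> obj C ==> f \<in> arr C x y ==> far F x y f \<in> mod_hom R (fob F x) (fob F y)"
 using F by (auto simp: is_functor_def kmod_def)

lemma mf_lin: "x \<in> obj C ==> y \<in> obj C ==> f \<in> arr C x y ==> lin R (fob F x) (fob F y) (far F x y f)"
 using mf_hom by (simp add: mod_hom_iff)

lemma mf_ext: "x \<in> obj C ==> y \<in> obj C ==> f \<in> arr C x y ==> far F x y f \<in> extensional (el F x)"
 using mf_hom by (simp add: mod_hom_iff)

lemma mf_closed: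
 "x \<in> obj C ==> y \<in> obj C ==> f \<in> arr C x y ==> u \<in> el F x ==> far F x y f u \<in> el F y"
 using mf_lin by (rule lin_closed)

lemma mf_id: "x \<in> obj C ==> u \<in> el F x ==> far F x x (idn C x) u = u" using F by (auto simp: is_functor_def kmod_def)

lemma mf_cmp:
 "x \<in> obj C ==> y \<in> obj C ==> z \<in> obj C ==> f \<in> arr C x y ==> g \<in> arr C y z ==> u \<in> el F x ==>
  far F x z (cmp C x y z g f) u = far F y z g (far F x y f u)"
 using F by (simp add: is_functor_def kmod_def compose_def)

end

lemma mfI:
 assumes m: "!!x. x \<in> obj C ==> module R (fob F x)"
  and l: "!!x y f. x \<in> obj C ==> y \<in> obj C ==> f \<in> arr C x y ==> lin R (fob F x) (fob F y) (far F x y f)"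
  and e: "!!x y f. x \<in> obj C ==> y \<in> obj C ==> f \<in> arr C x y ==> far F x y f \<in> extensional (el F x)"
  and i: "!!x u. x \<in> obj C ==> u \<in> el F x ==> far F x x (idn C x) u = u"
  and c: "!!x y z f g u. x \<in> obj C ==> y \<in> obj C ==> z \<in> obj C ==> f \<in> arr C x y ==> g \<in> arr C y z ==>
   u \<in> el F x ==> far F x z (cmp C x y z g f) u = far F y z g (far F x y f u)"
  and C: "category C"
 shows "modf R C F"
proof -
 interpret category C by (rule C)
 have "far F x x (idn C x) = (\<lambda>u \<in> el F x. u)" if "x \<in> obj C" for x
  using i[OF that] e[OF that that idn_closed[OF that]] by (auto simp: fun_eq_iff extensional_def)
 moreover have "far F x z (cmp C x y z g f) = compose (el F x) (far F y z g) (far F x y f)"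
  if "x \<in> obj C" "y \<in> obj C" "z \<in> obj C" "f \<in> arr C x y" "g \<in> arr C y z" for x y z f g
  using c[OF that] e[OF that(1,3) cmp_closed[OF that]] by (auto simp: fun_eq_iff extensional_def compose_def)
 ultimately show ?thesis using m l e by (simp add: is_functor_def kmod_def mod_hom_iff)
qed

definition natl where
 "natl R C F G e \<longleftrightarrow> (\<forall>x \<in> obj C. lin R (fob F x) (fob G x) (e x)) \<and>
   (\<forall>x \<in> obj C. \<forall>y \<in> obj C. \<forall>f \<in> arr C x y. \<forall>u \<in> el F x.
    e y (far F x y f u) = far G x y f (e x u))"

text \<open>The extensional normal form of a family: \<open>nat_hom\<close> consists of the
  \<open>natl\<close> families fixed by \<open>nres\<close>. Families can thus be handled pointwise
  and cut down at the end.\<close>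

definition nres where
 "nres C F e = (\<lambda>x \<in> obj C. \<lambda>u \<in> el F x. e x u)"

lemma natlI:
 assumes "!!x. x \<in> obj C ==> lin R (fob F x) (fob G x) (e x)"
  and "!!x y f u. x \<in> obj C ==> y \<in> obj C ==> f \<in> arr C x y ==> u \<in> el F x ==>
    e y (far F x y f u) = far G x y f (e x u)"
 shows "natl R C F G e" using assms by (simp add: natl_def)

lemma natl_lin: "natl R C F G e ==> x \<in> obj C ==> lin R (fob F x) (fob G x) (e x)" by (simp add: natl_def)

lemma natl_closed: "natl R C F G e ==> x \<in> obj C ==> u \<in> el F x ==> e x u \<in> el G x" using natl_lin lin_closed by metis

lemma natl_nat:
 "natl R C F G e ==> x \<in> obj C ==> y \<in> obj C ==> f \<in> arr C x y ==> u \<in> el F x ==>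
  e y (far F x y f u) = far G x y f (e x u)" by (simp add: natl_def)

lemma nres_apply: "x \<in> obj C ==> u \<in> el F x ==> nres C F e x u = e x u" by (simp add: nres_def)

lemma nres_cong:
 "(\<And>x u. x \<in> obj C ==> u \<in> el F x ==> e x u = e' x u) ==> nres C F e = nres C F e'"
 by (auto simp: nres_def fun_eq_iff)

lemma nres_nres: "nres C F (nres C F e) = nres C F e" by (auto intro: nres_cong simp: nres_apply)

lemma nat_hom_iff: "e \<in> nat_hom R C F G \<longleftrightarrow> natl R C F G e \<and> nres C F e = e"
proof -
 have "nres C F e = e \<longleftrightarrow> e \<in> extensional (obj C) \<and> (\<forall>x \<in> obj C. e x \<in> extensional (el F x))"
  by (auto simp: nres_def fun_eq_iff extensional_def)
 then show ?thesis by (auto simp: nat_hom_def natl_def PiE_def Pi_def mod_hom_iff)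
qed

lemma nat_hom_natl: "e \<in> nat_hom R C F G ==> natl R C F G e" by (simp add: nat_hom_iff)

lemma nat_hom_ext:
 assumes "e \<in> nat_hom R C F G" "e' \<in> nat_hom R C F G'"
  and "!!x u. x \<in> obj C ==> u \<in> el F x ==> e x u = e' x u"
 shows "e = e'" using assms nres_cong[of C F e e'] by (simp add: nat_hom_iff)

lemma natl_cong:
 assumes F: "modf R C F" and e: "natl R C F G e"
  and eq: "!!x u. x \<in> obj C ==> u \<in> el F x ==> e' x u = e x u"
 shows "natl R C F G e'"
proof (rule natlI)
 show "lin R (fob F x) (fob G x) (e' x)" if "x \<in> obj C" for x
  using natl_lin[OF e that] mf_mod[OF F that] eq[OF that] by (rule lin_cong)
qed (simp add: eq mf_closed[OF F] natl_nat[OF e])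

lemma nres_hom:
 assumes F: "modf R C F" and e: "natl R C F G e"
 shows "nres C F e \<in> nat_hom R C F G"
 using natl_cong[OF F e, of "nres C F e"] by (simp add: nat_hom_iff nres_nres nres_apply)

lemma natl_compose:
 assumes e: "natl R C F G e" and h: "natl R C G H h"
 shows "natl R C F H (\<lambda>x u. h x (e x u))"
proof (rule natlI)
 show "!!x. x \<in> obj C ==> lin R (fob F x) (fob H x) (\<lambda>u. h x (e x u))"
  using lin_compose[OF natl_lin[OF e] natl_lin[OF h]] by blast
qed (simp add: natl_nat[OF e] natl_nat[OF h] natl_closed[OF e])

lemma natl_id: "natl R C F F (\<lambda>x u. u)" by (rule natlI) (simp_all add: lin_id)

lemma natl_zero:
 assumes G: "modf R C G"
 shows "natl R C F G (\<lambda>x u. 0[fob G x])" by (rule natlI)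
   (simp_all add: lin_const_zero mf_mod[OF G] lin_zero[OF mf_mod[OF G] mf_mod[OF G] mf_lin[OF G]])

lemma natl_add:
 assumes G: "modf R C G" and e: "natl R C F G e" and h: "natl R C F G h"
 shows "natl R C F G (\<lambda>x u. e x u +[fob G x] h x u)" by (rule natlI)
   (simp_all add: lin_pointwise_add mf_mod[OF G] natl_lin[OF e] natl_lin[OF h] natl_nat[OF e]
    natl_nat[OF h] lin_add[OF mf_lin[OF G]] natl_closed[OF e] natl_closed[OF h])

lemma natl_minus:
 assumes G: "modf R C G" and e: "natl R C F G e" and h: "natl R C F G h"
 shows "natl R C F G (\<lambda>x u. e x u -[fob G x] h x u)" by (rule natlI)
   (simp_all add: lin_pointwise_minus mf_mod[OF G] natl_lin[OF e] natl_lin[OF h] natl_nat[OF e]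
    natl_nat[OF h] lin_minus[OF mf_mod[OF G] mf_mod[OF G] mf_lin[OF G]] natl_closed[OF e] natl_closed[OF h])

lemma natl_smult:
 assumes G: "modf R C G" and e: "natl R C F G e" and r: "r \<in> carrier R"
 shows "natl R C F G (\<lambda>x u. r *[fob G x] e x u)" by (rule natlI)
   (simp_all add: lin_pointwise_smult mf_mod[OF G] natl_lin[OF e] natl_nat[OF e] r
    lin_smult[OF mf_lin[OF G]] natl_closed[OF e])

lemma natl_inverse:
 assumes F: "modf R C F" and e: "natl R C F G e"
  and b: "!!x. x \<in> obj C ==> bij_betw (e x) (el F x) (el G x)"
  and g: "!!x u. x \<in> obj C ==> u \<in> el F x ==> g x (e x u) = u"
 shows "natl R C G F g"
proof (rule natlI)
 show "lin R (fob G x) (fob F x) (g x)" if x: "x \<in> obj C" for x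
  by (rule lin_inverse[OF mf_mod[OF F x] natl_lin[OF e x] b[OF x] g[OF x]])
next
 fix x y f v assume x: "x \<in> obj C" and y: "y \<in> obj C" and f: "f \<in> arr C x y" and v: "v \<in> el G x"
 obtain u where u: "u \<in> el F x" "v = e x u" using b[OF x] v unfolding bij_betw_def by blast
 have "g y (far G x y f v) = g y (e y (far F x y f u))" using natl_nat[OF e x y f u(1)] u by simp
 also have "\<dots> = far F x y f (g x v)" using g x y u mf_closed[OF F x y f u(1)] by simp
 finally show "g y (far G x y f v) = far F x y f (g x v)" .
qed

lemma nat_cmp_nres: "nat_cmp C F h e = nres C F (\<lambda>x u. h x (e x u))"
 by (simp add: nat_cmp_def nres_def compose_def cong: restrict_cong)

lemma nat_id_nres: "nat_id C F = nres C F (\<lambda>x u. u)" by (simp add: nat_id_def nres_def)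

lemma nat_cmp_apply: "x \<in> obj C ==> u \<in> el F x ==> nat_cmp C F h e x u = h x (e x u)"
 by (simp add: nat_cmp_nres nres_apply)

lemma nat_id_apply: "x \<in> obj C ==> u \<in> el F x ==> nat_id C F x u = u" by (simp add: nat_id_nres nres_apply)

lemma nat_cmp_hom:
 "modf R C F ==> e \<in> nat_hom R C F G ==> h \<in> nat_hom R C G H ==> nat_cmp C F h e \<in> nat_hom R C F H"
 unfolding nat_cmp_nres by (rule nres_hom[OF _ natl_compose[OF nat_hom_natl nat_hom_natl]])

lemma nat_id_hom: "modf R C F ==> nat_id C F \<in> nat_hom R C F F" unfolding nat_id_nres by (intro nres_hom natl_id)

subsection \<open>Subfunctors and subquotients\<close>

definition stable where
 "stable R C F N \<longleftrightarrow> (\<forall>x \<in> obj C. submodule (N x) R (fob F x)) \<and>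
   (\<forall>x \<in> obj C. \<forall>y \<in> obj C. \<forall>f \<in> arr C x y. \<forall>u \<in> N x. far F x y f u \<in> N y)"

lemma stable_sub: "stable R C F N ==> x \<in> obj C ==> submodule (N x) R (fob F x)" by (simp add: stable_def)

lemma stable_far:
 "stable R C F N ==> x \<in> obj C ==> y \<in> obj C ==> f \<in> arr C x y ==> u \<in> N x ==> far F x y f u \<in> N y"
 by (simp add: stable_def)

lemma stable_carrier:
 "modf R C F ==> stable R C F N ==> x \<in> obj C ==> u \<in> N x ==> u \<in> el F x"
 by (rule subsetD[OF submoduleD(1)[OF mf_mod stable_sub]])

lemma stable_all: "modf R C F ==> stable R C F (\<lambda>x. el F x)"
 by (simp add: stable_def mf_closed module.carrier_is_submodule mf_mod)

lemma stable_ker: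
 assumes F: "modf R C F" and G: "modf R C G" and e: "natl R C F G e"
 shows "stable R C F (\<lambda>x. ker_in (fob F x) (e x) (fob G x))"
 unfolding stable_def by (auto simp: ker_submodule[OF mf_mod[OF F] mf_mod[OF G] natl_lin[OF e], unfolded ker_in_def]
   ker_in_def natl_nat[OF e] mf_closed[OF F] lin_zero[OF mf_mod[OF G] mf_mod[OF G] mf_lin[OF G]])

lemma stable_image:
 assumes F: "modf R C F" and G: "modf R C G" and e: "natl R C F G e"
 shows "stable R C G (\<lambda>x. e x ` el F x)"
 unfolding stable_def
 by (auto simp: image_submodule mf_mod[OF F] mf_mod[OF G] natl_lin[OF e] natl_nat[OF e, symmetric]
   mf_closed[OF F])

definition subf :: "('o, 'a, 'k, 'u) modfun => ('o => 'u set) => ('o, 'a, 'k, 'u) modfun" where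
 "subf F N = \<lparr>fob = (\<lambda>x. (fob F x)\<lparr>carrier := N x\<rparr>), far = (\<lambda>x y f. restrict (far F x y f) (N x))\<rparr>"

lemma subf_simps [simp]: "el (subf F N) x = N x" "zero (fob (subf F N) x) = zero (fob F x)"
 "add (fob (subf F N) x) = add (fob F x)" "smult (fob (subf F N) x) = smult (fob F x)"
 "u \<in> N x ==> far (subf F N) x y f u = far F x y f u" by (simp_all add: subf_def)

lemma subf_functor:
 assumes C: "category C" and F: "modf R C F" and N: "stable R C F N"
 shows "modf R C (subf F N)"
proof (rule mfI)
 interpret category C by (rule C)
 show "module R (fob (subf F N) x)" if "x \<in> obj C" for x
  using submodule_module[OF mf_mod[OF F that] stable_sub[OF N that]] by (simp add: subf_def)
 fix x y f assume x: "x \<in> obj C" and y: "y \<in> obj C" and f: "f \<in> arr C x y"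
 have "!!u. u \<in> N x ==> u \<in> el F x" using stable_carrier[OF F N x] .
 then show "lin R (fob (subf F N) x) (fob (subf F N) y) (far (subf F N) x y f)"
  using submoduleD(3,5)[OF mf_mod[OF F x] stable_sub[OF N x]]
  by (auto intro!: linI simp: stable_far[OF N x y f] lin_add[OF mf_lin[OF F x y f]] lin_smult[OF mf_lin[OF F x y f]])
 show "far (subf F N) x y f \<in> extensional (el (subf F N) x)" by (simp add: subf_def)
next
 show "far (subf F N) x x (idn C x) u = u" if "x \<in> obj C" "u \<in> el (subf F N) x" for x u
  using that stable_carrier[OF F N] by (simp add: mf_id[OF F])
next
 fix x y z f g u assume x: "x \<in> obj C" "y \<in> obj C" "z \<in> obj C" "f \<in> arr C x y" "g \<in> arr C y z"
  and u: "u \<in> el (subf F N) x"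
 then show "far (subf F N) x z (cmp C x y z g f) u = far (subf F N) y z g (far (subf F N) x y f u)"
  using stable_carrier[OF F N] stable_far[OF N x(1,2,4)] by (simp add: mf_cmp[OF F])
qed (rule C)

lemma natl_subf_source:
 assumes F: "modf R C F" and N: "stable R C F N" and e: "natl R C F G e"
 shows "natl R C (subf F N) G e"
proof (rule natlI)
 show "lin R (fob (subf F N) x) (fob G x) (e x)" if "x \<in> obj C" for x
  using natl_lin[OF e that] stable_carrier[OF F N that] by (auto simp: lin_def)
qed (auto simp: natl_nat[OF e] stable_carrier[OF F N])

lemma subf_incl: "modf R C F ==> stable R C F N ==> natl R C (subf F N) F (\<lambda>x u. u)"
 using natl_subf_source natl_id by metis

lemma natl_subf_target:
 assumes e: "natl R C G F e" and N: "!!x u. x \<in> obj C ==> u \<in> el G x ==> e x u \<in> N x"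
 shows "natl R C G (subf F N) e"
proof (rule natlI)
 show "lin R (fob G x) (fob (subf F N) x) (e x)" if "x \<in> obj C" for x
  using natl_lin[OF e that] N that by (auto simp: lin_def)
qed (simp add: N natl_nat[OF e])

text \<open>The subquotient \<open>Z/B\<close> of \<open>F\<close>, its elements being
  representatives in \<open>Z\<close>. The shape is chosen so that \<open>cohom_fun K i\<close> is
  literally an instance.\<close>

definition sqf ::
 "('o, 'a, 'k, 'u) modfun => ('o => 'u set) => ('o => 'u set) => ('o, 'a, 'k, 'u) modfun" where
 "sqf F Z B = \<lparr>fob = (\<lambda>x. quot_mod ((fob F x)\<lparr>carrier := Z x\<rparr>) (B x)),
   far = (\<lambda>x y f. \<lambda>u \<in> carrier (quot_mod ((fob F x)\<lparr>carrier := Z x\<rparr>) (B x)).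
    coset_rep ((fob F y)\<lparr>carrier := Z y\<rparr>) (B y) (far F x y f u))\<rparr>"

abbreviation sqrep where
 "sqrep F Z B x \<equiv> coset_rep ((fob F x)\<lparr>carrier := Z x\<rparr>) (B x)"

context
 fixes R :: "'k ring" and C :: "('o, 'a) category_data" and F :: "('o, 'a, 'k, 'u) modfun" and Z B
 assumes C: "category C" and F: "modf R C F"
  and Z: "stable R C F Z" and B: "stable R C F B" and BZ: "!!x. x \<in> obj C ==> B x \<subseteq> Z x"
begin

interpretation category C by (rule C)

lemma sqf_quotient: "x \<in> obj C ==> module_quotient R ((fob F x)\<lparr>carrier := Z x\<rparr>) (B x)"
 by (intro module_quotient.intro submodule_module sub_submodule mf_mod[OF F] stable_sub[OF Z]
   stable_sub[OF B] BZ)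

lemma sqf_carrier: "x \<in> obj C ==> u \<in> el (sqf F Z B) x ==> u \<in> Z x"
 using module_quotient.quot_carrier_subset[OF sqf_quotient] by (fastforce simp: sqf_def)

text \<open>The representative differs from \<open>u\<close> by an element of \<open>B\<close>, and
  \<open>far F\<close> preserves \<open>B\<close>.\<close>

lemma sqrep_far:
 assumes x: "x \<in> obj C" and y: "y \<in> obj C" and f: "f \<in> arr C x y" and u: "u \<in> Z x"
 shows "sqrep F Z B y (far F x y f (sqrep F Z B x u)) = sqrep F Z B y (far F x y f u)"
proof -
 interpret Qx: module_quotient R "(fob F x)\<lparr>carrier := Z x\<rparr>" "B x" by (rule sqf_quotient[OF x])
 interpret Qy: module_quotient R "(fob F y)\<lparr>carrier := Z y\<rparr>" "B y" by (rule sqf_quotient[OF y])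
 note D = submoduleD[OF mf_mod[OF F x] stable_sub[OF Z x]]
 have r: "sqrep F Z B x u \<in> Z x" using Qx.coset_rep_closed u by simp
 have "sqrep F Z B x u -[fob F x] u \<in> B x"
  using Qx.coset_rep_minus[of u] u minus_restrict[OF mf_mod[OF F x] stable_sub[OF Z x] u] by simp
 then have "far F x y f (sqrep F Z B x u -[fob F x] u) \<in> B y" using stable_far[OF B x y f] by blast
 also have "far F x y f (sqrep F Z B x u -[fob F x] u) =
   far F x y f (sqrep F Z B x u) -[(fob F y)\<lparr>carrier := Z y\<rparr>] far F x y f u"
  using lin_minus[OF mf_mod[OF F x] mf_mod[OF F y] mf_lin[OF F x y f] subsetD[OF D(1) r] subsetD[OF D(1) u]]
   minus_restrict[OF mf_mod[OF F y] stable_sub[OF Z y] stable_far[OF Z x y f u]] by simp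
 finally show ?thesis using r u by (intro Qy.coset_rep_eqI) (simp_all add: stable_far[OF Z x y f])
qed

lemma sqf_functor: "modf R C (sqf F Z B)"
proof (rule mfI)
 show "module R (fob (sqf F Z B) x)" if "x \<in> obj C" for x
  using module_quotient.quot_module[OF sqf_quotient[OF that]] by (simp add: sqf_def)
 fix x y f assume x: "x \<in> obj C" and y: "y \<in> obj C" and f: "f \<in> arr C x y"
 interpret Qx: module_quotient R "(fob F x)\<lparr>carrier := Z x\<rparr>" "B x" by (rule sqf_quotient[OF x])
 interpret Qy: module_quotient R "(fob F y)\<lparr>carrier := Z y\<rparr>" "B y" by (rule sqf_quotient[OF y])
 show "far (sqf F Z B) x y f \<in> extensional (el (sqf F Z B) x)" by (simp add: sqf_def)
 have l1: "lin R ((fob F x)\<lparr>carrier := Z x\<rparr>) ((fob F y)\<lparr>carrier := Z y\<rparr>) (far F x y f)"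
  using natl_lin[OF subf_incl[OF F Z] x] mf_lin[OF F x y f] stable_far[OF Z x y f] stable_carrier[OF F Z x]
  by (auto simp: lin_def subf_def)
 have "lin R (quot_mod ((fob F x)\<lparr>carrier := Z x\<rparr>) (B x)) (fob (sqf F Z B) y) (\<lambda>u. sqrep F Z B y (far F x y f u))"
 proof (rule Qx.quot_lift_lin)
  show "module R (fob (sqf F Z B) y)" using Qy.quot_module by (simp add: sqf_def)
  show "lin R ((fob F x)\<lparr>carrier := Z x\<rparr>) (fob (sqf F Z B) y) (\<lambda>u. sqrep F Z B y (far F x y f u))"
   using lin_compose[OF l1 Qy.coset_rep_lin] by (simp add: sqf_def)
  show "sqrep F Z B y (far F x y f u) = 0[fob (sqf F Z B) y]" if "u \<in> B x" for u
   using Qy.coset_rep_zero_iff[of "far F x y f u"] stable_far[OF B x y f that] BZ[OF y] by (auto simp: sqf_def)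
 qed
 then have "lin R (fob (sqf F Z B) x) (fob (sqf F Z B) y) (\<lambda>u. sqrep F Z B y (far F x y f u))" by (simp add: sqf_def)
 then show "lin R (fob (sqf F Z B) x) (fob (sqf F Z B) y) (far (sqf F Z B) x y f)"
  by (rule lin_cong) (simp_all add: sqf_def Qx.quot_module)
next
 show "far (sqf F Z B) x x (idn C x) u = u" if "x \<in> obj C" "u \<in> el (sqf F Z B) x" for x u
  using that sqf_carrier[OF that] stable_carrier[OF F Z]
   module_quotient.coset_rep_fixed[OF sqf_quotient] by (simp add: mf_id[OF F] sqf_def)
next
 fix x y z f g u assume x: "x \<in> obj C" and y: "y \<in> obj C" and z: "z \<in> obj C"
  and f: "f \<in> arr C x y" and g: "g \<in> arr C y z" and u: "u \<in> el (sqf F Z B) x"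
 have uZ: "u \<in> Z x" using sqf_carrier[OF x u] .
 have c: "sqrep F Z B y (far F x y f u) \<in> el (sqf F Z B) y"
  using module_quotient.coset_rep_in_quot[OF sqf_quotient[OF y]] stable_far[OF Z x y f uZ] by (simp add: sqf_def)
 have "far (sqf F Z B) y z g (far (sqf F Z B) x y f u) =
   sqrep F Z B z (far F y z g (sqrep F Z B y (far F x y f u)))" using u c by (simp add: sqf_def)
 also have "\<dots> = sqrep F Z B z (far F y z g (far F x y f u))" by (rule sqrep_far[OF y z g stable_far[OF Z x y f uZ]])
 also have "\<dots> = far (sqf F Z B) x z (cmp C x y z g f) u"
  using u mf_cmp[OF F x y z f g stable_carrier[OF F Z x uZ]] by (simp add: sqf_def)
 finally show "far (sqf F Z B) x z (cmp C x y z g f) u = far (sqf F Z B) y z g (far (sqf F Z B) x y f u)" ..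
qed (rule C)

lemma sqf_proj: "natl R C (subf F Z) (sqf F Z B) (sqrep F Z B)"
proof (rule natlI)
 show "lin R (fob (subf F Z) x) (fob (sqf F Z B) x) (sqrep F Z B x)" if "x \<in> obj C" for x
  using module_quotient.coset_rep_lin[OF sqf_quotient[OF that]] by (simp add: sqf_def subf_def)
 fix x y f u assume h: "x \<in> obj C" "y \<in> obj C" "f \<in> arr C x y" and u: "u \<in> el (subf F Z) x"
 then have "sqrep F Z B x u \<in> el (sqf F Z B) x"
  using module_quotient.coset_rep_in_quot[OF sqf_quotient[OF h(1)]] by (simp add: sqf_def)
 then show "sqrep F Z B y (far (subf F Z) x y f u) = far (sqf F Z B) x y f (sqrep F Z B x u)"
  using u sqrep_far[OF h] by (simp add: sqf_def)
qed

lemma sqf_proj_surj: "x \<in> obj C ==> u \<in> el (sqf F Z B) x ==> sqrep F Z B x u = u"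
 using module_quotient.coset_rep_fixed[OF sqf_quotient] by (simp add: sqf_def)

lemma sqrep_zero_iff: "x \<in> obj C ==> u \<in> Z x ==> sqrep F Z B x u = 0[fob (sqf F Z B) x] \<longleftrightarrow> u \<in> B x"
 using module_quotient.coset_rep_zero_iff[OF sqf_quotient] by (simp add: sqf_def)

end

subsection \<open>The module of natural transformations\<close>

lemma hom_mod_simps [simp]:
 "carrier (hom_mod R C F G) = nat_hom R C F G"
 "0[hom_mod R C F G] = nres C F (\<lambda>x u. 0[fob G x])"
 "e +[hom_mod R C F G] h = nres C F (\<lambda>x u. e x u +[fob G x] h x u)"
 "r *[hom_mod R C F G] e = nres C F (\<lambda>x u. r *[fob G x] e x u)" by (simp_all add: hom_mod_def nres_def)

lemma hom_mod_module:
 assumes R: "cring R" and F: "modf R C F" and G: "modf R C G"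
 shows "module R (hom_mod R C F G)"
proof -
 let ?H = "hom_mod R C F G"
 note n = nat_hom_natl
 have c: "!!e x u. e \<in> nat_hom R C F G ==> x \<in> obj C ==> u \<in> el F x ==> e x u \<in> el G x" by (rule natl_closed[OF n])
 have M: "!!x. x \<in> obj C ==> abelian_group (fob G x)" "!!x. x \<in> obj C ==> abelian_monoid (fob G x)"
  by (rule module.axioms(2)[OF mf_mod[OF G]] abelian_group.axioms(1)[OF module.axioms(2)[OF mf_mod[OF G]]]; assumption)+
 note ag = abelian_monoid.a_assoc[OF M(2)] abelian_monoid.a_comm[OF M(2)] abelian_monoid.l_zero[OF M(2)]
  abelian_monoid.a_closed[OF M(2)] module.smult_closed[OF mf_mod[OF G]]
 have e_eq: "nres C F e' = e" if "e \<in> nat_hom R C F G" "!!x u. x \<in> obj C ==> u \<in> el F x ==> e' x u = e x u" for e e'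
  using nres_cong[of C F e' e] that by (simp add: nat_hom_iff)
 show ?thesis
 proof (rule moduleI[OF R])
  show "abelian_group ?H"
  proof (rule abelian_groupI)
   fix e h assume e: "e \<in> carrier ?H" and h: "h \<in> carrier ?H"
   then show "e +[?H] h \<in> carrier ?H" by (auto intro!: nres_hom[OF F] natl_add[OF G n n])
   show "e +[?H] h = h +[?H] e" using e h by (auto intro!: nres_cong abelian_monoid.a_comm[OF M(2)] c)
  next
   show "0[?H] \<in> carrier ?H" by (auto intro!: nres_hom[OF F] natl_zero[OF G])
  next
   fix e h k assume "e \<in> carrier ?H" "h \<in> carrier ?H" "k \<in> carrier ?H"
   then show "(e +[?H] h) +[?H] k = e +[?H] (h +[?H] k)"
    by (auto intro!: nres_cong simp: nres_apply abelian_monoid.a_assoc[OF M(2)] c)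
  next
   fix e assume e: "e \<in> carrier ?H"
   then show "0[?H] +[?H] e = e" by (auto intro!: e_eq simp: nres_apply abelian_monoid.l_zero[OF M(2)] c)
   show "\<exists>h \<in> carrier ?H. h +[?H] e = 0[?H]"
   proof
    let ?h = "nres C F (\<lambda>x u. 0[fob G x] -[fob G x] e x u)"
    show "?h \<in> carrier ?H" using e by (auto intro!: nres_hom[OF F] natl_minus[OF G natl_zero[OF G] n])
    have "(0[fob G x] -[fob G x] e x u) +[fob G x] e x u = 0[fob G x]" if h: "x \<in> obj C" "u \<in> el F x" for x u
    proof -
     interpret G: module R "fob G x" by (rule mf_mod[OF G h(1)])
     show ?thesis using c[OF _ h, of e] e by (simp add: G.minus_eq G.l_neg)
    qed
    then show "?h +[?H] e = 0[?H]" by (auto intro!: nres_cong simp: nres_apply)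
   qed
  qed
 next
  fix r e assume "r \<in> carrier R" "e \<in> carrier ?H"
  then show "r *[?H] e \<in> carrier ?H" by (auto intro!: nres_hom[OF F] natl_smult[OF G n])
 next
  fix r s e assume "r \<in> carrier R" "s \<in> carrier R" "e \<in> carrier ?H"
  then show "(r +[R] s) *[?H] e = r *[?H] e +[?H] s *[?H] e"
   by (auto intro!: nres_cong simp: nres_apply module.smult_l_distr[OF mf_mod[OF G]] c)
 next
  fix r e h assume "r \<in> carrier R" "e \<in> carrier ?H" "h \<in> carrier ?H"
  then show "r *[?H] (e +[?H] h) = r *[?H] e +[?H] r *[?H] h"
   by (auto intro!: nres_cong simp: nres_apply module.smult_r_distr[OF mf_mod[OF G]] c)
 next
  fix r s e assume "r \<in> carrier R" "s \<in> carrier R" "e \<in> carrier ?H"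
  then show "(r \<otimes>\<^bsub>R\<^esub> s) *[?H] e = r *[?H] (s *[?H] e)"
   by (auto intro!: nres_cong simp: nres_apply module.smult_assoc1[OF mf_mod[OF G]] c)
 next
  fix e assume "e \<in> carrier ?H"
  then show "\<one>\<^bsub>R\<^esub> *[?H] e = e" by (auto intro!: e_eq simp: module.smult_one[OF mf_mod[OF G]] c)
 qed
qed

section \<open>Transport of structure and direct sums\<close>

text \<open>Structure transported along a map injective on the carrier; it moves a module into a
  prescribed carrier type.\<close>

definition trm :: "('k, 'v) module => ('v => 'u) => ('k, 'u) module" where
 "trm M j = \<lparr>carrier = j ` carrier M, mult = undefined, one = undefined, zero = j 0[M],
   add = (\<lambda>p q. j (inv_into (carrier M) j p +[M] inv_into (carrier M) j q)),
   smult = (\<lambda>r p. j (r *[M] inv_into (carrier M) j p))\<rparr>"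

lemma trm_lin: "inj_on j (carrier M) ==> lin R M (trm M j) j" by (rule linI) (simp_all add: trm_def)

lemma trm_module: "module R M ==> inj_on j (carrier M) ==> module R (trm M j)"
 by (rule module_surj[OF _ trm_lin]) (simp_all add: trm_def)

lemma trm_carrier: "carrier (trm M j) = j ` carrier M" by (simp add: trm_def)

definition trf :: "('o, 'a, 'k, 'v) modfun => ('o => 'v => 'u) => ('o, 'a, 'k, 'u) modfun" where
 "trf G j = \<lparr>fob = (\<lambda>x. trm (fob G x) (j x)),
   far = (\<lambda>x y f. \<lambda>p \<in> j x ` el G x. j y (far G x y f (inv_into (el G x) (j x) p)))\<rparr>"

abbreviation trinv :: "('o, 'a, 'k, 'v) modfun => ('o => 'v => 'u) => 'o => 'u => 'v" where
 "trinv G j x \<equiv> inv_into (el G x) (j x)"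

lemma trf_carrier: "el (trf G j) x = j x ` el G x" by (simp add: trf_def trm_carrier)

context
 fixes R :: "'k ring" and C :: "('o, 'a) category_data" and G :: "('o, 'a, 'k, 'v) modfun"
  and j :: "'o => 'v => 'u"
 assumes C: "category C" and G: "modf R C G"
  and j: "!!x. x \<in> obj C ==> inj_on (j x) (el G x)"
begin

lemma trf_natl: "natl R C G (trf G j) j" by (rule natlI) (simp_all add: trf_def trm_lin j)

lemma trf_functor: "modf R C (trf G j)"
proof (rule mfI[OF _ _ _ _ _ C])
 show "module R (fob (trf G j) x)" if "x \<in> obj C" for x
  using trm_module[OF mf_mod[OF G that] j[OF that]] by (simp add: trf_def)
 show "lin R (fob (trf G j) x) (fob (trf G j) y) (far (trf G j) x y f)"
  if h: "x \<in> obj C" "y \<in> obj C" "f \<in> arr C x y" for x y f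
 proof -
  note c = inv_into_f_f[OF j[OF h(1)]]
  have "bij_betw (j x) (el G x) (carrier (trm (fob G x) (j x)))"
   using j[OF h(1)] by (simp add: bij_betw_def trm_carrier)
  then have "lin R (trm (fob G x) (j x)) (fob G x) (trinv G j x)"
   by (rule lin_inverse[OF mf_mod[OF G h(1)] trm_lin[OF j[OF h(1)]] _ c])
  from lin_compose[OF lin_compose[OF this mf_lin[OF G h]] trm_lin[OF j[OF h(2)]]]
  show ?thesis unfolding trf_def functor_data.simps
   by (rule lin_cong) (simp_all add: trm_module mf_mod[OF G h(1)] j[OF h(1)] trm_carrier)
 qed
 show "far (trf G j) x y f \<in> extensional (el (trf G j) x)" for x y f by (simp add: trf_def trm_carrier)
 show "far (trf G j) x x (idn C x) p = p" if "x \<in> obj C" "p \<in> el (trf G j) x" for x p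
  using that j[OF that(1)] by (auto simp: trf_def trm_carrier mf_id[OF G])
 show "far (trf G j) x z (cmp C x y z g f) p = far (trf G j) y z g (far (trf G j) x y f p)"
  if "x \<in> obj C" "y \<in> obj C" "z \<in> obj C" "f \<in> arr C x y" "g \<in> arr C y z" "p \<in> el (trf G j) x"
  for x y z f g p
 proof -
  have "far G x y f (trinv G j x p) \<in> el G y"
   using that by (auto simp: trf_def trm_carrier mf_closed[OF G] inv_into_into)
  then show ?thesis using that inv_into_f_f[OF j[OF that(2)]]
   by (auto simp: trf_def trm_carrier mf_cmp[OF G] inv_into_into)
 qed
qed

lemma trinv_trf: "x \<in> obj C ==> v \<in> el G x ==> trinv G j x (j x v) = v" using j by simp

lemma trinv_natl: "natl R C (trf G j) G (trinv G j)"
proof (rule natl_inverse[OF G trf_natl])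
 show "bij_betw (j x) (el G x) (el (trf G j) x)" if "x \<in> obj C" for x
  using j[OF that] by (simp add: bij_betw_def trf_carrier)
qed (rule trinv_trf)

end

section \<open>Direct sums of modules as finitely supported families\<close>

definition csum :: "'i set => ('i => ('k, 't) module) => ('k, 'i => 't) module" where
 "csum I M = \<lparr>carrier = {v \<in> \<Pi>\<^sub>E i \<in> I. carrier (M i). finite {i \<in> I. v i \<noteq> 0[M i]}},
   mult = undefined, one = undefined, zero = (\<lambda>i \<in> I. 0[M i]),
   add = (\<lambda>v w. \<lambda>i \<in> I. v i +[M i] w i), smult = (\<lambda>r v. \<lambda>i \<in> I. r *[M i] v i)\<rparr>"

definition cin :: "'i set => ('i => ('k, 't) module) => 'i => 't => 'i => 't" where
 "cin I M i t = (\<lambda>k \<in> I. if k = i then t else 0[M k])"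

text \<open>The map out of the sum with components \<open>\<phi> i\<close>. Summing over the support
  keeps the sum finite for an arbitrary index set.\<close>

definition cpair :: "'i set => ('i => ('k, 't) module) => ('k, 'w) module => ('i => 't => 'w) => ('i => 't) => 'w" where
 "cpair I M N \<phi> v = finsum N (\<lambda>i. \<phi> i (v i)) {i \<in> I. v i \<noteq> 0[M i]}"

lemma csum_closed: "v \<in> carrier (csum I M) ==> i \<in> I ==> v i \<in> carrier (M i)" by (auto simp: csum_def)

lemma csum_eqI:
 "v \<in> carrier (csum I M) ==> w \<in> carrier (csum I M) ==> (\<And>i. i \<in> I ==> v i = w i) ==> v = w"
 by (auto simp: csum_def intro: PiE_ext)

lemma csum_memI:
 assumes "!!i. i \<in> I ==> f i \<in> carrier (M i)" and "finite {i \<in> I. v i \<noteq> 0[M i]}" "finite {i \<in> I. w i \<noteq> 0[M i]}"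
  and z: "!!i. i \<in> I ==> v i = 0[M i] ==> w i = 0[M i] ==> f i = 0[M i]"
 shows "restrict f I \<in> carrier (csum I M)"
proof -
 have "finite {i \<in> I. restrict f I i \<noteq> 0[M i]}"
  by (rule finite_subset[OF _ finite_UnI[OF assms(2,3)]]) (use z in auto)
 then show ?thesis using assms(1) unfolding csum_def by (simp del: restrict_apply)
qed

lemma csum_support: "v \<in> carrier (csum I M) ==> finite {i \<in> I. v i \<noteq> 0[M i]}" by (simp add: csum_def)

lemma csum_restrict: "v \<in> carrier (csum I M) ==> restrict v I = v"
 by (auto simp: csum_def PiE_def extensional_restrict)

lemma csum_ops:
 "v +[csum I M] w = (\<lambda>i \<in> I. v i +[M i] w i)" "r *[csum I M] v = (\<lambda>i \<in> I. r *[M i] v i)"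
 "0[csum I M] = (\<lambda>i \<in> I. 0[M i])" by (simp_all add: csum_def)

context
 fixes R :: "'k ring" and I :: "'i set" and M :: "'i => ('k, 't) module"
 assumes R: "cring R" and M: "!!i. i \<in> I ==> module R (M i)"
begin

lemma csum_module: "module R (csum I M)"
proof -
 have ab: "!!i. i \<in> I ==> abelian_group (M i)" by (rule module.axioms(2)[OF M])
 have am: "!!i. i \<in> I ==> abelian_monoid (M i)" by (rule abelian_group.axioms(1)[OF ab])
 note A = abelian_monoid.a_closed[OF am] abelian_monoid.l_zero[OF am] abelian_monoid.zero_closed[OF am]
  abelian_group.a_inv_closed[OF ab] abelian_group.l_neg[OF ab] module.smult_closed[OF M]
  module.smult_r_null[OF M] csum_closed[where I = I and M = M]
 have eq: "restrict f I = v" if "v \<in> carrier (csum I M)" "!!i. i \<in> I ==> f i = v i" for f v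
  using csum_restrict[OF that(1)] that(2) by (metis restrict_ext)
 show ?thesis
 proof (rule moduleI[OF R])
  show "abelian_group (csum I M)"
  proof (rule abelian_groupI)
   fix v w assume v: "v \<in> carrier (csum I M)" and w: "w \<in> carrier (csum I M)"
   show "v +[csum I M] w \<in> carrier (csum I M)"
    unfolding csum_ops by (rule csum_memI[where v = v and w = w]) (simp_all add: v w csum_support A)
   show "v +[csum I M] w = w +[csum I M] v"
    unfolding csum_ops by (rule restrict_ext) (simp add: v w A abelian_monoid.a_comm[OF am])
   fix z assume z: "z \<in> carrier (csum I M)"
   show "(v +[csum I M] w) +[csum I M] z = v +[csum I M] (w +[csum I M] z)"
    unfolding csum_ops by (rule restrict_ext) (simp add: v w z A abelian_monoid.a_assoc[OF am])
  next
   show "0[csum I M] \<in> carrier (csum I M)"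
    unfolding csum_ops by (rule csum_memI[where v = "\<lambda>i. 0[M i]" and w = "\<lambda>i. 0[M i]"]) (simp_all add: A)
  next
   fix v assume v: "v \<in> carrier (csum I M)"
   show "0[csum I M] +[csum I M] v = v" unfolding csum_ops by (rule eq[OF v]) (simp add: A v)
   show "\<exists>w \<in> carrier (csum I M). w +[csum I M] v = 0[csum I M]"
   proof
    show "(\<lambda>i \<in> I. \<ominus>\<^bsub>M i\<^esub> v i) +[csum I M] v = 0[csum I M]" unfolding csum_ops by (rule restrict_ext) (simp add: A v)
    have "\<ominus>\<^bsub>M i\<^esub> 0[M i] = 0[M i]" if i: "i \<in> I" for i
     by (rule abelian_group.minus_equality[OF ab[OF i]]) (simp_all add: A i)
    then show "(\<lambda>i \<in> I. \<ominus>\<^bsub>M i\<^esub> v i) \<in> carrier (csum I M)"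
     by (intro csum_memI[where v = v and w = v]) (simp_all add: A v csum_support)
   qed
  qed
 next
  fix r v assume r: "r \<in> carrier R" and v: "v \<in> carrier (csum I M)"
  show "r *[csum I M] v \<in> carrier (csum I M)"
   unfolding csum_ops by (rule csum_memI[where v = v and w = v]) (simp_all add: v r csum_support A)
 next
  fix r s v assume "r \<in> carrier R" "s \<in> carrier R" "v \<in> carrier (csum I M)"
  then show "(r +[R] s) *[csum I M] v = r *[csum I M] v +[csum I M] s *[csum I M] v"
   unfolding csum_ops by (intro restrict_ext) (simp add: module.smult_l_distr[OF M] A)
 next
  fix r v w assume "r \<in> carrier R" "v \<in> carrier (csum I M)" "w \<in> carrier (csum I M)"
  then show "r *[csum I M] (v +[csum I M] w) = r *[csum I M] v +[csum I M] r *[csum I M] w"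
   unfolding csum_ops by (intro restrict_ext) (simp add: module.smult_r_distr[OF M] A)
 next
  fix r s v assume "r \<in> carrier R" "s \<in> carrier R" "v \<in> carrier (csum I M)"
  then show "(r \<otimes>\<^bsub>R\<^esub> s) *[csum I M] v = r *[csum I M] (s *[csum I M] v)"
   unfolding csum_ops by (intro restrict_ext) (simp add: module.smult_assoc1[OF M] A)
 next
  fix v assume v: "v \<in> carrier (csum I M)"
  then show "\<one>\<^bsub>R\<^esub> *[csum I M] v = v" unfolding csum_ops by (intro eq[OF v]) (simp add: module.smult_one[OF M] A)
 qed
qed

lemma cin_lin: "i \<in> I ==> lin R (M i) (csum I M) (cin I M i)"
proof -
 assume i: "i \<in> I"
 have ab: "!!i. i \<in> I ==> abelian_group (M i)" by (rule module.axioms(2)[OF M])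
 have am: "!!i. i \<in> I ==> abelian_monoid (M i)" by (rule abelian_group.axioms(1)[OF ab])
 have "finite {k \<in> I. (if k = i then t else 0[M k]) \<noteq> 0[M k]}" for t by (rule finite_subset[of _ "{i}"]) auto
 then show ?thesis
  using abelian_monoid.zero_closed[OF am] abelian_monoid.l_zero[OF am] module.smult_r_null[OF M]
  by (intro linI) (auto simp: csum_def cin_def intro!: restrict_ext cong: conj_cong)
qed

text \<open>Induction on a finite set that covers the support: each step splits off one coordinate
  by means of \<open>cin\<close>.\<close>

lemma csum_induct:
 assumes N: "submodule N R (csum I M)" and g: "!!i t. i \<in> I ==> t \<in> carrier (M i) ==> cin I M i t \<in> N"
 shows "carrier (csum I M) \<subseteq> N"
proof -
 have ab: "!!i. i \<in> I ==> abelian_group (M i)" by (rule module.axioms(2)[OF M])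
 have am: "!!i. i \<in> I ==> abelian_monoid (M i)" by (rule abelian_group.axioms(1)[OF ab])
 have "\<forall>v \<in> carrier (csum I M). {i \<in> I. v i \<noteq> 0[M i]} \<subseteq> A \<longrightarrow> v \<in> N" if "finite A" for A
  using that
 proof (induction A)
  case empty
  have "v = 0[csum I M]" if "v \<in> carrier (csum I M)" "{i \<in> I. v i \<noteq> 0[M i]} \<subseteq> {}" for v
   by (rule csum_eqI[OF that(1)]) (use that abelian_monoid.zero_closed[OF am] in \<open>auto simp: csum_def\<close>)
  then show ?case using submoduleD(2)[OF csum_module N] by auto
 next
  case (insert i A)
  show ?case
  proof (intro ballI impI)
   fix v assume v: "v \<in> carrier (csum I M)" and s: "{i \<in> I. v i \<noteq> 0[M i]} \<subseteq> insert i A"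
   show "v \<in> N"
   proof (cases "i \<in> I")
    case False
    then show ?thesis using insert.IH v s by auto
   next
    case i: True
    let ?w = "(\<lambda>k \<in> I. if k = i then 0[M k] else v k)"
    have w: "?w \<in> carrier (csum I M)"
     using v abelian_monoid.zero_closed[OF am] by (auto simp: csum_def elim!: rev_finite_subset split: if_splits)
    have "{i \<in> I. ?w i \<noteq> 0[M i]} \<subseteq> A" using s by auto
    then have "?w \<in> N" using insert.IH w by blast
    moreover have c: "cin I M i (v i) \<in> N" using g i csum_closed[OF v i] .
    moreover have "cin I M i (v i) +[csum I M] ?w = v"
    proof (rule csum_eqI[OF _ v])
     interpret S: module R "csum I M" by (rule csum_module)
     show "cin I M i (v i) +[csum I M] ?w \<in> carrier (csum I M)"
      using w lin_closed[OF cin_lin[OF i] csum_closed[OF v i]] by (rule S.a_closed[rotated])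
     show "(cin I M i (v i) +[csum I M] ?w) k = v k" if "k \<in> I" for k
      using that csum_closed[OF v that] abelian_monoid.l_zero[OF am[OF that]] abelian_monoid.r_zero[OF am[OF that]]
      by (auto simp: csum_def cin_def)
    qed
    ultimately show ?thesis using submoduleD(3)[OF csum_module N] by metis
   qed
  qed
 qed
 then show ?thesis by (force simp: csum_def)
qed

context
 fixes N :: "('k, 'w) module" and \<phi> :: "'i => 't => 'w"
 assumes N: "module R N" and \<phi>: "!!i. i \<in> I ==> lin R (M i) N (\<phi> i)"
begin

interpretation N: module R N by (rule N)

text \<open>Two families have different supports; additivity of \<open>cpair\<close> compares the
  sums over a common finite set.\<close>

lemma cpair_over:
 assumes v: "v \<in> carrier (csum I M)" and A: "finite A" "A \<subseteq> I" "{i \<in> I. v i \<noteq> 0[M i]} \<subseteq> A"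
 shows "cpair I M N \<phi> v = finsum N (\<lambda>i. \<phi> i (v i)) A"
 unfolding cpair_def
proof (rule N.add.finprod_mono_neutral_cong_left[OF A(1,3)])
 show "\<phi> i (v i) = 0[N]" if "i \<in> A - {i \<in> I. v i \<noteq> 0[M i]}" for i using that A(2) lin_zero[OF M N \<phi>] by auto
 show "(\<lambda>i. \<phi> i (v i)) \<in> A \<rightarrow> carrier N" using lin_closed[OF \<phi> csum_closed[OF v]] A(2) by auto
qed simp

lemma cpair_lin: "lin R (csum I M) N (cpair I M N \<phi>)"
proof (rule linI)
 interpret S: module R "csum I M" by (rule csum_module)
 have c: "(\<lambda>i. \<phi> i (v i)) \<in> A \<rightarrow> carrier N" if "A \<subseteq> I" "v \<in> carrier (csum I M)" for v A
  using lin_closed[OF \<phi> csum_closed[OF that(2)]] that(1) by auto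
 show "cpair I M N \<phi> v \<in> carrier N" if v: "v \<in> carrier (csum I M)" for v
  unfolding cpair_def by (rule N.finsum_closed) (use c[OF _ v] in auto)
 show "cpair I M N \<phi> (v +[csum I M] w) = cpair I M N \<phi> v +[N] cpair I M N \<phi> w"
  if v: "v \<in> carrier (csum I M)" and w: "w \<in> carrier (csum I M)" for v w
 proof -
  let ?A = "{i \<in> I. v i \<noteq> 0[M i]} \<union> {i \<in> I. w i \<noteq> 0[M i]}"
  have A: "finite ?A" "?A \<subseteq> I" using v w by (auto simp: csum_def)
  have vw: "v +[csum I M] w \<in> carrier (csum I M)" using v w by (rule S.a_closed)
  have "{i \<in> I. (v +[csum I M] w) i \<noteq> 0[M i]} \<subseteq> ?A"
   using abelian_monoid.l_zero[OF abelian_group.axioms(1)[OF module.axioms(2)[OF M]]]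
    abelian_monoid.zero_closed[OF abelian_group.axioms(1)[OF module.axioms(2)[OF M]]] by (auto simp: csum_def)
  then have "cpair I M N \<phi> (v +[csum I M] w) = finsum N (\<lambda>i. \<phi> i ((v +[csum I M] w) i)) ?A" by (intro cpair_over vw A)
  also have "\<dots> = finsum N (\<lambda>i. \<phi> i (v i) +[N] \<phi> i (w i)) ?A"
  proof (rule N.finsum_cong'[OF HOL.refl])
   show "(\<lambda>i. \<phi> i (v i) +[N] \<phi> i (w i)) \<in> ?A \<rightarrow> carrier N" using c[OF A(2) v] c[OF A(2) w] by auto
   show "\<phi> i ((v +[csum I M] w) i) = \<phi> i (v i) +[N] \<phi> i (w i)" if "i \<in> ?A" for i
   proof -
    have "i \<in> I" using that by auto
    then show ?thesis using lin_add[OF \<phi> csum_closed[OF v] csum_closed[OF w]] by (simp add: csum_def)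
   qed
  qed
  also have "\<dots> = finsum N (\<lambda>i. \<phi> i (v i)) ?A +[N] finsum N (\<lambda>i. \<phi> i (w i)) ?A"
   by (rule N.finsum_addf[OF c[OF A(2) v] c[OF A(2) w]])
  also have "\<dots> = cpair I M N \<phi> v +[N] cpair I M N \<phi> w" using cpair_over[OF v A] cpair_over[OF w A] by auto
  finally show ?thesis .
 qed
 show "cpair I M N \<phi> (r *[csum I M] v) = r *[N] cpair I M N \<phi> v"
  if r: "r \<in> carrier R" and v: "v \<in> carrier (csum I M)" for r v
 proof -
  let ?A = "{i \<in> I. v i \<noteq> 0[M i]}"
  have A: "finite ?A" "?A \<subseteq> I" using v by (auto simp: csum_def)
  have rv: "r *[csum I M] v \<in> carrier (csum I M)" using r v by (rule S.smult_closed)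
  have "{i \<in> I. (r *[csum I M] v) i \<noteq> 0[M i]} \<subseteq> ?A" using module.smult_r_null[OF M r] by (auto simp: csum_def)
  then have "cpair I M N \<phi> (r *[csum I M] v) = finsum N (\<lambda>i. \<phi> i ((r *[csum I M] v) i)) ?A" by (intro cpair_over rv A)
  also have "\<dots> = finsum N (\<lambda>i. r *[N] \<phi> i (v i)) ?A"
  proof (rule N.finsum_cong'[OF HOL.refl])
   show "(\<lambda>i. r *[N] \<phi> i (v i)) \<in> ?A \<rightarrow> carrier N" using c[OF A(2) v] r by auto
   show "\<phi> i ((r *[csum I M] v) i) = r *[N] \<phi> i (v i)" if "i \<in> ?A" for i
    using that lin_smult[OF \<phi> r csum_closed[OF v]] by (simp add: csum_def)
  qed
  also have "\<dots> = r *[N] finsum N (\<lambda>i. \<phi> i (v i)) ?A"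
   by (rule N.finsum_smult_ldistr[OF A(1) r c[OF A(2) v], symmetric])
  finally show ?thesis by (simp add: cpair_def)
 qed
qed

lemma cpair_cin: "i \<in> I ==> t \<in> carrier (M i) ==> cpair I M N \<phi> (cin I M i t) = \<phi> i t"
proof -
 assume i: "i \<in> I" and t: "t \<in> carrier (M i)"
 have "cpair I M N \<phi> (cin I M i t) = finsum N (\<lambda>k. \<phi> k (cin I M i t k)) {i}"
  by (rule cpair_over) (use lin_closed[OF cin_lin[OF i] t] i in \<open>auto simp: cin_def\<close>)
 also have "\<dots> = finsum N (\<lambda>k. \<phi> i t) {i}"
  by (rule N.finsum_cong') (use i lin_closed[OF \<phi>[OF i] t] in \<open>auto simp: cin_def\<close>)
 also have "\<dots> = \<phi> i t" using lin_closed[OF \<phi>[OF i] t] by simp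
 finally show ?thesis .
qed

end

text \<open>The set where two linear maps agree is a submodule, so \<open>csum_induct\<close>
  applies. The same equalizer argument recurs for the functors \<open>S a\<close> and for tensor
  products.\<close>

lemma csum_unique:
 assumes N: "module R N" and f: "lin R (csum I M) N f" and g: "lin R (csum I M) N g"
  and e: "!!i t. i \<in> I ==> t \<in> carrier (M i) ==> f (cin I M i t) = g (cin I M i t)"
  and v: "v \<in> carrier (csum I M)"
 shows "f v = g v"
proof -
 interpret S: module R "csum I M" by (rule csum_module)
 interpret N: module R N by (rule N)
 have "submodule {v \<in> carrier (csum I M). f v = g v} R (csum I M)" by (rule submoduleI'[OF csum_module])
    (auto simp: lin_add[OF f] lin_add[OF g] lin_smult[OF f] lin_smult[OF g]
     lin_zero[OF csum_module N f] lin_zero[OF csum_module N g])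
 from csum_induct[OF this] e v show ?thesis by (auto simp: lin_closed[OF cin_lin])
qed

end

section \<open>Yoneda systems\<close>

locale kcat =
 fixes R :: "'k ring" and C :: "('o, 'a) category_data"
 assumes cr: "cring R" and ct: "category C"

sublocale kcat \<subseteq> category C by (rule ct)

text \<open>
 The functors \<open>S a\<close> are the representable functors of a quotient of the \<open>k\<close>-linearization of \<open>C\<close>
 with the same objects; \<open>u a\<close> is the class of the identity.
\<close>

locale yoneda_system = kcat R C for R :: "'k ring" and C :: "('o, 'a) category_data" +
 fixes S :: "'o => ('o, 'a, 'k, 't) modfun" and u :: "'o => 't"
 assumes S_functor: "a \<in> obj C ==> modf R C (S a)"
  and u_closed: "a \<in> obj C ==> u a \<in> el (S a) a"
  and spanning: "[|a \<in> obj C; x \<in> obj C; submodule N R (fob (S a) x);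
    \<And>f. f \<in> arr C a x ==> far (S a) a x f (u a) \<in> N|] ==> el (S a) x \<subseteq> N"
  and yoneda: "[|a \<in> obj C; x \<in> obj C; t \<in> el (S a) x|]
    ==> \<exists>e. natl R C (S x) (S a) e \<and> e x (u x) = t"
begin

text \<open>The functors that factor through the quotient category.\<close>

definition amod :: "('o, 'a, 'k, 'u) modfun => bool" where
 "amod G \<longleftrightarrow> modf R C G \<and>
   (\<forall>a \<in> obj C. \<forall>g \<in> el G a. \<exists>e. natl R C (S a) G e \<and> e a (u a) = g)"

text \<open>In the quotient category, \<open>yo G a g x t\<close> is the image of \<open>g\<close>
  under \<open>G\<close> applied to the morphism \<open>t\<close> from \<open>a\<close> to
  \<open>x\<close>. The choice is harmless because \<open>spanning\<close> makes the transformation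
  unique.\<close>

definition yo :: "('o, 'a, 'k, 'u) modfun => 'o => 'u => 'o => 't => 'u" where
 "yo G a g = (SOME e. natl R C (S a) G e \<and> e a (u a) = g)"

lemma amodI:
 "modf R C G ==>
  (\<And>a g. a \<in> obj C ==> g \<in> el G a ==> \<exists>e. natl R C (S a) G e \<and> e a (u a) = g) ==> amod G" by (simp add: amod_def)

lemma amod_functor: "amod G ==> modf R C G" by (simp add: amod_def)

lemma S_amod: "a \<in> obj C ==> amod (S a)" by (simp add: amod_def S_functor yoneda)

lemma yo_natl: "amod G ==> a \<in> obj C ==> g \<in> el G a ==> natl R C (S a) G (yo G a g)"
 and yo_u: "amod G ==> a \<in> obj C ==> g \<in> el G a ==> yo G a g a (u a) = g"
proof -
 assume "amod G" "a \<in> obj C" "g \<in> el G a"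
 then have "\<exists>e. natl R C (S a) G e \<and> e a (u a) = g" by (simp add: amod_def)
 from someI_ex[OF this] show "natl R C (S a) G (yo G a g)" "yo G a g a (u a) = g" by (simp_all add: yo_def)
qed

lemma yo_closed:
 "amod G ==> a \<in> obj C ==> g \<in> el G a ==> x \<in> obj C ==> t \<in> el (S a) x ==>
  yo G a g x t \<in> el G x" by (rule natl_closed[OF yo_natl])

text \<open>The elements of \<open>S a x\<close> that \<open>e\<close> sends into \<open>N x\<close>
  form a submodule, and it contains the generators named in \<open>spanning\<close>.\<close>

lemma natl_S_land:
 assumes a: "a \<in> obj C" and G: "modf R C G" and e: "natl R C (S a) G e"
  and N: "stable R C G N" and g: "e a (u a) \<in> N a" and x: "x \<in> obj C" and t: "t \<in> el (S a) x"
 shows "e x t \<in> N x"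
proof -
 interpret S: module R "fob (S a) x" by (rule mf_mod[OF S_functor[OF a] x])
 note D = submoduleD[OF mf_mod[OF G x] stable_sub[OF N x]]
 note l = natl_lin[OF e x]
 have "submodule {t \<in> el (S a) x. e x t \<in> N x} R (fob (S a) x)" by (rule submoduleI'[OF mf_mod[OF S_functor[OF a] x]])
    (auto simp: D lin_add[OF l] lin_smult[OF l] lin_zero[OF mf_mod[OF S_functor[OF a] x] mf_mod[OF G x] l])
 from spanning[OF a x this] t show ?thesis
  by (auto simp: natl_nat[OF e a x] u_closed[OF a] mf_closed[OF S_functor[OF a] a x] stable_far[OF N a x _ g])
qed

lemma natl_S_unique:
 assumes a: "a \<in> obj C" and G: "modf R C G" and e: "natl R C (S a) G e" and h: "natl R C (S a) G h"
  and g: "e a (u a) = h a (u a)" and x: "x \<in> obj C" and t: "t \<in> el (S a) x"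
 shows "e x t = h x t"
proof -
 interpret S: module R "fob (S a) x" by (rule mf_mod[OF S_functor[OF a] x])
 note l = natl_lin[OF e x] and l' = natl_lin[OF h x] and m = mf_mod[OF S_functor[OF a] x] mf_mod[OF G x]
 have "submodule {t \<in> el (S a) x. e x t = h x t} R (fob (S a) x)" by (rule submoduleI'[OF m(1)])
    (auto simp: lin_add[OF l] lin_smult[OF l] lin_add[OF l'] lin_smult[OF l'] lin_zero[OF m l] lin_zero[OF m l'])
 from spanning[OF a x this] t show ?thesis
  by (auto simp: natl_nat[OF e a x] natl_nat[OF h a x] u_closed[OF a] mf_closed[OF S_functor[OF a] a x] g)
qed

lemma yo_eq:
 assumes G: "modf R C G" and a: "a \<in> obj C" and e: "natl R C (S a) G e" and g: "e a (u a) = g"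
  and x: "x \<in> obj C" and t: "t \<in> el (S a) x"
 shows "yo G a g x t = e x t"
proof -
 have "natl R C (S a) G (yo G a g) \<and> yo G a g a (u a) = g" unfolding yo_def by (rule someI[of _ e]) (simp add: e g)
 then show ?thesis using natl_S_unique[OF a G _ e _ x t] g by blast
qed

lemma yo_add:
 assumes G: "amod G" and a: "a \<in> obj C" and g: "g \<in> el G a" and h: "h \<in> el G a"
  and x: "x \<in> obj C" and t: "t \<in> el (S a) x"
 shows "yo G a (g +[fob G a] h) x t = yo G a g x t +[fob G x] yo G a h x t"
 using yo_u[OF G a] g h
 by (intro yo_eq[OF amod_functor[OF G] a _ _ x t] natl_add[OF amod_functor[OF G]] yo_natl[OF G a]) simp_all

lemma yo_smult:
 assumes G: "amod G" and a: "a \<in> obj C" and g: "g \<in> el G a" and r: "r \<in> carrier R"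
  and x: "x \<in> obj C" and t: "t \<in> el (S a) x"
 shows "yo G a (r *[fob G a] g) x t = r *[fob G x] yo G a g x t"
 using yo_u[OF G a g] r
 by (intro yo_eq[OF amod_functor[OF G] a _ _ x t] natl_smult[OF amod_functor[OF G]] yo_natl[OF G a g]) simp_all

lemma yo_lin:
 assumes G: "amod G" and a: "a \<in> obj C" and x: "x \<in> obj C" and t: "t \<in> el (S a) x"
 shows "lin R (fob G a) (fob G x) (\<lambda>g. yo G a g x t)"
 by (rule linI) (simp_all add: yo_closed[OF G a _ x t] yo_add[OF G a _ _ x t] yo_smult[OF G a _ _ x t])

lemma yo_natl_comp:
 assumes G: "amod G" and H: "modf R C H" and e: "natl R C G H e" and a: "a \<in> obj C"
  and g: "g \<in> el G a" and x: "x \<in> obj C" and t: "t \<in> el (S a) x"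
 shows "yo H a (e a g) x t = e x (yo G a g x t)"
 by (rule yo_eq[OF H a natl_compose[OF yo_natl[OF G a g] e] _ x t]) (simp add: yo_u[OF G a g])

text \<open>Associativity of the action; \<open>yo (S a) b s x t\<close> is the composite of
  \<open>s\<close> and \<open>t\<close> in the quotient category.\<close>

lemma yo_yo:
 assumes G: "amod G" and a: "a \<in> obj C" and g: "g \<in> el G a" and b: "b \<in> obj C"
  and s: "s \<in> el (S a) b" and x: "x \<in> obj C" and t: "t \<in> el (S b) x"
 shows "yo G b (yo G a g b s) x t = yo G a g x (yo (S a) b s x t)"
 by (rule yo_natl_comp[OF S_amod[OF a] amod_functor[OF G] yo_natl[OF G a g] b s x t])

lemma yo_id: "a \<in> obj C ==> x \<in> obj C ==> t \<in> el (S a) x ==> yo (S a) a (u a) x t = t"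
 by (rule yo_eq[OF S_functor _ natl_id]) simp_all

lemma yo_far:
 assumes G: "amod G" and a: "a \<in> obj C" and g: "g \<in> el G a" and x: "x \<in> obj C" and f: "f \<in> arr C a x"
 shows "yo G a g x (far (S a) a x f (u a)) = far G a x f g"
 by (simp add: natl_nat[OF yo_natl[OF G a g] a x f u_closed[OF a]] yo_u[OF G a g])

text \<open>Lift the element along the surjection, take the transformation belonging to the lift,
  and compose with \<open>e\<close>.\<close>

lemma amod_surj:
 assumes G: "amod G" and H: "modf R C H" and e: "natl R C G H e"
  and s: "!!x h. x \<in> obj C ==> h \<in> el H x ==> \<exists>g \<in> el G x. e x g = h"
 shows "amod H"
proof (rule amodI[OF H])
 fix a h assume a: "a \<in> obj C" and "h \<in> el H a"
 then obtain g where g: "g \<in> el G a" "e a g = h" using s by blast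
 show "\<exists>e. natl R C (S a) H e \<and> e a (u a) = h"
  using natl_compose[OF yo_natl[OF G a g(1)] e] yo_u[OF G a g(1)] g(2) by auto
qed

text \<open>By \<open>natl_S_land\<close> the transformation that belongs to an element of
  \<open>N\<close> never leaves \<open>N\<close>.\<close>

lemma amod_subf:
 assumes G: "amod G" and N: "stable R C G N"
 shows "amod (subf G N)"
proof (rule amodI)
 show "modf R C (subf G N)" by (rule subf_functor[OF ct amod_functor[OF G] N])
 fix a g assume a: "a \<in> obj C" and g: "g \<in> el (subf G N) a"
 then have gc: "g \<in> el G a" using stable_carrier[OF amod_functor[OF G] N a] by simp
 have "natl R C (S a) (subf G N) (yo G a g)"
 proof (rule natl_subf_target[OF yo_natl[OF G a gc]])
  show "yo G a g x t \<in> N x" if "x \<in> obj C" "t \<in> el (S a) x" for x t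
   using natl_S_land[OF a amod_functor[OF G] yo_natl[OF G a gc] N _ that] yo_u[OF G a gc] g by simp
 qed
 then show "\<exists>e. natl R C (S a) (subf G N) e \<and> e a (u a) = g" using yo_u[OF G a gc] by blast
qed

lemma amod_sqf:
 assumes G: "amod G" and Z: "stable R C G Z" and B: "stable R C G B" and BZ: "!!x. x \<in> obj C ==> B x \<subseteq> Z x"
 shows "amod (sqf G Z B)"
proof (rule amod_surj[OF amod_subf[OF G Z]])
 note c = ct amod_functor[OF G] Z B BZ
 show "modf R C (sqf G Z B)" by (rule sqf_functor[OF c])
 show "natl R C (subf G Z) (sqf G Z B) (sqrep G Z B)" by (rule sqf_proj[OF c])
 show "\<exists>g \<in> el (subf G Z) x. sqrep G Z B x g = h"
  if "x \<in> obj C" "h \<in> el (sqf G Z B) x" for x h using sqf_carrier[OF c that] sqf_proj_surj[OF c that] by auto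
qed

lemma amod_trf:
 assumes G: "amod G" and j: "!!x. x \<in> obj C ==> inj_on (j x) (el G x)"
 shows "amod (trf G j)"
 by (rule amod_surj[OF G trf_functor[OF ct amod_functor[OF G] j] trf_natl[OF ct amod_functor[OF G] j]])
   (auto simp: trf_carrier)

lemma zero_fun_functor: "modf R C (zero_fun :: ('o, 'a, 'k, 'u) modfun)"
proof (rule mfI[OF _ _ _ _ _ ct])
 show "module R (fob (zero_fun :: ('o, 'a, 'k, 'u) modfun) x)" for x
  unfolding zero_fun_def by (auto intro!: moduleI[OF cr] abelian_groupI)
qed (auto simp: zero_fun_def lin_def)

lemma zero_functor_amod: "modf R C G ==> zero_functor C G ==> amod G"
proof (rule amodI)
 fix a g assume G: "modf R C G" "zero_functor C G" and a: "a \<in> obj C" "g \<in> el G a"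
 then have "g = 0[fob G a]" by (auto simp: zero_functor_def trivial_mod_def)
 then show "\<exists>e. natl R C (S a) G e \<and> e a (u a) = g" using natl_zero[OF G(1)] by blast
qed

lemma zero_functor_zero_fun: "zero_functor C (zero_fun :: ('o, 'a, 'k, 'u) modfun)"
 by (simp add: zero_functor_def trivial_mod_def zero_fun_def)

lemma zero_fun_amod: "amod (zero_fun :: ('o, 'a, 'k, 'u) modfun)"
 by (intro zero_functor_amod zero_fun_functor zero_functor_zero_fun)

end

section \<open>Free functors and the subcategory generated by the standard functors\<close>

lemma ex1_unique: "\<exists>!x. P x ==> P a ==> P b ==> a = b" by blast

text \<open>\<open>h\<close> evaluates \<open>l\<close> at an arbitrary preimage; two preimages
  differ by an element that \<open>e\<close> kills, hence \<open>l\<close> too. This supplies the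
  universal property of cokernels.\<close>

lemma natl_factor:
 assumes P: "modf R C P" and G: "modf R C G" and L: "modf R C L"
  and e: "natl R C P G e" and l: "natl R C P L l"
  and s: "!!x v. x \<in> obj C ==> v \<in> el G x ==> \<exists>w \<in> el P x. e x w = v"
  and k: "!!x w. x \<in> obj C ==> w \<in> el P x ==> e x w = 0[fob G x] ==> l x w = 0[fob L x]"
 shows "\<exists>h. natl R C G L h \<and> (\<forall>x \<in> obj C. \<forall>w \<in> el P x. h x (e x w) = l x w)"
proof -
 define h where "h = (\<lambda>x v. l x (SOME w. w \<in> el P x \<and> e x w = v))"
 have he: "h x (e x w) = l x w" if x: "x \<in> obj C" and w: "w \<in> el P x" for x w
 proof -
  interpret M: module R "fob P x" by (rule mf_mod[OF P x])
  define w' where "w' = (SOME w'. w' \<in> el P x \<and> e x w' = e x w)"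
  have w': "w' \<in> el P x" "e x w' = e x w"
   unfolding w'_def using someI[of "\<lambda>w'. w' \<in> el P x \<and> e x w' = e x w" w] w by auto
  have "e x (w' -[fob P x] w) = 0[fob G x]"
   using w w' by (simp add: lin_minus[OF mf_mod[OF P x] mf_mod[OF G x] natl_lin[OF e x]]
    minus_eq_zero_iff[OF mf_mod[OF G x]] natl_closed[OF e x])
  then have "l x (w' -[fob P x] w) = 0[fob L x]" using k[OF x, of "w' -[fob P x] w"] w w' by simp
  then have "l x w' = l x w" using w w' by (simp add: lin_minus[OF mf_mod[OF P x] mf_mod[OF L x] natl_lin[OF l x]]
    minus_eq_zero_iff[OF mf_mod[OF L x]] natl_closed[OF l x])
  then show ?thesis by (simp add: h_def w'_def)
 qed
 have "natl R C G L h"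
 proof (rule natlI)
  fix x assume x: "x \<in> obj C"
  interpret M: module R "fob P x" by (rule mf_mod[OF P x])
  show "lin R (fob G x) (fob L x) (h x)"
  proof (rule linI)
   fix v assume "v \<in> el G x"
   then obtain w where w: "w \<in> el P x" "v = e x w" using s[OF x] by metis
   then show "h x v \<in> el L x" using natl_closed[OF l x] he[OF x] by simp
   show "h x (r *[fob G x] v) = r *[fob L x] h x v" if "r \<in> carrier R" for r
    using w that he[OF x, of "r *[fob P x] w"] he[OF x w(1)]
    by (simp add: lin_smult[OF natl_lin[OF e x]] lin_smult[OF natl_lin[OF l x]])
   fix v' assume "v' \<in> el G x"
   then obtain w' where w': "w' \<in> el P x" "v' = e x w'" using s[OF x] by metis
   show "h x (v +[fob G x] v') = h x v +[fob L x] h x v'"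
    using w w' he[OF x, of "w +[fob P x] w'"] he[OF x w(1)] he[OF x w'(1)]
    by (simp add: lin_add[OF natl_lin[OF e x]] lin_add[OF natl_lin[OF l x]])
  qed
 next
  fix x y f v assume x: "x \<in> obj C" and y: "y \<in> obj C" and f: "f \<in> arr C x y" and v: "v \<in> el G x"
  obtain w where w: "w \<in> el P x" "v = e x w" using s[OF x v] by metis
  have "h y (far G x y f v) = h y (e y (far P x y f w))" by (simp add: w(2) natl_nat[OF e x y f w(1)])
  also have "\<dots> = far L x y f (h x v)" by (simp add: w(2) he x y mf_closed[OF P x y f] w(1) natl_nat[OF l x y f])
  finally show "h y (far G x y f v) = far L x y f (h x v)" .
 qed
 then show ?thesis using he by blast
qed

text \<open>The inverse isomorphism acts surjectively on values, so a generating set needs elements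
  over only one object in each isomorphism class.\<close>

lemma isomorphic_retract:
 assumes F: "modf R C F" and i: "isomorphic C x y"
 shows "\<exists>f \<in> arr C y x. \<forall>g \<in> el F x. \<exists>g' \<in> el F y. far F y x f g' = g"
proof -
 from i obtain f f' where xy: "x \<in> obj C" "y \<in> obj C" and f: "f \<in> arr C x y" "f' \<in> arr C y x"
  "cmp C x y x f' f = idn C x" by (auto simp: isomorphic_def)
 have "far F y x f' (far F x y f g) = g" if "g \<in> el F x" for g
  using mf_cmp[OF F xy(1,2,1) f(1,2) that] mf_id[OF F xy(1) that] f(3) by simp
 then show ?thesis using f(2) mf_closed[OF F xy f(1)] by blast
qed

context yoneda_system
begin

section \<open>Direct sums of the functors \<open>S a\<close>\<close>

definition cop :: "'i set => ('i => 'o) => ('o, 'a, 'k, 'i => 't) modfun" where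
 "cop I a = \<lparr>fob = (\<lambda>x. csum I (\<lambda>i. fob (S (a i)) x)),
   far = (\<lambda>x y f. \<lambda>v \<in> carrier (csum I (\<lambda>i. fob (S (a i)) x)). \<lambda>i \<in> I. far (S (a i)) x y f (v i))\<rparr>"

definition copin :: "'i set => ('i => 'o) => 'i => 'o => 't => 'i => 't" where
 "copin I a i = (\<lambda>x. cin I (\<lambda>i. fob (S (a i)) x) i)"

definition copair ::
 "'i set => ('i => 'o) => ('o, 'a, 'k, 'v) modfun => ('i => 'o => 't => 'v) => 'o => ('i => 't) => 'v" where
 "copair I a G \<phi> = (\<lambda>x. cpair I (\<lambda>i. fob (S (a i)) x) (fob G x) (\<lambda>i. \<phi> i x))"

lemma cop_fob: "fob (cop I a) x = csum I (\<lambda>i. fob (S (a i)) x)" by (simp add: cop_def)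

context
 fixes I :: "'i set" and a :: "'i => 'o"
 assumes a: "!!i. i \<in> I ==> a i \<in> obj C"
begin

lemma cop_summand: "x \<in> obj C ==> i \<in> I ==> module R (fob (S (a i)) x)" by (rule mf_mod[OF S_functor[OF a]])

lemma cop_closed: "x \<in> obj C ==> v \<in> el (cop I a) x ==> i \<in> I ==> v i \<in> el (S (a i)) x"
 unfolding cop_fob by (rule csum_closed)

lemma cop_far_lin:
 assumes x: "x \<in> obj C" and y: "y \<in> obj C" and f: "f \<in> arr C x y"
 shows "lin R (fob (cop I a) x) (fob (cop I a) y) (far (cop I a) x y f)"
proof -
 interpret M: module R "fob (cop I a) x" unfolding cop_fob by (rule csum_module[OF cr cop_summand[OF x]])
 note l = mf_lin[OF S_functor[OF a] x y f]
 have z: "far (S (a i)) x y f 0[fob (S (a i)) x] = 0[fob (S (a i)) y]" if "i \<in> I" for i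
  by (rule lin_zero[OF cop_summand[OF x that] cop_summand[OF y that] l[OF that]])
 have ap: "far (cop I a) x y f v = (\<lambda>i \<in> I. far (S (a i)) x y f (v i))" if "v \<in> el (cop I a) x" for v
  using that by (simp add: cop_def)
 show ?thesis
 proof (rule linI)
  fix v assume v: "v \<in> el (cop I a) x"
  note vc = v[unfolded cop_fob]
  have fin: "finite {i \<in> I. v i \<noteq> 0[fob (S (a i)) x]}" by (rule csum_support[OF vc])
  have "(\<lambda>i \<in> I. far (S (a i)) x y f (v i)) \<in> carrier (csum I (\<lambda>i. fob (S (a i)) y))"
  \<comment> \<open>Both witnesses vanish wherever \<open>v\<close> does, so their supports are
    finite; at the remaining indices the second agrees with the image, which yields the vanishing
    condition.\<close>
  proof (rule csum_memI[where v = "\<lambda>i. if v i = 0[fob (S (a i)) x] then 0[fob (S (a i)) y] else undefined"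
     and w = "\<lambda>i. if v i = 0[fob (S (a i)) x] then 0[fob (S (a i)) y] else far (S (a i)) x y f (v i)"])
   show "finite {i \<in> I. (if v i = 0[fob (S (a i)) x] then 0[fob (S (a i)) y] else undefined) \<noteq> 0[fob (S (a i)) y]}"
    by (rule finite_subset[OF _ fin]) auto
   show "finite {i \<in> I. (if v i = 0[fob (S (a i)) x] then 0[fob (S (a i)) y] else far (S (a i)) x y f (v i)) \<noteq> 0[fob (S (a i)) y]}"
    by (rule finite_subset[OF _ fin]) auto
  qed (auto simp: lin_closed[OF l] cop_closed[OF x v] z split: if_splits)
  then show "far (cop I a) x y f v \<in> el (cop I a) y" by (simp add: ap[OF v] cop_fob)
  show "far (cop I a) x y f (r *[fob (cop I a) x] v) = r *[fob (cop I a) y] far (cop I a) x y f v"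
   if r: "r \<in> carrier R" for r
   unfolding ap[OF v] ap[OF M.smult_closed[OF r v]] unfolding cop_fob csum_ops
   by (rule restrict_ext) (simp add: lin_smult[OF l r] cop_closed[OF x v])
  fix w assume w: "w \<in> el (cop I a) x"
  show "far (cop I a) x y f (v +[fob (cop I a) x] w) = far (cop I a) x y f v +[fob (cop I a) y] far (cop I a) x y f w"
   unfolding ap[OF v] ap[OF w] ap[OF M.a_closed[OF v w]] unfolding cop_fob csum_ops
   by (rule restrict_ext) (simp add: lin_add[OF l] cop_closed[OF x v] cop_closed[OF x w])
 qed
qed

lemma cop_functor: "modf R C (cop I a)"
proof (rule mfI[OF _ cop_far_lin _ _ _ ct])
 show "module R (fob (cop I a) x)" if "x \<in> obj C" for x
  unfolding cop_fob by (rule csum_module[OF cr cop_summand[OF that]])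
 show "far (cop I a) x y f \<in> extensional (el (cop I a) x)" for x y f by (simp add: cop_def)
 have r: "restrict v I = v" if "x \<in> obj C" "v \<in> el (cop I a) x" for x v
  using csum_restrict that(2) by (simp add: cop_fob)
 show "far (cop I a) x x (idn C x) v = v" if x: "x \<in> obj C" and v: "v \<in> el (cop I a) x" for x v
 proof -
  have "far (cop I a) x x (idn C x) v = restrict v I"
   using v mf_id[OF S_functor[OF a] x cop_closed[OF x v]] by (auto simp: cop_def intro!: restrict_ext)
  then show ?thesis using r[OF x v] by simp
 qed
 show "far (cop I a) x z (cmp C x y z g f) v = far (cop I a) y z g (far (cop I a) x y f v)"
  if x: "x \<in> obj C" "y \<in> obj C" "z \<in> obj C" "f \<in> arr C x y" "g \<in> arr C y z" and v: "v \<in> el (cop I a) x"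
  for x y z f g v
  using v lin_closed[OF cop_far_lin[OF x(1,2,4)] v] mf_cmp[OF S_functor[OF a] x cop_closed[OF x(1) v]]
  by (auto simp: cop_def intro!: restrict_ext)
qed

lemma copin_natl: "i \<in> I ==> natl R C (S (a i)) (cop I a) (copin I a i)"
proof (rule natlI)
 assume i: "i \<in> I"
 show "lin R (fob (S (a i)) x) (fob (cop I a) x) (copin I a i x)" if "x \<in> obj C" for x
  unfolding copin_def cop_fob by (rule cin_lin[where M = "\<lambda>i. fob (S (a i)) x", OF cr cop_summand[OF that] i])
 fix x y f t assume x: "x \<in> obj C" and y: "y \<in> obj C" and f: "f \<in> arr C x y" and t: "t \<in> el (S (a i)) x"
 have "cin I (\<lambda>i. fob (S (a i)) x) i t \<in> carrier (csum I (\<lambda>i. fob (S (a i)) x))"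
  by (rule lin_closed[OF cin_lin[where M = "\<lambda>i. fob (S (a i)) x", OF cr cop_summand[OF x] i] t])
 then show "copin I a i y (far (S (a i)) x y f t) = far (cop I a) x y f (copin I a i x t)"
  using lin_zero[OF cop_summand[OF x] cop_summand[OF y] mf_lin[OF S_functor[OF a] x y f]]
  by (auto simp: copin_def cop_def cin_def intro!: restrict_ext)
qed

lemma cop_unique:
 assumes G: "modf R C G" and x: "x \<in> obj C"
  and e: "lin R (fob (cop I a) x) (fob G x) e" and h: "lin R (fob (cop I a) x) (fob G x) h"
  and eq: "!!i t. i \<in> I ==> t \<in> el (S (a i)) x ==> e (copin I a i x t) = h (copin I a i x t)"
  and v: "v \<in> el (cop I a) x"
 shows "e v = h v" by (rule csum_unique[OF cr cop_summand[OF x] mf_mod[OF G x] e[unfolded cop_fob] h[unfolded cop_fob]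
    eq[unfolded copin_def] v[unfolded cop_fob]])

lemma copair_copin:
 assumes G: "modf R C G" and \<phi>: "!!i. i \<in> I ==> natl R C (S (a i)) G (\<phi> i)"
  and "x \<in> obj C" "i \<in> I" "t \<in> el (S (a i)) x"
 shows "copair I a G \<phi> x (copin I a i x t) = \<phi> i x t"
 unfolding copair_def copin_def
 by (rule cpair_cin[where M = "\<lambda>i. fob (S (a i)) x" and \<phi> = "\<lambda>i. \<phi> i x", OF cr cop_summand[OF assms(3)] mf_mod[OF G assms(3)] natl_lin[OF \<phi> assms(3)] assms(4,5)])

lemma copair_natl:
 assumes G: "modf R C G" and \<phi>: "!!i. i \<in> I ==> natl R C (S (a i)) G (\<phi> i)"
 shows "natl R C (cop I a) G (copair I a G \<phi>)"
proof (rule natlI)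
 show l: "lin R (fob (cop I a) x) (fob G x) (copair I a G \<phi> x)" if "x \<in> obj C" for x
  unfolding copair_def cop_fob by (rule cpair_lin[where M = "\<lambda>i. fob (S (a i)) x" and \<phi> = "\<lambda>i. \<phi> i x", OF cr cop_summand[OF that] mf_mod[OF G that] natl_lin[OF \<phi> that]])
 fix x y f v assume x: "x \<in> obj C" and y: "y \<in> obj C" and f: "f \<in> arr C x y" and v: "v \<in> el (cop I a) x"
 show "copair I a G \<phi> y (far (cop I a) x y f v) = far G x y f (copair I a G \<phi> x v)"
 proof (rule csum_unique[where M = "\<lambda>i. fob (S (a i)) x" and I = I, OF cr cop_summand[OF x] mf_mod[OF G y] _ _ _ v[unfolded cop_fob]])
  show "lin R (csum I (\<lambda>i. fob (S (a i)) x)) (fob G y) (\<lambda>v. copair I a G \<phi> y (far (cop I a) x y f v))"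
   using lin_compose[OF cop_far_lin[OF x y f] l[OF y]] by (simp add: cop_fob)
  show "lin R (csum I (\<lambda>i. fob (S (a i)) x)) (fob G y) (\<lambda>v. far G x y f (copair I a G \<phi> x v))"
   using lin_compose[OF l[OF x] mf_lin[OF G x y f]] by (simp add: cop_fob)
  fix i t assume i: "i \<in> I" and t: "t \<in> el (S (a i)) x"
  show "copair I a G \<phi> y (far (cop I a) x y f (cin I (\<lambda>i. fob (S (a i)) x) i t)) =
    far G x y f (copair I a G \<phi> x (cin I (\<lambda>i. fob (S (a i)) x) i t))"
   using natl_nat[OF copin_natl[OF i] x y f t, symmetric] copair_copin[OF G \<phi> x i t]
    copair_copin[OF G \<phi> y i mf_closed[OF S_functor[OF a[OF i]] x y f t]] natl_nat[OF \<phi>[OF i] x y f t]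
   by (simp add: copin_def)
 qed
qed

text \<open>The elements at \<open>b\<close> that come from some transformation
  \<open>S b \<rightarrow> cop I a\<close> form a submodule, and it contains every summand because
  each \<open>S (a i)\<close> is itself \<open>amod\<close>.\<close>

lemma cop_amod: "amod (cop I a)"
proof (rule amodI[OF cop_functor])
 fix b v assume b: "b \<in> obj C" and v: "v \<in> el (cop I a) b"
 let ?N = "{v \<in> el (cop I a) b. \<exists>e. natl R C (S b) (cop I a) e \<and> e b (u b) = v}"
 interpret M: module R "fob (cop I a) b" by (rule mf_mod[OF cop_functor b])
 have "submodule ?N R (fob (cop I a) b)"
 proof (rule submoduleI'[OF mf_mod[OF cop_functor b]])
  show "0[fob (cop I a) b] \<in> ?N" using natl_zero[OF cop_functor] by auto
  show "v +[fob (cop I a) b] w \<in> ?N" if "v \<in> ?N" "w \<in> ?N" for v w using that by (auto dest: natl_add[OF cop_functor])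
  show "r *[fob (cop I a) b] v \<in> ?N" if "r \<in> carrier R" "v \<in> ?N" for r v
   using that by (auto dest: natl_smult[OF cop_functor])
 qed auto
 moreover have "cin I (\<lambda>i. fob (S (a i)) b) i t \<in> ?N" if i: "i \<in> I" and t: "t \<in> el (S (a i)) b" for i t
  using natl_closed[OF copin_natl[OF i] b t] natl_compose[OF yo_natl[OF S_amod[OF a[OF i]] b t] copin_natl[OF i]]
   yo_u[OF S_amod[OF a[OF i]] b t] by (auto simp: copin_def)
 ultimately have "el (cop I a) b \<subseteq> ?N" unfolding cop_fob by (intro csum_induct[OF cr cop_summand[OF b]])
 then show "\<exists>e. natl R C (S b) (cop I a) e \<and> e b (u b) = v" using v by blast
qed

end

text \<open>Over a finite index set every family has finite support, so the full product of
  \<open>direct_sum\<close> is the whole of \<open>csum\<close>.\<close>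

lemma direct_sum_cop: "direct_sum (map S as) = cop {..<length as} (\<lambda>i. as ! i)"
proof -
 have f: "(\<Pi>\<^sub>E i \<in> {..<length as}. el (map S as ! i) x) =
   {v \<in> \<Pi>\<^sub>E i \<in> {..<length as}. el (S (as ! i)) x. finite {i \<in> {..<length as}. v i \<noteq> 0[fob (S (as ! i)) x]}}" for x
  by (auto simp: PiE_def Pi_def)
 show ?thesis
  unfolding direct_sum_def cop_def csum_def length_map f
  by (rule functor_data.equality) (simp_all add: fun_eq_iff cong: restrict_cong)
qed

end

text \<open>
 The modules have carriers in \<open>'u\<close>; \<open>\<kappa>\<close>, \<open>pr\<close> and \<open>sk\<close> witness that \<open>'u\<close> is large enough.
\<close>

locale large_yoneda = yoneda_system R C S u
 for R :: "'k ring" and C :: "('o, 'a) category_data" and S :: "'o => ('o, 'a, 'k, 't) modfun" and u :: "'o => 't" +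
 fixes \<kappa> :: "'t => 'u" and pr :: "'u \<times> 'u => 'u" and sk :: "'o => 'u"
 assumes inj_\<kappa>: "inj \<kappa>" and inj_pr: "inj pr" and inf_u: "infinite (UNIV :: 'u set)"
  and skel: "[|x \<in> obj C; y \<in> obj C; sk x = sk y|] ==> isomorphic C x y"
begin

definition c0 :: 'u where "c0 = (SOME x. True)"
definition c1 :: 'u where "c1 = (SOME x. x \<noteq> c0)"

lemma c01: "c1 \<noteq> c0"
 unfolding c1_def by (rule someI_ex) (metis (full_types) ex_new_if_finite finite.intros inf_u insertI1)

text \<open>An injective code for lists built from the injective pairing alone; the tags
  \<open>c0\<close> and \<open>c1\<close> tell the empty list from a nonempty one.\<close>

primrec enc :: "'u list => 'u" where
 "enc [] = pr (c0, c0)"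
| "enc (x # xs) = pr (c1, pr (x, enc xs))"

lemma enc_inj: "enc xs = enc ys ==> xs = ys"
proof (induction xs arbitrary: ys)
 case Nil
 then show ?case using c01 by (cases ys) (auto dest: injD[OF inj_pr])
next
 case (Cons x xs)
 then show ?case using c01 by (cases ys) (auto dest!: injD[OF inj_pr])
qed

text \<open>A finite set is coded by the code of one chosen enumeration, from which the set can be
  recovered.\<close>

definition enf :: "'u set => 'u" where
 "enf A = enc (SOME xs. set xs = A)"

lemma enf_inj: "finite A ==> finite B ==> enf A = enf B ==> A = B"
proof -
 assume "finite A" "finite B" "enf A = enf B"
 then have "set (SOME xs. set xs = A) = A" "set (SOME xs. set xs = B) = B"
  by (auto intro!: someI_ex[of "\<lambda>xs. set xs = _"] finite_list)
 then show ?thesis using \<open>enf A = enf B\<close> enc_inj unfolding enf_def by metis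
qed

text \<open>\<open>\<xi>\<close> embeds the index set in \<open>'u\<close>.\<close>

definition ecop :: "('i => 'u) => 'i set => ('i => 'o) => 'o => ('i => 't) => 'u" where
 "ecop \<xi> I a x v = enf ((\<lambda>i. pr (\<xi> i, \<kappa> (v i))) ` {i \<in> I. v i \<noteq> 0[fob (S (a i)) x]})"

text \<open>The code is that of the finite graph of index-value pairs over the support. The graph
  determines the family, since off the support all values are zero.\<close>

lemma ecop_inj:
 assumes a: "!!i. i \<in> I ==> a i \<in> obj C" and \<xi>: "inj_on \<xi> I" and x: "x \<in> obj C"
 shows "inj_on (ecop \<xi> I a x) (el (cop I a) x)"
proof (rule inj_onI)
 fix v w assume v: "v \<in> el (cop I a) x" and w: "w \<in> el (cop I a) x"
  and e: "ecop \<xi> I a x v = ecop \<xi> I a x w"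
 let ?A = "\<lambda>v. {i \<in> I. v i \<noteq> 0[fob (S (a i)) x]}" and ?f = "\<lambda>v i. pr (\<xi> i, \<kappa> (v i))"
 have fin: "finite (?A v)" "finite (?A w)" using csum_support v w by (simp_all add: cop_fob)
 have eq: "?f v ` ?A v = ?f w ` ?A w" using e fin unfolding ecop_def by (intro enf_inj) auto
 have "v i = w i" if i: "i \<in> I" for i
 proof -
  have *: "v i = w i" if "?f v ` ?A v = ?f w ` ?A w" "i \<in> ?A v" for v w
  proof -
   from that have "?f v i \<in> ?f w ` ?A w" by blast
   then obtain k where k: "k \<in> ?A w" "?f v i = ?f w k" by blast
   then have "\<xi> i = \<xi> k" "v i = w k" using injD[OF inj_pr k(2)] by (simp_all add: inj_eq[OF inj_\<kappa>])
   then show ?thesis using \<xi> i k(1) by (auto dest: inj_onD)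
  qed
  consider "i \<in> ?A v" | "i \<in> ?A w" | "v i = 0[fob (S (a i)) x]" "w i = 0[fob (S (a i)) x]" using i by blast
  then show ?thesis
  proof cases
   case 1
   then show ?thesis by (rule *[OF eq])
  next
   case 2
   then show ?thesis by (rule *[OF eq[symmetric], symmetric])
  qed simp
 qed
 then show "v = w"
  by (rule csum_eqI[where I = I and M = "\<lambda>i. fob (S (a i)) x", OF v[unfolded cop_fob] w[unfolded cop_fob]])
qed

definition fcop :: "('i => 'u) => 'i set => ('i => 'o) => ('o, 'a, 'k, 'u) modfun" where
 "fcop \<xi> I a = trf (cop I a) (ecop \<xi> I a)"

text \<open>The copy of \<open>S b\<close> with carriers in \<open>'u\<close>: diagrams, cones and
  projectives all live in that type, while \<open>S b\<close> may not.\<close>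

definition std :: "'o => ('o, 'a, 'k, 'u) modfun" where
 "std b = trf (S b) (\<lambda>x. \<kappa>)"

lemma inj_on_\<kappa>: "inj_on \<kappa> A" using inj_\<kappa> by (rule inj_on_subset) simp

lemma std_functor: "b \<in> obj C ==> modf R C (std b)"
 and std_natl: "b \<in> obj C ==> natl R C (S b) (std b) (\<lambda>x. \<kappa>)"
 and std_inv_natl: "b \<in> obj C ==> natl R C (std b) (S b) (trinv (S b) (\<lambda>x. \<kappa>))"
 and std_inv: "b \<in> obj C ==> x \<in> obj C ==> t \<in> el (S b) x ==> trinv (S b) (\<lambda>x. \<kappa>) x (\<kappa> t) = t"
 unfolding std_def by (rule trf_functor[OF ct S_functor] trf_natl[OF ct S_functor] trinv_natl[OF ct S_functor]
   trinv_trf[OF ct S_functor]; simp add: inj_on_\<kappa>)+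

lemma std_carrier: "p \<in> el (std b) x ==> \<exists>t \<in> el (S b) x. p = \<kappa> t" by (auto simp: std_def trf_carrier)

lemma std_gen: "b \<in> obj C ==> std b \<in> gen_mod R C S"
proof (rule gen_mod.standard)
 assume b: "b \<in> obj C"
 show "std b \<in> obj (modcat R C)" using std_functor[OF b] by (simp add: modcat_def)
 have n: "nres C (S b) (\<lambda>x. \<kappa>) \<in> nat_hom R C (S b) (std b)" by (rule nres_hom[OF S_functor[OF b] std_natl[OF b]])
 have "nres C (S b) (\<lambda>x. \<kappa>) x \<in> mod_iso R (fob (S b) x) (fob (std b) x)" if x: "x \<in> obj C" for x
 proof (rule mod_isoI)
  show "nres C (S b) (\<lambda>x. \<kappa>) x \<in> mod_hom R (fob (S b) x) (fob (std b) x)" using n x by (auto simp: nat_hom_def)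
  show "inj_on (nres C (S b) (\<lambda>x. \<kappa>) x) (el (S b) x)" using inj_on_\<kappa> x by (auto simp: nres_def inj_on_def)
  show "el (std b) x \<subseteq> nres C (S b) (\<lambda>x. \<kappa>) x ` el (S b) x" using x by (auto simp: nres_def std_def trf_carrier)
 qed
 then show "nat_isomorphic R C (S b) (std b)" unfolding nat_isomorphic_def using n by blast
qed

text \<open>\<open>is_colimit\<close> is a limit in the opposite category; here its universal
  property is restated with cocones. It is applied to discrete diagrams and to parallel
  pairs.\<close>

lemma colimit_gen:
 fixes L :: "('o, 'a, 'k, 'u) modfun"
 assumes J: "category (J :: ('u, 'u) category_data)"
  and Dg: "is_functor J (modcat R C :: (('o, 'a, 'k, 'u) modfun, ('o, 'u, 'u) nat_trans) category_data) Dg"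
  and g: "!!j. j \<in> obj J ==> fob Dg j \<in> gen_mod R C S"
  and L: "modf R C L" and l: "!!j. j \<in> obj J ==> l j \<in> nat_hom R C (fob Dg j) L"
  and cocone: "!!i j f. i \<in> obj J ==> j \<in> obj J ==> f \<in> arr J i j ==> nat_cmp C (fob Dg i) (l j) (far Dg i j f) = l i"
  and univ: "!!(L' :: ('o, 'a, 'k, 'u) modfun) l'. modf R C L' ==> (\<And>j. j \<in> obj J ==> l' j \<in> nat_hom R C (fob Dg j) L') ==>
    (\<And>i j f. i \<in> obj J ==> j \<in> obj J ==> f \<in> arr J i j ==> nat_cmp C (fob Dg i) (l' j) (far Dg i j f) = l' i) ==>
    \<exists>!h. h \<in> nat_hom R C L L' \<and> (\<forall>j \<in> obj J. nat_cmp C (fob Dg j) h (l j) = l' j)"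
 shows "L \<in> gen_mod R C S"
proof (rule gen_mod.colimit[OF J Dg])
 show "\<forall>j \<in> obj J. fob Dg j \<in> gen_mod R C S" using g by blast
 show "is_colimit (modcat R C) J Dg L l"
  unfolding is_colimit_def is_limit_def is_cone_def op_cat_def op_fun_def modcat_def
 proof (simp add: L l cocone, intro allI impI, elim conjE)
  fix L' :: "('o, 'a, 'k, 'u) modfun" and l' assume L': "modf R C L'" and l': "\<forall>j \<in> obj J. l' j \<in> nat_hom R C (fob Dg j) L'"
   and c': "\<forall>i \<in> obj J. \<forall>j \<in> obj J. \<forall>f \<in> arr J j i. nat_cmp C (fob Dg j) (l' i) (far Dg j i f) = l' j"
  show "\<exists>!h. h \<in> nat_hom R C L L' \<and> (\<forall>j \<in> obj J. nat_cmp C (fob Dg j) h (l j) = l' j)"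
   by (rule univ[OF L']) (use l' c' in blast)+
 qed
qed

text \<open>For a limit, the transformations belonging to the components of \<open>g\<close> form a
  cone on \<open>S b\<close>, and its mediating map hits \<open>g\<close> because the
  \<open>l j\<close> are jointly injective. For a colimit, the elements reached by transformations
  from standard functors form a subfunctor containing the images of all \<open>l j\<close>, hence
  everything.\<close>

lemma gen_mod_amod: "(G :: ('o, 'a, 'k, 'u) modfun) \<in> gen_mod R C S ==> amod G"
proof (induction rule: gen_mod.induct)
 case (standard F b)
 then have F: "modf R C F" by (simp add: modcat_def)
 from standard obtain e where e: "e \<in> nat_hom R C (S b) F" "\<forall>x \<in> obj C. e x \<in> mod_iso R (fob (S b) x) (fob F x)"
  by (auto simp: nat_isomorphic_def)
 show ?case
 proof (rule amod_surj[OF S_amod[OF standard(2)] F nat_hom_natl[OF e(1)]])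
  show "\<exists>g \<in> el (S b) x. e x g = h" if "x \<in> obj C" "h \<in> el F x" for x h
  proof -
   have "e x ` el (S b) x = el F x" using bspec[OF e(2) that(1)] by (simp add: mod_iso_def bij_betw_def)
   then show ?thesis using that(2) by (metis imageE)
  qed
 qed
next
 case (limit J Dg L l)
 let ?D = "modcat R C :: (('o, 'a, 'k, 'u) modfun, ('o, 'u, 'u) nat_trans) category_data"
 have cone: "is_cone ?D J Dg L l" and univ: "!!L' l'. is_cone ?D J Dg L' l' ==>
   \<exists>!h. h \<in> nat_hom R C L' L \<and> (\<forall>j \<in> obj J. nat_cmp C L' (l j) h = l' j)"
  using limit.hyps(3) unfolding is_limit_def by (simp_all add: modcat_def)
 have L: "modf R C L" and l: "!!j. j \<in> obj J ==> l j \<in> nat_hom R C L (fob Dg j)"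
  and lf: "!!i j f. i \<in> obj J ==> j \<in> obj J ==> f \<in> arr J i j ==> nat_cmp C L (far Dg i j f) (l i) = l j"
  using cone by (auto simp: is_cone_def modcat_def)
 have Df: "!!j. j \<in> obj J ==> modf R C (fob Dg j)"
  and Da: "!!i j f. i \<in> obj J ==> j \<in> obj J ==> f \<in> arr J i j ==> far Dg i j f \<in> nat_hom R C (fob Dg i) (fob Dg j)"
  using limit.hyps(2) by (auto simp: is_functor_def[of J] modcat_def)
 have Dam: "!!j. j \<in> obj J ==> amod (fob Dg j)" using limit.IH by blast
 define K where "K = (\<lambda>x. {v \<in> el L x. \<forall>j \<in> obj J. l j x v = 0[fob (fob Dg j) x]})"
 have KS: "stable R C L K" unfolding stable_def
 proof (intro conjI ballI)
  fix x assume x: "x \<in> obj C"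
  interpret M: module R "fob L x" by (rule mf_mod[OF L x])
  have D: "module R (fob (fob Dg j) x)" if "j \<in> obj J" for j by (rule mf_mod[OF Df[OF that] x])
  note ll = natl_lin[OF nat_hom_natl[OF l] x]
  have z: "0[fob (fob Dg j) x] +[fob (fob Dg j) x] 0[fob (fob Dg j) x] = 0[fob (fob Dg j) x]"
   "r \<in> carrier R ==> r *[fob (fob Dg j) x] 0[fob (fob Dg j) x] = 0[fob (fob Dg j) x]" if "j \<in> obj J" for j r
  proof -
   interpret N: module R "fob (fob Dg j) x" by (rule D[OF that])
   show "0[fob (fob Dg j) x] +[fob (fob Dg j) x] 0[fob (fob Dg j) x] = 0[fob (fob Dg j) x]" by simp
   show "r \<in> carrier R ==> r *[fob (fob Dg j) x] 0[fob (fob Dg j) x] = 0[fob (fob Dg j) x]" by simp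
  qed
  show "submodule (K x) R (fob L x)" by (rule submoduleI'[OF mf_mod[OF L x]])
     (auto simp: K_def lin_add[OF ll] lin_smult[OF ll] lin_zero[OF mf_mod[OF L x] D ll] z)
 next
  fix x y f v assume h: "x \<in> obj C" "y \<in> obj C" "f \<in> arr C x y" and "v \<in> K x"
  then show "far L x y f v \<in> K y" by (auto simp: K_def mf_closed[OF L] natl_nat[OF nat_hom_natl[OF l]]
     lin_zero[OF mf_mod[OF Df] mf_mod[OF Df] mf_lin[OF Df]])
 qed
 \<comment> \<open>On the common kernel the inclusion and the zero map both mediate the zero cone,
   so uniqueness makes them equal.\<close>
 have K0: "v = 0[fob L x]" if x: "x \<in> obj C" and v: "v \<in> K x" for x v
 proof -
  let ?K = "subf L K"
  have Kf: "modf R C ?K" by (rule subf_functor[OF ct L KS])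
  have i: "nres C ?K (\<lambda>x v. v) \<in> nat_hom R C ?K L" by (rule nres_hom[OF Kf subf_incl[OF L KS]])
  have o: "nres C ?K (\<lambda>x v. 0[fob L x]) \<in> nat_hom R C ?K L" by (rule nres_hom[OF Kf natl_zero[OF L]])
  let ?z = "\<lambda>j. nres C ?K (\<lambda>x v. 0[fob (fob Dg j) x])"
  have z: "?z j \<in> nat_hom R C ?K (fob Dg j)" if "j \<in> obj J" for j by (rule nres_hom[OF Kf natl_zero[OF Df[OF that]]])
  have zc: "nat_cmp C ?K (far Dg i j f) (?z i) = ?z j"
   if "i \<in> obj J" "j \<in> obj J" "f \<in> arr J i j" for i j f
   unfolding nat_cmp_nres by (rule nres_cong)
     (simp add: nres_apply lin_zero[OF mf_mod[OF Df[OF that(1)]] mf_mod[OF Df[OF that(2)]] natl_lin[OF nat_hom_natl[OF Da[OF that]]]])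
  have "is_cone ?D J Dg ?K ?z" unfolding is_cone_def using Kf z zc by (simp add: modcat_def)
  note U = univ[OF this]
  have "nat_cmp C ?K (l j) (nres C ?K (\<lambda>x v. v)) = ?z j" if "j \<in> obj J" for j
   unfolding nat_cmp_nres by (rule nres_cong) (use that in \<open>simp add: nres_apply K_def\<close>)
  moreover have "nat_cmp C ?K (l j) (nres C ?K (\<lambda>x v. 0[fob L x])) = ?z j" if "j \<in> obj J" for j
   unfolding nat_cmp_nres
   by (rule nres_cong) (simp add: nres_apply lin_zero[OF mf_mod[OF L] mf_mod[OF Df[OF that]] natl_lin[OF nat_hom_natl[OF l[OF that]]]])
  ultimately have "nres C ?K (\<lambda>x v. v) = nres C ?K (\<lambda>x v. 0[fob L x])" using i o by (intro ex1_unique[OF U]) blast+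
  then have "nres C ?K (\<lambda>x v. v) x v = nres C ?K (\<lambda>x v. 0[fob L x]) x v" by simp
  then show ?thesis using x v by (simp add: nres_def)
 qed
 show ?case
 proof (rule amodI[OF L])
  fix b g assume b: "b \<in> obj C" and g: "g \<in> el L b"
  have lg: "l j b g \<in> el (fob Dg j) b" if "j \<in> obj J" for j by (rule natl_closed[OF nat_hom_natl[OF l[OF that]] b g])
  \<comment> \<open>The apex of a cone must have carriers in \<open>'u\<close>, so the copy
    \<open>std b\<close> stands in for \<open>S b\<close>.\<close>
  define \<phi> where "\<phi> j = nres C (std b) (\<lambda>x p. yo (fob Dg j) b (l j b g) x (trinv (S b) (\<lambda>x. \<kappa>) x p))" for j
  have \<phi>: "\<phi> j \<in> nat_hom R C (std b) (fob Dg j)" if j: "j \<in> obj J" for j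
   unfolding \<phi>_def
   by (rule nres_hom[OF std_functor[OF b] natl_compose[OF std_inv_natl[OF b] yo_natl[OF Dam[OF j] b lg[OF j]]]])
  have \<phi>a: "\<phi> j x (\<kappa> t) = yo (fob Dg j) b (l j b g) x t" if "x \<in> obj C" "t \<in> el (S b) x" for j x t
   using that std_inv[OF b that] natl_closed[OF std_natl[OF b] that] by (simp add: \<phi>_def nres_apply)
  have \<phi>c: "nat_cmp C (std b) (far Dg i j f) (\<phi> i) = \<phi> j" if h: "i \<in> obj J" "j \<in> obj J" "f \<in> arr J i j" for i j f
  proof (rule nat_hom_ext[OF nat_cmp_hom[OF std_functor[OF b] \<phi>[OF h(1)] Da[OF h]] \<phi>[OF h(2)]])
   fix x p assume x: "x \<in> obj C" and p: "p \<in> el (std b) x"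
   from std_carrier[OF p] obtain t where t: "t \<in> el (S b) x" "p = \<kappa> t" by auto
   have "far Dg i j f b (l i b g) = l j b g"
    using fun_cong[OF fun_cong[OF lf[OF h]], of b g] b g by (simp add: nat_cmp_apply)
   then show "nat_cmp C (std b) (far Dg i j f) (\<phi> i) x p = \<phi> j x p"
    using yo_natl_comp[OF Dam[OF h(1)] Df[OF h(2)] nat_hom_natl[OF Da[OF h]] b lg[OF h(1)] x t(1)] x p t
    by (simp add: nat_cmp_apply \<phi>a)
  qed
  have "is_cone ?D J Dg (std b) \<phi>" unfolding is_cone_def using std_functor[OF b] \<phi> \<phi>c by (simp add: modcat_def)
  from ex1_implies_ex[OF univ[OF this]] obtain h where h: "h \<in> nat_hom R C (std b) L"
   "\<forall>j \<in> obj J. nat_cmp C (std b) (l j) h = \<phi> j" by blast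
  let ?e = "\<lambda>x t. h x (\<kappa> t)"
  have e: "natl R C (S b) L ?e" by (rule natl_compose[OF std_natl[OF b] nat_hom_natl[OF h(1)]])
  have ub: "\<kappa> (u b) \<in> el (std b) b" by (rule natl_closed[OF std_natl[OF b] b u_closed[OF b]])
  have ec: "?e b (u b) \<in> el L b" by (rule natl_closed[OF e b u_closed[OF b]])
  have "l j b (?e b (u b)) = l j b g" if j: "j \<in> obj J" for j
   using fun_cong[OF fun_cong[OF bspec[OF h(2) j]], of b "\<kappa> (u b)"] b ub \<phi>a[OF b u_closed[OF b], of j]
    yo_u[OF Dam[OF j] b lg[OF j]] by (simp add: nat_cmp_apply)
  then have "?e b (u b) -[fob L b] g \<in> K b"
   using ec g lg module.axioms(2)[OF mf_mod[OF L b]] unfolding K_def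
   by (simp add: lin_minus[OF mf_mod[OF L b] mf_mod[OF Df b] natl_lin[OF nat_hom_natl[OF l] b]]
     minus_eq_zero_iff[OF mf_mod[OF Df b]] abelian_group.minus_closed)
  then have "?e b (u b) = g" using K0[OF b] minus_eq_zero_iff[OF mf_mod[OF L b] ec g] by blast
  then show "\<exists>e. natl R C (S b) L e \<and> e b (u b) = g" using e by blast
 qed
next
 case (colimit J Dg L l)
 let ?D = "modcat R C :: (('o, 'a, 'k, 'u) modfun, ('o, 'u, 'u) nat_trans) category_data"
 have L: "modf R C L" and l: "!!j. j \<in> obj J ==> l j \<in> nat_hom R C (fob Dg j) L"
  and univ: "!!(L' :: ('o, 'a, 'k, 'u) modfun) l'. modf R C L' ==> (\<forall>j \<in> obj J. l' j \<in> nat_hom R C (fob Dg j) L') ==>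
    (\<forall>i \<in> obj J. \<forall>j \<in> obj J. \<forall>f \<in> arr J j i. nat_cmp C (fob Dg j) (l' i) (far Dg j i f) = l' j) ==>
    \<exists>!h. h \<in> nat_hom R C L L' \<and> (\<forall>j \<in> obj J. nat_cmp C (fob Dg j) h (l j) = l' j)"
  using colimit.hyps(3) by (simp_all add: is_colimit_def is_limit_def is_cone_def op_cat_def op_fun_def modcat_def)
 have Df: "!!j. j \<in> obj J ==> modf R C (fob Dg j)"
  and Da: "!!i j f. i \<in> obj J ==> j \<in> obj J ==> f \<in> arr J i j ==> far Dg i j f \<in> nat_hom R C (fob Dg i) (fob Dg j)"
  using colimit.hyps(2) by (auto simp: is_functor_def[of J] modcat_def)
 have Dam: "!!j. j \<in> obj J ==> amod (fob Dg j)" using colimit.IH by blast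
 \<comment> \<open>The elements that some transformation out of a standard functor reaches; the aim
   is \<open>N = L\<close>.\<close>
 define N where "N = (\<lambda>x. {v \<in> el L x. \<exists>e. natl R C (S x) L e \<and> e x (u x) = v})"
 have N: "stable R C L N" unfolding stable_def
 proof (intro conjI ballI)
  fix x assume x: "x \<in> obj C"
  interpret M: module R "fob L x" by (rule mf_mod[OF L x])
  show "submodule (N x) R (fob L x)"
  proof (rule submoduleI'[OF mf_mod[OF L x]])
   show "0[fob L x] \<in> N x" using natl_zero[OF L] by (auto simp: N_def)
   show "v +[fob L x] w \<in> N x" if "v \<in> N x" "w \<in> N x" for v w using that by (auto simp: N_def dest: natl_add[OF L])
   show "r *[fob L x] v \<in> N x" if "r \<in> carrier R" "v \<in> N x" for r v
    using that by (auto simp: N_def dest: natl_smult[OF L])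
  qed (auto simp: N_def)
 next
  fix x y f v assume x: "x \<in> obj C" and y: "y \<in> obj C" and f: "f \<in> arr C x y" and v: "v \<in> N x"
  then obtain e where e: "natl R C (S x) L e" "e x (u x) = v" by (auto simp: N_def)
  have t: "far (S x) x y f (u x) \<in> el (S x) y" by (rule mf_closed[OF S_functor[OF x] x y f u_closed[OF x]])
  have "natl R C (S y) L (\<lambda>z t. e z (yo (S x) y (far (S x) x y f (u x)) z t))"
   by (rule natl_compose[OF yo_natl[OF S_amod[OF x] y t] e(1)])
  moreover have "e y (yo (S x) y (far (S x) x y f (u x)) y (u y)) = far L x y f v"
   using natl_nat[OF e(1) x y f u_closed[OF x]] yo_u[OF S_amod[OF x] y t] e(2) by simp
  moreover have "far L x y f v \<in> el L y" using v by (intro mf_closed[OF L x y f]) (simp add: N_def)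
  ultimately show "far L x y f v \<in> N y" unfolding N_def by blast
 qed
 have lN: "l j x w \<in> N x" if j: "j \<in> obj J" and x: "x \<in> obj C" and w: "w \<in> el (fob Dg j) x" for j x w
  unfolding N_def
  using natl_closed[OF nat_hom_natl[OF l[OF j]] x w] yo_u[OF Dam[OF j] x w]
   natl_compose[OF yo_natl[OF Dam[OF j] x w] nat_hom_natl[OF l[OF j]]] by auto
 let ?Z = "\<lambda>x. el L x"
 let ?Q = "sqf L ?Z N"
 have NZ: "!!x. x \<in> obj C ==> N x \<subseteq> ?Z x" by (auto simp: N_def)
 note c = ct L stable_all[OF L] N NZ
 have Q: "modf R C ?Q" by (rule sqf_functor[OF c])
 have pr0: "natl R C L (subf L ?Z) (\<lambda>x v. v)" by (rule natl_subf_target[OF natl_id])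
 have p: "nres C L (sqrep L ?Z N) \<in> nat_hom R C L ?Q" by (rule nres_hom[OF L natl_compose[OF pr0 sqf_proj[OF c]]])
 have o: "nres C L (\<lambda>x v. 0[fob ?Q x]) \<in> nat_hom R C L ?Q" by (rule nres_hom[OF L natl_zero[OF Q]])
 let ?z = "\<lambda>j. nres C (fob Dg j) (\<lambda>x v. 0[fob ?Q x])"
 \<comment> \<open>Both the projection \<open>L \<rightarrow> L/N\<close> and the zero map vanish on
   every \<open>l j\<close>. Uniqueness identifies them, so \<open>L/N\<close> is zero.\<close>
 have "\<exists>!h. h \<in> nat_hom R C L ?Q \<and> (\<forall>j \<in> obj J. nat_cmp C (fob Dg j) h (l j) = ?z j)"
 proof (rule univ[OF Q])
  show "\<forall>j \<in> obj J. ?z j \<in> nat_hom R C (fob Dg j) ?Q" using nres_hom[OF Df natl_zero[OF Q]] by blast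
  show "\<forall>i \<in> obj J. \<forall>j \<in> obj J. \<forall>f \<in> arr J j i. nat_cmp C (fob Dg j) (?z i) (far Dg j i f) = ?z j"
   unfolding nat_cmp_nres by (auto intro!: nres_cong simp: nres_apply natl_closed[OF nat_hom_natl[OF Da]])
 qed
 moreover have "nat_cmp C (fob Dg j) (nres C L (sqrep L ?Z N)) (l j) = ?z j" if j: "j \<in> obj J" for j
  unfolding nat_cmp_nres
 proof (rule nres_cong)
  fix x w assume x: "x \<in> obj C" and w: "w \<in> el (fob Dg j) x"
  then show "nres C L (sqrep L ?Z N) x (l j x w) = 0[fob ?Q x]"
   using lN[OF j x w] sqrep_zero_iff[OF c x, of "l j x w"] NZ[OF x] by (auto simp: nres_apply)
 qed
 moreover have "nat_cmp C (fob Dg j) (nres C L (\<lambda>x v. 0[fob ?Q x])) (l j) = ?z j" if j: "j \<in> obj J" for j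
  unfolding nat_cmp_nres by (rule nres_cong) (simp add: nres_apply natl_closed[OF nat_hom_natl[OF l[OF j]]])
 ultimately have eq: "nres C L (sqrep L ?Z N) = nres C L (\<lambda>x v. 0[fob ?Q x])" using p o by (elim ex1_unique) blast+
 show ?case
 proof (rule amodI[OF L])
  fix b g assume b: "b \<in> obj C" and g: "g \<in> el L b"
  have "sqrep L ?Z N b g = 0[fob ?Q b]" using fun_cong[OF fun_cong[OF eq], of b g] b g by (simp add: nres_def)
  then have "g \<in> N b" using sqrep_zero_iff[OF c b g] by simp
  then show "\<exists>e. natl R C (S b) L e \<and> e b (u b) = g" by (simp add: N_def)
 qed
qed

end

lemma projective_inD:
 assumes "projective_in R C X P" "G \<in> X" "H \<in> X" "e \<in> nat_hom R C G H" "f \<in> nat_hom R C P H" "nat_surj C G H e"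
 shows "\<exists>g \<in> nat_hom R C P G. nat_cmp C P e g = f" using assms unfolding projective_in_def by blast

lemma mf_zero: "modf R C F ==> x \<in> obj C ==> 0[fob F x] \<in> el F x"
 by (rule abelian_monoid.zero_closed[OF abelian_group.axioms(1)[OF module.axioms(2)[OF mf_mod]]])

section \<open>Free functors with carriers in the universe, and enough projectives\<close>

context large_yoneda
begin

context
 fixes I :: "'i set" and a :: "'i => 'o" and \<xi> :: "'i => 'u"
 assumes a: "!!i. i \<in> I ==> a i \<in> obj C" and \<xi>: "inj_on \<xi> I"
begin

text \<open>The inclusion of the summand \<open>S (a i)\<close> into the free functor; its value at
  \<open>u (a i)\<close> is the basis element of index \<open>i\<close>.\<close>

definition fin :: "'i => 'o => 't => 'u" where
 "fin i = (\<lambda>x t. ecop \<xi> I a x (copin I a i x t))"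

definition fpair :: "('o, 'a, 'k, 'v) modfun => ('i => 'o => 't => 'v) => 'o => 'u => 'v" where
 "fpair G \<phi> = (\<lambda>x p. copair I a G \<phi> x (trinv (cop I a) (ecop \<xi> I a) x p))"

lemmas fc = ct cop_functor[OF a] ecop_inj[OF a \<xi>]

lemma fcop_functor: "modf R C (fcop \<xi> I a)"
 unfolding fcop_def by (rule trf_functor[OF ct cop_functor[OF a] ecop_inj[OF a \<xi>]])

lemma fcop_amod: "amod (fcop \<xi> I a)" unfolding fcop_def by (rule amod_trf[OF cop_amod[OF a] ecop_inj[OF a \<xi>]])

lemma fcop_natl: "natl R C (cop I a) (fcop \<xi> I a) (ecop \<xi> I a)"
 unfolding fcop_def by (rule trf_natl[OF ct cop_functor[OF a] ecop_inj[OF a \<xi>]])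

lemma fcop_inv_natl: "natl R C (fcop \<xi> I a) (cop I a) (trinv (cop I a) (ecop \<xi> I a))"
 unfolding fcop_def by (rule trinv_natl[OF ct cop_functor[OF a] ecop_inj[OF a \<xi>]])

lemma fcop_inv:
 "x \<in> obj C ==> v \<in> el (cop I a) x ==> trinv (cop I a) (ecop \<xi> I a) x (ecop \<xi> I a x v) = v"
 by (rule trinv_trf[OF ct cop_functor[OF a] ecop_inj[OF a \<xi>]])

lemma fcop_carrier: "p \<in> el (fcop \<xi> I a) x ==> \<exists>v \<in> el (cop I a) x. p = ecop \<xi> I a x v"
 by (auto simp: fcop_def trf_carrier)

lemma fin_natl: "i \<in> I ==> natl R C (S (a i)) (fcop \<xi> I a) (fin i)"
 unfolding fin_def by (rule natl_compose[OF copin_natl[OF a] fcop_natl])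

lemma fpair_natl:
 assumes G: "modf R C G" and \<phi>: "!!i. i \<in> I ==> natl R C (S (a i)) G (\<phi> i)"
 shows "natl R C (fcop \<xi> I a) G (fpair G \<phi>)"
 unfolding fpair_def by (rule natl_compose[OF fcop_inv_natl copair_natl[OF a G \<phi>]])

lemma fpair_fin:
 assumes G: "modf R C G" and \<phi>: "!!i. i \<in> I ==> natl R C (S (a i)) G (\<phi> i)"
  and x: "x \<in> obj C" and i: "i \<in> I" and t: "t \<in> el (S (a i)) x"
 shows "fpair G \<phi> x (fin i x t) = \<phi> i x t"
 using copair_copin[where I = I and a = a and \<phi> = \<phi>, OF a G \<phi> x i t]
  fcop_inv[OF x natl_closed[OF copin_natl[where I = I and a = a, OF a i] x t]] by (simp add: fpair_def fin_def)

lemma fcop_unique: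
 assumes G: "modf R C G" and e: "natl R C (fcop \<xi> I a) G e" and h: "natl R C (fcop \<xi> I a) G h"
  and eq: "!!i. i \<in> I ==> e (a i) (fin i (a i) (u (a i))) = h (a i) (fin i (a i) (u (a i)))"
  and x: "x \<in> obj C" and p: "p \<in> el (fcop \<xi> I a) x"
 shows "e x p = h x p"
proof -
 from fcop_carrier[OF p] obtain v where v: "v \<in> el (cop I a) x" "p = ecop \<xi> I a x v" by auto
 have "e x (ecop \<xi> I a x v) = h x (ecop \<xi> I a x v)"
 proof (rule cop_unique[OF a G x natl_lin[OF natl_compose[OF fcop_natl e] x] natl_lin[OF natl_compose[OF fcop_natl h] x] _ v(1)])
  fix i t assume i: "i \<in> I" and t: "t \<in> el (S (a i)) x"
  have "e x (fin i x t) = h x (fin i x t)"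
   by (rule natl_S_unique[OF a[OF i] G natl_compose[OF fin_natl[OF i] e] natl_compose[OF fin_natl[OF i] h] eq[OF i] x t])
  then show "e x (ecop \<xi> I a x (copin I a i x t)) = h x (ecop \<xi> I a x (copin I a i x t))" by (simp add: fin_def)
 qed
 then show ?thesis by (simp add: v(2))
qed

text \<open>The coproduct is the colimit of the discrete diagram of the functors
  \<open>std (a i)\<close>. Its index category consists of elements of \<open>'u\<close>, which is
  what the injection \<open>\<xi>\<close> is for.\<close>

lemma fcop_gen: "fcop \<xi> I a \<in> gen_mod R C S"
proof -
 define J :: "('u, 'u) category_data" where
  "J = \<lparr>obj = \<xi> ` I, arr = (\<lambda>i j. if i = j then {c0} else {}), idn = (\<lambda>_. c0), cmp = (\<lambda>_ _ _ _ _. c0)\<rparr>"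
 define b where "b j = inv_into I \<xi> j" for j
 define Dg :: "('u, 'u, ('o, 'a, 'k, 'u) modfun, ('o, 'u, 'u) nat_trans) functor_data" where
  "Dg = \<lparr>fob = (\<lambda>j. std (a (b j))), far = (\<lambda>i j f. nat_id C (std (a (b i))))\<rparr>"
 define l where "l j = nres C (std (a (b j))) (\<lambda>x p. fin (b j) x (trinv (S (a (b j))) (\<lambda>x. \<kappa>) x p))" for j
 have bI: "b j \<in> I" if "j \<in> obj J" for j using that \<xi> by (auto simp: J_def b_def)
 have ab: "a (b j) \<in> obj C" if "j \<in> obj J" for j by (rule a[OF bI[OF that]])
 have nid: "nat_cmp C F e (nat_id C F) = e" if "e \<in> nat_hom R C F G" for e and F G :: "('o, 'a, 'k, 'u) modfun"
  using that nres_cong[of C F "\<lambda>x v. e x (nat_id C F x v)" e] by (simp add: nat_cmp_nres nat_id_apply nat_hom_iff)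
 have lh: "l j \<in> nat_hom R C (fob Dg j) (fcop \<xi> I a)" if j: "j \<in> obj J" for j
  unfolding l_def Dg_def
  by (simp add: nres_hom[OF std_functor[OF ab[OF j]] natl_compose[OF std_inv_natl[OF ab[OF j]] fin_natl[OF bI[OF j]]]])
 have l\<kappa>: "l j x (\<kappa> t) = fin (b j) x t" if "j \<in> obj J" "x \<in> obj C" "t \<in> el (S (a (b j))) x" for j x t
  using std_inv[OF ab[OF that(1)] that(2,3)] natl_closed[OF std_natl[OF ab[OF that(1)]] that(2,3)] that(2)
  by (simp add: l_def nres_apply)
 show ?thesis
 proof (rule colimit_gen[of J Dg])
  show "category J" by (rule category.intro) (auto simp: J_def split: if_splits)
  show "is_functor J (modcat R C) Dg"
   unfolding is_functor_def[of J "modcat R C" Dg]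
   using std_functor[OF ab] nat_id_hom[OF std_functor[OF ab]] nid[OF nat_id_hom[OF std_functor[OF ab]]]
   by (auto simp: modcat_def Dg_def J_def split: if_splits)
  show "fob Dg j \<in> gen_mod R C S" if "j \<in> obj J" for j using std_gen[OF ab[OF that]] by (simp add: Dg_def)
  show "modf R C (fcop \<xi> I a)" by (rule fcop_functor)
  show "l j \<in> nat_hom R C (fob Dg j) (fcop \<xi> I a)" if "j \<in> obj J" for j by (rule lh[OF that])
  show "nat_cmp C (fob Dg i) (l j) (far Dg i j f) = l i" if "i \<in> obj J" "j \<in> obj J" "f \<in> arr J i j" for i j f
   using that nid[OF lh[OF that(1)]] by (auto simp: J_def Dg_def split: if_splits)
  fix L :: "('o, 'a, 'k, 'u) modfun" and l'
  assume L: "modf R C L" and l': "!!j. j \<in> obj J ==> l' j \<in> nat_hom R C (fob Dg j) L"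
  define \<phi> where "\<phi> i = (\<lambda>x t. l' (\<xi> i) x (\<kappa> t))" for i
  have b\<xi>: "b (\<xi> i) = i" if "i \<in> I" for i using that \<xi> by (simp add: b_def)
  have l'': "natl R C (std (a i)) L (l' (\<xi> i))" if "i \<in> I" for i
   using nat_hom_natl[OF l'[of "\<xi> i"]] that b\<xi>[OF that] by (simp add: J_def Dg_def)
  have \<phi>: "natl R C (S (a i)) L (\<phi> i)" if "i \<in> I" for i
   unfolding \<phi>_def by (rule natl_compose[OF std_natl[OF a[OF that]] l''[OF that]])
  show "\<exists>!h. h \<in> nat_hom R C (fcop \<xi> I a) L \<and> (\<forall>j \<in> obj J. nat_cmp C (fob Dg j) h (l j) = l' j)"
  proof (rule ex1I[of _ "nres C (fcop \<xi> I a) (fpair L \<phi>)"], intro conjI ballI)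
   show h: "nres C (fcop \<xi> I a) (fpair L \<phi>) \<in> nat_hom R C (fcop \<xi> I a) L"
    by (rule nres_hom[OF fcop_functor fpair_natl[OF L \<phi>]])
   fix j assume j: "j \<in> obj J"
   note F = std_functor[OF ab[OF j]]
   have Dj: "fob Dg j = std (a (b j))" by (simp add: Dg_def)
   have \<xi>b: "\<xi> (b j) = j" using j by (auto simp: J_def b_def f_inv_into_f)
   show "nat_cmp C (fob Dg j) (nres C (fcop \<xi> I a) (fpair L \<phi>)) (l j) = l' j"
   proof (rule nat_hom_ext[OF nat_cmp_hom[OF F[folded Dj] lh[OF j] h] l'[OF j]])
    fix x p assume x: "x \<in> obj C" and p: "p \<in> el (fob Dg j) x"
    from std_carrier[OF p[unfolded Dj]] obtain t where t: "t \<in> el (S (a (b j))) x" "p = \<kappa> t" by auto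
    have "\<phi> (b j) x t = l' j x (\<kappa> t)" by (simp add: \<phi>_def \<xi>b)
    then show "nat_cmp C (fob Dg j) (nres C (fcop \<xi> I a) (fpair L \<phi>)) (l j) x p = l' j x p"
     using x p t(2) natl_closed[OF fin_natl[OF bI[OF j]] x t(1)] fpair_fin[OF L \<phi> x bI[OF j] t(1)]
     by (simp add: nat_cmp_apply l\<kappa>[OF j x t(1)] nres_apply)
   qed
  next
   fix h assume h: "h \<in> nat_hom R C (fcop \<xi> I a) L \<and> (\<forall>j \<in> obj J. nat_cmp C (fob Dg j) h (l j) = l' j)"
   show "h = nres C (fcop \<xi> I a) (fpair L \<phi>)"
   proof (rule nat_hom_ext[OF conjunct1[OF h] nres_hom[OF fcop_functor fpair_natl[OF L \<phi>]]])
    fix x p assume x: "x \<in> obj C" and p: "p \<in> el (fcop \<xi> I a) x"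
    have "h x p = fpair L \<phi> x p"
    proof (rule fcop_unique[OF L nat_hom_natl[OF conjunct1[OF h]] fpair_natl[OF L \<phi>] _ x p])
     fix i assume i: "i \<in> I"
     let ?y = "a i"
     have j: "\<xi> i \<in> obj J" using i by (simp add: J_def)
     have y: "?y \<in> obj C" by (rule a[OF i])
     have "nat_cmp C (fob Dg (\<xi> i)) h (l (\<xi> i)) ?y (\<kappa> (u ?y)) = l' (\<xi> i) ?y (\<kappa> (u ?y))" using h j by simp
     then have "h ?y (fin i ?y (u ?y)) = l' (\<xi> i) ?y (\<kappa> (u ?y))"
      using y l\<kappa>[OF j y] u_closed[OF y] natl_closed[OF std_natl[OF y] y u_closed[OF y]]
      by (simp add: nat_cmp_apply b\<xi>[OF i] Dg_def)
     then show "h ?y (fin i ?y (u ?y)) = fpair L \<phi> ?y (fin i ?y (u ?y))"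
      using fpair_fin[OF L \<phi> y i u_closed[OF y]] by (simp only: \<phi>_def[of i])
    qed
    then show "h x p = nres C (fcop \<xi> I a) (fpair L \<phi>) x p" using x p by (simp add: nres_apply)
   qed
  qed
 qed
qed

text \<open>Lift the images of the basis elements through the surjection and extend freely. The
  extension exists because \<open>G\<close> is \<open>amod\<close>, and it lifts \<open>f\<close>
  because maps out of a free functor are determined on basis elements.\<close>

lemma fcop_projective: "projective_in R C (gen_mod R C S) (fcop \<xi> I a)"
 unfolding projective_in_def
proof (intro conjI ballI impI)
 show "fcop \<xi> I a \<in> gen_mod R C S" by (rule fcop_gen)
 fix G H :: "('o, 'a, 'k, 'u) modfun" and e f
 assume "G \<in> gen_mod R C S" "H \<in> gen_mod R C S" and e: "e \<in> nat_hom R C G H"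
  and f: "f \<in> nat_hom R C (fcop \<xi> I a) H" and s: "nat_surj C G H e"
 then have G: "amod G" and H: "amod H" by (auto intro: gen_mod_amod)
 note e' = nat_hom_natl[OF e] and f' = nat_hom_natl[OF f] and G' = amod_functor[OF G] and H' = amod_functor[OF H]
 define v where "v i = fin i (a i) (u (a i))" for i
 have v: "v i \<in> el (fcop \<xi> I a) (a i)" if "i \<in> I" for i
  unfolding v_def by (rule natl_closed[OF fin_natl[OF that] a[OF that] u_closed[OF a[OF that]]])
 have "\<exists>g. g \<in> el G (a i) \<and> e (a i) g = f (a i) (v i)" if "i \<in> I" for i
 proof -
  have "f (a i) (v i) \<in> el H (a i)" by (rule natl_closed[OF f' a[OF that] v[OF that]])
  also have "\<dots> = e (a i) ` el G (a i)" using s a[OF that] by (simp add: nat_surj_def)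
  finally show ?thesis by force
 qed
 then obtain g where g: "!!i. i \<in> I ==> g i \<in> el G (a i)" "!!i. i \<in> I ==> e (a i) (g i) = f (a i) (v i)" by metis
 let ?\<phi> = "\<lambda>i. yo G (a i) (g i)"
 have \<phi>: "!!i. i \<in> I ==> natl R C (S (a i)) G (?\<phi> i)" using yo_natl[OF G a g(1)] .
 note n = fpair_natl[OF G' \<phi>]
 show "\<exists>g \<in> nat_hom R C (fcop \<xi> I a) G. nat_cmp C (fcop \<xi> I a) e g = f"
 proof (rule bexI[OF _ nres_hom[OF fcop_functor n]], rule nat_hom_ext[OF nat_cmp_hom[OF fcop_functor nres_hom[OF fcop_functor n] e] f])
  fix x p assume x: "x \<in> obj C" and p: "p \<in> el (fcop \<xi> I a) x"
  have "e x (fpair G ?\<phi> x p) = f x p"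
  proof (rule fcop_unique[OF H' natl_compose[OF n e'] f' _ x p])
   fix i assume i: "i \<in> I"
   show "e (a i) (fpair G ?\<phi> (a i) (fin i (a i) (u (a i)))) = f (a i) (fin i (a i) (u (a i)))"
    using fpair_fin[OF G' \<phi> a[OF i] i u_closed[OF a[OF i]]] yo_u[OF G a[OF i] g(1)[OF i]] g(2)[OF i]
    by (simp add: v_def)
  qed
  then show "nat_cmp C (fcop \<xi> I a) e (nres C (fcop \<xi> I a) (fpair G ?\<phi>)) x p = f x p"
   using x p by (simp add: nat_cmp_apply nres_apply)
 qed
qed

end

text \<open>The free functor with one basis element for each element of \<open>G\<close>, over
  representatives of objects only. This keeps the index set small enough to embed into
  \<open>'u\<close> by \<open>pr (sk a, g)\<close>; the other objects are reached by
  \<open>isomorphic_retract\<close>.\<close>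

lemma cover:
 assumes G: "amod (G :: ('o, 'a, 'k, 'u) modfun)"
 obtains P :: "('o, 'a, 'k, 'u) modfun" and e where "P \<in> gen_mod R C S" "projective_in R C (gen_mod R C S) P"
  "natl R C P G e" "!!x g. x \<in> obj C ==> g \<in> el G x ==> \<exists>p \<in> el P x. e x p = g"
proof -
 note G' = amod_functor[OF G]
 \<comment> \<open>The representative depends only on the label \<open>sk x\<close>, so
   \<open>sk\<close> is injective on the chosen representatives.\<close>
 define r where "r x = (SOME y. y \<in> obj C \<and> sk y = sk x)" for x
 have r: "r x \<in> obj C" "sk (r x) = sk x" if "x \<in> obj C" for x
  using someI[of "\<lambda>y. y \<in> obj C \<and> sk y = sk x" x] that by (auto simp: r_def)
 have rr: "sk (r x) = sk (r y) ==> x \<in> obj C ==> y \<in> obj C ==> r x = r y" for x y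
  using r(2)[of x] r(2)[of y] by (simp add: r_def)
 define I where "I = {(a, g). a \<in> r ` obj C \<and> g \<in> el G a}"
 define \<xi> where "\<xi> = (\<lambda>(a, g). pr (sk a, g))"
 have \<xi>: "inj_on \<xi> I" by (auto simp: inj_on_def I_def \<xi>_def inj_eq[OF inj_pr] intro: rr)
 have a: "!!i. i \<in> I ==> fst i \<in> obj C" using r by (auto simp: I_def)
 let ?\<phi> = "\<lambda>i. yo G (fst i) (snd i)"
 have \<phi>: "!!i. i \<in> I ==> natl R C (S (fst i)) G (?\<phi> i)" using yo_natl[OF G a] by (auto simp: I_def)
 have sur: "\<exists>p \<in> el (fcop \<xi> I fst) x. fpair I fst \<xi> G ?\<phi> x p = g"
  if x: "x \<in> obj C" and g: "g \<in> el G x" for x g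
 proof -
  have "isomorphic C x (r x)" by (rule skel[OF x r(1)[OF x] r(2)[OF x, symmetric]])
  from isomorphic_retract[OF G' this] g obtain f g' where f: "f \<in> arr C (r x) x"
   and g': "g' \<in> el G (r x)" "far G (r x) x f g' = g" by blast
  have i: "(r x, g') \<in> I" using g' x by (auto simp: I_def)
  let ?t = "far (S (r x)) (r x) x f (u (r x))"
  have t: "?t \<in> el (S (r x)) x"
   by (rule mf_closed[OF S_functor[OF r(1)[OF x]] r(1)[OF x] x f u_closed[OF r(1)[OF x]]])
  have "fpair I fst \<xi> G ?\<phi> x (fin I fst \<xi> (r x, g') x ?t) = ?\<phi> (r x, g') x ?t"
   by (rule fpair_fin[where a = fst and \<phi> = ?\<phi>, OF a \<xi> G' \<phi> x i]) (use t in simp_all)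
  also have "\<dots> = g" using yo_far[OF G r(1)[OF x] g'(1) x f] g'(2) by simp
  finally show ?thesis using natl_closed[OF fin_natl[OF a \<xi> i] x] t by auto
 qed
 show thesis by (rule that[OF fcop_gen[where a = fst, OF a \<xi>] fcop_projective[where a = fst, OF a \<xi>]
     fpair_natl[where a = fst and \<phi> = ?\<phi>, OF a \<xi> G' \<phi>] sur])
qed

text \<open>The exact sequence exhibits \<open>G\<close> as the coequalizer of \<open>d\<close> and
  the zero map, a colimit over two objects.\<close>

lemma cokernel_gen:
 fixes G P0 P1 :: "('o, 'a, 'k, 'u) modfun"
 assumes P: "P0 \<in> gen_mod R C S" "P1 \<in> gen_mod R C S" and G: "modf R C G"
  and d: "natl R C P0 P1 d" and e: "natl R C P1 G e"
  and s: "!!x g. x \<in> obj C ==> g \<in> el G x ==> \<exists>p \<in> el P1 x. e x p = g"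
  and ed: "!!x p. x \<in> obj C ==> p \<in> el P0 x ==> e x (d x p) = 0[fob G x]"
  and ex: "!!x p. x \<in> obj C ==> p \<in> el P1 x ==> e x p = 0[fob G x] ==> \<exists>q \<in> el P0 x. d x q = p"
 shows "G \<in> gen_mod R C S"
proof -
 have P0: "modf R C P0" and P1: "modf R C P1" using amod_functor[OF gen_mod_amod] P by auto
 \<comment> \<open>Two objects \<open>c0\<close>, \<open>c1\<close> and a parallel pair between
   them: the arrow named \<open>c0\<close> is sent to \<open>d\<close>, the one named
   \<open>c1\<close> to zero. Identities are named \<open>c0\<close> as well.\<close>
 define J :: "('u, 'u) category_data" where
  "J = \<lparr>obj = {c0, c1}, arr = (\<lambda>i j. if i = j then {c0} else if i = c0 \<and> j = c1 then {c0, c1} else {}),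
   idn = (\<lambda>_. c0), cmp = (\<lambda>x y z g f. if x = y then g else f)\<rparr>"
 let ?d = "nres C P0 d" and ?o = "nres C P0 (\<lambda>x p. 0[fob P1 x])"
 define Dg :: "('u, 'u, ('o, 'a, 'k, 'u) modfun, ('o, 'u, 'u) nat_trans) functor_data" where
  "Dg = \<lparr>fob = (\<lambda>j. if j = c0 then P0 else P1),
    far = (\<lambda>i j f. if i = j then nat_id C (if i = c0 then P0 else P1) else if f = c0 then ?d else ?o)\<rparr>"
 let ?e0 = "nres C P0 (\<lambda>x p. 0[fob G x])" and ?e1 = "nres C P1 e"
 have dh: "?d \<in> nat_hom R C P0 P1" by (rule nres_hom[OF P0 d])
 have oh: "?o \<in> nat_hom R C P0 P1" by (rule nres_hom[OF P0 natl_zero[OF P1]])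
 have e0h: "?e0 \<in> nat_hom R C P0 G" by (rule nres_hom[OF P0 natl_zero[OF G]])
 have e1h: "?e1 \<in> nat_hom R C P1 G" by (rule nres_hom[OF P1 e])
 have nid: "nat_cmp C F h (nat_id C F) = h" if "h \<in> nat_hom R C F H" for h and F H :: "('o, 'a, 'k, 'u) modfun"
  using that nres_cong[of C F "\<lambda>x v. h x (nat_id C F x v)" h] by (simp add: nat_cmp_nres nat_id_apply nat_hom_iff)
 have idn: "nat_cmp C F (nat_id C H) h = h" if "h \<in> nat_hom R C F H" for h and F H :: "('o, 'a, 'k, 'u) modfun"
  using that nres_cong[of C F "\<lambda>x v. nat_id C H x (h x v)" h] natl_closed[OF nat_hom_natl[OF that]]
  by (simp add: nat_cmp_nres nat_id_apply nat_hom_iff)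
 show ?thesis
 proof (rule colimit_gen[of J Dg G "\<lambda>j. if j = c0 then ?e0 else ?e1"])
  show "category J" using c01 by unfold_locales (auto simp: J_def split: if_splits)
  show "is_functor J (modcat R C) Dg"
   unfolding is_functor_def[of J "modcat R C" Dg]
   using c01 P0 P1 dh oh nat_id_hom[OF P0] nat_id_hom[OF P1]
   by (auto simp: modcat_def J_def Dg_def nid idn split: if_splits)
  show "fob Dg j \<in> gen_mod R C S" if "j \<in> obj J" for j using P by (simp add: Dg_def)
  show "modf R C G" by (rule G)
  show "(if j = c0 then ?e0 else ?e1) \<in> nat_hom R C (fob Dg j) G" for j using e0h e1h by (simp add: Dg_def)
  have c: "nat_cmp C P0 ?e1 ?d = ?e0" "nat_cmp C P0 ?e1 ?o = ?e0"
   unfolding nat_cmp_nres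
   using ed natl_closed[OF d] mf_zero[OF P1] lin_zero[OF mf_mod[OF P1] mf_mod[OF G] natl_lin[OF e]]
   by (auto intro!: nres_cong simp: nres_apply)
  show "nat_cmp C (fob Dg i) (if j = c0 then ?e0 else ?e1) (far Dg i j f) = (if i = c0 then ?e0 else ?e1)"
   if "i \<in> obj J" "j \<in> obj J" "f \<in> arr J i j" for i j f
   using that c01 c nid[OF e0h] nid[OF e1h] by (auto simp: J_def Dg_def split: if_splits)
  fix L :: "('o, 'a, 'k, 'u) modfun" and l
  assume L: "modf R C L" and l: "!!j. j \<in> obj J ==> l j \<in> nat_hom R C (fob Dg j) L"
   and lc: "!!i j f. i \<in> obj J ==> j \<in> obj J ==> f \<in> arr J i j ==> nat_cmp C (fob Dg i) (l j) (far Dg i j f) = l i"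
  have l1: "l c1 \<in> nat_hom R C P1 L" and l0: "l c0 \<in> nat_hom R C P0 L"
   using l[of c0] l[of c1] c01 by (auto simp: J_def Dg_def)
  have "nat_cmp C P0 (l c1) ?d = l c0" "nat_cmp C P0 (l c1) ?o = l c0"
   using lc[of c0 c1 c0] lc[of c0 c1 c1] c01 by (auto simp: J_def Dg_def)
  then have ldo: "nat_cmp C P0 (l c1) ?d = nat_cmp C P0 (l c1) ?o" and lo: "nat_cmp C P0 (l c1) ?o = l c0" by auto
  have ld: "l c1 x (d x q) = 0[fob L x]" if "x \<in> obj C" "q \<in> el P0 x" for x q
   using fun_cong[OF fun_cong[OF ldo], of x q] that
    lin_zero[OF mf_mod[OF P1] mf_mod[OF L] natl_lin[OF nat_hom_natl[OF l1]]] by (simp add: nat_cmp_apply nres_apply)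
  have "\<exists>h. natl R C G L h \<and> (\<forall>x \<in> obj C. \<forall>w \<in> el P1 x. h x (e x w) = l c1 x w)"
   by (rule natl_factor[OF P1 G L e nat_hom_natl[OF l1] s]) (use ex ld in metis)+
  then obtain h where h: "natl R C G L h" "!!x w. x \<in> obj C ==> w \<in> el P1 x ==> h x (e x w) = l c1 x w" by blast
  let ?h = "nres C G h"
  have hh: "?h \<in> nat_hom R C G L" by (rule nres_hom[OF G h(1)])
  have a1: "nat_cmp C P1 ?h ?e1 = l c1"
   by (rule nat_hom_ext[OF nat_cmp_hom[OF P1 e1h hh] l1]) (simp add: nat_cmp_apply nres_apply natl_closed[OF e] h(2))
  have a0: "nat_cmp C P0 h' ?e0 = l c0" if "h' \<in> nat_hom R C G L" for h'
   using lo lin_zero[OF mf_mod[OF P1] mf_mod[OF L] natl_lin[OF nat_hom_natl[OF l1]]]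
    lin_zero[OF mf_mod[OF G] mf_mod[OF L] natl_lin[OF nat_hom_natl[OF that]]]
    nres_cong[of C P0 "\<lambda>x p. h' x (?e0 x p)" "\<lambda>x p. l c1 x (?o x p)"] by (simp add: nat_cmp_nres nres_apply)
  show "\<exists>!h. h \<in> nat_hom R C G L \<and> (\<forall>j \<in> obj J. nat_cmp C (fob Dg j) h (if j = c0 then ?e0 else ?e1) = l j)"
  proof (rule ex1I[of _ ?h])
   show "?h \<in> nat_hom R C G L \<and> (\<forall>j \<in> obj J. nat_cmp C (fob Dg j) ?h (if j = c0 then ?e0 else ?e1) = l j)"
    using hh a1 a0[OF hh] c01 by (auto simp: J_def Dg_def)
   fix h' assume h': "h' \<in> nat_hom R C G L \<and> (\<forall>j \<in> obj J. nat_cmp C (fob Dg j) h' (if j = c0 then ?e0 else ?e1) = l j)"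
   then have "c1 \<in> obj J \<longrightarrow> nat_cmp C (fob Dg c1) h' (if c1 = c0 then ?e0 else ?e1) = l c1" by blast
   then have c1: "nat_cmp C P1 h' ?e1 = l c1" using c01 by (simp add: J_def Dg_def)
   show "h' = ?h"
   proof (rule nat_hom_ext[OF conjunct1[OF h'] hh])
    fix x g assume x: "x \<in> obj C" and g: "g \<in> el G x"
    from s[OF this] obtain p where p: "p \<in> el P1 x" "e x p = g" by auto
    show "h' x g = ?h x g"
     using fun_cong[OF fun_cong[OF c1], of x p] x p g h(2)[OF x p(1)] by (simp add: nat_cmp_apply nres_apply)
   qed
  qed
 qed
qed

text \<open>Cover \<open>G\<close>, then cover the kernel of that cover: \<open>G\<close> becomes
  the cokernel of a map between free functors, which lie in the generated class.\<close>

lemma amod_gen: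
 assumes G: "amod (G :: ('o, 'a, 'k, 'u) modfun)"
 shows "G \<in> gen_mod R C S"
proof -
 note G' = amod_functor[OF G]
 show ?thesis
 proof (rule cover[OF G])
  fix P1 :: "('o, 'a, 'k, 'u) modfun" and e
  assume P1: "P1 \<in> gen_mod R C S" and e: "natl R C P1 G e"
   and sur: "!!x g. x \<in> obj C ==> g \<in> el G x ==> \<exists>p \<in> el P1 x. e x p = g"
  note P1a = gen_mod_amod[OF P1]
  let ?N = "\<lambda>x. ker_in (fob P1 x) (e x) (fob G x)"
  note st = stable_ker[OF amod_functor[OF P1a] G' e]
  show ?thesis
  proof (rule cover[OF amod_subf[OF P1a st]])
   fix P0 :: "('o, 'a, 'k, 'u) modfun" and d
   assume P0: "P0 \<in> gen_mod R C S" and d: "natl R C P0 (subf P1 ?N) d"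
    and sd: "!!x g. x \<in> obj C ==> g \<in> el (subf P1 ?N) x ==> \<exists>p \<in> el P0 x. d x p = g"
   show ?thesis
   proof (rule cokernel_gen[OF P0 P1 G' natl_compose[OF d subf_incl[OF amod_functor[OF P1a] st]] e sur])
    show "e x (d x p) = 0[fob G x]" if "x \<in> obj C" "p \<in> el P0 x" for x p
     using natl_closed[OF d that] by (simp add: ker_in_def)
    show "\<exists>q \<in> el P0 x. d x q = p" if "x \<in> obj C" "p \<in> el P1 x" "e x p = 0[fob G x]" for x p
     using sd that by (simp add: ker_in_def)
   qed
  qed
 qed
qed

lemma gen_mod_iff: "(G :: ('o, 'a, 'k, 'u) modfun) \<in> gen_mod R C S \<longleftrightarrow> amod G" using gen_mod_amod amod_gen by blast

abbreviation projective :: "('o, 'a, 'k, 'u) modfun => bool" where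
 "projective \<equiv> projective_in R C (gen_mod R C S)"

lemma projective_amod: "projective P ==> amod P" unfolding projective_in_def using gen_mod_amod by blast

text \<open>\<open>d\<close> need not be surjective: projectivity is applied to \<open>L\<close>
  over the image of \<open>d\<close>, which is again a module of the category. This is the form in
  which exactness of complexes is used.\<close>

lemma proj_lift:
 assumes P: "projective P" and L: "amod (L :: ('o, 'a, 'k, 'u) modfun)" and K: "amod (K :: ('o, 'a, 'k, 'u) modfun)"
  and d: "natl R C L K d" and f: "natl R C P K f"
  and fd: "!!x v. x \<in> obj C ==> v \<in> el P x ==> f x v \<in> d x ` el L x"
 shows "\<exists>g. natl R C P L g \<and> (\<forall>x \<in> obj C. \<forall>v \<in> el P x. d x (g x v) = f x v)"
proof -
 note L' = amod_functor[OF L] and K' = amod_functor[OF K] and P' = amod_functor[OF projective_amod[OF P]]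
 let ?N = "\<lambda>x. d x ` el L x"
 note st = stable_image[OF L' K' d]
 have d': "nres C L d \<in> nat_hom R C L (subf K ?N)" by (rule nres_hom[OF L' natl_subf_target[OF d]]) auto
 have f': "nres C P f \<in> nat_hom R C P (subf K ?N)" by (rule nres_hom[OF P' natl_subf_target[OF f fd]])
 have "nat_surj C L (subf K ?N) (nres C L d)" by (auto simp: nat_surj_def nres_apply)
 from projective_inD[OF P _ _ d' f' this] obtain g where g: "g \<in> nat_hom R C P L" "nat_cmp C P (nres C L d) g = nres C P f"
  using amod_gen[OF L] amod_gen[OF amod_subf[OF K st]] by blast
 have "d x (g x v) = f x v" if "x \<in> obj C" "v \<in> el P x" for x v
  using fun_cong[OF fun_cong[OF g(2)], of x v] that natl_closed[OF nat_hom_natl[OF g(1)] that]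
  by (simp add: nat_cmp_apply nres_apply)
 then show ?thesis using nat_hom_natl[OF g(1)] by blast
qed

end

section \<open>Complexes of functors\<close>

lemma eval_cx_simps [simp]: "chob (eval_cx K x) i = fob (chob K i) x" "chd (eval_cx K x) i = chd K i x"
 by (simp_all add: eval_cx_def)

definition fcx where
 "fcx R C K \<longleftrightarrow> (\<forall>i. modf R C (chob K i)) \<and> (\<forall>i. natl R C (chob K i) (chob K (i + 1)) (chd K i)) \<and>
   (\<forall>i. \<forall>x \<in> obj C. \<forall>w \<in> el (chob K i) x. chd K (i + 1) x (chd K i x w) = 0[fob (chob K (i + 1 + 1)) x])"

lemma fcxD:
 assumes "fcx R C K"
 shows "modf R C (chob K i)" "natl R C (chob K i) (chob K (i + 1)) (chd K i)"
  "natl R C (chob K (i - 1)) (chob K i) (chd K (i - 1))"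
  "x \<in> obj C ==> w \<in> el (chob K (i - 1)) x ==> chd K i x (chd K (i - 1) x w) = 0[fob (chob K (i + 1)) x]"
proof -
 show 1: "modf R C (chob K i)" "natl R C (chob K i) (chob K (i + 1)) (chd K i)" for i
  using assms by (simp_all add: fcx_def)
 show "natl R C (chob K (i - 1)) (chob K i) (chd K (i - 1))" using 1(2)[of "i - 1"] by simp
 assume "x \<in> obj C" "w \<in> el (chob K (i - 1)) x"
 then have "chd K (i - 1 + 1) x (chd K (i - 1) x w) = 0[fob (chob K (i - 1 + 1 + 1)) x]"
  using assms unfolding fcx_def by blast
 then show "chd K i x (chd K (i - 1) x w) = 0[fob (chob K (i + 1)) x]" by simp
qed

lemma fcx_mcx: "fcx R C K ==> x \<in> obj C ==> mcx R (eval_cx K x)"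
proof -
 assume K: "fcx R C K" and x: "x \<in> obj C"
 show "mcx R (eval_cx K x)" unfolding mcx_def
 proof (intro conjI allI ballI)
  show "module R (chob (eval_cx K x) i)" for i using mf_mod[OF fcxD(1)[OF K] x] by simp
  show "lin R (chob (eval_cx K x) i) (chob (eval_cx K x) (i + 1)) (chd (eval_cx K x) i)" for i
   using natl_lin[OF fcxD(2)[OF K] x] by simp
  show "chd (eval_cx K x) (i + 1) (chd (eval_cx K x) i w) = 0[chob (eval_cx K x) (i + 1 + 1)]"
   if "w \<in> carrier (chob (eval_cx K x) i)" for i w using K x that unfolding fcx_def by simp
 qed
qed

abbreviation Zc where "Zc K i x \<equiv> cocycles (eval_cx K x) i"
abbreviation Bc where "Bc K i x \<equiv> coboundaries (eval_cx K x) i"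

lemma Zc_iff: "w \<in> Zc K i x \<longleftrightarrow> w \<in> el (chob K i) x \<and> chd K i x w = 0[fob (chob K (i + 1)) x]"
 by (simp add: cocycles_def ker_in_def)

lemma Bc_eq: "Bc K i x = chd K (i - 1) x ` el (chob K (i - 1)) x" by (simp add: coboundaries_def)

lemma Zc_stable: "fcx R C K ==> stable R C (chob K i) (Zc K i)"
 using stable_ker[OF fcxD(1) fcxD(1) fcxD(2)] by (simp add: cocycles_def)

lemma Bc_stable: "fcx R C K ==> stable R C (chob K i) (Bc K i)"
 using stable_image[OF fcxD(1) fcxD(1) fcxD(3)] by (simp add: coboundaries_def)

lemma Bc_Zc: "fcx R C K ==> x \<in> obj C ==> Bc K i x \<subseteq> Zc K i x" by (rule coboundaries_cocycles[OF fcx_mcx])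

lemma cohom_fun_sqf: "cohom_fun K i = sqf (chob K i) (Zc K i) (Bc K i)"
 by (simp add: cohom_fun_def sqf_def cohom_def cohom_map_def)

definition cmap where
 "cmap R C K L \<phi> \<longleftrightarrow> (\<forall>i. natl R C (chob K i) (chob L i) (\<phi> i)) \<and>
   (\<forall>i. \<forall>x \<in> obj C. \<forall>w \<in> el (chob K i) x. chd L i x (\<phi> i x w) = \<phi> (i + 1) x (chd K i x w))"

lemma cmapD:
 assumes "cmap R C K L \<phi>"
 shows "natl R C (chob K i) (chob L i) (\<phi> i)"
  "x \<in> obj C ==> w \<in> el (chob K i) x ==> chd L i x (\<phi> i x w) = \<phi> (i + 1) x (chd K i x w)"
  "x \<in> obj C ==> w \<in> el (chob K (i - 1)) x ==> chd L (i - 1) x (\<phi> (i - 1) x w) = \<phi> i x (chd K (i - 1) x w)"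
proof -
 show 1: "natl R C (chob K i) (chob L i) (\<phi> i)"
  "x \<in> obj C ==> w \<in> el (chob K i) x ==> chd L i x (\<phi> i x w) = \<phi> (i + 1) x (chd K i x w)" for i
  using assms by (simp_all add: cmap_def)
 show "x \<in> obj C ==> w \<in> el (chob K (i - 1)) x ==> chd L (i - 1) x (\<phi> (i - 1) x w) = \<phi> i x (chd K (i - 1) x w)"
  using 1(2)[of "i - 1"] by simp
qed

text \<open>A homotopy between \<open>\<rho>\<close> and the identity, in the form
  \<open>\<rho> + d h + h d = 1\<close>; with \<open>\<rho> = 0\<close> it is a contraction.\<close>

definition htpy where
 "htpy R C K \<rho> h \<longleftrightarrow> (\<forall>i. natl R C (chob K i) (chob K (i - 1)) (h i)) \<and>
   (\<forall>i. \<forall>x \<in> obj C. \<forall>w \<in> el (chob K i) x.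
    \<rho> i x w +[fob (chob K i) x] (chd K (i - 1) x (h i x w) +[fob (chob K i) x] h (i + 1) x (chd K i x w)) = w)"

definition heq where
 "heq R C K L \<phi> \<psi> h k \<longleftrightarrow> cmap R C K L \<phi> \<and> cmap R C L K \<psi> \<and>
   htpy R C K (\<lambda>i x w. \<psi> i x (\<phi> i x w)) h \<and> htpy R C L (\<lambda>i x w. \<phi> i x (\<psi> i x w)) k"

section \<open>Comparison of complexes of projectives\<close>

lemma add_minus_minus_cancel:
 assumes "module R M" "a \<in> carrier M" "b \<in> carrier M" "c \<in> carrier M"
 shows "b +[M] ((a -[M] b -[M] c) +[M] c) = a"
proof -
 interpret M: module R M by fact
 have c: "(x -[M] y) +[M] y = x" if "x \<in> carrier M" "y \<in> carrier M" for x y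
  using that by (simp add: M.minus_eq M.a_assoc M.l_neg)
 have "(a -[M] b -[M] c) +[M] c = a -[M] b" using assms by (intro c) simp_all
 moreover have "b +[M] (a -[M] b) = a" using c[of a b] M.a_comm[of b "a -[M] b"] assms by simp
 ultimately show ?thesis by simp
qed

text \<open>
 A complex of projectives over \<open>F\<close>, exact below degree \<open>n\<close> and contracted by \<open>s\<close> above it; for \<open>n = 0\<close>
 and \<open>s = 0\<close> this is a projective resolution.
\<close>

context large_yoneda
begin

definition aug ::
 "('o, 'a, 'k, 'u) funcx => int => ('o, 'a, 'k, 'u) modfun => ('o, 'u, 'u) nat_trans =>
   (int => ('o, 'u, 'u) nat_trans) => bool" where
 "aug K n F \<epsilon> s \<longleftrightarrow> fcx R C K \<and> (\<forall>i. projective (chob K i)) \<and>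
   (\<forall>i<n. \<forall>x \<in> obj C. Zc K i x \<subseteq> Bc K i x) \<and> amod F \<and> natl R C (chob K n) F \<epsilon> \<and>
   (\<forall>x \<in> obj C. \<forall>w \<in> Bc K n x. \<epsilon> x w = 0[fob F x]) \<and>
   (\<forall>x \<in> obj C. \<forall>v \<in> el F x. \<exists>w \<in> Zc K n x. \<epsilon> x w = v) \<and>
   (\<forall>x \<in> obj C. \<forall>w \<in> Zc K n x. \<epsilon> x w = 0[fob F x] \<longrightarrow> w \<in> Bc K n x) \<and>
   (\<forall>i>n. natl R C (chob K i) (chob K (i - 1)) (s i)) \<and>
   (\<forall>i>n. \<forall>x \<in> obj C. \<forall>w \<in> el (chob K i) x.
    chd K (i - 1) x (s i x w) +[fob (chob K i) x] s (i + 1) x (chd K i x w) = w) \<and>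
   (\<forall>x \<in> obj C. \<forall>w \<in> el (chob K n) x. \<epsilon> x (s (n + 1) x (chd K n x w)) = 0[fob F x])"

lemma augD:
 assumes "aug K n F \<epsilon> s"
 shows "fcx R C K" "projective (chob K i)" "amod (chob K i)"
  "i < n ==> x \<in> obj C ==> w \<in> Zc K i x ==> w \<in> Bc K i x" "amod F" "natl R C (chob K n) F \<epsilon>"
  "x \<in> obj C ==> w \<in> Bc K n x ==> \<epsilon> x w = 0[fob F x]"
  "x \<in> obj C ==> v \<in> el F x ==> \<exists>w \<in> Zc K n x. \<epsilon> x w = v"
  "x \<in> obj C ==> w \<in> Zc K n x ==> \<epsilon> x w = 0[fob F x] ==> w \<in> Bc K n x"
  "i > n ==> natl R C (chob K i) (chob K (i - 1)) (s i)"
  "i > n ==> x \<in> obj C ==> w \<in> el (chob K i) x ==>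
    chd K (i - 1) x (s i x w) +[fob (chob K i) x] s (i + 1) x (chd K i x w) = w"
  "x \<in> obj C ==> w \<in> el (chob K n) x ==> \<epsilon> x (s (n + 1) x (chd K n x w)) = 0[fob F x]"
 using assms unfolding aug_def by (auto intro: projective_amod)

text \<open>Zero above degree \<open>n\<close>, a lift of \<open>\<epsilon>\<close> in degree
  \<open>n\<close>, and below it successive lifts through the exact complex \<open>L\<close>. The
  vanishing above \<open>n\<close> is what makes composites of such maps amenable to the
  contractions \<open>s\<close>.\<close>

lemma aug_map:
 assumes K: "aug K n F \<epsilon> s" and L: "aug L n F \<epsilon>' s'"
 shows "\<exists>\<phi>. cmap R C K L \<phi> \<and> (\<forall>i>n. \<forall>x \<in> obj C. \<forall>w \<in> el (chob K i) x. \<phi> i x w = 0[fob (chob L i) x]) \<and>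
   (\<forall>x \<in> obj C. \<forall>w \<in> el (chob K n) x. \<epsilon>' x (\<phi> n x w) = \<epsilon> x w \<and> \<phi> n x w \<in> Zc L n x)"
proof -
 note KD = augD[OF K] and LD = augD[OF L]
 note Kc = fcxD[OF KD(1)] and Lc = fcxD[OF LD(1)]
 have ZL: "stable R C (chob L n) (Zc L n)" by (rule Zc_stable[OF LD(1)])
 \<comment> \<open>The lift is sought inside the cocycles of \<open>L\<close>: the map being zero in
   degree \<open>n + 1\<close>, the differential has to kill its values in degree
   \<open>n\<close>.\<close>
 have "\<exists>g. natl R C (chob K n) (subf (chob L n) (Zc L n)) g \<and>
   (\<forall>x \<in> obj C. \<forall>v \<in> el (chob K n) x. \<epsilon>' x (g x v) = \<epsilon> x v)"
 proof (rule proj_lift[OF KD(2) amod_subf[OF LD(3) ZL] KD(5) natl_subf_source[OF Lc(1) ZL LD(6)] KD(6)])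
  show "\<epsilon> x v \<in> \<epsilon>' x ` el (subf (chob L n) (Zc L n)) x"
   if "x \<in> obj C" "v \<in> el (chob K n) x" for x v
   using LD(8)[OF that(1) natl_closed[OF KD(6) that]] unfolding subf_simps by (metis imageI)
 qed
 then obtain g0 where g0: "natl R C (chob K n) (subf (chob L n) (Zc L n)) g0"
   "!!x v. x \<in> obj C ==> v \<in> el (chob K n) x ==> \<epsilon>' x (g0 x v) = \<epsilon> x v" by blast
 have g0n: "natl R C (chob K n) (chob L n) g0" by (rule natl_compose[OF g0(1) subf_incl[OF Lc(1) ZL]])
 have g0Z: "g0 x w \<in> Zc L n x" if "x \<in> obj C" "w \<in> el (chob K n) x" for x w using natl_closed[OF g0(1) that] by simp
 \<comment> \<open>\<open>m\<close> counts steps below \<open>n\<close>. Sending coboundaries to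
   coboundaries is the invariant that makes the next lift possible; \<open>Q\<close> is the
   commuting square between consecutive choices.\<close>
 define P where "P m g \<longleftrightarrow> natl R C (chob K (n - int m)) (chob L (n - int m)) g \<and>
   (\<forall>x \<in> obj C. \<forall>w \<in> Bc K (n - int m) x. g x w \<in> Bc L (n - int m) x)" for m g
 define Q where "Q m g g' \<longleftrightarrow> (\<forall>x \<in> obj C. \<forall>w \<in> el (chob K (n - int m - 1)) x.
   chd L (n - int m - 1) x (g' x w) = g x (chd K (n - int m - 1) x w))" for m g g'
 have P0: "P 0 g0" unfolding P_def
 proof (intro conjI ballI)
  show "natl R C (chob K (n - int 0)) (chob L (n - int 0)) g0" using g0n by simp
  fix x w assume x: "x \<in> obj C" and "w \<in> Bc K (n - int 0) x"
  then have w: "w \<in> Bc K n x" by simp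
  have wc: "w \<in> el (chob K n) x" using subsetD[OF Bc_Zc[OF KD(1) x] w] by (simp add: Zc_iff)
  show "g0 x w \<in> Bc L (n - int 0) x" using LD(9)[OF x g0Z[OF x wc]] g0(2)[OF x wc] KD(7)[OF x w] by simp
 qed
 have step: "\<exists>g'. P (Suc m) g' \<and> Q m g g'" if g: "P m g" for m g
 proof -
  let ?i = "n - int m" and ?j = "n - int m - 1"
  have j: "n - int (Suc m) = ?j" by simp
  have gn: "natl R C (chob K ?i) (chob L ?i) g" using g by (simp add: P_def)
  have "\<exists>g'. natl R C (chob K ?j) (chob L ?j) g' \<and>
    (\<forall>x \<in> obj C. \<forall>v \<in> el (chob K ?j) x. chd L ?j x (g' x v) = g x (chd K ?j x v))"
  proof (rule proj_lift[OF KD(2) LD(3) LD(3) Lc(3) natl_compose[OF Kc(3) gn]])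
   fix x v assume x: "x \<in> obj C" and v: "v \<in> el (chob K ?j) x"
   have "chd K ?j x v \<in> Bc K ?i x" using v by (auto simp: Bc_eq)
   then show "g x (chd K ?j x v) \<in> chd L ?j x ` el (chob L ?j) x" using g x by (auto simp: P_def Bc_eq)
  qed
  then obtain g' where g': "natl R C (chob K ?j) (chob L ?j) g'"
   "!!x v. x \<in> obj C ==> v \<in> el (chob K ?j) x ==> chd L ?j x (g' x v) = g x (chd K ?j x v)" by blast
  have "g' x w \<in> Bc L ?j x" if x: "x \<in> obj C" and w: "w \<in> Bc K ?j x" for x w
  proof (rule LD(4)[OF _ x])
   from w have "w \<in> Zc K ?j x" using Bc_Zc[OF KD(1) x] by blast
   then have wc: "w \<in> el (chob K ?j) x" and dw: "chd K ?j x w = 0[fob (chob K ?i) x]" by (simp_all add: Zc_iff)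
   show "g' x w \<in> Zc L ?j x"
    using g'(2)[OF x wc] natl_closed[OF g'(1) x wc] dw
     lin_zero[OF mf_mod[OF Kc(1) x] mf_mod[OF Lc(1) x] natl_lin[OF gn x]] by (simp add: Zc_iff)
  qed simp
  then have "P (Suc m) g'" unfolding P_def j using g'(1) by blast
  moreover have "Q m g g'" unfolding Q_def using g'(2) by blast
  ultimately show ?thesis by blast
 qed
 obtain f where f: "!!m. P m (f m)" "!!m. Q m (f m) (f (Suc m))" and f0: "f 0 = g0"
 proof -
  have "\<exists>f. \<forall>m. (P m (f m) \<and> (m = 0 \<longrightarrow> f m = g0)) \<and> Q m (f m) (f (Suc m))"
   by (rule dependent_nat_choice) (use P0 step in auto)
  then show ?thesis using that by blast
 qed
 define \<phi> where "\<phi> i = (if i > n then (\<lambda>x w. 0[fob (chob L i) x]) else f (nat (n - i)))" for i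
 have \<phi>f: "\<phi> (n - int m) = f m" for m by (simp add: \<phi>_def)
 have le: "\<exists>m. i = n - int m" if "i \<le> n" for i using that by (intro exI[of _ "nat (n - i)"]) simp
 have \<phi>n: "natl R C (chob K i) (chob L i) (\<phi> i)" for i
 proof (cases "i > n")
  case True
  then show ?thesis using natl_zero[OF Lc(1)] by (simp add: \<phi>_def)
 next
  case False
  then obtain m where "i = n - int m" using le by force
  then show ?thesis using f(1)[of m] \<phi>f by (simp add: P_def)
 qed
 have "cmap R C K L \<phi>" unfolding cmap_def
 proof (intro conjI allI ballI \<phi>n)
  fix i x w assume x: "x \<in> obj C" and w: "w \<in> el (chob K i) x"
  have dw: "chd K i x w \<in> el (chob K (i + 1)) x" by (rule natl_closed[OF Kc(2) x w])
  consider "i > n" | "i = n" | "i < n" by linarith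
  then show "chd L i x (\<phi> i x w) = \<phi> (i + 1) x (chd K i x w)"
  proof cases
   case 1
   then show ?thesis using lin_zero[OF mf_mod[OF Lc(1) x] mf_mod[OF Lc(1) x] natl_lin[OF Lc(2) x]]
    by (simp add: \<phi>_def)
  next
   case 2
   then show ?thesis using g0Z[OF x] w by (simp add: \<phi>_def f0 Zc_iff)
  next
   case 3
   then obtain m where m: "i + 1 = n - int m" using le[of "i + 1"] by auto
   then have i: "i = n - int m - 1" "i = n - int (Suc m)" by simp_all
   have "chd L i x (f (Suc m) x w) = f m x (chd K i x w)"
    using f(2)[of m] x w unfolding Q_def i(1)[symmetric] by blast
   then show ?thesis using \<phi>f[of m] \<phi>f[of "Suc m"] by (simp only: m[symmetric] i(2)[symmetric])
  qed
 qed
 then show ?thesis using g0(2) g0Z by (intro exI[of _ \<phi>]) (simp add: \<phi>_def f0)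
qed

text \<open>
 Homotopies are built downwards from degree \<open>M + 1\<close>, as long as \<open>E\<close> holds; \<open>E\<close> bounds the
 degrees in which the complex is known to be exact.
\<close>

lemma homotopy_down:
 assumes K: "fcx R C K" "!!i. projective (chob K i)"
  and \<rho>: "cmap R C K K \<rho>"
  and s: "natl R C (chob K (M + 1)) (chob K M) s"
  and E: "!!i. i < M ==> E i ==> E (i + 1)"
  and ex: "!!i x w. i < M ==> E i ==> x \<in> obj C ==> w \<in> Zc K i x ==> w \<in> Bc K i x"
  and land: "!!x w. E M ==> x \<in> obj C ==> w \<in> el (chob K M) x ==>
   w -[fob (chob K M) x] \<rho> M x w -[fob (chob K M) x] s x (chd K M x w) \<in> Bc K M x"
 shows "\<exists>h. h (M + 1) = s \<and> (\<forall>i \<le> M + 1. natl R C (chob K i) (chob K (i - 1)) (h i)) \<and>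
  (\<forall>i \<le> M. E i \<longrightarrow> (\<forall>x \<in> obj C. \<forall>w \<in> el (chob K i) x.
   \<rho> i x w +[fob (chob K i) x] (chd K (i - 1) x (h i x w) +[fob (chob K i) x] h (i + 1) x (chd K i x w)) = w))"
proof -
 note Kc = fcxD[OF K(1)]
 have Ka: "amod (chob K i)" for i by (rule projective_amod[OF K(2)])
 \<comment> \<open>The error \<open>1 - \<rho> - h d\<close> left by a candidate \<open>h\<close>
   one degree above; the next component of the homotopy is a lift of this error through the
   differential.\<close>
 define r where "r i h x w = w -[fob (chob K i) x] \<rho> i x w -[fob (chob K i) x] h x (chd K i x w)" for i h x w
 have rn: "natl R C (chob K i) (chob K i) (r i h)" if "natl R C (chob K (i + 1)) (chob K i) h" for i h
  unfolding r_def
  by (rule natl_minus[OF Kc(1) natl_minus[OF Kc(1) natl_id cmapD(1)[OF \<rho>]] natl_compose[OF Kc(2) that]])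
 define P where "P m h \<longleftrightarrow> natl R C (chob K (M + 1 - int m)) (chob K (M - int m)) h \<and>
   (E (M - int m) \<longrightarrow> (\<forall>x \<in> obj C. \<forall>w \<in> el (chob K (M - int m)) x. r (M - int m) h x w \<in> Bc K (M - int m) x))" for m h
 define Q where "Q m h h' \<longleftrightarrow> (E (M - int m) \<longrightarrow> (\<forall>x \<in> obj C. \<forall>w \<in> el (chob K (M - int m)) x.
   chd K (M - int m - 1) x (h' x w) = r (M - int m) h x w))" for m h h'
 have P0: "P 0 s" using s land by (simp add: P_def r_def)
 have step: "\<exists>h'. P (Suc m) h' \<and> Q m h h'" if h: "P m h" for m h
 proof -
  let ?i = "M - int m" and ?j = "M - int m - 1"
  have j: "M - int (Suc m) = ?j" "M + 1 - int (Suc m) = ?i" by simp_all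
  have i1: "M + 1 - int m = ?i + 1" "?j + 1 = ?i" by simp_all
  have hn: "natl R C (chob K (?i + 1)) (chob K ?i) h" using h i1 by (simp add: P_def)
  show ?thesis
  proof (cases "E ?i")
   case False
   \<comment> \<open>\<open>E\<close> passes upwards, so once it fails it fails in all lower
     degrees, where no identity is claimed and zero maps will do.\<close>
   then have "\<not> E ?j" using E[of ?j] i1(2) by auto
   then show ?thesis using False natl_zero[OF Kc(1)] unfolding P_def Q_def j by blast
  next
   case True
   have "\<exists>h'. natl R C (chob K ?i) (chob K ?j) h' \<and>
     (\<forall>x \<in> obj C. \<forall>v \<in> el (chob K ?i) x. chd K ?j x (h' x v) = r ?i h x v)"
   proof (rule proj_lift[OF K(2) Ka Ka Kc(3) rn[OF hn]])
    show "r ?i h x v \<in> chd K ?j x ` el (chob K ?j) x"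
     if "x \<in> obj C" "v \<in> el (chob K ?i) x" for x v using h True that by (simp add: P_def Bc_eq)
   qed
   then obtain h' where h': "natl R C (chob K ?i) (chob K ?j) h'"
    "!!x v. x \<in> obj C ==> v \<in> el (chob K ?i) x ==> chd K ?j x (h' x v) = r ?i h x v" by blast
   have "r ?j h' x w \<in> Bc K ?j x" if e: "E ?j" and x: "x \<in> obj C" and w: "w \<in> el (chob K ?j) x" for x w
   proof (rule ex[OF _ e x])
    let ?Mi = "fob (chob K ?i) x"
    interpret Mi: module R ?Mi by (rule mf_mod[OF Kc(1) x])
    have c: "\<rho> ?j x w \<in> el (chob K ?j) x" by (rule natl_closed[OF cmapD(1)[OF \<rho>] x w])
    have dw: "chd K ?j x w \<in> carrier ?Mi" by (rule natl_closed[OF Kc(3) x w])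
    have hc: "h' x (chd K ?j x w) \<in> el (chob K ?j) x" by (rule natl_closed[OF h'(1) x dw])
    interpret Mj: module R "fob (chob K ?j) x" by (rule mf_mod[OF Kc(1) x])
    have dd: "chd K ?i x (chd K ?j x w) = 0[fob (chob K (?i + 1)) x]" by (rule Kc(4)[OF x w])
    note lm = lin_minus[OF mf_mod[OF Kc(1) x] mf_mod[OF Kc(1) x] natl_lin[OF Kc(3) x]]
    have \<rho>d: "chd K ?j x (\<rho> ?j x w) = \<rho> ?i x (chd K ?j x w)" by (rule cmapD(3)[OF \<rho> x w])
    have \<rho>c: "\<rho> ?i x (chd K ?j x w) \<in> carrier ?Mi" by (rule natl_closed[OF cmapD(1)[OF \<rho>] x dw])
    have h0: "h x (chd K ?i x (chd K ?j x w)) = 0[?Mi]"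
     unfolding dd by (rule lin_zero[OF mf_mod[OF Kc(1) x] mf_mod[OF Kc(1) x] natl_lin[OF hn x]])
    have rr: "r ?i h x (chd K ?j x w) = chd K ?j x w -[?Mi] \<rho> ?i x (chd K ?j x w)"
     unfolding r_def h0 using dw \<rho>c minus_eq_zero_iff[OF Mi.module_axioms]
     by (metis Mi.minus_eq Mi.minus_closed Mi.r_neg Mi.r_zero Mi.add.inv_closed Mi.a_assoc Mi.l_neg Mi.zero_closed Mi.l_zero)
    \<comment> \<open>The differential of the new error: \<open>d h' d\<close> equals
      \<open>d - \<rho> d\<close> by the choice of \<open>h'\<close>, and that is also
      \<open>d - d \<rho>\<close>, so everything cancels.\<close>
    have "chd K ?j x (w -[fob (chob K ?j) x] \<rho> ?j x w -[fob (chob K ?j) x] h' x (chd K ?j x w)) =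
      (chd K ?j x w -[?Mi] \<rho> ?i x (chd K ?j x w)) -[?Mi] (chd K ?j x w -[?Mi] \<rho> ?i x (chd K ?j x w))"
     using w c hc by (simp add: lm \<rho>d h'(2)[OF x dw] rr)
    also have "\<dots> = 0[?Mi]" using dw \<rho>c minus_eq_zero_iff[OF Mi.module_axioms] by simp
    finally show "r ?j h' x w \<in> Zc K ?j x" using w c hc unfolding Zc_iff i1(2) i1(2) unfolding r_def by simp
   qed simp
   then have "P (Suc m) h'" unfolding P_def j using h'(1) by blast
   moreover have "Q m h h'" unfolding Q_def using h'(2) by blast
   ultimately show ?thesis by blast
  qed
 qed
 obtain f where f: "!!m. P m (f m)" "!!m. Q m (f m) (f (Suc m))" and f0: "f 0 = s"
 proof -
  have "\<exists>f. \<forall>m. (P m (f m) \<and> (m = 0 \<longrightarrow> f m = s)) \<and> Q m (f m) (f (Suc m))"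
   by (rule dependent_nat_choice) (use P0 step in auto)
  then show ?thesis using that by blast
 qed
 define h where "h i = f (nat (M + 1 - i))" for i
 have hf: "h (M + 1 - int m) = f m" for m by (simp add: h_def)
 have hn: "natl R C (chob K i) (chob K (i - 1)) (h i)" if "i \<le> M + 1" for i
 proof -
  from that obtain m where m: "i = M + 1 - int m" by (metis add.commute diff_add_cancel nonneg_int_cases zle_iff_zadd add_diff_cancel_left')
  then have "i - 1 = M - int m" by simp
  then show ?thesis using f(1)[of m] hf[of m] unfolding P_def m[symmetric] by (simp add: m[symmetric])
 qed
 show ?thesis
 proof (intro exI[of _ h] conjI allI impI ballI)
  show "h (M + 1) = s" using hf[of 0] f0 by simp
  show "natl R C (chob K i) (chob K (i - 1)) (h i)" if "i \<le> M + 1" for i by (rule hn[OF that])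
  fix i x w assume i: "i \<le> M" and e: "E i" and x: "x \<in> obj C" and w: "w \<in> el (chob K i) x"
  obtain m where m: "i = M - int m" using i by (metis zle_iff_zadd add_diff_cancel_right')
  then have "M + 1 - int m = i + 1" "M + 1 - int (Suc m) = i" by simp_all
  then have hm: "h (i + 1) = f m" "h i = f (Suc m)" using hf[of m] hf[of "Suc m"] by metis+
  have "chd K (i - 1) x (h i x w) = r i (h (i + 1)) x w"
   using f(2)[of m] e x w unfolding Q_def m[symmetric] hm by blast
  moreover have "\<rho> i x w \<in> el (chob K i) x" by (rule natl_closed[OF cmapD(1)[OF \<rho>] x w])
  moreover have "h (i + 1) x (chd K i x w) \<in> el (chob K i) x"
   using natl_closed[OF hn[of "i + 1"] x natl_closed[OF Kc(2) x w]] i by simp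
  ultimately show "\<rho> i x w +[fob (chob K i) x] (chd K (i - 1) x (h i x w) +[fob (chob K i) x] h (i + 1) x (chd K i x w)) = w"
   using add_minus_minus_cancel[OF mf_mod[OF Kc(1) x] w] by (simp add: r_def)
 qed
qed

text \<open>Above degree \<open>n\<close> the map \<open>\<rho>\<close> vanishes and
  \<open>s\<close> itself is the homotopy. In degree \<open>n\<close> the error
  \<open>1 - \<rho> - s d\<close> lands in the cocycles and is killed by \<open>\<epsilon>\<close>,
  hence is a coboundary; from there \<open>homotopy_down\<close> takes over.\<close>

lemma aug_htpy:
 assumes K: "aug K n F \<epsilon> s" and \<rho>: "cmap R C K K \<rho>"
  and z: "!!i x w. i > n ==> x \<in> obj C ==> w \<in> el (chob K i) x ==> \<rho> i x w = 0[fob (chob K i) x]"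
  and e: "!!x w. x \<in> obj C ==> w \<in> el (chob K n) x ==> \<epsilon> x (\<rho> n x w) = \<epsilon> x w"
 shows "\<exists>h. htpy R C K \<rho> h"
proof -
 note KD = augD[OF K]
 note Kc = fcxD[OF KD(1)]
 have s1: "natl R C (chob K (n + 1)) (chob K n) (s (n + 1))" using KD(10)[of "n + 1"] by simp
 have land: "w -[fob (chob K n) x] \<rho> n x w -[fob (chob K n) x] s (n + 1) x (chd K n x w) \<in> Bc K n x"
  if x: "x \<in> obj C" and w: "w \<in> el (chob K n) x" for x w
 proof (rule KD(9)[OF x])
  let ?M = "fob (chob K n) x" and ?N = "fob (chob K (n + 1)) x"
  interpret M: module R ?M by (rule mf_mod[OF Kc(1) x])
  interpret N: module R ?N by (rule mf_mod[OF Kc(1) x])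
  interpret F: module R "fob F x" by (rule mf_mod[OF amod_functor[OF KD(5)] x])
  let ?s = "s (n + 1) x (chd K n x w)"
  have dw: "chd K n x w \<in> carrier ?N" by (rule natl_closed[OF Kc(2) x w])
  have c: "\<rho> n x w \<in> carrier ?M" by (rule natl_closed[OF cmapD(1)[OF \<rho>] x w])
  have sc: "?s \<in> carrier ?M" by (rule natl_closed[OF s1 x dw])
  have d\<rho>: "chd K n x (\<rho> n x w) = 0[?N]" using cmapD(2)[OF \<rho> x w] z[of "n + 1", OF _ x dw] by simp
  have dd: "chd K (n + 1) x (chd K n x w) = 0[fob (chob K (n + 1 + 1)) x]" using Kc(4)[OF x, of w "n + 1"] w by simp
  have s2: "natl R C (chob K (n + 1 + 1)) (chob K (n + 1)) (s (n + 1 + 1))"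
   using KD(10)[of "n + 1 + 1"] unfolding add_diff_cancel_right' by linarith
  have "s (n + 1 + 1) x 0[fob (chob K (n + 1 + 1)) x] = 0[?N]"
   by (rule lin_zero[OF mf_mod[OF Kc(1) x] mf_mod[OF Kc(1) x] natl_lin[OF s2 x]])
  then have ds: "chd K n x ?s = chd K n x w" using KD(11)[of "n + 1", OF _ x dw] dd natl_closed[OF Kc(2) x sc] by simp
  note lm = lin_minus[OF mf_mod[OF Kc(1) x] mf_mod[OF Kc(1) x] natl_lin[OF Kc(2) x]]
  have "chd K n x (w -[?M] \<rho> n x w -[?M] ?s) = (chd K n x w -[?N] 0[?N]) -[?N] chd K n x w"
   using w c sc by (simp add: lm d\<rho> ds)
  also have "chd K n x w -[?N] 0[?N] = chd K n x w"
   using add_minus_cancel[OF N.module_axioms dw N.zero_closed] dw by simp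
  also have "chd K n x w -[?N] chd K n x w = 0[?N]" using minus_eq_zero_iff[OF N.module_axioms dw dw] by simp
  finally show "w -[?M] \<rho> n x w -[?M] ?s \<in> Zc K n x" using w c sc by (simp add: Zc_iff)
  have ec: "\<epsilon> x w \<in> el F x" by (rule natl_closed[OF KD(6) x w])
  have zz: "0[fob F x] -[fob F x] 0[fob F x] = 0[fob F x]" "\<epsilon> x w -[fob F x] \<epsilon> x w = 0[fob F x]"
   using minus_eq_zero_iff[OF F.module_axioms] ec by simp_all
  show "\<epsilon> x (w -[?M] \<rho> n x w -[?M] ?s) = 0[fob F x]"
   using w c sc by (simp add: lin_minus[OF M.module_axioms F.module_axioms natl_lin[OF KD(6) x]] e[OF x w] KD(12)[OF x w] zz)
 qed
 have "\<exists>h. h (n + 1) = s (n + 1) \<and> (\<forall>i \<le> n + 1. natl R C (chob K i) (chob K (i - 1)) (h i)) \<and>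
  (\<forall>i \<le> n. True \<longrightarrow> (\<forall>x \<in> obj C. \<forall>w \<in> el (chob K i) x.
   \<rho> i x w +[fob (chob K i) x] (chd K (i - 1) x (h i x w) +[fob (chob K i) x] h (i + 1) x (chd K i x w)) = w))"
  by (rule homotopy_down[OF KD(1,2) \<rho> s1 _ KD(4) land]) simp_all
 then obtain h where h: "h (n + 1) = s (n + 1)" "!!i. i \<le> n + 1 ==> natl R C (chob K i) (chob K (i - 1)) (h i)"
  "!!i x w. i \<le> n ==> x \<in> obj C ==> w \<in> el (chob K i) x ==>
   \<rho> i x w +[fob (chob K i) x] (chd K (i - 1) x (h i x w) +[fob (chob K i) x] h (i + 1) x (chd K i x w)) = w" by blast
 define k where "k i = (if i > n then s i else h i)" for i
 have "htpy R C K \<rho> k" unfolding htpy_def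
 proof (intro conjI allI ballI)
  show "natl R C (chob K i) (chob K (i - 1)) (k i)" for i using h(2)[of i] KD(10)[of i] by (simp add: k_def)
  fix i x w assume x: "x \<in> obj C" and w: "w \<in> el (chob K i) x"
  interpret M: module R "fob (chob K i) x" by (rule mf_mod[OF Kc(1) x])
  show "\<rho> i x w +[fob (chob K i) x] (chd K (i - 1) x (k i x w) +[fob (chob K i) x] k (i + 1) x (chd K i x w)) = w"
  proof (cases "i > n")
   case True
   then show ?thesis using z[OF True x w] KD(11)[OF True x w] w by (simp add: k_def)
  next
   case False
   then have "k i = h i" "k (i + 1) = h (i + 1)" using h(1) by (cases "i = n"; simp add: k_def)+
   then show ?thesis using h(3)[OF _ x w] False by simp
  qed
 qed
 then show ?thesis by blast
qed

text \<open>Both composites of the two lifts lie over the identity of \<open>F\<close> and vanish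
  above \<open>n\<close>, which is all that \<open>aug_htpy\<close> asks for.\<close>

theorem comparison:
 assumes K: "aug K n F \<epsilon> s" and L: "aug L n F \<epsilon>' s'"
 shows "\<exists>\<phi> \<psi> h k. heq R C K L \<phi> \<psi> h k"
proof -
 from aug_map[OF K L] obtain \<phi> where \<phi>: "cmap R C K L \<phi>"
  "\<forall>i>n. \<forall>x \<in> obj C. \<forall>w \<in> el (chob K i) x. \<phi> i x w = 0[fob (chob L i) x]"
  "\<forall>x \<in> obj C. \<forall>w \<in> el (chob K n) x. \<epsilon>' x (\<phi> n x w) = \<epsilon> x w \<and> \<phi> n x w \<in> Zc L n x" by blast
 from aug_map[OF L K] obtain \<psi> where \<psi>: "cmap R C L K \<psi>"
  "\<forall>i>n. \<forall>x \<in> obj C. \<forall>w \<in> el (chob L i) x. \<psi> i x w = 0[fob (chob K i) x]"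
  "\<forall>x \<in> obj C. \<forall>w \<in> el (chob L n) x. \<epsilon> x (\<psi> n x w) = \<epsilon>' x w \<and> \<psi> n x w \<in> Zc K n x" by blast
 note KD = augD[OF K] and LD = augD[OF L]
 note \<phi>0 = lin_zero[OF mf_mod[OF fcxD(1)[OF KD(1)]] mf_mod[OF fcxD(1)[OF LD(1)]] natl_lin[OF cmapD(1)[OF \<phi>(1)]]]
  and \<psi>0 = lin_zero[OF mf_mod[OF fcxD(1)[OF LD(1)]] mf_mod[OF fcxD(1)[OF KD(1)]] natl_lin[OF cmapD(1)[OF \<psi>(1)]]]
 note \<phi>c = natl_closed[OF cmapD(1)[OF \<phi>(1)]] and \<psi>c = natl_closed[OF cmapD(1)[OF \<psi>(1)]]
 have cc: "cmap R C K K (\<lambda>i x w. \<psi> i x (\<phi> i x w))" "cmap R C L L (\<lambda>i x w. \<phi> i x (\<psi> i x w))"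
  unfolding cmap_def
  using natl_compose[OF cmapD(1)[OF \<phi>(1)] cmapD(1)[OF \<psi>(1)]] natl_compose[OF cmapD(1)[OF \<psi>(1)] cmapD(1)[OF \<phi>(1)]]
   cmapD(2)[OF \<phi>(1)] cmapD(2)[OF \<psi>(1)] \<phi>c \<psi>c by simp_all
 have "\<exists>h. htpy R C K (\<lambda>i x w. \<psi> i x (\<phi> i x w)) h"
  by (rule aug_htpy[OF K cc(1)]) (use \<phi>(2,3) \<psi>(2,3) \<phi>c \<psi>0 in simp_all)
 moreover have "\<exists>k. htpy R C L (\<lambda>i x w. \<phi> i x (\<psi> i x w)) k"
  by (rule aug_htpy[OF L cc(2)]) (use \<phi>(2,3) \<psi>(2,3) \<psi>c \<phi>0 in simp_all)
 ultimately show ?thesis using \<phi>(1) \<psi>(1) unfolding heq_def by blast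
qed

text \<open>Exactness above \<open>n\<close> together with vanishing in large degrees contracts the
  complex there, so the cocycles in degree \<open>n\<close> split off. That is how
  \<open>\<epsilon>\<close>, given on cocycles only, extends to all of degree
  \<open>n\<close>.\<close>

lemma aug_of_exact:
 fixes F :: "('o, 'a, 'k, 'u) modfun"
 assumes K: "fcx R C K" "!!i. projective (chob K i)" and N: "!!i. i > N ==> zero_functor C (chob K i)"
  and ex: "!!i x w. i \<noteq> n ==> x \<in> obj C ==> w \<in> Zc K i x ==> w \<in> Bc K i x"
  and F: "amod F" and \<epsilon>: "natl R C (subf (chob K n) (Zc K n)) F \<epsilon>"
  and \<epsilon>B: "!!x w. x \<in> obj C ==> w \<in> Zc K n x ==> \<epsilon> x w = 0[fob F x] \<longleftrightarrow> w \<in> Bc K n x"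
  and \<epsilon>s: "!!x v. x \<in> obj C ==> v \<in> el F x ==> \<exists>w \<in> Zc K n x. \<epsilon> x w = v"
 shows "\<exists>\<epsilon>' s. aug K n F \<epsilon>' s"
proof -
 note Kc = fcxD[OF K(1)]
 \<comment> \<open>From degree \<open>M\<close> on the complex is zero, so the contraction may start
   there with the zero map and descend as far as degree \<open>n + 1\<close>.\<close>
 define M where "M = max N n + 1"
 have M: "M > N" "M > n" by (auto simp: M_def)
 have z: "w = 0[fob (chob K i) x]" if "i \<ge> M" "x \<in> obj C" "w \<in> el (chob K i) x" for i x w
  using N[of i] that M(1) by (auto simp: zero_functor_def trivial_mod_def)
 have cz: "cmap R C K K (\<lambda>i x w. 0[fob (chob K i) x])"
  unfolding cmap_def by (intro conjI allI ballI natl_zero[OF Kc(1)])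
    (simp add: lin_zero[OF mf_mod[OF Kc(1)] mf_mod[OF Kc(1)] natl_lin[OF Kc(2)]])
 have "\<exists>h. h (M + 1) = (\<lambda>x w. 0[fob (chob K M) x]) \<and> (\<forall>i \<le> M + 1. natl R C (chob K i) (chob K (i - 1)) (h i)) \<and>
  (\<forall>i \<le> M. i > n \<longrightarrow> (\<forall>x \<in> obj C. \<forall>w \<in> el (chob K i) x.
   0[fob (chob K i) x] +[fob (chob K i) x] (chd K (i - 1) x (h i x w) +[fob (chob K i) x] h (i + 1) x (chd K i x w)) = w))"
 proof (rule homotopy_down[OF K cz])
  show "natl R C (chob K (M + 1)) (chob K M) (\<lambda>x w. 0[fob (chob K M) x])" by (rule natl_zero[OF Kc(1)])
  show "w \<in> Bc K i x" if "i < M" "i > n" "x \<in> obj C" "w \<in> Zc K i x" for i x w using ex that by simp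
  show "w -[fob (chob K M) x] 0[fob (chob K M) x] -[fob (chob K M) x] 0[fob (chob K M) x] \<in> Bc K M x"
   if x: "x \<in> obj C" and w: "w \<in> el (chob K M) x" for x w
  proof -
   interpret M: module R "fob (chob K M) x" by (rule mf_mod[OF Kc(1) x])
   have "w -[fob (chob K M) x] 0[fob (chob K M) x] -[fob (chob K M) x] 0[fob (chob K M) x] = 0[fob (chob K M) x]"
    using w by (intro z[OF order.refl x]) simp
   then show ?thesis using submoduleD(2)[OF mf_mod[OF Kc(1) x] stable_sub[OF Bc_stable[OF K(1)] x]] by simp
  qed
 qed simp
 then obtain h where h: "h (M + 1) = (\<lambda>x w. 0[fob (chob K M) x])" "!!i. i \<le> M + 1 ==> natl R C (chob K i) (chob K (i - 1)) (h i)"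
  "!!i x w. i \<le> M ==> i > n ==> x \<in> obj C ==> w \<in> el (chob K i) x ==>
   0[fob (chob K i) x] +[fob (chob K i) x] (chd K (i - 1) x (h i x w) +[fob (chob K i) x] h (i + 1) x (chd K i x w)) = w"
  by blast
 define s where "s i = (if i \<le> M + 1 then h i else (\<lambda>x w. 0[fob (chob K (i - 1)) x]))" for i
 have sn: "natl R C (chob K i) (chob K (i - 1)) (s i)" for i
 proof (cases "i \<le> M + 1")
  case True
  then show ?thesis using h(2)[OF True] by (simp add: s_def)
 next
  case False
  then have "s i = (\<lambda>x w. 0[fob (chob K (i - 1)) x])" by (simp add: s_def)
  then show ?thesis using natl_zero[OF Kc(1)] by metis
 qed
 have sn1: "natl R C (chob K (i + 1)) (chob K i) (s (i + 1))" for i using sn[of "i + 1"] by simp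
 have ss: "chd K (i - 1) x (s i x w) +[fob (chob K i) x] s (i + 1) x (chd K i x w) = w"
  if i: "i > n" and x: "x \<in> obj C" and w: "w \<in> el (chob K i) x" for i x w
 proof -
  interpret M: module R "fob (chob K i) x" by (rule mf_mod[OF Kc(1) x])
  have c: "chd K (i - 1) x (s i x w) +[fob (chob K i) x] s (i + 1) x (chd K i x w) \<in> el (chob K i) x"
   using natl_closed[OF Kc(3) x natl_closed[OF sn x w]] natl_closed[OF sn1 x natl_closed[OF Kc(2) x w]] by simp
  show ?thesis
  proof (cases "i \<le> M")
   case True
   then show ?thesis using h(3)[OF True i x w] c by (simp add: s_def)
  next
   case False
   then show ?thesis using z[OF _ x c] z[OF _ x w] by simp
  qed
 qed
 \<comment> \<open>The projection \<open>1 - s d\<close> onto the cocycles: \<open>d s d = d\<close>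
   puts its values there, and on a cocycle the second term vanishes.\<close>
 define p where "p x w = w -[fob (chob K n) x] s (n + 1) x (chd K n x w)" for x w
 have pn: "natl R C (chob K n) (chob K n) p"
  unfolding p_def by (rule natl_minus[OF Kc(1) natl_id natl_compose[OF Kc(2) sn1]])
 have dsd: "chd K n x (s (n + 1) x (chd K n x w)) = chd K n x w" if x: "x \<in> obj C" and w: "w \<in> el (chob K n) x" for x w
 proof -
  interpret N: module R "fob (chob K (n + 1)) x" by (rule mf_mod[OF Kc(1) x])
  have dw: "chd K n x w \<in> el (chob K (n + 1)) x" by (rule natl_closed[OF Kc(2) x w])
  have dd: "chd K (n + 1) x (chd K n x w) = 0[fob (chob K (n + 1 + 1)) x]" using Kc(4)[OF x, of w "n + 1"] w by simp
  have "s (n + 1 + 1) x 0[fob (chob K (n + 1 + 1)) x] = 0[fob (chob K (n + 1)) x]"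
   by (rule lin_zero[OF mf_mod[OF Kc(1) x] mf_mod[OF Kc(1) x] natl_lin[OF sn1 x]])
  then show ?thesis using ss[of "n + 1", OF _ x dw] dd natl_closed[OF Kc(2) x natl_closed[OF sn1 x dw]] by simp
 qed
 have pZ: "p x w \<in> Zc K n x" if x: "x \<in> obj C" and w: "w \<in> el (chob K n) x" for x w
  using w natl_closed[OF pn x w] natl_closed[OF sn1 x natl_closed[OF Kc(2) x w]] natl_closed[OF Kc(2) x w]
   minus_eq_zero_iff[OF mf_mod[OF Kc(1) x]]
  by (simp add: Zc_iff) (simp add: p_def lin_minus[OF mf_mod[OF Kc(1) x] mf_mod[OF Kc(1) x] natl_lin[OF Kc(2) x]] dsd[OF x w])
 have pid: "p x w = w" if x: "x \<in> obj C" and w: "w \<in> Zc K n x" for x w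
 proof -
  interpret M: module R "fob (chob K n) x" by (rule mf_mod[OF Kc(1) x])
  have "w \<in> el (chob K n) x" using w by (simp add: Zc_iff)
  then have "w -[fob (chob K n) x] 0[fob (chob K n) x] = w"
   using add_minus_cancel[OF M.module_axioms _ M.zero_closed, of w] by simp
  then show ?thesis
   using w lin_zero[OF mf_mod[OF Kc(1) x] mf_mod[OF Kc(1) x] natl_lin[OF sn1 x]] by (simp add: p_def Zc_iff)
 qed
 have ps: "p x (s (n + 1) x (chd K n x w)) = 0[fob (chob K n) x]" if x: "x \<in> obj C" and w: "w \<in> el (chob K n) x" for x w
  using minus_eq_zero_iff[OF mf_mod[OF Kc(1) x]] natl_closed[OF sn1 x natl_closed[OF Kc(2) x w]]
  by (simp add: p_def dsd[OF x w])
 have en: "natl R C (chob K n) F (\<lambda>x w. \<epsilon> x (p x w))" by (rule natl_compose[OF natl_subf_target[OF pn pZ] \<epsilon>])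
 have "aug K n F (\<lambda>x w. \<epsilon> x (p x w)) s"
  unfolding aug_def
 proof (intro conjI allI ballI impI)
  fix x assume x: "x \<in> obj C"
  have BZ: "Bc K n x \<subseteq> Zc K n x" by (rule Bc_Zc[OF K(1) x])
  show "\<epsilon> x (p x w) = 0[fob F x]" if "w \<in> Bc K n x" for w using that BZ \<epsilon>B[OF x] pid[OF x] by auto
  show "\<exists>w \<in> Zc K n x. \<epsilon> x (p x w) = v" if "v \<in> el F x" for v using \<epsilon>s[OF x that] pid[OF x] by auto
  show "w \<in> Bc K n x" if "w \<in> Zc K n x" "\<epsilon> x (p x w) = 0[fob F x]" for w using that \<epsilon>B[OF x] pid[OF x] by simp
  show "\<epsilon> x (p x (s (n + 1) x (chd K n x w))) = 0[fob F x]" if "w \<in> el (chob K n) x" for w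
   unfolding ps[OF x that]
   using lin_zero[OF mf_mod[OF subf_functor[OF ct Kc(1) Zc_stable[OF K(1)]] x] mf_mod[OF amod_functor[OF F] x] natl_lin[OF \<epsilon> x]]
   by simp
 qed (use K F en sn ss ex in auto)
 then show ?thesis by blast
qed

lemma is_complex_fcx: "is_complex R C (gen_mod R C S) K ==> fcx R C (K :: ('o, 'a, 'k, 'u) funcx)"
proof -
 assume K: "is_complex R C (gen_mod R C S) K"
 have d: "natl R C (chob K i) (chob K (i + 1)) (chd K i)" for i
  using K by (auto simp: is_complex_def intro: nat_hom_natl)
 have f: "modf R C (chob K i)" for i using K amod_functor[OF gen_mod_amod] by (auto simp: is_complex_def)
 have "chd K (i + 1) x (chd K i x w) = 0[fob (chob K (i + 1 + 1)) x]"
  if "x \<in> obj C" "w \<in> el (chob K i) x" for i x w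
 proof -
  have "chd K i x w \<in> Bc K (i + 1) x" using that by (auto simp: Bc_eq)
  then have "chd K i x w \<in> Zc K (i + 1) x" using K that(1) unfolding is_complex_def by blast
  then show ?thesis by (simp add: Zc_iff)
 qed
 then show ?thesis using f d by (simp add: fcx_def)
qed

lemma fcx_is_complex:
 assumes K: "fcx R C (K :: ('o, 'a, 'k, 'u) funcx)" and a: "!!i. amod (chob K i)"
  and d: "!!i. chd K i \<in> nat_hom R C (chob K i) (chob K (i + 1))"
 shows "is_complex R C (gen_mod R C S) K" using assms Bc_Zc[OF K] amod_gen by (simp add: is_complex_def)

end

section \<open>Shifted complexes, projective resolutions and finite dual bases\<close>

definition shift_cx :: "('x, 'f) cochain => int => ('x, 'f) cochain" where
 "shift_cx K n = \<lparr>chob = (\<lambda>i. chob K (i - n)), chd = (\<lambda>i. chd K (i - n))\<rparr>"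

lemma shift_cx_simps [simp]: "chob (shift_cx K n) i = chob K (i - n)" "chd (shift_cx K n) i = chd K (i - n)"
 by (simp_all add: shift_cx_def)

lemma shift_cx_0 [simp]: "shift_cx K 0 = K" by (simp add: shift_cx_def)

lemma cohom_shift: "cohom (shift_cx K n) i = cohom K (i - n)"
 and cocycles_shift: "cocycles (shift_cx K n) i = cocycles K (i - n)"
 and coboundaries_shift: "coboundaries (shift_cx K n) i = coboundaries K (i - n)"
 by (simp_all add: cohom_def cocycles_def coboundaries_def algebra_simps)

lemma eval_cx_shift: "eval_cx (shift_cx K n) x = shift_cx (eval_cx K x) n" by (simp add: eval_cx_def shift_cx_def)

lemma fcx_shift:
 assumes "fcx R C K"
 shows "fcx R C (shift_cx K n)"
proof -
 have e: "i + 1 - n = i - n + 1" "i + 1 + 1 - n = i - n + 1 + 1" for i by simp_all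
 show ?thesis using assms unfolding fcx_def shift_cx_simps e by blast
qed

context yoneda_system
begin

text \<open>A finite dual basis: elements \<open>g i\<close> and functionals
  \<open>q i : Q \<rightarrow> S (a i)\<close> such that every \<open>w\<close> is the sum of the
  \<open>g i\<close> acted on by \<open>q i w\<close>. Unlike a presentation by a surjection, it
  passes to the dual.\<close>

definition fdb where
 "fdb Q I a g q \<longleftrightarrow> finite I \<and>
   (\<forall>i \<in> I. a i \<in> obj C \<and> g i \<in> el Q (a i) \<and> natl R C Q (S (a i)) (q i)) \<and>
   (\<forall>x \<in> obj C. \<forall>w \<in> el Q x. finsum (fob Q x) (\<lambda>i. yo Q (a i) (g i) x (q i x w)) I = w)"

end

context large_yoneda
begin

text \<open>A resolution vanishes in positive degrees, so after shifting by \<open>n\<close> the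
  zero maps contract it above degree \<open>n\<close>.\<close>

lemma resolution_aug:
 fixes F :: "('o, 'a, 'k, 'u) modfun"
 assumes P: "proj_resolution R C (gen_mod R C S) P e F" and F: "amod F"
 shows "\<exists>s. aug (shift_cx P n) n F e s"
proof -
 have Pc: "fcx R C P" using P is_complex_fcx by (auto simp: proj_resolution_def)
 note Pf = fcxD[OF Pc]
 define s where "s = (\<lambda>i x (w :: 'u). 0[fob (chob P (i - 1 - n)) x])"
 have z: "w = 0[fob (chob P i) x]" if "i > 0" "x \<in> obj C" "w \<in> el (chob P i) x" for i x w
  using P that by (auto simp: proj_resolution_def zero_functor_def trivial_mod_def)
 have Z0: "Zc P 0 x = el (chob P 0) x" if "x \<in> obj C" for x
  using z[of 1, OF _ that natl_closed[OF Pf(2)[of 0, simplified] that]] by (auto simp: Zc_iff)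
 have e: "natl R C (chob P 0) F e" using P by (auto simp: proj_resolution_def intro: nat_hom_natl)
 have B0: "!!x. x \<in> obj C ==> Bc P 0 x = ker_in (fob (chob P 0) x) (e x) (fob F x)"
  and es: "!!x v. x \<in> obj C ==> v \<in> el F x ==> \<exists>w \<in> el (chob P 0) x. e x w = v"
  and ex: "!!i x. i < 0 ==> x \<in> obj C ==> Zc P i x = Bc P i x"
  and pj: "!!i. projective (chob P i)"
  using P unfolding proj_resolution_def nat_surj_def by (auto simp: image_iff) (metis imageE)
 have m0: "0[fob (chob P i) x] \<in> el (chob P i) x" if "x \<in> obj C" for i x by (rule mf_zero[OF Pf(1) that])
 have "aug (shift_cx P n) n F e s"
  unfolding aug_def eval_cx_shift cocycles_shift coboundaries_shift
 proof (intro conjI allI ballI impI)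
  show "fcx R C (shift_cx P n)" by (rule fcx_shift[OF Pc])
  show "Zc P (i - n) x \<subseteq> Bc P (i - n) x" if "i < n" "x \<in> obj C" for i x using ex[of "i - n" x] that by simp
  show "natl R C (chob (shift_cx P n) i) (chob (shift_cx P n) (i - 1)) (s i)" for i
   unfolding s_def using natl_zero[OF Pf(1)] by simp
  fix i x w assume x: "x \<in> obj C" and i: "i > n" and w: "w \<in> el (chob (shift_cx P n) i) x"
  interpret M: module R "fob (chob P (i - n)) x" by (rule mf_mod[OF Pf(1) x])
  have "natl R C (chob P (i - 1 - n)) (chob P (i - n)) (chd P (i - 1 - n))"
   using Pf(3)[of "i - n"] by (simp add: algebra_simps)
  then have c: "chd P (i - 1 - n) x 0[fob (chob P (i - 1 - n)) x] \<in> el (chob P (i - n)) x"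
   by (rule natl_closed[OF _ x m0[OF x]])
  show "chd (shift_cx P n) (i - 1) x (s i x w) +[fob (chob (shift_cx P n) i) x]
    s (i + 1) x (chd (shift_cx P n) i x w) = w" using i w z[OF _ x c] z[OF _ x, of "i - n" w] by (simp add: s_def)
 next
  fix x w assume x: "x \<in> obj C" "w \<in> el (chob (shift_cx P n) n) x"
  show "e x (s (n + 1) x (chd (shift_cx P n) n x w)) = 0[fob F x]"
   using lin_zero[OF mf_mod[OF Pf(1) x(1)] mf_mod[OF amod_functor[OF F] x(1)] natl_lin[OF e x(1)]] by (simp add: s_def)
 qed (use pj F e Z0 B0 es in \<open>auto simp: ker_in_def\<close>)
 then show ?thesis by blast
qed

text \<open>Iterate: cover the module by a projective, pass to the kernel of the cover, and cover
  again.\<close>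

lemma resolution_exists:
 assumes G: "amod (G :: ('o, 'a, 'k, 'u) modfun)"
 shows "\<exists>P e. proj_resolution R C (gen_mod R C S) P e G"
proof -
 define good where "good H Pe \<longleftrightarrow> projective (fst Pe) \<and> natl R C (fst Pe) H (snd Pe) \<and>
   (\<forall>x \<in> obj C. \<forall>g \<in> el H x. \<exists>p \<in> el (fst Pe) x. snd Pe x p = g)"
  for H :: "('o, 'a, 'k, 'u) modfun" and Pe :: "('o, 'a, 'k, 'u) modfun \<times> ('o, 'u, 'u) nat_trans"
 define cov where "cov H = (SOME Pe. good H Pe)" for H
 have cov: "good H (cov H)" if H: "amod H" for H
 proof (rule cover[OF H])
  fix P :: "('o, 'a, 'k, 'u) modfun" and e
  assume "projective P" "natl R C P H e"
   "!!x g. x \<in> obj C ==> g \<in> el H x ==> \<exists>p \<in> el P x. e x p = g"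
  then have "good H (P, e)" by (simp add: good_def)
  then show ?thesis unfolding cov_def by (rule someI)
 qed
 \<comment> \<open>The first syzygy of \<open>H\<close> with respect to its chosen cover;
   \<open>Gs n\<close> is then the \<open>n\<close>-th syzygy of \<open>G\<close>.\<close>
 define nx where "nx H = subf (fst (cov H)) (\<lambda>x. ker_in (fob (fst (cov H)) x) (snd (cov H) x) (fob H x))" for H
 define Gs where "Gs n = (nx ^^ n) G" for n
 define Q where "Q n = fst (cov (Gs n))" for n
 define d where "d n = snd (cov (Gs n))" for n
 have Gs: "amod (Gs n)" for n
 proof (induction n)
  case (Suc n)
  note c = cov[OF Suc, unfolded good_def]
  have "amod (nx (Gs n))" unfolding nx_def
   by (rule amod_subf[OF projective_amod stable_ker[OF amod_functor[OF projective_amod] amod_functor[OF Suc]]])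
     (use c in auto)
  then show ?case by (simp add: Gs_def)
 qed (simp add: Gs_def G)
 have Q: "projective (Q n)" and dn: "natl R C (Q n) (Gs n) (d n)"
  and ds: "x \<in> obj C ==> d n x ` el (Q n) x = el (Gs n) x" for n x
  using cov[OF Gs[of n]] natl_closed[of R C "Q n" "Gs n" "d n" x] unfolding good_def Q_def d_def
  by (auto simp: image_iff) (metis)
 have GS: "Gs (Suc n) = subf (Q n) (\<lambda>x. ker_in (fob (Q n) x) (d n x) (fob (Gs n) x))" for n
  by (simp add: Gs_def nx_def Q_def d_def)
 have Qf: "modf R C (Q n)" for n by (rule amod_functor[OF projective_amod[OF Q]])
 have st: "stable R C (Q n) (\<lambda>x. ker_in (fob (Q n) x) (d n x) (fob (Gs n) x))" for n
  by (rule stable_ker[OF Qf amod_functor[OF Gs] dn])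
 have dQ: "natl R C (Q (Suc n)) (Q n) (d (Suc n))" for n
  using natl_compose[OF dn[of "Suc n", unfolded GS] subf_incl[OF Qf st]] .
 have im: "d (Suc n) x ` el (Q (Suc n)) x = ker_in (fob (Q n) x) (d n x) (fob (Gs n) x)" if "x \<in> obj C" for n x
  using ds[OF that, of "Suc n"] by (simp add: GS)
 have zG: "0[fob (Gs (Suc n)) x] = 0[fob (Q n) x]" for n x by (simp add: GS)
 \<comment> \<open>Degree \<open>- m\<close> holds the cover of the \<open>m\<close>-th syzygy,
   positive degrees hold \<open>zero_fun\<close>. In degree 0 the differential already goes to
   \<open>zero_fun\<close>.\<close>
 define P :: "('o, 'a, 'k, 'u) funcx" where
  "P = \<lparr>chob = (\<lambda>i. if i \<le> 0 then Q (nat (- i)) else zero_fun),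
   chd = (\<lambda>i. if i < 0 then nres C (Q (nat (- i))) (d (nat (- i)))
    else nres C (if i \<le> 0 then Q (nat (- i)) else zero_fun) (\<lambda>x w. 0[fob (zero_fun :: ('o, 'a, 'k, 'u) modfun) x]))\<rparr>"
 have Pc: "chob P i = (if i \<le> 0 then Q (nat (- i)) else zero_fun)" for i by (simp add: P_def)
 have neg: "\<exists>m. i = - int (Suc m)" if "i < 0" for i :: int using that by (intro exI[of _ "nat (- i - 1)"]) simp
 have Pm: "chob P (- int m) = Q m" for m by (simp add: P_def)
 have dm: "chd P (- int (Suc m)) = nres C (Q (Suc m)) (d (Suc m))" for m by (simp add: P_def nat_add_distrib)
 have ia: "- int (Suc m) + 1 = - int m" "- int m - 1 = - int (Suc m)" for m by simp_all
 have zf: "modf R C (chob P i)" for i by (simp add: Pc Qf zero_fun_functor)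
 have dh: "chd P i \<in> nat_hom R C (chob P i) (chob P (i + 1))" for i
 proof (cases "i < 0")
  case True
  then obtain m where m: "i = - int (Suc m)" using neg by blast
  show ?thesis unfolding m dm unfolding ia Pm by (rule nres_hom[OF Qf dQ])
 next
  case False
  then have "chd P i = nres C (chob P i) (\<lambda>x w. 0[fob (chob P (i + 1)) x])" by (simp add: P_def)
  then show ?thesis using nres_hom[OF zf natl_zero[OF zf]] by simp
 qed
 have B: "Bc P (- int m) x = ker_in (fob (Q m) x) (d m x) (fob (Gs m) x)" if x: "x \<in> obj C" for m x
  unfolding Bc_eq ia dm Pm using x im[OF x, of m] by (auto simp: nres_apply image_def)
 have Z: "Zc P (- int (Suc m)) x = ker_in (fob (Q (Suc m)) x) (d (Suc m) x) (fob (Gs (Suc m)) x)" if x: "x \<in> obj C" for m x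
  unfolding cocycles_def eval_cx_simps unfolding dm ia Pm using x by (auto simp: ker_in_def nres_apply zG)
 have BZ: "Bc P i x \<subseteq> Zc P i x" if x: "x \<in> obj C" for i x
 proof (cases "i < 0")
  case True
  then obtain m where m: "i = - int (Suc m)" using neg by blast
  show ?thesis unfolding m Z[OF x] B[OF x] ..
 next
  case False
  have c: "chd P (i - 1) x w \<in> el (chob P i) x" if "w \<in> el (chob P (i - 1)) x" for w
   using natl_closed[OF nat_hom_natl[OF dh[of "i - 1"]] x that] by simp
  have "chd P i x v = 0[fob (chob P (i + 1)) x]" if "v \<in> el (chob P i) x" for v
   using False that x by (simp add: P_def nres_def)
  then show ?thesis using c by (auto simp: Bc_eq Zc_iff)
 qed
 \<comment> \<open>A resolution has projective terms in every degree, the positive ones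
   included.\<close>
 have zp: "projective zero_fun"
  unfolding projective_in_def
 proof (intro conjI ballI impI)
  show "(zero_fun :: ('o, 'a, 'k, 'u) modfun) \<in> gen_mod R C S" by (rule amod_gen[OF zero_fun_amod])
  fix G H :: "('o, 'a, 'k, 'u) modfun" and e f
  assume G: "G \<in> gen_mod R C S" and e: "e \<in> nat_hom R C G H" and f: "f \<in> nat_hom R C (zero_fun :: ('o, 'a, 'k, 'u) modfun) H" and H: "H \<in> gen_mod R C S"
  note Gf = amod_functor[OF gen_mod_amod[OF G]] and Hf = amod_functor[OF gen_mod_amod[OF H]]
  have o: "nres C (zero_fun :: ('o, 'a, 'k, 'u) modfun) (\<lambda>x u. 0[fob G x]) \<in> nat_hom R C zero_fun G"
   by (rule nres_hom[OF zero_fun_functor natl_zero[OF Gf]])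
  have v: "w = 0[fob (zero_fun :: ('o, 'a, 'k, 'u) modfun) x]" if "w \<in> el (zero_fun :: ('o, 'a, 'k, 'u) modfun) x" for x w
   using that by (simp add: zero_fun_def)
  show "\<exists>g \<in> nat_hom R C (zero_fun :: ('o, 'a, 'k, 'u) modfun) G. nat_cmp C (zero_fun :: ('o, 'a, 'k, 'u) modfun) e g = f"
  proof (rule bexI[OF _ o])
   show "nat_cmp C (zero_fun :: ('o, 'a, 'k, 'u) modfun) e (nres C (zero_fun :: ('o, 'a, 'k, 'u) modfun) (\<lambda>x u. 0[fob G x])) = f"
   proof (rule nat_hom_ext[OF nat_cmp_hom[OF zero_fun_functor o e] f])
   fix x w assume x: "x \<in> obj C" and w: "w \<in> el (zero_fun :: ('o, 'a, 'k, 'u) modfun) x"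
   show "nat_cmp C (zero_fun :: ('o, 'a, 'k, 'u) modfun) e (nres C (zero_fun :: ('o, 'a, 'k, 'u) modfun) (\<lambda>x u. 0[fob G x])) x w = f x w"
    using x w v[OF w] lin_zero[OF mf_mod[OF Gf x] mf_mod[OF Hf x] natl_lin[OF nat_hom_natl[OF e] x]]
     lin_zero[OF mf_mod[OF zero_fun_functor x] mf_mod[OF Hf x] natl_lin[OF nat_hom_natl[OF f] x]]
    by (simp add: nat_cmp_apply nres_apply)
   qed
  qed
 qed
 have pj: "projective (chob P i)" for i by (simp add: Pc Q zp)
 have "proj_resolution R C (gen_mod R C S) P (nres C (Q 0) (d 0)) G"
  unfolding proj_resolution_def is_complex_def
 proof (intro conjI allI ballI impI)
  show "chob P i \<in> gen_mod R C S" for i using amod_gen[OF projective_amod[OF pj]] .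
  show "zero_functor C (chob P i)" if "i > 0" for i using that by (simp add: Pc zero_functor_zero_fun)
  show "Zc P i x = Bc P i x" if i: "i < 0" and x: "x \<in> obj C" for i x
  proof -
   obtain m where m: "i = - int (Suc m)" using neg[OF i] by blast
   show ?thesis unfolding m Z[OF x] B[OF x] ..
  qed
  have c0: "chob P 0 = Q 0" using Pm[of 0] by simp
  have G0: "Gs 0 = G" by (simp add: Gs_def)
  show "nres C (Q 0) (d 0) \<in> nat_hom R C (chob P 0) G" unfolding c0 using nres_hom[OF Qf dn[of 0]] G0 by simp
  show "nat_surj C (chob P 0) G (nres C (Q 0) (d 0))"
   unfolding c0 nat_surj_def
  proof
   fix x assume x: "x \<in> obj C"
   have "nres C (Q 0) (d 0) x ` el (Q 0) x = d 0 x ` el (Q 0) x" by (rule image_cong[OF HOL.refl nres_apply[OF x]])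
   then show "nres C (Q 0) (d 0) x ` el (Q 0) x = el G x" using ds[OF x, of 0] G0 by simp
  qed
  show "ker_in (fob (chob P 0) x) (nres C (Q 0) (d 0) x) (fob G x) = Bc P 0 x" if x: "x \<in> obj C" for x
  proof -
   have "Bc P 0 x = ker_in (fob (Q 0) x) (d 0 x) (fob G x)" using B[OF x, of 0] G0 by simp
   then show ?thesis unfolding c0 by (simp add: ker_in_def nres_apply[OF x] cong: conj_cong)
  qed
 qed (rule dh BZ pj; assumption)+
 then show ?thesis by blast
qed

text \<open>Split the surjection from a finite sum of standard functors onto the projective
  \<open>Q\<close>. The coordinates of the splitting are the functionals, the images of the basis
  elements are the \<open>g i\<close>.\<close>

lemma finite_type_fdb:
 assumes Q: "projective Q" and f: "finite_type R C S Q"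
 shows "\<exists>(I :: nat set) a g q. fdb Q I a g q"
proof -
 from f obtain as e where as: "set as \<subseteq> obj C" and e: "e \<in> nat_hom R C (direct_sum (map S as)) Q"
  and es: "nat_surj C (direct_sum (map S as)) Q e" by (auto simp: finite_type_def)
 let ?I = "{..<length as}"
 define a where "a i = as ! i" for i
 have a: "a i \<in> obj C" if "i \<in> ?I" for i using as that by (auto simp: a_def)
 have ds: "direct_sum (map S as) = cop ?I a" unfolding direct_sum_cop a_def ..
 note Qa = projective_amod[OF Q]
 note Qf = amod_functor[OF Qa]
 have en: "natl R C (cop ?I a) Q e" using nat_hom_natl[OF e] unfolding ds .
 \<comment> \<open>The finite sum has carriers in \<open>nat => 't\<close>; projectivity can be used
   only after copying it into \<open>'u\<close>, for which its indices are embedded there.\<close>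
 obtain \<xi> :: "nat => 'u" where "inj \<xi>" using infinite_countable_subset[OF inf_u] by blast
 then have \<xi>: "inj_on \<xi> ?I" by (rule inj_on_subset) simp
 note ci = fcop_inv_natl[where I = ?I and a = a and \<xi> = \<xi>, OF a \<xi>]
 let ?b = "trinv (cop ?I a) (ecop \<xi> ?I a)"
 have "\<exists>\<sigma>. natl R C Q (fcop \<xi> ?I a) \<sigma> \<and> (\<forall>x \<in> obj C. \<forall>w \<in> el Q x. e x (?b x (\<sigma> x w)) = w)"
 proof (rule proj_lift[OF Q fcop_amod[where I = ?I and a = a and \<xi> = \<xi>, OF a \<xi>] Qa natl_compose[OF ci en] natl_id])
  fix x w assume x: "x \<in> obj C" and w: "w \<in> el Q x"
  then obtain v where v: "v \<in> el (cop ?I a) x" "e x v = w" using es unfolding nat_surj_def ds by (metis imageE)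
  have "ecop \<xi> ?I a x v \<in> el (fcop \<xi> ?I a) x"
   by (rule natl_closed[OF fcop_natl[where I = ?I and a = a and \<xi> = \<xi>, OF a \<xi>] x v(1)])
  moreover have "e x (?b x (ecop \<xi> ?I a x v)) = w"
   using fcop_inv[where I = ?I and a = a and \<xi> = \<xi>, OF a \<xi> x v(1)] v(2) by simp
  ultimately show "w \<in> (\<lambda>p. e x (?b x p)) ` el (fcop \<xi> ?I a) x" by (metis imageI)
 qed
 then obtain \<sigma> where \<sigma>: "natl R C Q (fcop \<xi> ?I a) \<sigma>"
  "!!x w. x \<in> obj C ==> w \<in> el Q x ==> e x (?b x (\<sigma> x w)) = w" by blast
 have vn: "natl R C Q (cop ?I a) (\<lambda>x w. ?b x (\<sigma> x w))" by (rule natl_compose[OF \<sigma>(1) ci])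
 define q where "q i x w = ?b x (\<sigma> x w) i" for i x w
 have pn: "natl R C (cop ?I a) (S (a i)) (\<lambda>x v. v i)" if i: "i \<in> ?I" for i
 proof (rule natlI)
  show "lin R (fob (cop ?I a) x) (fob (S (a i)) x) (\<lambda>v. v i)" if "x \<in> obj C" for x
   unfolding cop_fob
   using i csum_closed[where I = ?I and M = "\<lambda>i. fob (S (a i)) x" and i = i] by (simp add: lin_def csum_ops)
  show "far (cop ?I a) x y f v i = far (S (a i)) x y f (v i)"
   if "x \<in> obj C" "y \<in> obj C" "f \<in> arr C x y" "v \<in> el (cop ?I a) x" for x y f v using that i by (simp add: cop_def)
 qed
 define g where "g i = e (a i) (copin ?I a i (a i) (u (a i)))" for i
 have cn: "natl R C (S (a i)) (cop ?I a) (copin ?I a i)" if i: "i \<in> ?I" for i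
  by (rule copin_natl[where I = ?I and a = a]) (use a i in auto)
 have gc: "g i \<in> el Q (a i)" if i: "i \<in> ?I" for i
  unfolding g_def by (rule natl_closed[OF natl_compose[OF cn[OF i] en] a[OF i] u_closed[OF a[OF i]]])
 let ?\<phi> = "\<lambda>i. yo Q (a i) (g i)"
 have \<phi>: "natl R C (S (a i)) Q (?\<phi> i)" if i: "i \<in> ?I" for i by (rule yo_natl[OF Qa a[OF i] gc[OF i]])
 have "finsum (fob Q x) (\<lambda>i. ?\<phi> i x (q i x w)) ?I = w" if x: "x \<in> obj C" and w: "w \<in> el Q x" for x w
 proof -
  let ?v = "?b x (\<sigma> x w)"
  have v: "?v \<in> el (cop ?I a) x" by (rule natl_closed[OF vn x w])
  have "copair ?I a Q ?\<phi> x ?v = e x ?v"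
  proof (rule cop_unique[where I = ?I and a = a, OF a Qf x natl_lin[OF copair_natl[where I = ?I and a = a and \<phi> = ?\<phi>, OF a Qf \<phi>] x] natl_lin[OF en x] _ v])
   fix i t assume i: "i \<in> ?I" and t: "t \<in> el (S (a i)) x"
   have "yo Q (a i) (g i) x t = e x (copin ?I a i x t)"
    by (rule yo_eq[OF Qf a[OF i] natl_compose[OF cn[OF i] en] _ x t]) (simp add: g_def)
   then show "copair ?I a Q ?\<phi> x (copin ?I a i x t) = e x (copin ?I a i x t)"
    using copair_copin[where I = ?I and a = a and \<phi> = ?\<phi>, OF a Qf \<phi> x i t] by simp
  qed
  moreover have "copair ?I a Q ?\<phi> x ?v = finsum (fob Q x) (\<lambda>i. ?\<phi> i x (?v i)) ?I"
   unfolding copair_def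
  proof (rule cpair_over[where R = R])
   show "module R (fob (S (a i)) x)" if "i \<in> ?I" for i by (rule mf_mod[OF S_functor[OF a[OF that]] x])
   show "lin R (fob (S (a i)) x) (fob Q x) (?\<phi> i x)" if "i \<in> ?I" for i by (rule natl_lin[OF \<phi>[OF that] x])
   show "?v \<in> carrier (csum ?I (\<lambda>i. fob (S (a i)) x))" using v by (simp add: cop_fob)
  qed (use cr mf_mod[OF Qf x] in auto)
  ultimately show ?thesis using \<sigma>(2)[OF x w] by (simp add: q_def)
 qed
 moreover have "natl R C Q (S (a i)) (q i)" if "i \<in> ?I" for i
  unfolding q_def by (rule natl_compose[OF vn pn[OF that]])
 ultimately have "fdb Q ?I a g q" unfolding fdb_def using a gc by blast
 then show ?thesis by blast
qed

end

section \<open>Free modules and the tensor product\<close>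

definition reg :: "'k ring => ('k, 'k) module" where
 "reg R = \<lparr>carrier = carrier R, mult = undefined, one = undefined, zero = 0[R], add = add R, smult = mult R\<rparr>"

lemma reg_simps [simp]: "carrier (reg R) = carrier R" "0[reg R] = 0[R]" "a +[reg R] b = a +[R] b"
 "a *[reg R] b = a \<otimes>\<^bsub>R\<^esub> b" by (simp_all add: reg_def)

lemma reg_module: "cring R ==> module R (reg R)"
proof -
 assume "cring R"
 then interpret cring R .
 have "\<exists>y \<in> carrier R. y +[R] x = 0[R]" if "x \<in> carrier R" for x
  using that l_neg by (intro bexI[of _ "\<ominus>\<^bsub>R\<^esub> x"]) simp_all
 then show ?thesis by (intro moduleI[OF \<open>cring R\<close>] abelian_groupI) (auto simp: a_ac m_assoc l_distr r_distr)
qed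

context
 fixes R :: "'k ring" and S :: "'s set"
 assumes R: "cring R"
begin

interpretation R: cring R by (rule R)

abbreviation Ms :: "('k, 's => 'k) module" where "Ms \<equiv> csum S (\<lambda>_. reg R)"

lemma reg_m: "module R (reg R)" by (rule reg_module[OF R])

lemma free_carrier: "c \<in> carrier (free_mod R S) \<longleftrightarrow>
  (\<forall>s. c s \<in> carrier R) \<and> (\<forall>s. s \<notin> S \<longrightarrow> c s = 0[R]) \<and> finite {s. c s \<noteq> 0[R]}" by (simp add: free_mod_def)

lemma free_ops: "0[free_mod R S] = (\<lambda>s. 0[R])" "c +[free_mod R S] d = (\<lambda>s. c s +[R] d s)"
 "r *[free_mod R S] c = (\<lambda>s. r \<otimes>\<^bsub>R\<^esub> c s)" by (simp_all add: free_mod_def)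

text \<open>Elements of \<open>csum\<close> are \<open>undefined\<close> off \<open>S\<close>,
  elements of \<open>free_mod\<close> are zero there. \<open>fext\<close> and restriction to
  \<open>S\<close> translate, so that results about direct sums carry over.\<close>

definition fext :: "('s => 'k) => 's => 'k" where
 "fext v = (\<lambda>s. if s \<in> S then v s else 0[R])"

lemma fext_lin: "lin R Ms (free_mod R S) fext"
proof (rule linI)
 fix v assume v: "v \<in> carrier Ms"
 have "finite {s. fext v s \<noteq> 0[R]}" using csum_support[OF v] by (rule rev_finite_subset) (auto simp: fext_def)
 then show "fext v \<in> carrier (free_mod R S)" using csum_closed[OF v] by (auto simp: free_carrier fext_def)
qed (auto simp: free_ops fext_def csum_ops fun_eq_iff)

lemma restrict_csum: "c \<in> carrier (free_mod R S) ==> restrict c S \<in> carrier Ms"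
 by (rule csum_memI[where v = c and w = c]) (auto simp: free_carrier elim: rev_finite_subset)

lemma fext_restrict: "c \<in> carrier (free_mod R S) ==> fext (restrict c S) = c"
 by (auto simp: fext_def free_carrier fun_eq_iff)

lemma free_module: "module R (free_mod R S)"
proof (rule module_surj[OF csum_module[OF R reg_m] fext_lin])
 show "carrier (free_mod R S) \<subseteq> fext ` carrier Ms" using restrict_csum fext_restrict by (metis image_eqI subsetI)
 show "fext 0[Ms] = 0[free_mod R S]" by (auto simp: fext_def csum_ops free_ops)
qed

lemma restrict_lin: "lin R (free_mod R S) Ms (\<lambda>c. restrict c S)"
 by (rule linI[OF restrict_csum]) (auto simp: csum_ops free_ops intro!: restrict_ext)

lemma basis_closed: "s \<in> S ==> basis_elt R s \<in> carrier (free_mod R S)"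
proof -
 assume "s \<in> S"
 moreover have "finite {t. basis_elt R s t \<noteq> 0[R]}" by (rule finite_subset[of _ "{s}"]) (auto simp: basis_elt_def)
 ultimately show ?thesis by (auto simp: free_carrier basis_elt_def)
qed

lemma free_induct:
 assumes N: "submodule N R (free_mod R S)" and b: "!!s. s \<in> S ==> basis_elt R s \<in> N"
 shows "carrier (free_mod R S) \<subseteq> N"
proof
 fix c assume c: "c \<in> carrier (free_mod R S)"
 note m = csum_module[OF R reg_m]
 interpret M: module R Ms by (rule m)
 note D = submoduleD[OF free_module N]
 have "submodule {v \<in> carrier Ms. fext v \<in> N} R Ms" by (rule submoduleI'[OF m])
    (auto simp: lin_add[OF fext_lin] lin_smult[OF fext_lin] lin_zero[OF m free_module fext_lin] D)
 moreover have "cin S (\<lambda>_. reg R) s r \<in> {v \<in> carrier Ms. fext v \<in> N}" if s: "s \<in> S" and r: "r \<in> carrier (reg R)" for s r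
 proof -
  have "fext (cin S (\<lambda>_. reg R) s r) = r *[free_mod R S] basis_elt R s"
   using r s by (auto simp: fext_def cin_def basis_elt_def free_ops fun_eq_iff)
  then show ?thesis using lin_closed[OF cin_lin[OF R reg_m s] r] D(5) b[OF s] r by simp
 qed
 ultimately have "carrier Ms \<subseteq> {v \<in> carrier Ms. fext v \<in> N}" by (rule csum_induct[OF R reg_m])
 then show "c \<in> N" using restrict_csum[OF c] fext_restrict[OF c] by auto
qed

definition flin :: "('k, 'w) module => ('s => 'w) => ('s => 'k) => 'w" where
 "flin N \<beta> c = cpair S (\<lambda>_. reg R) N (\<lambda>s r. r *[N] \<beta> s) (restrict c S)"

lemma flin_scale:
 assumes N: "module R N" and \<beta>: "!!s. s \<in> S ==> \<beta> s \<in> carrier N" and s: "s \<in> S"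
 shows "lin R (reg R) N (\<lambda>r. r *[N] \<beta> s)"
proof -
 interpret N: module R N by (rule N)
 show ?thesis using \<beta>[OF s] by (intro linI) (auto simp: N.smult_l_distr N.smult_assoc1)
qed

lemma flin_lin: "module R N ==> (\<And>s. s \<in> S ==> \<beta> s \<in> carrier N) ==> lin R (free_mod R S) N (flin N \<beta>)"
 unfolding flin_def by (rule lin_compose[OF restrict_lin cpair_lin[OF R reg_m _ flin_scale]])

lemma flin_basis:
 assumes N: "module R N" and \<beta>: "!!s. s \<in> S ==> \<beta> s \<in> carrier N" and s: "s \<in> S"
 shows "flin N \<beta> (basis_elt R s) = \<beta> s"
proof -
 have "restrict (basis_elt R s) S = cin S (\<lambda>_. reg R) s \<one>\<^bsub>R\<^esub>"
  by (auto simp: basis_elt_def cin_def intro!: restrict_ext)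
 moreover have "cpair S (\<lambda>_. reg R) N (\<lambda>s r. r *[N] \<beta> s) (cin S (\<lambda>_. reg R) s \<one>\<^bsub>R\<^esub>) = \<one>\<^bsub>R\<^esub> *[N] \<beta> s"
  by (rule cpair_cin[where R = R and M = "\<lambda>_. reg R" and \<phi> = "\<lambda>s r. r *[N] \<beta> s"])
    (use \<beta> in \<open>auto simp: R reg_m N s intro!: flin_scale[OF N]\<close>)
 ultimately have "flin N \<beta> (basis_elt R s) = \<one>\<^bsub>R\<^esub> *[N] \<beta> s" unfolding flin_def by simp
 then show ?thesis using module.smult_one[OF N \<beta>[OF s]] by simp
qed

end

text \<open>For fixed \<open>t\<close> the coefficient at \<open>t\<close> is the linear functional
  that sends a basis element \<open>s\<close> to 1 or 0 according to whether \<open>h s = t\<close>.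
  Linearity of \<open>free_map\<close> thus reduces to that of \<open>flin\<close>.\<close>

lemma free_map_sum:
 assumes R: "cring R" and c: "c \<in> carrier (free_mod R S)"
 shows "free_map R h c t = flin R S (reg R) (\<lambda>s. if h s = t then \<one>\<^bsub>R\<^esub> else 0[R]) c"
proof -
 interpret R: cring R by (rule R)
 have c': "!!s. c s \<in> carrier R" "!!s. s \<notin> S ==> c s = 0[R]" "finite {s. c s \<noteq> 0[R]}"
  using c by (auto simp: free_carrier[OF R])
 interpret N: module R "reg R" by (rule reg_module[OF R])
 have fs: "finsum (reg R) f A = finsum R f A" for f :: "'b => 'a" and A
  by (simp add: finsum_def finprod_def reg_def foldD_def)
 have "flin R S (reg R) (\<lambda>s. if h s = t then \<one>\<^bsub>R\<^esub> else 0[R]) c =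
   finsum R (\<lambda>s. restrict c S s \<otimes>\<^bsub>R\<^esub> (if h s = t then \<one>\<^bsub>R\<^esub> else 0[R])) {s \<in> S. restrict c S s \<noteq> 0[R]}"
  unfolding flin_def[OF R] cpair_def fs by simp
 also have "\<dots> = finsum R c {s. c s \<noteq> 0[R] \<and> h s = t}"
 proof (rule R.add.finprod_mono_neutral_cong_right)
  have "{s \<in> S. restrict c S s \<noteq> 0[R]} \<subseteq> {s. c s \<noteq> 0[R]}" by auto
  then show "finite {s \<in> S. restrict c S s \<noteq> 0[R]}" using c'(3) by (rule finite_subset)
 qed (use c'(1,2) in \<open>auto split: if_splits\<close>)
 finally show ?thesis by (simp add: free_map_def)
qed

lemma free_map_lin:
 assumes R: "cring R" and h: "!!s. s \<in> S ==> h s \<in> S'"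
 shows "lin R (free_mod R S) (free_mod R S') (free_map R h)"
proof -
 interpret R: cring R by (rule R)
 interpret M: module R "free_mod R S" by (rule free_module[OF R])
 let ?f = "\<lambda>t. flin R S (reg R) (\<lambda>s. if h s = t then \<one>\<^bsub>R\<^esub> else 0[R])"
 have l: "lin R (free_mod R S) (reg R) (?f t)" for t by (rule flin_lin[OF R reg_module[OF R]]) simp
 note e = free_map_sum[OF R, of _ S h]
 show ?thesis
 proof (rule linI)
  fix c assume c: "c \<in> carrier (free_mod R S)"
  have sup: "{s. c s \<noteq> 0[R]} \<subseteq> S" "finite {s. c s \<noteq> 0[R]}" using c by (auto simp: free_carrier[OF R])
  have z: "free_map R h c t = 0[R]" if "t \<notin> h ` {s. c s \<noteq> 0[R]}" for t
  proof -
   have "{s. c s \<noteq> 0[R] \<and> h s = t} = {}" using that by auto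
   then show ?thesis unfolding free_map_def by (metis R.finsum_empty)
  qed
  have "finite {t. free_map R h c t \<noteq> 0[R]}" by (rule finite_subset[OF _ finite_imageI[OF sup(2)]]) (use z in blast)
  moreover have "t \<in> S'" if "free_map R h c t \<noteq> 0[R]" for t using z[of t] that h sup(1) by blast
  ultimately show "free_map R h c \<in> carrier (free_mod R S')"
   using lin_closed[OF l c] e[OF c] by (auto simp: free_carrier[OF R])
  show "free_map R h (r *[free_mod R S] c) = r *[free_mod R S'] free_map R h c" if "r \<in> carrier R" for r
   using lin_smult[OF l that c] e[OF c] e[OF M.smult_closed[OF that c]] by (simp add: free_ops[OF R, of S'] fun_eq_iff)
  fix d assume d: "d \<in> carrier (free_mod R S)"
  show "free_map R h (c +[free_mod R S] d) = free_map R h c +[free_mod R S'] free_map R h d"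
   using lin_add[OF l c d] e[OF c] e[OF d] e[OF M.a_closed[OF c d]] by (simp add: free_ops[OF R, of S'] fun_eq_iff)
 qed
qed

lemma free_map_basis:
 assumes R: "cring R" and s: "s \<in> S"
 shows "free_map R h (basis_elt R s) = basis_elt R (h s)"
proof
 interpret R: cring R by (rule R)
 show "free_map R h (basis_elt R s) t = basis_elt R (h s) t" for t
  unfolding free_map_sum[OF R basis_closed[OF R s]]
  using flin_basis[where \<beta> = "\<lambda>s. if h s = t then \<one>\<^bsub>R\<^esub> else 0[R]", OF R reg_module[OF R] _ s]
  by (auto simp: basis_elt_def)
qed

lemma span_submodule:
 assumes M: "module R M" and X: "X \<subseteq> carrier M"
 shows "submodule (span_in R M X) R M" and "X \<subseteq> span_in R M X"
  and "submodule N R M ==> X \<subseteq> N ==> span_in R M X \<subseteq> N"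
proof -
 interpret M: module R M by (rule M)
 have c: "submodule (carrier M) R M" by (rule M.carrier_is_submodule)
 show "submodule (span_in R M X) R M"
 proof (rule submoduleI'[OF M])
  show "span_in R M X \<subseteq> carrier M" using c X by (auto simp: span_in_def)
  show "0[M] \<in> span_in R M X" by (auto simp: span_in_def submoduleD(2)[OF M])
  show "a +[M] b \<in> span_in R M X" if "a \<in> span_in R M X" "b \<in> span_in R M X" for a b
   using that by (auto simp: span_in_def submoduleD(3)[OF M])
  show "r *[M] a \<in> span_in R M X" if "r \<in> carrier R" "a \<in> span_in R M X" for r a
   using that by (auto simp: span_in_def submoduleD(5)[OF M])
 qed
qed (auto simp: span_in_def)

section \<open>The tensor product over \<open>C\<close> and its universal property\<close>

locale tensor_pair =
 fixes R :: "'k ring" and C :: "('o, 'a) category_data"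
  and F :: "('o, 'a, 'k, 'u) modfun" and G :: "('o, 'a, 'k, 'v) modfun"
 assumes R: "cring R" and F: "modf R (op_cat C) F" and G: "modf R C G"
begin

definition "TM = free_mod R (tensor_gens C F G)"
definition "TB = span_in R TM (tensor_rels R C F G)"
text \<open>The pure tensor \<open>a \<otimes> b\<close> in the summand at \<open>x\<close>.\<close>

definition "tn x a b = tensor_proj R C F G (basis_elt R (x, a, b))"

lemma F_mod: "x \<in> obj C ==> module R (fob F x)" using mf_mod[OF F] by (simp add: op_cat_def)

lemma F_far: "x \<in> obj C ==> y \<in> obj C ==> f \<in> arr C x y ==> lin R (fob F y) (fob F x) (far F y x f)"
 using mf_lin[OF F] by (simp add: op_cat_def)

lemmas G_mod = mf_mod[OF G] and G_far = mf_lin[OF G]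

lemma TM_module: "module R TM" unfolding TM_def by (rule free_module[OF R])

lemma gen_closed: "x \<in> obj C ==> a \<in> el F x ==> b \<in> el G x ==> basis_elt R (x, a, b) \<in> carrier TM"
 unfolding TM_def by (rule basis_closed[OF R]) (simp add: tensor_gens_def)

lemma rels_cases:
 assumes r: "r \<in> tensor_rels R C F G"
  and add_l: "!!x a a' b. x \<in> obj C ==> a \<in> el F x ==> a' \<in> el F x ==> b \<in> el G x ==>
   P (basis_elt R (x, a +[fob F x] a', b) -[TM] (basis_elt R (x, a, b) +[TM] basis_elt R (x, a', b)))"
  and add_r: "!!x a b b'. x \<in> obj C ==> a \<in> el F x ==> b \<in> el G x ==> b' \<in> el G x ==>
   P (basis_elt R (x, a, b +[fob G x] b') -[TM] (basis_elt R (x, a, b) +[TM] basis_elt R (x, a, b')))"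
  and smult_l: "!!x r a b. x \<in> obj C ==> r \<in> carrier R ==> a \<in> el F x ==> b \<in> el G x ==>
   P (basis_elt R (x, r *[fob F x] a, b) -[TM] (r *[TM] basis_elt R (x, a, b)))"
  and smult_r: "!!x r a b. x \<in> obj C ==> r \<in> carrier R ==> a \<in> el F x ==> b \<in> el G x ==>
   P (basis_elt R (x, a, r *[fob G x] b) -[TM] (r *[TM] basis_elt R (x, a, b)))"
  and bal: "!!x y f a b. x \<in> obj C ==> y \<in> obj C ==> f \<in> arr C x y ==> a \<in> el F y ==> b \<in> el G x ==>
   P (basis_elt R (x, far F y x f a, b) -[TM] basis_elt R (y, a, far G x y f b))"
 shows "P r"
 using r unfolding tensor_rels_def Let_def TM_def[symmetric]
 by (elim UnE CollectE exE conjE) (simp_all only: add_l add_r smult_l smult_r bal)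

lemma rels_closed: "tensor_rels R C F G \<subseteq> carrier TM"
proof
 fix r assume "r \<in> tensor_rels R C F G"
 interpret M: module R TM by (rule TM_module)
 note l = lin_closed[OF F_far] lin_closed[OF G_far]
 from \<open>r \<in> _\<close> show "r \<in> carrier TM"
 proof (rule rels_cases)
  show "basis_elt R (x, a +[fob F x] a', b) -[TM] (basis_elt R (x, a, b) +[TM] basis_elt R (x, a', b)) \<in> carrier TM"
   if "x \<in> obj C" "a \<in> el F x" "a' \<in> el F x" "b \<in> el G x" for x a a' b
  proof -
   interpret N: module R "fob F x" by (rule F_mod[OF that(1)])
   show ?thesis using that by (intro M.minus_closed M.a_closed gen_closed) simp_all
  qed
  show "basis_elt R (x, a, b +[fob G x] b') -[TM] (basis_elt R (x, a, b) +[TM] basis_elt R (x, a, b')) \<in> carrier TM"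
   if "x \<in> obj C" "a \<in> el F x" "b \<in> el G x" "b' \<in> el G x" for x a b b'
  proof -
   interpret N: module R "fob G x" by (rule G_mod[OF that(1)])
   show ?thesis using that by (intro M.minus_closed M.a_closed gen_closed) simp_all
  qed
  show "basis_elt R (x, r *[fob F x] a, b) -[TM] (r *[TM] basis_elt R (x, a, b)) \<in> carrier TM"
   if "x \<in> obj C" "r \<in> carrier R" "a \<in> el F x" "b \<in> el G x" for x r a b
  proof -
   interpret N: module R "fob F x" by (rule F_mod[OF that(1)])
   show ?thesis using that by (intro M.minus_closed M.smult_closed gen_closed) simp_all
  qed
  show "basis_elt R (x, a, r *[fob G x] b) -[TM] (r *[TM] basis_elt R (x, a, b)) \<in> carrier TM"
   if "x \<in> obj C" "r \<in> carrier R" "a \<in> el F x" "b \<in> el G x" for x r a b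
  proof -
   interpret N: module R "fob G x" by (rule G_mod[OF that(1)])
   show ?thesis using that by (intro M.minus_closed M.smult_closed gen_closed) simp_all
  qed
  show "basis_elt R (x, far F y x f a, b) -[TM] basis_elt R (y, a, far G x y f b) \<in> carrier TM"
   if "x \<in> obj C" "y \<in> obj C" "f \<in> arr C x y" "a \<in> el F y" "b \<in> el G x" for x y f a b
   using that by (intro M.minus_closed gen_closed) (simp_all add: l)
 qed
qed

lemmas span = span_submodule[OF TM_module rels_closed, folded TB_def]

lemma TQ: "module_quotient R TM TB" by (rule module_quotient.intro[OF TM_module span(1)])

lemma tensor_eq: "tensor R C F G = quot_mod TM TB" by (simp add: tensor_def TM_def TB_def Let_def)

lemma tensor_proj_eq: "tensor_proj R C F G = coset_rep TM TB" by (simp add: tensor_proj_def TM_def TB_def Let_def)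

lemma tensor_module: "module R (tensor R C F G)" unfolding tensor_eq by (rule module_quotient.quot_module[OF TQ])

lemma proj_lin: "lin R TM (tensor R C F G) (tensor_proj R C F G)"
 unfolding tensor_eq tensor_proj_eq by (rule module_quotient.coset_rep_lin[OF TQ])

lemma proj_surj: "v \<in> carrier (tensor R C F G) ==> v \<in> carrier TM \<and> tensor_proj R C F G v = v"
 unfolding tensor_eq tensor_proj_eq
 using module_quotient.coset_rep_fixed[OF TQ] module_quotient.quot_carrier_subset[OF TQ] by blast

lemma tn_closed:
 "x \<in> obj C ==> a \<in> el F x ==> b \<in> el G x ==> tn x a b \<in> carrier (tensor R C F G)"
 unfolding tn_def by (rule lin_closed[OF proj_lin gen_closed])

text \<open>Pull \<open>N\<close> back to the free module on the generators, where
  \<open>free_induct\<close> applies.\<close>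

lemma tensor_induct:
 assumes N: "submodule N R (tensor R C F G)"
  and t: "!!x a b. x \<in> obj C ==> a \<in> el F x ==> b \<in> el G x ==> tn x a b \<in> N"
 shows "carrier (tensor R C F G) \<subseteq> N"
proof
 fix v assume v: "v \<in> carrier (tensor R C F G)"
 interpret M: module R TM by (rule TM_module)
 note D = submoduleD[OF tensor_module N]
 have "submodule {c \<in> carrier TM. tensor_proj R C F G c \<in> N} R TM" by (rule submoduleI'[OF TM_module])
    (auto simp: lin_add[OF proj_lin] lin_smult[OF proj_lin] lin_zero[OF TM_module tensor_module proj_lin] D)
 then have "carrier TM \<subseteq> {c \<in> carrier TM. tensor_proj R C F G c \<in> N}"
  unfolding TM_def by (rule free_induct[OF R]) (use t gen_closed in \<open>auto simp: tensor_gens_def tn_def TM_def\<close>)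
 then show "v \<in> N" using proj_surj[OF v] by auto
qed

lemma tensor_unique:
 assumes N: "module R N" and f: "lin R (tensor R C F G) N f" and g: "lin R (tensor R C F G) N g"
  and e: "!!x a b. x \<in> obj C ==> a \<in> el F x ==> b \<in> el G x ==> f (tn x a b) = g (tn x a b)"
  and v: "v \<in> carrier (tensor R C F G)"
 shows "f v = g v"
proof -
 interpret M: module R "tensor R C F G" by (rule tensor_module)
 have "submodule {v \<in> carrier (tensor R C F G). f v = g v} R (tensor R C F G)" by (rule submoduleI'[OF tensor_module])
    (auto simp: lin_add[OF f] lin_add[OF g] lin_smult[OF f] lin_smult[OF g]
     lin_zero[OF tensor_module N f] lin_zero[OF tensor_module N g])
 from tensor_induct[OF this] e v tn_closed show ?thesis by blast
qed

lemma tn_rel: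
 assumes "p -[TM] q \<in> tensor_rels R C F G" "p \<in> carrier TM" "q \<in> carrier TM"
 shows "tensor_proj R C F G p = tensor_proj R C F G q"
 unfolding tensor_proj_eq using assms span(2) by (intro module_quotient.coset_rep_eqI[OF TQ]) auto

lemma tn_add_l:
 assumes x: "x \<in> obj C" and a: "a \<in> el F x" "a' \<in> el F x" and b: "b \<in> el G x"
 shows "tn x (a +[fob F x] a') b = tn x a b +[tensor R C F G] tn x a' b"
proof -
 interpret N: module R "fob F x" by (rule F_mod[OF x])
 interpret M: module R TM by (rule TM_module)
 note g = gen_closed[OF x _ b]
 have "tn x (a +[fob F x] a') b = tensor_proj R C F G (basis_elt R (x, a, b) +[TM] basis_elt R (x, a', b))"
  unfolding tn_def
 proof (rule tn_rel)
  show "basis_elt R (x, a +[fob F x] a', b) -[TM] (basis_elt R (x, a, b) +[TM] basis_elt R (x, a', b)) \<in> tensor_rels R C F G"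
   unfolding tensor_rels_def Let_def TM_def[symmetric]
   by (rule UnI1, rule UnI1, rule UnI1, rule UnI1, rule CollectI, intro exI conjI, rule HOL.refl) (use x a b in simp_all)
 qed (use a g in auto)
 then show ?thesis using lin_add[OF proj_lin g[OF a(1)] g[OF a(2)]] by (simp add: tn_def)
qed

lemma tn_add_r:
 assumes x: "x \<in> obj C" and a: "a \<in> el F x" and b: "b \<in> el G x" "b' \<in> el G x"
 shows "tn x a (b +[fob G x] b') = tn x a b +[tensor R C F G] tn x a b'"
proof -
 interpret N: module R "fob G x" by (rule G_mod[OF x])
 interpret M: module R TM by (rule TM_module)
 note g = gen_closed[OF x a]
 have "tn x a (b +[fob G x] b') = tensor_proj R C F G (basis_elt R (x, a, b) +[TM] basis_elt R (x, a, b'))"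
  unfolding tn_def
 proof (rule tn_rel)
  show "basis_elt R (x, a, b +[fob G x] b') -[TM] (basis_elt R (x, a, b) +[TM] basis_elt R (x, a, b')) \<in> tensor_rels R C F G"
   unfolding tensor_rels_def Let_def TM_def[symmetric]
   by (rule UnI1, rule UnI1, rule UnI1, rule UnI2, rule CollectI, intro exI conjI, rule HOL.refl) (use x a b in simp_all)
 qed (use b g in auto)
 then show ?thesis using lin_add[OF proj_lin g[OF b(1)] g[OF b(2)]] by (simp add: tn_def)
qed

lemma tn_smult_l:
 assumes x: "x \<in> obj C" and r: "r \<in> carrier R" and a: "a \<in> el F x" and b: "b \<in> el G x"
 shows "tn x (r *[fob F x] a) b = r *[tensor R C F G] tn x a b"
proof -
 interpret N: module R "fob F x" by (rule F_mod[OF x])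
 interpret M: module R TM by (rule TM_module)
 note g = gen_closed[OF x _ b]
 have "tn x (r *[fob F x] a) b = tensor_proj R C F G (r *[TM] basis_elt R (x, a, b))"
  unfolding tn_def
 proof (rule tn_rel)
  show "basis_elt R (x, r *[fob F x] a, b) -[TM] (r *[TM] basis_elt R (x, a, b)) \<in> tensor_rels R C F G"
   unfolding tensor_rels_def Let_def TM_def[symmetric]
   by (rule UnI1, rule UnI1, rule UnI2, rule CollectI, intro exI conjI, rule HOL.refl) (use x r a b in simp_all)
 qed (use a g r in auto)
 then show ?thesis using lin_smult[OF proj_lin r g[OF a]] by (simp add: tn_def)
qed

lemma tn_smult_r:
 assumes x: "x \<in> obj C" and r: "r \<in> carrier R" and a: "a \<in> el F x" and b: "b \<in> el G x"
 shows "tn x a (r *[fob G x] b) = r *[tensor R C F G] tn x a b"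
proof -
 interpret N: module R "fob G x" by (rule G_mod[OF x])
 interpret M: module R TM by (rule TM_module)
 note g = gen_closed[OF x a]
 have "tn x a (r *[fob G x] b) = tensor_proj R C F G (r *[TM] basis_elt R (x, a, b))"
  unfolding tn_def
 proof (rule tn_rel)
  show "basis_elt R (x, a, r *[fob G x] b) -[TM] (r *[TM] basis_elt R (x, a, b)) \<in> tensor_rels R C F G"
   unfolding tensor_rels_def Let_def TM_def[symmetric]
   by (rule UnI1, rule UnI2, rule CollectI, intro exI conjI, rule HOL.refl) (use x r a b in simp_all)
 qed (use b g r in auto)
 then show ?thesis using lin_smult[OF proj_lin r g[OF b]] by (simp add: tn_def)
qed

lemma tn_bal:
 assumes x: "x \<in> obj C" "y \<in> obj C" "f \<in> arr C x y" and a: "a \<in> el F y" and b: "b \<in> el G x"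
 shows "tn x (far F y x f a) b = tn y a (far G x y f b)"
 unfolding tn_def
proof (rule tn_rel)
 show "basis_elt R (x, far F y x f a, b) -[TM] basis_elt R (y, a, far G x y f b) \<in> tensor_rels R C F G"
   unfolding tensor_rels_def Let_def TM_def[symmetric]
   by (rule UnI2, rule CollectI, intro exI conjI, rule HOL.refl) (use x a b in simp_all)
qed (auto intro!: gen_closed x a b lin_closed[OF F_far[OF x] a] lin_closed[OF G_far[OF x] b])

lemma tn_zero_l:
 assumes x: "x \<in> obj C" and b: "b \<in> el G x"
 shows "tn x 0[fob F x] b = 0[tensor R C F G]"
proof -
 interpret M: module R "tensor R C F G" by (rule tensor_module)
 interpret N: module R "fob F x" by (rule F_mod[OF x])
 have "tn x 0[fob F x] b \<in> carrier (tensor R C F G)" by (rule tn_closed[OF x N.zero_closed b])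
 then show ?thesis using tn_add_l[OF x N.zero_closed N.zero_closed b] by simp
qed

lemma kills_span:
 assumes N: "module R N" and f: "lin R TM N f" and k: "!!r. r \<in> tensor_rels R C F G ==> f r = 0[N]" and c: "c \<in> TB"
 shows "f c = 0[N]"
proof -
 have "TB \<subseteq> ker_in TM f N"
  by (rule span(3)[OF ker_submodule[OF TM_module N f]]) (use k rels_closed in \<open>auto simp: ker_in_def\<close>)
 then show ?thesis using c by (auto simp: ker_in_def)
qed

text \<open>A linear map on the free module whose values on generators are bilinear and balanced
  kills each of the five families of relations, hence their span.\<close>

lemma bilinear_kills:
 assumes N: "module R N" and f: "lin R TM N f"
  and \<beta>: "!!x a b. x \<in> obj C ==> a \<in> el F x ==> b \<in> el G x ==> f (basis_elt R (x, a, b)) = \<beta> x a b"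
  and add_l: "!!x a a' b. x \<in> obj C ==> a \<in> el F x ==> a' \<in> el F x ==> b \<in> el G x ==>
   \<beta> x (a +[fob F x] a') b = \<beta> x a b +[N] \<beta> x a' b"
  and add_r: "!!x a b b'. x \<in> obj C ==> a \<in> el F x ==> b \<in> el G x ==> b' \<in> el G x ==>
   \<beta> x a (b +[fob G x] b') = \<beta> x a b +[N] \<beta> x a b'"
  and smult_l: "!!x r a b. x \<in> obj C ==> r \<in> carrier R ==> a \<in> el F x ==> b \<in> el G x ==>
   \<beta> x (r *[fob F x] a) b = r *[N] \<beta> x a b"
  and smult_r: "!!x r a b. x \<in> obj C ==> r \<in> carrier R ==> a \<in> el F x ==> b \<in> el G x ==>
   \<beta> x a (r *[fob G x] b) = r *[N] \<beta> x a b"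
  and bal: "!!x y f a b. x \<in> obj C ==> y \<in> obj C ==> f \<in> arr C x y ==> a \<in> el F y ==> b \<in> el G x ==>
   \<beta> x (far F y x f a) b = \<beta> y a (far G x y f b)"
  and c: "c \<in> TB"
 shows "f c = 0[N]"
proof (rule kills_span[OF N f _ c])
 fix r assume r: "r \<in> tensor_rels R C F G"
 interpret M: module R TM by (rule TM_module)
 interpret N: module R N by (rule N)
 note ll = lin_minus[OF TM_module N f] lin_add[OF f] lin_smult[OF f] gen_closed minus_eq_zero_iff[OF N] \<beta>
 have \<beta>c: "\<beta> x a b \<in> carrier N" if "x \<in> obj C" "a \<in> el F x" "b \<in> el G x" for x a b
  using lin_closed[OF f gen_closed[OF that]] \<beta>[OF that] by simp
 show "f r = 0[N]"
 proof (rule rels_cases[OF r])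
  show "f (basis_elt R (x, a +[fob F x] a', b) -[TM] (basis_elt R (x, a, b) +[TM] basis_elt R (x, a', b))) = 0[N]"
   if "x \<in> obj C" "a \<in> el F x" "a' \<in> el F x" "b \<in> el G x" for x a a' b
  proof -
   interpret X: module R "fob F x" by (rule F_mod[OF that(1)])
   show ?thesis using that \<beta>c by (simp add: ll add_l)
  qed
  show "f (basis_elt R (x, a, b +[fob G x] b') -[TM] (basis_elt R (x, a, b) +[TM] basis_elt R (x, a, b'))) = 0[N]"
   if "x \<in> obj C" "a \<in> el F x" "b \<in> el G x" "b' \<in> el G x" for x a b b'
  proof -
   interpret X: module R "fob G x" by (rule G_mod[OF that(1)])
   show ?thesis using that \<beta>c by (simp add: ll add_r)
  qed
  show "f (basis_elt R (x, r *[fob F x] a, b) -[TM] (r *[TM] basis_elt R (x, a, b))) = 0[N]"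
   if "x \<in> obj C" "r \<in> carrier R" "a \<in> el F x" "b \<in> el G x" for x r a b
  proof -
   interpret X: module R "fob F x" by (rule F_mod[OF that(1)])
   show ?thesis using that \<beta>c by (simp add: ll smult_l)
  qed
  show "f (basis_elt R (x, a, r *[fob G x] b) -[TM] (r *[TM] basis_elt R (x, a, b))) = 0[N]"
   if "x \<in> obj C" "r \<in> carrier R" "a \<in> el F x" "b \<in> el G x" for x r a b
  proof -
   interpret X: module R "fob G x" by (rule G_mod[OF that(1)])
   show ?thesis using that \<beta>c by (simp add: ll smult_r)
  qed
  show "f (basis_elt R (x, far F y x g a, b) -[TM] basis_elt R (y, a, far G x y g b)) = 0[N]"
   if h: "x \<in> obj C" "y \<in> obj C" "g \<in> arr C x y" "a \<in> el F y" "b \<in> el G x" for x y g a b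
   using h \<beta>c lin_closed[OF F_far[OF h(1-3)] h(4)] lin_closed[OF G_far[OF h(1-3)] h(5)] by (simp add: ll bal)
 qed
qed

lemma tensor_lift:
 fixes N :: "('k, 'w) module"
 assumes N: "module R N"
  and \<beta>c: "!!x a b. x \<in> obj C ==> a \<in> el F x ==> b \<in> el G x ==> \<beta> x a b \<in> carrier N"
  and add_l: "!!x a a' b. x \<in> obj C ==> a \<in> el F x ==> a' \<in> el F x ==> b \<in> el G x ==>
   \<beta> x (a +[fob F x] a') b = \<beta> x a b +[N] \<beta> x a' b"
  and add_r: "!!x a b b'. x \<in> obj C ==> a \<in> el F x ==> b \<in> el G x ==> b' \<in> el G x ==>
   \<beta> x a (b +[fob G x] b') = \<beta> x a b +[N] \<beta> x a b'"
  and smult_l: "!!x r a b. x \<in> obj C ==> r \<in> carrier R ==> a \<in> el F x ==> b \<in> el G x ==>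
   \<beta> x (r *[fob F x] a) b = r *[N] \<beta> x a b"
  and smult_r: "!!x r a b. x \<in> obj C ==> r \<in> carrier R ==> a \<in> el F x ==> b \<in> el G x ==>
   \<beta> x a (r *[fob G x] b) = r *[N] \<beta> x a b"
  and bal: "!!x y f a b. x \<in> obj C ==> y \<in> obj C ==> f \<in> arr C x y ==> a \<in> el F y ==> b \<in> el G x ==>
   \<beta> x (far F y x f a) b = \<beta> y a (far G x y f b)"
 shows "\<exists>\<phi>. lin R (tensor R C F G) N \<phi> \<and>
  (\<forall>x \<in> obj C. \<forall>a \<in> el F x. \<forall>b \<in> el G x. \<phi> (tn x a b) = \<beta> x a b)"
proof -
 let ?\<beta> = "\<lambda>(x, a, b). \<beta> x a b"
 let ?f = "flin R (tensor_gens C F G) N ?\<beta>"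
 have c: "!!s. s \<in> tensor_gens C F G ==> ?\<beta> s \<in> carrier N" using \<beta>c by (auto simp: tensor_gens_def)
 have f: "lin R TM N ?f" unfolding TM_def by (rule flin_lin[OF R N c])
 have b: "?f (basis_elt R (x, a, b)) = \<beta> x a b"
  if "x \<in> obj C" "a \<in> el F x" "b \<in> el G x" for x a b
 proof -
  have "(x, a, b) \<in> tensor_gens C F G" using that by (simp add: tensor_gens_def)
  from flin_basis[where \<beta> = ?\<beta>, OF R N c this] show ?thesis by simp
 qed
 have z: "!!c. c \<in> TB ==> ?f c = 0[N]" by (rule bilinear_kills[OF N f b add_l add_r smult_l smult_r bal])
 have "lin R (tensor R C F G) N ?f" unfolding tensor_eq by (rule module_quotient.quot_lift_lin[OF TQ N f z])
 moreover have "?f (tn x a b) = \<beta> x a b"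
  if "x \<in> obj C" "a \<in> el F x" "b \<in> el G x" for x a b
  unfolding tn_def tensor_proj_eq
  using module_quotient.quot_lift_rep[OF TQ N f z gen_closed[OF that]] b[OF that] by simp
 ultimately show ?thesis by blast
qed

end

text \<open>\<open>tensor_map\<close> is computed on a representative in the free module. It
  respects the relations because \<open>p\<close> and \<open>q\<close> are linear and natural, which
  makes it linear and yields its values on pure tensors.\<close>

lemma tensor_map_props:
 assumes T: "tensor_pair R C F G" and T': "tensor_pair R C F' G'"
  and p: "natl R (op_cat C) F F' p" and q: "natl R C G G' q"
 shows "lin R (tensor R C F G) (tensor R C F' G') (tensor_map R C F G F' G' p q)" (is ?lin)
  and "!!x a b. x \<in> obj C ==> a \<in> el F x ==> b \<in> el G x ==>
   tensor_map R C F G F' G' p q (tensor_pair.tn R C F G x a b) = tensor_pair.tn R C F' G' x (p x a) (q x b)"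
proof -
 interpret T: tensor_pair R C F G by (rule T)
 interpret T': tensor_pair R C F' G' by (rule T')
 let ?h = "\<lambda>(x, a, b). (x, p x a, q x b)"
 let ?f = "\<lambda>c. tensor_proj R C F' G' (free_map R ?h c)"
 have pl: "lin R (fob F x) (fob F' x) (p x)" if "x \<in> obj C" for x using natl_lin[OF p] that by (simp add: op_cat_def)
 note ql = natl_lin[OF q]
 have pn: "p x (far F y x f a) = far F' y x f (p y a)"
  if "x \<in> obj C" "y \<in> obj C" "f \<in> arr C x y" "a \<in> el F y" for x y f a
  using natl_nat[OF p] that by (simp add: op_cat_def)
 have f: "lin R T.TM (tensor R C F' G') ?f"
  unfolding T.TM_def by (rule lin_compose[OF free_map_lin[OF T.R] T'.proj_lin[unfolded T'.TM_def]])
    (auto simp: tensor_gens_def lin_closed[OF pl] lin_closed[OF ql])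
 have b: "?f (basis_elt R (x, a, b)) = T'.tn x (p x a) (q x b)"
  if "x \<in> obj C" "a \<in> el F x" "b \<in> el G x" for x a b
  using free_map_basis[OF T.R, of "(x, a, b)" "tensor_gens C F G" ?h] that by (simp add: tensor_gens_def T'.tn_def)
 have z: "?f c = 0[tensor R C F' G']" if "c \<in> T.TB" for c
  by (rule T.bilinear_kills[OF T'.tensor_module f b _ _ _ _ _ that])
    (simp_all add: lin_add[OF pl] lin_add[OF ql] lin_smult[OF pl] lin_smult[OF ql] lin_closed[OF pl] lin_closed[OF ql]
     T'.tn_add_l T'.tn_add_r T'.tn_smult_l T'.tn_smult_r pn natl_nat[OF q] T'.tn_bal)
 have "lin R (tensor R C F G) (tensor R C F' G') ?f"
  unfolding T.tensor_eq by (rule module_quotient.quot_lift_lin[OF T.TQ T'.tensor_module f z])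
 then show ?lin by (rule lin_cong[OF _ T.tensor_module]) (simp add: tensor_map_def)
 show "tensor_map R C F G F' G' p q (T.tn x a b) = T'.tn x (p x a) (q x b)"
  if h: "x \<in> obj C" "a \<in> el F x" "b \<in> el G x" for x a b
 proof -
  have "tensor_map R C F G F' G' p q (T.tn x a b) = ?f (T.tn x a b)"
   using T.tn_closed[OF h] by (simp add: tensor_map_def)
  also have "\<dots> = ?f (basis_elt R (x, a, b))"
   using module_quotient.quot_lift_rep[OF T.TQ T'.tensor_module f z T.gen_closed[OF h]]
   by (simp add: T.tn_def T.tensor_proj_eq)
  finally show ?thesis using b[OF h] by simp
 qed
qed

section \<open>Finite sums of linear maps, bijective chain maps and the opposite category\<close>

lemma lin_finsum:
 assumes M: "module R M" and N: "module R N" and f: "lin R M N f" and I: "finite I"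
  and c: "!!i. i \<in> I ==> c i \<in> carrier M"
 shows "f (finsum M c I) = finsum N (\<lambda>i. f (c i)) I"
 using I c
proof (induction I)
 case empty
 interpret M: module R M by (rule M)
 interpret N: module R N by (rule N)
 show ?case using lin_zero[OF M N f] by simp
next
 case (insert i I)
 interpret M: module R M by (rule M)
 interpret N: module R N by (rule N)
 have cI: "c \<in> I \<rightarrow> carrier M" "(\<lambda>i. f (c i)) \<in> I \<rightarrow> carrier N" using insert.prems lin_closed[OF f] by auto
 show ?case
  using insert cI lin_closed[OF f] by (simp add: M.finsum_insert N.finsum_insert lin_add[OF f] M.finsum_closed)
qed

lemma finsum_eq:
 assumes "module R N" "!!i. i \<in> I ==> c i = d i" "!!i. i \<in> I ==> d i \<in> carrier N"
 shows "finsum N c I = finsum N d I"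
proof -
 interpret N: module R N by fact
 show ?thesis using assms(2,3) by (intro N.finsum_cong') auto
qed

lemma lin_finsum_maps:
 assumes M: "module R M" and N: "module R N" and I: "finite I" and f: "!!i. i \<in> I ==> lin R M N (f i)"
 shows "lin R M N (\<lambda>x. finsum N (\<lambda>i. f i x) I)"
 using I f
proof (induction I)
 case empty
 interpret N: module R N by (rule N)
 show ?case using lin_const_zero[OF N] by simp
next
 case (insert i I)
 interpret N: module R N by (rule N)
 have l: "lin R M N (\<lambda>x. f i x +[N] finsum N (\<lambda>i. f i x) I)" using insert by (intro lin_pointwise_add[OF N]) simp_all
 have "finsum N (\<lambda>i. f i x) (insert i I) = f i x +[N] finsum N (\<lambda>i. f i x) I" if "x \<in> carrier M" for x
  using insert lin_closed[OF _ that] by (intro N.finsum_insert) auto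
 then show ?case by (rule lin_cong[OF l M])
qed

lemma bij_chain_coh_iso:
 assumes K: "mcx R K" and L: "mcx R L" and f: "!!i. lin R (chob K i) (chob L i) (f i)"
  and c: "!!i u. u \<in> carrier (chob K i) ==> chd L i (f i u) = f (i + 1) (chd K i u)"
  and b: "!!i. bij_betw (f i) (carrier (chob K i)) (carrier (chob L i))"
 shows "coh_iso_at R K L i (f i)"
 unfolding coh_iso_at_def
proof (intro conjI ballI impI)
 have inj: "u = v" if "f i u = f i v" "u \<in> carrier (chob K i)" "v \<in> carrier (chob K i)" for i u v
  using b[of i] that by (auto simp: bij_betw_def dest: inj_onD)
 have surj: "\<exists>u \<in> carrier (chob K i). v = f i u" if "v \<in> carrier (chob L i)" for i v
  using b[of i] that unfolding bij_betw_def by blast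
 show "coh_map_at R K L i (f i)" by (rule chain_map_coh_map_at[OF K L f c])
 show "u \<in> coboundaries K i" if u: "u \<in> cocycles K i" and fu: "f i u \<in> coboundaries L i" for u
 proof -
  from fu obtain w where w: "w \<in> carrier (chob L (i - 1))" "f i u = chd L (i - 1) w" by (auto simp: coboundaries_def)
  from surj[OF w(1)] obtain v where v: "v \<in> carrier (chob K (i - 1))" "w = f (i - 1) v" by blast
  have "f i u = f i (chd K (i - 1) v)" using w(2) c[OF v(1)] v(2) by simp
  then have "u = chd K (i - 1) v" by (rule inj[OF _ cocycles_carrier[OF u] lin_closed[OF mcxD(3)[OF K] v(1)]])
  then show ?thesis using v(1) by (intro coboundariesI)
 qed
 show "\<exists>u \<in> cocycles K i. v -[chob L i] f i u \<in> coboundaries L i" if v: "v \<in> cocycles L i" for v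
 proof -
  note vc = cocycles_carrier[OF v]
  from surj[OF vc] obtain u where u: "u \<in> carrier (chob K i)" "v = f i u" by blast
  interpret K1: module R "chob K (i + 1)" by (rule mcxD(1)[OF K])
  have "f (i + 1) (chd K i u) = f (i + 1) 0[chob K (i + 1)]"
   using c[OF u(1)] u(2) v lin_zero[OF mcxD(1)[OF K] mcxD(1)[OF L] f] by (simp add: cocycles_def ker_in_def)
  then have "chd K i u = 0[chob K (i + 1)]" by (rule inj[OF _ lin_closed[OF mcxD(2)[OF K] u(1)] K1.zero_closed])
  then have "u \<in> cocycles K i" using u(1) by (simp add: cocycles_def ker_in_def)
  moreover have "v -[chob L i] f i u \<in> coboundaries L i"
   using minus_eq_zero_iff[OF mcxD(1)[OF L] vc vc] u(2) submoduleD(2)[OF mcxD(1)[OF L] coboundaries_submodule[OF L]] by simp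
  ultimately show ?thesis by blast
 qed
qed

lemma op_cat_simps [simp]: "obj (op_cat C) = obj C" "arr (op_cat C) x y = arr C y x"
 "idn (op_cat C) = idn C" "cmp (op_cat C) x y z g f = cmp C z y x f g" by (simp_all add: op_cat_def)

lemma op_cat_category: "category C ==> category (op_cat C)"
proof -
 assume "category C"
 then interpret category C .
 show ?thesis by unfold_locales (simp_all add: idn_closed cmp_closed cmp_idn_left cmp_idn_right cmp_assoc)
qed

context large_yoneda
begin

text \<open>Lift the values \<open>f (g i)\<close> to elements \<open>v i\<close> of
  \<open>G\<close>, and let \<open>w\<close> go to the sum of the \<open>v i\<close> acted on by
  \<open>q i w\<close>. The dual basis identity shows that this lifts \<open>f\<close>. It applies
  to duals, which inherit a dual basis by \<open>fdb_dual\<close>.\<close>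

lemma fdb_projective:
 assumes Q: "amod (Q :: ('o, 'a, 'k, 'u) modfun)" and d: "fdb Q I a g q"
 shows "projective Q"
 unfolding projective_in_def
proof (intro conjI ballI impI)
 show "Q \<in> gen_mod R C S" by (rule amod_gen[OF Q])
 fix G H :: "('o, 'a, 'k, 'u) modfun" and e f
 assume "G \<in> gen_mod R C S" "H \<in> gen_mod R C S" and e: "e \<in> nat_hom R C G H"
  and f: "f \<in> nat_hom R C Q H" and s: "nat_surj C G H e"
 then have G: "amod G" and H: "amod H" by (auto intro: gen_mod_amod)
 note e' = nat_hom_natl[OF e] and f' = nat_hom_natl[OF f] and G' = amod_functor[OF G] and H' = amod_functor[OF H]
  and Q' = amod_functor[OF Q]
 have I: "finite I" and a: "!!i. i \<in> I ==> a i \<in> obj C" and g: "!!i. i \<in> I ==> g i \<in> el Q (a i)"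
  and q: "!!i. i \<in> I ==> natl R C Q (S (a i)) (q i)"
  and sm: "!!x w. x \<in> obj C ==> w \<in> el Q x ==> finsum (fob Q x) (\<lambda>i. yo Q (a i) (g i) x (q i x w)) I = w"
  using d unfolding fdb_def by auto
 have "\<exists>v. v \<in> el G (a i) \<and> e (a i) v = f (a i) (g i)" if "i \<in> I" for i
 proof -
  have "f (a i) (g i) \<in> el H (a i)" by (rule natl_closed[OF f' a[OF that] g[OF that]])
  also have "\<dots> = e (a i) ` el G (a i)" using s a[OF that] by (simp add: nat_surj_def)
  finally show ?thesis by force
 qed
 then obtain v where v: "!!i. i \<in> I ==> v i \<in> el G (a i)" "!!i. i \<in> I ==> e (a i) (v i) = f (a i) (g i)" by metis
 let ?c = "\<lambda>i x w. yo G (a i) (v i) x (q i x w)"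
 let ?k = "\<lambda>x w. finsum (fob G x) (\<lambda>i. ?c i x w) I"
 have c: "natl R C Q G (?c i)" if "i \<in> I" for i by (rule natl_compose[OF q[OF that] yo_natl[OF G a[OF that] v(1)[OF that]]])
 have k: "natl R C Q G ?k"
 proof (rule natlI)
  show "lin R (fob Q x) (fob G x) (?k x)" if "x \<in> obj C" for x
   by (rule lin_finsum_maps[OF mf_mod[OF Q' that] mf_mod[OF G' that] I natl_lin[OF c that]])
  fix x y h w assume x: "x \<in> obj C" and y: "y \<in> obj C" and h: "h \<in> arr C x y" and w: "w \<in> el Q x"
  have "far G x y h (?k x w) = finsum (fob G y) (\<lambda>i. far G x y h (?c i x w)) I"
   by (rule lin_finsum[OF mf_mod[OF G' x] mf_mod[OF G' y] mf_lin[OF G' x y h] I natl_closed[OF c x w]])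
  also have "\<dots> = ?k y (far Q x y h w)"
  proof (rule finsum_eq[OF mf_mod[OF G' y]])
   show "far G x y h (?c i x w) = ?c i y (far Q x y h w)" if "i \<in> I" for i
    using natl_nat[OF c[OF that] x y h w] by simp
   show "?c i y (far Q x y h w) \<in> el G y" if "i \<in> I" for i
    by (rule natl_closed[OF c[OF that] y mf_closed[OF Q' x y h w]])
  qed
  finally show "?k y (far Q x y h w) = far G x y h (?k x w)" ..
 qed
 show "\<exists>k \<in> nat_hom R C Q G. nat_cmp C Q e k = f"
 proof (rule bexI[OF _ nres_hom[OF Q' k]], rule nat_hom_ext[OF nat_cmp_hom[OF Q' nres_hom[OF Q' k] e] f])
  fix x w assume x: "x \<in> obj C" and w: "w \<in> el Q x"
  have qc: "q i x w \<in> el (S (a i)) x" if "i \<in> I" for i by (rule natl_closed[OF q[OF that] x w])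
  have yc: "yo Q (a i) (g i) x (q i x w) \<in> el Q x" if "i \<in> I" for i
   by (rule yo_closed[OF Q a[OF that] g[OF that] x qc[OF that]])
  have "e x (?k x w) = finsum (fob H x) (\<lambda>i. e x (?c i x w)) I"
   by (rule lin_finsum[OF mf_mod[OF G' x] mf_mod[OF H' x] natl_lin[OF e' x] I natl_closed[OF c x w]])
  also have "\<dots> = finsum (fob H x) (\<lambda>i. f x (yo Q (a i) (g i) x (q i x w))) I"
  proof (rule finsum_eq[OF mf_mod[OF H' x]])
   fix i assume i: "i \<in> I"
   show "e x (?c i x w) = f x (yo Q (a i) (g i) x (q i x w))"
    using yo_natl_comp[OF G H' e' a[OF i] v(1)[OF i] x qc[OF i]] yo_natl_comp[OF Q H' f' a[OF i] g[OF i] x qc[OF i]] v(2)[OF i]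
    by simp
   show "f x (yo Q (a i) (g i) x (q i x w)) \<in> el H x" by (rule natl_closed[OF f' x yc[OF i]])
  qed
  also have "\<dots> = f x (finsum (fob Q x) (\<lambda>i. yo Q (a i) (g i) x (q i x w)) I)"
   by (rule lin_finsum[OF mf_mod[OF Q' x] mf_mod[OF H' x] natl_lin[OF f' x] I yc, symmetric])
  also have "\<dots> = f x w" using sm[OF x w] by simp
  finally show "nat_cmp C Q e (nres C Q ?k) x w = f x w" using x w by (simp add: nat_cmp_apply nres_apply)
 qed
qed

end

section \<open>Yoneda bifunctors\<close>

locale yoneda_bif =
 fixes R :: "'k ring" and C :: "('o, 'a) category_data" and T :: "('o \<times> 'o, 'a \<times> 'a, 'k, 'm) modfun"
  and \<mu> :: "('o \<times> 'o, 'a => 'k, 'm) nat_trans"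
 assumes cR: "cring R" and cC: "category C" and yb: "yoneda_bifunctor R C T \<mu>"
begin

interpretation category C by (rule cC)

abbreviation S where "S \<equiv> T_lower C T"
abbreviation U where "U \<equiv> T_upper C T"
abbreviation L where "L \<equiv> T_lower_map C T"

definition uni where "uni a = \<mu> (a, a) (basis_elt R (idn C a))"

lemma T_functor: "is_functor (prod_cat (op_cat C) C) (kmod R) T" using yb by (simp add: yoneda_bifunctor_def)

lemma T_mod: "x \<in> obj C ==> y \<in> obj C ==> module R (fob T (x, y))"
 by (rule mf_mod[OF T_functor]) (simp add: prod_cat_def)

lemma T_lin: "x \<in> obj C ==> x' \<in> obj C ==> y \<in> obj C ==> y' \<in> obj C ==> f \<in> arr C x' x ==> g \<in> arr C y y' ==>
  lin R (fob T (x, y)) (fob T (x', y')) (far T (x, y) (x', y') (f, g))"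
 by (rule mf_lin[OF T_functor]) (simp_all add: prod_cat_def)

lemma T_ext: "x \<in> obj C ==> x' \<in> obj C ==> y \<in> obj C ==> y' \<in> obj C ==> f \<in> arr C x' x ==> g \<in> arr C y y' ==>
  far T (x, y) (x', y') (f, g) \<in> extensional (el T (x, y))"
 by (rule mf_ext[OF T_functor]) (simp_all add: prod_cat_def)

lemma T_id: "x \<in> obj C ==> y \<in> obj C ==> t \<in> el T (x, y) ==> far T (x, y) (x, y) (idn C x, idn C y) t = t"
 using mf_id[OF T_functor, of "(x, y)" t] by (simp add: prod_cat_def)

lemma T_cmp: "x \<in> obj C ==> x' \<in> obj C ==> x'' \<in> obj C ==> y \<in> obj C ==> y' \<in> obj C ==> y'' \<in> obj C ==>
  f \<in> arr C x' x ==> f' \<in> arr C x'' x' ==> g \<in> arr C y y' ==> g' \<in> arr C y' y'' ==> t \<in> el T (x, y) ==>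
  far T (x', y') (x'', y'') (f', g') (far T (x, y) (x', y') (f, g) t) =
  far T (x, y) (x'', y'') (cmp C x'' x' x f f', cmp C y y' y'' g' g) t"
 using mf_cmp[OF T_functor, of "(x, y)" "(x', y')" "(x'', y'')" "(f, g)" "(f', g')" t] by (simp add: prod_cat_def)

lemma T_swap:
 assumes "x \<in> obj C" "x' \<in> obj C" "y \<in> obj C" "y' \<in> obj C" "f \<in> arr C x' x" "g \<in> arr C y y'" "t \<in> el T (x, y)"
 shows "far T (x', y) (x', y') (idn C x', g) (far T (x, y) (x', y) (f, idn C y) t) =
  far T (x, y') (x', y') (f, idn C y') (far T (x, y) (x, y') (idn C x, g) t)"
 using assms by (simp add: T_cmp idn_closed cmp_idn_left cmp_idn_right)

lemma lower_functor: "a \<in> obj C ==> modf R C (S a)" by (rule mfI)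
   (simp_all add: T_lower_def T_mod T_lin T_ext T_id T_cmp idn_closed cmp_idn_left cC)

lemma upper_functor: "a \<in> obj C ==> modf R (op_cat C) (U a)" by (rule mfI)
   (simp_all add: T_upper_def T_mod T_lin T_ext T_id T_cmp idn_closed cmp_idn_left op_cat_category[OF cC])

lemma L_apply: "z \<in> obj C ==> L x y f z = far T (x, z) (y, z) (f, idn C z)" by (simp add: T_lower_map_def)

lemma L_natl: "x \<in> obj C ==> y \<in> obj C ==> f \<in> arr C y x ==> natl R C (S x) (S y) (L x y f)"
 by (rule natlI) (simp_all add: L_apply T_lower_def T_lin idn_closed T_swap)

lemma mu_natl: "natl R (prod_cat (op_cat C) C) (free_hom R C) T \<mu>"
 using yb by (simp add: yoneda_bifunctor_def nat_hom_natl)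

lemma mu_lin: "x \<in> obj C ==> y \<in> obj C ==> lin R (free_mod R (arr C x y)) (fob T (x, y)) (\<mu> (x, y))"
 using natl_lin[OF mu_natl, of "(x, y)"] by (simp add: prod_cat_def free_hom_def)

lemma uni_closed: "a \<in> obj C ==> uni a \<in> el T (a, a)"
 unfolding uni_def by (rule lin_closed[OF mu_lin basis_closed[OF cR]]) (simp_all add: idn_closed)

text \<open>An arrow acting on the class of an identity from either side gives the class of the
  arrow. This is the link between the covariant functors \<open>S\<close> and the contravariant
  functors \<open>U\<close>.\<close>

lemma mu_basis:
 assumes x: "x \<in> obj C" and y: "y \<in> obj C" and f: "f \<in> arr C x y"
 shows "far T (x, x) (x, y) (idn C x, f) (uni x) = \<mu> (x, y) (basis_elt R f)"
  and "far T (y, y) (x, y) (f, idn C y) (uni y) = \<mu> (x, y) (basis_elt R f)"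
proof -
 note b = basis_closed[OF cR]
 have "far T (x, x) (x, y) (idn C x, f) (uni x) =
   \<mu> (x, y) (free_map R (\<lambda>h. cmp C x x y f (cmp C x x x h (idn C x))) (basis_elt R (idn C x)))"
  using natl_nat[OF mu_natl, of "(x, x)" "(x, y)" "(idn C x, f)" "basis_elt R (idn C x)"] x y f b[OF idn_closed[OF x]]
  by (simp add: prod_cat_def free_hom_def uni_def idn_closed)
 then show "far T (x, x) (x, y) (idn C x, f) (uni x) = \<mu> (x, y) (basis_elt R f)"
  using x y f free_map_basis[where h = "\<lambda>h. cmp C x x y f (cmp C x x x h (idn C x))", OF cR idn_closed[OF x]] by (simp add: idn_closed cmp_idn_right)
 have "far T (y, y) (x, y) (f, idn C y) (uni y) =
   \<mu> (x, y) (free_map R (\<lambda>h. cmp C x y y (idn C y) (cmp C x y y h f)) (basis_elt R (idn C y)))"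
  using natl_nat[OF mu_natl, of "(y, y)" "(x, y)" "(f, idn C y)" "basis_elt R (idn C y)"] x y f b[OF idn_closed[OF y]]
  by (simp add: prod_cat_def free_hom_def uni_def idn_closed)
 then show "far T (y, y) (x, y) (f, idn C y) (uni y) = \<mu> (x, y) (basis_elt R f)"
  using x y f free_map_basis[where h = "\<lambda>h. cmp C x y y (idn C y) (cmp C x y y h f)", OF cR idn_closed[OF y]] by (simp add: idn_closed cmp_idn_left)
qed

text \<open>\<open>\<mu>\<close> is surjective and the arrows form a basis of the free module, so
  the classes of arrows span.\<close>

lemma T_spanning:
 assumes x: "x \<in> obj C" and y: "y \<in> obj C" and N: "submodule N R (fob T (x, y))"
  and f: "!!f. f \<in> arr C x y ==> \<mu> (x, y) (basis_elt R f) \<in> N"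
 shows "el T (x, y) \<subseteq> N"
proof
 fix t assume "t \<in> el T (x, y)"
 moreover have "\<mu> (x, y) ` carrier (free_mod R (arr C x y)) = el T (x, y)"
  using yb x y by (auto simp: yoneda_bifunctor_def nat_surj_def prod_cat_def free_hom_def)
 ultimately obtain c where c: "c \<in> carrier (free_mod R (arr C x y))" "t = \<mu> (x, y) c" by (metis imageE)
 note m = free_module[OF cR, of "arr C x y"]
 interpret M: module R "free_mod R (arr C x y)" by (rule m)
 note l = mu_lin[OF x y]
 have "submodule {c \<in> carrier (free_mod R (arr C x y)). \<mu> (x, y) c \<in> N} R (free_mod R (arr C x y))"
  by (rule submoduleI'[OF m])
    (auto simp: lin_add[OF l] lin_smult[OF l] lin_zero[OF m T_mod[OF x y] l] submoduleD[OF T_mod[OF x y] N])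
 then have "carrier (free_mod R (arr C x y)) \<subseteq> {c \<in> carrier (free_mod R (arr C x y)). \<mu> (x, y) c \<in> N}"
  by (rule free_induct[OF cR]) (use f basis_closed[OF cR] in auto)
 then show "t \<in> N" using c by auto
qed

text \<open>Surjectivity of the evaluation map in \<open>yoneda_bifunctor\<close> gives the axiom
  \<open>yoneda\<close>; surjectivity of \<open>\<mu>\<close> gives \<open>spanning\<close>, the
  generators being classes of arrows by \<open>mu_basis\<close>.\<close>

sublocale low: yoneda_system R C S uni
proof (intro yoneda_system.intro kcat.intro yoneda_system_axioms.intro)
 fix a x assume a: "a \<in> obj C"
 show "modf R C (S a)" by (rule lower_functor[OF a])
 show "uni a \<in> el (S a) a" using uni_closed[OF a] by (simp add: T_lower_def)
 assume x: "x \<in> obj C"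
 show "el (S a) x \<subseteq> N" if "submodule N R (fob (S a) x)"
  "!!f. f \<in> arr C a x ==> far (S a) a x f (uni a) \<in> N" for N
  using T_spanning[OF a x, of N] that mu_basis(1)[OF a x] by (simp add: T_lower_def)
 fix t assume t: "t \<in> el (S a) x"
 let ?ev = "\<lambda>F \<in> nat_hom R C (S x) (S a). F x (uni x)"
 have "?ev \<in> mod_iso R (hom_mod R C (S x) (S a)) (fob T (a, x))"
  using yb a x by (simp add: yoneda_bifunctor_def uni_def)
 then have "?ev ` nat_hom R C (S x) (S a) = el T (a, x)" by (simp add: mod_iso_def bij_betw_def)
 moreover have "t \<in> el T (a, x)" using t by (simp add: T_lower_def)
 ultimately have "t \<in> ?ev ` nat_hom R C (S x) (S a)" by (simp only:)
 then obtain F where F: "t = ?ev F" "F \<in> nat_hom R C (S x) (S a)" by (rule imageE)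
 then have "natl R C (S x) (S a) F \<and> F x (uni x) = t" by (simp add: nat_hom_natl)
 then show "\<exists>e. natl R C (S x) (S a) e \<and> e x (uni x) = t" by (rule exI[of _ F])
qed (rule cR cC)+

lemma S_fob: "fob (S x) a = fob T (x, a)" and U_fob: "fob (U a) x = fob T (x, a)"
 by (simp_all add: T_lower_def T_upper_def)

lemma U_far: "a \<in> obj C ==> far (U a) x y f = L x y f a" by (simp add: T_upper_def L_apply)

lemma L_uni: "x \<in> obj C ==> y \<in> obj C ==> f \<in> arr C x y ==> L y x f y (uni y) = far (S x) x y f (uni x)"
 using mu_basis by (simp add: L_apply T_lower_def)

text \<open>Precomposition with an arrow is the action of its class: both transformations
  \<open>S y \<rightarrow> S x\<close> take \<open>uni y\<close> to the class of
  \<open>f\<close>.\<close>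

lemma L_yo:
 assumes "x \<in> obj C" "y \<in> obj C" "f \<in> arr C x y" "z \<in> obj C" "t \<in> el (S y) z"
 shows "low.yo (S x) y (far (S x) x y f (uni x)) z t = L y x f z t"
 by (rule low.yo_eq[OF lower_functor[OF assms(1)] assms(2) L_natl[OF assms(2,1,3)] L_uni[OF assms(1-3)] assms(4,5)])

text \<open>The Yoneda condition is imposed on the functors \<open>S a\<close> only. For
  \<open>U a\<close> the transformation with value \<open>t\<close> at \<open>uni x\<close> is
  composition with \<open>t\<close>, that is \<open>s \<mapsto> yo (S y) x s a t\<close>; its
  naturality in \<open>y\<close> comes from the covariant side.\<close>

sublocale up: yoneda_system R "op_cat C" U uni
proof (intro yoneda_system.intro kcat.intro yoneda_system_axioms.intro)
 show "cring R" by (rule cR)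
 show "category (op_cat C)" by (rule op_cat_category[OF cC])
 fix a x assume "a \<in> obj (op_cat C)"
 then have a: "a \<in> obj C" by simp
 show "modf R (op_cat C) (U a)" by (rule upper_functor[OF a])
 show "uni a \<in> el (U a) a" using uni_closed[OF a] by (simp add: U_fob)
 assume "x \<in> obj (op_cat C)"
 then have x: "x \<in> obj C" by simp
 show "el (U a) x \<subseteq> N" if "submodule N R (fob (U a) x)"
  "!!f. f \<in> arr (op_cat C) a x ==> far (U a) a x f (uni a) \<in> N" for N
  using T_spanning[OF x a, of N] that mu_basis(2)[OF x a] by (simp add: T_upper_def)
 fix t assume "t \<in> el (U a) x"
 then have t': "t \<in> el (S x) a" by (simp add: U_fob S_fob)
 let ?e = "\<lambda>y s. low.yo (S y) x s a t"
 have "natl R (op_cat C) (U x) (U a) ?e"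
 proof (rule natlI)
  show "lin R (fob (U x) y) (fob (U a) y) (?e y)" if "y \<in> obj (op_cat C)" for y
   using low.yo_lin[OF low.S_amod x a t', of y] that by (simp add: U_fob S_fob)
  fix y y' f s assume "y \<in> obj (op_cat C)" "y' \<in> obj (op_cat C)" "f \<in> arr (op_cat C) y y'" and s: "s \<in> el (U x) y"
  then have y: "y \<in> obj C" "y' \<in> obj C" "f \<in> arr C y' y" and s': "s \<in> el (S y) x" by (simp_all add: U_fob S_fob)
  show "?e y' (far (U x) y y' f s) = far (U a) y y' f (?e y s)"
   unfolding U_far[OF x] U_far[OF a]
   by (rule low.yo_natl_comp[OF low.S_amod[OF y(1)] lower_functor[OF y(2)] L_natl[OF y] x s' a t'])
 qed
 moreover have "?e x (uni x) = t" by (rule low.yo_id[OF x a t'])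
 ultimately show "\<exists>e. natl R (op_cat C) (U x) (U a) e \<and> e x (uni x) = t" by blast
qed

end

section \<open>Hom complexes and tensor complexes\<close>

lemma precomp_lin:
 assumes F: "modf R C F" and F': "modf R C F'" and G: "modf R C G"
  and d: "natl R C F F' d"
 shows "lin R (hom_mod R C F' G) (hom_mod R C F G) (\<lambda>h. nat_cmp C F h d)"
proof (rule linI)
 show "nat_cmp C F h d \<in> carrier (hom_mod R C F G)" if "h \<in> carrier (hom_mod R C F' G)" for h
  using that unfolding nat_cmp_nres hom_mod_simps by (rule nres_hom[OF F natl_compose[OF d nat_hom_natl]])
qed (auto simp: nat_cmp_nres nres_apply natl_closed[OF d] intro!: nres_cong)

lemma postcomp_lin:
 assumes F: "modf R C F" and G: "modf R C G" and G': "modf R C G'"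
  and p: "natl R C G G' p"
 shows "lin R (hom_mod R C F G) (hom_mod R C F G') (\<lambda>h. nat_cmp C F p h)"
proof (rule linI)
 have c: "h x w \<in> el G x" if "h \<in> nat_hom R C F G" "x \<in> obj C" "w \<in> el F x" for h x w
  by (rule natl_closed[OF nat_hom_natl[OF that(1)] that(2,3)])
 show "nat_cmp C F p h \<in> carrier (hom_mod R C F G')" if "h \<in> carrier (hom_mod R C F G)" for h
  using that unfolding nat_cmp_nres hom_mod_simps by (rule nres_hom[OF F natl_compose[OF nat_hom_natl p]])
 show "nat_cmp C F p (h +[hom_mod R C F G] k) = nat_cmp C F p h +[hom_mod R C F G'] nat_cmp C F p k"
  if "h \<in> carrier (hom_mod R C F G)" "k \<in> carrier (hom_mod R C F G)" for h k
  using that by (auto simp: nat_cmp_nres nres_apply c lin_add[OF natl_lin[OF p]] intro!: nres_cong)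
 show "nat_cmp C F p (r *[hom_mod R C F G] h) = r *[hom_mod R C F G'] nat_cmp C F p h"
  if "r \<in> carrier R" "h \<in> carrier (hom_mod R C F G)" for r h
  using that by (auto simp: nat_cmp_nres nres_apply c lin_smult[OF natl_lin[OF p]] intro!: nres_cong)
qed

lemma hom_cx_chob: "chob (hom_cx R C K G) i = hom_mod R C (chob K (- i)) G" by (simp add: hom_cx_def)

lemma hom_cx_chd:
 "u \<in> nat_hom R C (chob K (- i)) G ==>
  chd (hom_cx R C K G) i u = nat_cmp C (chob K (- i - 1)) u (chd K (- i - 1))" by (simp add: hom_cx_def hom_map_def)

context
 fixes R :: "'k ring" and C :: "('o, 'a) category_data" and G :: "('o, 'a, 'k, 'v) modfun"
 assumes cR: "cring R" and G: "modf R C G"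
begin

lemma hom_cx_mcx:
 assumes K: "fcx R C K"
 shows "mcx R (hom_cx R C K G)"
proof -
 note Kc = fcxD[OF K]
 have d: "natl R C (chob K (- i - 1)) (chob K (- i)) (chd K (- i - 1))" for i using Kc(3)[of "- i"] by simp
 have e: "- (i + 1) = - i - (1 :: int)" "- (i + 1 + 1) = - i - 1 - (1 :: int)" for i by simp_all
 have l: "lin R (chob (hom_cx R C K G) i) (chob (hom_cx R C K G) (i + 1)) (chd (hom_cx R C K G) i)" for i
  unfolding hom_cx_chob e
  by (rule lin_cong[OF precomp_lin[OF Kc(1) Kc(1) G d] hom_mod_module[OF cR Kc(1) G]]) (simp add: hom_cx_chd)
 show ?thesis
  unfolding mcx_def
 proof (intro conjI allI ballI)
  show "module R (chob (hom_cx R C K G) i)" for i unfolding hom_cx_chob by (rule hom_mod_module[OF cR Kc(1) G])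
  show "lin R (chob (hom_cx R C K G) i) (chob (hom_cx R C K G) (i + 1)) (chd (hom_cx R C K G) i)" for i by (rule l)
  fix i u assume u: "u \<in> carrier (chob (hom_cx R C K G) i)"
  then have u': "u \<in> nat_hom R C (chob K (- i)) G" by (simp add: hom_cx_chob)
  have du: "chd (hom_cx R C K G) i u \<in> nat_hom R C (chob K (- (i + 1))) G"
   using lin_closed[OF l u] by (simp add: hom_cx_chob)
  have dd: "chd K (- i - 1) x (chd K (- i - 1 - 1) x w) = 0[fob (chob K (- i)) x]"
   if "x \<in> obj C" "w \<in> el (chob K (- i - 1 - 1)) x" for x w using Kc(4)[OF that(1), of w "- i - 1"] that(2) by simp
  have dc: "chd K (- i - 1 - 1) x w \<in> el (chob K (- i - 1)) x"
   if "x \<in> obj C" "w \<in> el (chob K (- i - 1 - 1)) x" for x w by (rule natl_closed[OF Kc(3) that])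
  have "chd (hom_cx R C K G) (i + 1) (chd (hom_cx R C K G) i u) =
    nat_cmp C (chob K (- i - 1 - 1)) (nat_cmp C (chob K (- i - 1)) u (chd K (- i - 1))) (chd K (- i - 1 - 1))"
   using hom_cx_chd[OF du] hom_cx_chd[OF u'] unfolding e by simp
  also have "\<dots> = nres C (chob K (- i - 1 - 1)) (\<lambda>x w. 0[fob G x])"
   unfolding nat_cmp_nres
   using lin_zero[OF mf_mod[OF Kc(1)] mf_mod[OF G] natl_lin[OF nat_hom_natl[OF u']]]
   by (intro nres_cong) (simp only: nres_apply dc dd)
  finally show "chd (hom_cx R C K G) (i + 1) (chd (hom_cx R C K G) i u) = 0[chob (hom_cx R C K G) (i + 1 + 1)]"
   unfolding hom_cx_chob e by simp
 qed
qed

lemma hom_cx_square: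
 assumes K: "fcx R C K" and L: "fcx R C L" and \<phi>: "cmap R C K L \<phi>" and u: "u \<in> carrier (chob (hom_cx R C L G) i)"
 shows "chd (hom_cx R C K G) i (nat_cmp C (chob K (- i)) u (\<phi> (- i))) =
  nat_cmp C (chob K (- (i + 1))) (chd (hom_cx R C L G) i u) (\<phi> (- (i + 1)))"
proof -
 note Kc = fcxD[OF K]
 have u': "u \<in> nat_hom R C (chob L (- i)) G" using u by (simp add: hom_cx_chob)
 have v: "nat_cmp C (chob K (- i)) u (\<phi> (- i)) \<in> nat_hom R C (chob K (- i)) G"
  unfolding nat_cmp_nres by (rule nres_hom[OF Kc(1) natl_compose[OF cmapD(1)[OF \<phi>] nat_hom_natl[OF u']]])
 have e: "- (i + 1) = - i - 1" by simp
 show ?thesis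
  unfolding hom_cx_chd[OF u'] hom_cx_chd[OF v] e
  unfolding nat_cmp_nres
  using cmapD(3)[OF \<phi>, of _ _ "- i"] natl_closed[OF Kc(3)[of "- i"]] natl_closed[OF cmapD(1)[OF \<phi>], of _ _ "- i - 1"]
  by (intro nres_cong) (simp add: nres_apply)
qed

text \<open>An additive functor preserves the homotopy identity; contravariance exchanges the terms
  \<open>d h\<close> and \<open>h d\<close>. Indices such as \<open>i + 1 - 1\<close> are left as
  the hypotheses of \<open>homotopy_equivalence_coh_iso_at\<close> produce them.\<close>

lemma hom_cx_htpy:
 assumes K: "fcx R C K" and \<rho>: "!!i. natl R C (chob K i) (chob K i) (\<rho> i)" and h: "htpy R C K \<rho> h"
  and u: "u \<in> carrier (chob (hom_cx R C K G) i)"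
 shows "nres C (chob K (- i)) (\<lambda>x w. u x (\<rho> (- i) x w)) +[chob (hom_cx R C K G) i]
  (chd (hom_cx R C K G) (i - 1) (nat_cmp C (chob K (- (i - 1))) u (h (- (i - 1)))) +[chob (hom_cx R C K G) i]
   nat_cmp C (chob K (- (i + 1 - 1))) (chd (hom_cx R C K G) i u) (h (- (i + 1 - 1)))) = u"
proof -
 note Kc = fcxD[OF K]
 have hn: "natl R C (chob K i) (chob K (i - 1)) (h i)" for i using h by (simp add: htpy_def)
 have u': "u \<in> nat_hom R C (chob K (- i)) G" using u by (simp add: hom_cx_chob)
 have hn': "natl R C (chob K (- (i - 1))) (chob K (- i)) (h (- (i - 1)))" using hn[of "- (i - 1)"] by simp
 have v: "nat_cmp C (chob K (- (i - 1))) u (h (- (i - 1))) \<in> nat_hom R C (chob K (- (i - 1))) G"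
  unfolding nat_cmp_nres by (rule nres_hom[OF Kc(1) natl_compose[OF hn' nat_hom_natl[OF u']]])
 have e: "- (i - 1) - 1 = - i" "- (i + 1 - 1) = - i" "- (i - 1) = - i + 1" by simp_all
 note un = natl_lin[OF nat_hom_natl[OF u']]
 have dc: "chd K (- i) x w \<in> el (chob K (- i + 1)) x" "h (- i) x w \<in> el (chob K (- i - 1)) x"
  "\<rho> (- i) x w \<in> el (chob K (- i)) x"
  if "x \<in> obj C" "w \<in> el (chob K (- i)) x" for x w
  using natl_closed[OF Kc(2) that] natl_closed[OF hn that] natl_closed[OF \<rho> that] by simp_all
 have dc2: "h (- i + 1) x w \<in> el (chob K (- i)) x" if "x \<in> obj C" "w \<in> el (chob K (- i + 1)) x" for x w
  using natl_closed[OF hn' that(1)] that(2) unfolding e by simp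
 have dc3: "chd K (- i - 1) x w \<in> el (chob K (- i)) x" if "x \<in> obj C" "w \<in> el (chob K (- i - 1)) x" for x w
  by (rule natl_closed[OF Kc(3) that])
 have eq: "u x (\<rho> (- i) x w) +[fob G x] (u x (h (- i + 1) x (chd K (- i) x w)) +[fob G x] u x (chd K (- i - 1) x (h (- i) x w))) = u x w"
  if x: "x \<in> obj C" and w: "w \<in> el (chob K (- i)) x" for x w
 proof -
  interpret M: module R "fob (chob K (- i)) x" by (rule mf_mod[OF Kc(1) x])
  have "\<rho> (- i) x w +[fob (chob K (- i)) x] (chd K (- i - 1) x (h (- i) x w) +[fob (chob K (- i)) x] h (- i + 1) x (chd K (- i) x w)) = w"
   by (rule conjunct2[OF h[unfolded htpy_def], rule_format, OF x w])
  then have "\<rho> (- i) x w +[fob (chob K (- i)) x] (h (- i + 1) x (chd K (- i) x w) +[fob (chob K (- i)) x] chd K (- i - 1) x (h (- i) x w)) = w"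
   by (subst M.a_comm[OF dc2[OF x dc(1)[OF x w]] dc3[OF x dc(2)[OF x w]]])
  then show ?thesis
   using lin_add[OF un[OF x] dc(3)[OF x w] M.a_closed[OF dc2[OF x dc(1)[OF x w]] dc3[OF x dc(2)[OF x w]]]]
    lin_add[OF un[OF x] dc2[OF x dc(1)[OF x w]] dc3[OF x dc(2)[OF x w]]] by simp
 qed
 have "nres C (chob K (- i)) (\<lambda>x w. u x (\<rho> (- i) x w) +[fob G x] (u x (h (- i + 1) x (chd K (- i) x w)) +[fob G x] u x (chd K (- i - 1) x (h (- i) x w)))) =
   nres C (chob K (- i)) u" by (rule nres_cong) (rule eq)
 also have "\<dots> = u" using u' by (simp add: nat_hom_iff)
 finally have r: "nres C (chob K (- i)) (\<lambda>x w. u x (\<rho> (- i) x w) +[fob G x] (u x (h (- i + 1) x (chd K (- i) x w)) +[fob G x] u x (chd K (- i - 1) x (h (- i) x w)))) = u" .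
 show ?thesis
  unfolding hom_cx_chd[OF u'] hom_cx_chd[OF v]
  unfolding e nat_cmp_nres hom_cx_chob hom_mod_simps
  by (rule HOL.trans[OF nres_cong r]) (simp only: nres_apply dc dc2 add_diff_cancel)
qed

text \<open>By contravariance \<open>\<phi>\<close> induces a map out of the complex of
  \<open>L\<close>, and the homotopy \<open>k\<close> on \<open>L\<close> becomes the one on the
  source.\<close>

lemma hom_cx_heq:
 assumes K: "fcx R C K" and L: "fcx R C L" and hq: "heq R C K L \<phi> \<psi> h k"
 shows "coh_iso_at R (hom_cx R C L G) (hom_cx R C K G) i (\<lambda>f. nat_cmp C (chob K (- i)) f (\<phi> (- i)))"
proof -
 note Kc = fcxD[OF K] and Lc = fcxD[OF L]
 have \<phi>: "cmap R C K L \<phi>" and \<psi>: "cmap R C L K \<psi>" and hh: "htpy R C K (\<lambda>i x w. \<psi> i x (\<phi> i x w)) h"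
  and kk: "htpy R C L (\<lambda>i x w. \<phi> i x (\<psi> i x w)) k" using hq by (auto simp: heq_def)
 have hn: "natl R C (chob K (- (i - 1))) (chob K (- i)) (h (- (i - 1)))"
  and kn: "natl R C (chob L (- (i - 1))) (chob L (- i)) (k (- (i - 1)))" for i
  using hh kk by (auto simp: htpy_def dest!: spec[of _ "- (i - 1)"])
 show ?thesis
 proof (rule homotopy_equivalence_coh_iso_at[where f = "\<lambda>i f. nat_cmp C (chob K (- i)) f (\<phi> (- i))"
    and g = "\<lambda>i f. nat_cmp C (chob L (- i)) f (\<psi> (- i))"
    and h = "\<lambda>i f. nat_cmp C (chob L (- (i - 1))) f (k (- (i - 1)))"
    and k = "\<lambda>i f. nat_cmp C (chob K (- (i - 1))) f (h (- (i - 1)))", OF hom_cx_mcx[OF L] hom_cx_mcx[OF K]])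
  show "lin R (chob (hom_cx R C L G) i) (chob (hom_cx R C K G) i) (\<lambda>f. nat_cmp C (chob K (- i)) f (\<phi> (- i)))" for i
   unfolding hom_cx_chob by (rule precomp_lin[OF Kc(1) Lc(1) G cmapD(1)[OF \<phi>]])
  show "lin R (chob (hom_cx R C K G) i) (chob (hom_cx R C L G) i) (\<lambda>f. nat_cmp C (chob L (- i)) f (\<psi> (- i)))" for i
   unfolding hom_cx_chob by (rule precomp_lin[OF Lc(1) Kc(1) G cmapD(1)[OF \<psi>]])
  show "lin R (chob (hom_cx R C L G) i) (chob (hom_cx R C L G) (i - 1)) (\<lambda>f. nat_cmp C (chob L (- (i - 1))) f (k (- (i - 1))))" for i
   unfolding hom_cx_chob by (rule precomp_lin[OF Lc(1) Lc(1) G kn])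
  show "lin R (chob (hom_cx R C K G) i) (chob (hom_cx R C K G) (i - 1)) (\<lambda>f. nat_cmp C (chob K (- (i - 1))) f (h (- (i - 1))))" for i
   unfolding hom_cx_chob by (rule precomp_lin[OF Kc(1) Kc(1) G hn])
  have r: "nat_cmp C A (nat_cmp C B u p) q = nres C A (\<lambda>x w. u x (p x (q x w)))" if "natl R C A B q" for A B u p q
   unfolding nat_cmp_nres by (rule nres_cong) (simp add: nres_apply natl_closed[OF that])
  show "nat_cmp C (chob L (- i)) (nat_cmp C (chob K (- i)) u (\<phi> (- i))) (\<psi> (- i)) +[chob (hom_cx R C L G) i]
    (chd (hom_cx R C L G) (i - 1) (nat_cmp C (chob L (- (i - 1))) u (k (- (i - 1)))) +[chob (hom_cx R C L G) i]
     nat_cmp C (chob L (- (i + 1 - 1))) (chd (hom_cx R C L G) i u) (k (- (i + 1 - 1)))) = u"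
   if "u \<in> carrier (chob (hom_cx R C L G) i)" for i u
   unfolding r[OF cmapD(1)[OF \<psi>]] by (rule hom_cx_htpy[OF L natl_compose[OF cmapD(1)[OF \<psi>] cmapD(1)[OF \<phi>]] kk that])
  show "nat_cmp C (chob K (- i)) (nat_cmp C (chob L (- i)) u (\<psi> (- i))) (\<phi> (- i)) +[chob (hom_cx R C K G) i]
    (chd (hom_cx R C K G) (i - 1) (nat_cmp C (chob K (- (i - 1))) u (h (- (i - 1)))) +[chob (hom_cx R C K G) i]
     nat_cmp C (chob K (- (i + 1 - 1))) (chd (hom_cx R C K G) i u) (h (- (i + 1 - 1)))) = u"
   if "u \<in> carrier (chob (hom_cx R C K G) i)" for i u
   unfolding r[OF cmapD(1)[OF \<phi>]] by (rule hom_cx_htpy[OF K natl_compose[OF cmapD(1)[OF \<phi>] cmapD(1)[OF \<psi>]] hh that])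
 qed (rule hom_cx_square[OF K L \<phi>] hom_cx_square[OF L K \<psi>], assumption)+
qed

end

section \<open>Tensor complexes\<close>

lemma tensor_cx_simps [simp]: "chob (tensor_cx R C K G) i = tensor R C (chob K i) G"
 "chd (tensor_cx R C K G) i = tensor_map R C (chob K i) G (chob K (i + 1)) G (chd K i) (nat_id C G)"
 by (simp_all add: tensor_cx_def)

context
 fixes R :: "'k ring" and C :: "('o, 'a) category_data" and G :: "('o, 'a, 'k, 'v) modfun"
 assumes cR: "cring R" and G: "modf R C G"
begin

abbreviation tmap where
 "tmap F F' p \<equiv> tensor_map R C F G F' G p (nat_id C G)"

lemma natl_nat_id: "natl R C G G (nat_id C G)" by (rule nat_hom_natl[OF nat_id_hom[OF G]])

lemma tp: "modf R (op_cat C) F ==> tensor_pair R C F G" by (intro tensor_pair.intro cR G)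

lemma tmap_lin:
 "modf R (op_cat C) F ==> modf R (op_cat C) F' ==> natl R (op_cat C) F F' p ==>
  lin R (tensor R C F G) (tensor R C F' G) (tmap F F' p)" by (rule tensor_map_props(1)[OF tp tp _ natl_nat_id])

lemma tmap_tn:
 "modf R (op_cat C) F ==> modf R (op_cat C) F' ==> natl R (op_cat C) F F' p ==>
  x \<in> obj C ==> a \<in> el F x ==> b \<in> el G x ==>
  tmap F F' p (tensor_pair.tn R C F G x a b) = tensor_pair.tn R C F' G x (p x a) b"
 using tensor_map_props(2)[OF tp tp _ natl_nat_id, of F F' p x a b] by (simp add: nat_id_apply)

lemma tensor_cx_mcx:
 assumes K: "fcx R (op_cat C) K"
 shows "mcx R (tensor_cx R C K G)"
 unfolding mcx_def tensor_cx_simps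
proof (intro conjI allI ballI)
 note Kc = fcxD[OF K]
 note tpi = tp[OF Kc(1)]
 show "module R (tensor R C (chob K i) G)" for i by (rule tensor_pair.tensor_module[OF tpi])
 show l: "lin R (tensor R C (chob K i) G) (tensor R C (chob K (i + 1)) G) (tmap (chob K i) (chob K (i + 1)) (chd K i))" for i
  by (rule tmap_lin[OF Kc(1) Kc(1) Kc(2)])
 fix i u assume u: "u \<in> carrier (tensor R C (chob K i) G)"
 let ?N = "tensor R C (chob K (i + 1 + 1)) G"
 have N: "module R ?N" by (rule tensor_pair.tensor_module[OF tpi])
 show "tmap (chob K (i + 1)) (chob K (i + 1 + 1)) (chd K (i + 1)) (tmap (chob K i) (chob K (i + 1)) (chd K i) u) = 0[?N]"
 proof (rule tensor_pair.tensor_unique[OF tpi N lin_compose[OF l l] lin_const_zero[OF N] _ u])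
  fix x a b assume x: "x \<in> obj C" and a: "a \<in> el (chob K i) x" and b: "b \<in> el G x"
  have x': "x \<in> obj (op_cat C)" using x by simp
  have da: "chd K i x a \<in> el (chob K (i + 1)) x" by (rule natl_closed[OF Kc(2) x' a])
  have "chd K (i + 1) x (chd K i x a) = 0[fob (chob K (i + 1 + 1)) x]" using Kc(4)[OF x', of a "i + 1"] a by simp
  then show "tmap (chob K (i + 1)) (chob K (i + 1 + 1)) (chd K (i + 1)) (tmap (chob K i) (chob K (i + 1)) (chd K i)
    (tensor_pair.tn R C (chob K i) G x a b)) = 0[?N]"
   using tmap_tn[OF Kc(1) Kc(1) Kc(2) x a b] tmap_tn[OF Kc(1) Kc(1) Kc(2) x da b] tensor_pair.tn_zero_l[OF tpi x b] by simp
 qed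
qed

lemma tensor_cx_square:
 assumes K: "fcx R (op_cat C) K" and L: "fcx R (op_cat C) L" and \<phi>: "cmap R (op_cat C) K L \<phi>"
  and u: "u \<in> carrier (tensor R C (chob K i) G)"
 shows "tmap (chob L i) (chob L (i + 1)) (chd L i) (tmap (chob K i) (chob L i) (\<phi> i) u) =
  tmap (chob K (i + 1)) (chob L (i + 1)) (\<phi> (i + 1)) (tmap (chob K i) (chob K (i + 1)) (chd K i) u)"
proof -
 note Kc = fcxD[OF K] and Lc = fcxD[OF L]
 note \<phi>n = cmapD(1)[OF \<phi>]
 show ?thesis
 proof (rule tensor_pair.tensor_unique[OF tp[OF Kc(1)] tensor_pair.tensor_module[OF tp[OF Lc(1)]]
    lin_compose[OF tmap_lin[OF Kc(1) Lc(1) \<phi>n] tmap_lin[OF Lc(1) Lc(1) Lc(2)]]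
    lin_compose[OF tmap_lin[OF Kc(1) Kc(1) Kc(2)] tmap_lin[OF Kc(1) Lc(1) \<phi>n]] _ u])
  fix x a b assume x: "x \<in> obj C" and a: "a \<in> el (chob K i) x" and b: "b \<in> el G x"
  have x': "x \<in> obj (op_cat C)" using x by simp
  show "tmap (chob L i) (chob L (i + 1)) (chd L i) (tmap (chob K i) (chob L i) (\<phi> i) (tensor_pair.tn R C (chob K i) G x a b)) =
   tmap (chob K (i + 1)) (chob L (i + 1)) (\<phi> (i + 1)) (tmap (chob K i) (chob K (i + 1)) (chd K i) (tensor_pair.tn R C (chob K i) G x a b))"
   using tmap_tn[OF Kc(1) Lc(1) \<phi>n x a b] tmap_tn[OF Kc(1) Kc(1) Kc(2) x a b] cmapD(2)[OF \<phi> x' a]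
    tmap_tn[OF Lc(1) Lc(1) Lc(2) x natl_closed[OF \<phi>n x' a] b] tmap_tn[OF Kc(1) Lc(1) \<phi>n x natl_closed[OF Kc(2) x' a] b]
   by simp
 qed
qed

text \<open>Both sides are linear, so pure tensors suffice; there it is the homotopy identity in the
  first factor, by additivity of \<open>tn\<close>.\<close>

lemma tensor_cx_htpy:
 assumes K: "fcx R (op_cat C) K" and L: "fcx R (op_cat C) L"
  and \<phi>: "cmap R (op_cat C) K L \<phi>" and \<psi>: "cmap R (op_cat C) L K \<psi>"
  and h: "htpy R (op_cat C) K (\<lambda>i x w. \<psi> i x (\<phi> i x w)) h" and u: "u \<in> carrier (tensor R C (chob K i) G)"
 shows "tmap (chob L i) (chob K i) (\<psi> i) (tmap (chob K i) (chob L i) (\<phi> i) u) +[tensor R C (chob K i) G]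
  (tmap (chob K (i - 1)) (chob K (i - 1 + 1)) (chd K (i - 1)) (tmap (chob K i) (chob K (i - 1)) (h i) u) +[tensor R C (chob K i) G]
   tmap (chob K (i + 1)) (chob K (i + 1 - 1)) (h (i + 1)) (tmap (chob K i) (chob K (i + 1)) (chd K i) u)) = u"
proof -
 note Kc = fcxD[OF K] and Lc = fcxD[OF L]
 note \<phi>n = cmapD(1)[OF \<phi>] and \<psi>n = cmapD(1)[OF \<psi>]
 have hn: "natl R (op_cat C) (chob K i) (chob K (i - 1)) (h i)" for i using h by (simp add: htpy_def)
 have hn': "natl R (op_cat C) (chob K (i + 1)) (chob K i) (h (i + 1))" using hn[of "i + 1"] by simp
 note tpi = tp[OF Kc(1)]
 note m = tensor_pair.tensor_module[OF tpi]
 show ?thesis unfolding diff_add_cancel add_diff_cancel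
 proof (rule tensor_pair.tensor_unique[OF tpi m lin_pointwise_add[OF m
    lin_compose[OF tmap_lin[OF Kc(1) Lc(1) \<phi>n] tmap_lin[OF Lc(1) Kc(1) \<psi>n]] lin_pointwise_add[OF m
    lin_compose[OF tmap_lin[OF Kc(1) Kc(1) hn] tmap_lin[OF Kc(1) Kc(1) Kc(3)]]
    lin_compose[OF tmap_lin[OF Kc(1) Kc(1) Kc(2)] tmap_lin[OF Kc(1) Kc(1) hn']]]] lin_id _ u])
  fix x a b assume x: "x \<in> obj C" and a: "a \<in> el (chob K i) x" and b: "b \<in> el G x"
  have x': "x \<in> obj (op_cat C)" using x by simp
  interpret M: module R "fob (chob K i) x" by (rule mf_mod[OF Kc(1) x'])
  note c = natl_closed[OF \<phi>n x' a] natl_closed[OF Kc(2) x' a] natl_closed[OF hn x' a]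
  have e: "\<psi> i x (\<phi> i x a) +[fob (chob K i) x] (chd K (i - 1) x (h i x a) +[fob (chob K i) x] h (i + 1) x (chd K i x a)) = a"
   using h x a by (simp add: htpy_def)
  note c2 = natl_closed[OF \<psi>n x' c(1)] natl_closed[OF Kc(3) x' c(3)] natl_closed[OF hn' x' c(2)]
  show "tmap (chob L i) (chob K i) (\<psi> i) (tmap (chob K i) (chob L i) (\<phi> i) (tensor_pair.tn R C (chob K i) G x a b)) +[tensor R C (chob K i) G]
   (tmap (chob K (i - 1)) (chob K i) (chd K (i - 1)) (tmap (chob K i) (chob K (i - 1)) (h i) (tensor_pair.tn R C (chob K i) G x a b)) +[tensor R C (chob K i) G]
    tmap (chob K (i + 1)) (chob K i) (h (i + 1)) (tmap (chob K i) (chob K (i + 1)) (chd K i) (tensor_pair.tn R C (chob K i) G x a b))) =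
   tensor_pair.tn R C (chob K i) G x a b"
   unfolding tmap_tn[OF Kc(1) Lc(1) \<phi>n x a b] tmap_tn[OF Kc(1) Kc(1) Kc(2) x a b] tmap_tn[OF Kc(1) Kc(1) hn x a b]
    tmap_tn[OF Lc(1) Kc(1) \<psi>n x c(1) b] tmap_tn[OF Kc(1) Kc(1) Kc(3) x c(3) b] tmap_tn[OF Kc(1) Kc(1) hn' x c(2) b]
    tensor_pair.tn_add_l[OF tpi x c2(2,3) b, THEN HOL.sym]
    tensor_pair.tn_add_l[OF tpi x c2(1) M.a_closed[OF c2(2,3)] b, THEN HOL.sym] e ..
 qed
qed

lemma tensor_cx_heq:
 assumes K: "fcx R (op_cat C) K" and L: "fcx R (op_cat C) L" and hq: "heq R (op_cat C) K L \<phi> \<psi> h k"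
 shows "coh_iso_at R (tensor_cx R C K G) (tensor_cx R C L G) i (tmap (chob K i) (chob L i) (\<phi> i))"
proof -
 note Kc = fcxD[OF K] and Lc = fcxD[OF L]
 have \<phi>: "cmap R (op_cat C) K L \<phi>" and \<psi>: "cmap R (op_cat C) L K \<psi>"
  and hh: "htpy R (op_cat C) K (\<lambda>i x w. \<psi> i x (\<phi> i x w)) h"
  and kk: "htpy R (op_cat C) L (\<lambda>i x w. \<phi> i x (\<psi> i x w)) k" using hq by (auto simp: heq_def)
 have hn: "natl R (op_cat C) (chob K i) (chob K (i - 1)) (h i)"
  and kn: "natl R (op_cat C) (chob L i) (chob L (i - 1)) (k i)" for i using hh kk by (simp_all add: htpy_def)
 show ?thesis by (rule homotopy_equivalence_coh_iso_at[where f = "\<lambda>i. tmap (chob K i) (chob L i) (\<phi> i)"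
    and g = "\<lambda>i. tmap (chob L i) (chob K i) (\<psi> i)"
    and h = "\<lambda>i. tmap (chob K i) (chob K (i - 1)) (h i)"
    and k = "\<lambda>i. tmap (chob L i) (chob L (i - 1)) (k i)",
    OF tensor_cx_mcx[OF K] tensor_cx_mcx[OF L], unfolded tensor_cx_simps,
    OF tmap_lin[OF Kc(1) Lc(1) cmapD(1)[OF \<phi>]] tensor_cx_square[OF K L \<phi>]
     tmap_lin[OF Lc(1) Kc(1) cmapD(1)[OF \<psi>]] tensor_cx_square[OF L K \<psi>]
     tmap_lin[OF Kc(1) Kc(1) hn] tensor_cx_htpy[OF K L \<phi> \<psi> hh]
     tmap_lin[OF Lc(1) Lc(1) kn] tensor_cx_htpy[OF L K \<psi> \<phi> kk]])
qed

end

section \<open>Duality\<close>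

lemma hom_eval_lin:
 assumes G: "modf R C G" and x: "x \<in> obj C" and w: "w \<in> el F x"
 shows "lin R (hom_mod R C F G) (fob G x) (\<lambda>h. h x w)"
 by (rule linI) (use x w in \<open>auto simp: nres_apply intro: natl_closed[OF nat_hom_natl]\<close>)

lemma nat_cmp_natl_hom:
 assumes F: "modf R C F" and h: "h \<in> nat_hom R C F G" and e: "natl R C G H e"
 shows "nres C F (\<lambda>z w. e z (h z w)) \<in> nat_hom R C F H" by (rule nres_hom[OF F natl_compose[OF nat_hom_natl[OF h] e]])

context yoneda_bif
begin

abbreviation DD where "DD \<equiv> dual R C T"

lemma dual_fob: "fob (DD F) x = hom_mod R C F (S x)" by (simp add: dual_def)

lemma dual_far: "h \<in> nat_hom R C F (S x) ==> far (DD F) x y f h = nres C F (\<lambda>z w. L x y f z (h z w))"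
 by (simp add: dual_def nat_cmp_nres)

lemma yo_hom:
 assumes F: "modf R C F" and G: "low.amod G" and h: "h \<in> nat_hom R C F (S x)"
  and x: "x \<in> obj C" and b: "b \<in> el G x"
 shows "nres C F (\<lambda>z w. low.yo G x b z (h z w)) \<in> nat_hom R C F G"
 by (rule nat_cmp_natl_hom[OF F h low.yo_natl[OF G x b]])

lemma hom_closed: "h \<in> nat_hom R C F G ==> z \<in> obj C ==> w \<in> el F z ==> h z w \<in> el G z"
 by (rule natl_closed[OF nat_hom_natl])

context
 fixes F :: "('o, 'a, 'k, 'm) modfun"
 assumes F: "modf R C F"
begin

lemma dual_functor: "modf R (op_cat C) (DD F)"
proof (rule mfI)
 show "module R (fob (DD F) x)" if "x \<in> obj (op_cat C)" for x
  using that unfolding dual_fob by (intro hom_mod_module[OF cR F lower_functor]) simp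
 show "lin R (fob (DD F) x) (fob (DD F) y) (far (DD F) x y f)"
  if "x \<in> obj (op_cat C)" "y \<in> obj (op_cat C)" "f \<in> arr (op_cat C) x y" for x y f
 proof -
  have x: "x \<in> obj C" and y: "y \<in> obj C" and f: "f \<in> arr C y x" using that by simp_all
  show ?thesis unfolding dual_fob
   by (rule lin_cong[OF postcomp_lin[OF F lower_functor[OF x] lower_functor[OF y] L_natl[OF x y f]] hom_mod_module[OF cR F lower_functor[OF x]]])
     (simp add: dual_def)
 qed
 show "far (DD F) x y f \<in> extensional (el (DD F) x)" for x y f by (simp add: dual_def)
 show "far (DD F) x x (idn (op_cat C) x) u = u" if "x \<in> obj (op_cat C)" "u \<in> el (DD F) x" for x u
 proof -
  have x: "x \<in> obj C" and u: "u \<in> nat_hom R C F (S x)" using that by (simp_all add: dual_fob)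
  have "far (DD F) x x (idn C x) u = nres C F u" unfolding dual_far[OF u]
   using mf_id[OF upper_functor] U_far hom_closed[OF u] x by (intro nres_cong) (simp add: U_fob S_fob)
  then show ?thesis using u by (simp add: nat_hom_iff)
 qed
 fix x y z f g u
 assume "x \<in> obj (op_cat C)" "y \<in> obj (op_cat C)" "z \<in> obj (op_cat C)" "f \<in> arr (op_cat C) x y" "g \<in> arr (op_cat C) y z" "u \<in> el (DD F) x"
 then have x: "x \<in> obj C" and y: "y \<in> obj C" and z: "z \<in> obj C" and f: "f \<in> arr C y x" and g: "g \<in> arr C z y"
  and u: "u \<in> nat_hom R C F (S x)" by (simp_all add: dual_fob)
 have v: "nres C F (\<lambda>z w. L x y f z (u z w)) \<in> nat_hom R C F (S y)" by (rule nat_cmp_natl_hom[OF F u L_natl[OF x y f]])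
 show "far (DD F) x z (cmp (op_cat C) x y z g f) u = far (DD F) y z g (far (DD F) x y f u)"
  unfolding dual_far[OF u] dual_far[OF v]
 proof (rule nres_cong)
  fix a w assume a: "a \<in> obj C" and w: "w \<in> el F a"
  have "u a w \<in> el (U a) x" using hom_closed[OF u a w] by (simp add: S_fob U_fob)
  then show "L x z (cmp (op_cat C) x y z g f) a (u a w) = L y z g a (nres C F (\<lambda>z w. L x y f z (u z w)) a w)"
   using mf_cmp[OF upper_functor[OF a], of x y z f g "u a w"] x y z f g a w by (simp add: U_far nres_apply)
 qed
qed (rule op_cat_category[OF cC])

text \<open>An element \<open>t\<close> of \<open>T(y, a)\<close> is a transformation
  \<open>S a \<rightarrow> S y\<close>; composing \<open>g\<close> with it gives an element of the
  dual at \<open>y\<close>. This action shows that duals are modules of the opposite kind.\<close>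

lemma dual_yo_natl:
 assumes a: "a \<in> obj C" and g: "g \<in> nat_hom R C F (S a)"
 shows "natl R (op_cat C) (U a) (DD F) (\<lambda>y t. nres C F (\<lambda>z w. low.yo (S y) a t z (g z w)))"
proof (rule natlI)
 fix y assume "y \<in> obj (op_cat C)"
 then have y: "y \<in> obj C" by simp
 note yl = lin_add[OF low.yo_lin[OF low.S_amod[OF y] a _ hom_closed[OF g]]] lin_smult[OF low.yo_lin[OF low.S_amod[OF y] a _ hom_closed[OF g]]]
 show "lin R (fob (U a) y) (fob (DD F) y) (\<lambda>t. nres C F (\<lambda>z w. low.yo (S y) a t z (g z w)))"
  unfolding dual_fob U_fob S_fob[symmetric]
  by (rule linI) (auto simp: nres_apply yl simp del: S_fob intro!: nres_cong intro: yo_hom[OF F low.S_amod[OF y] g a])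
next
 fix y y' f t assume "y \<in> obj (op_cat C)" "y' \<in> obj (op_cat C)" "f \<in> arr (op_cat C) y y'" "t \<in> el (U a) y"
 then have y: "y \<in> obj C" "y' \<in> obj C" "f \<in> arr C y' y" and t: "t \<in> el (S y) a" by (simp_all add: U_fob S_fob)
 show "nres C F (\<lambda>z w. low.yo (S y') a (far (U a) y y' f t) z (g z w)) =
   far (DD F) y y' f (nres C F (\<lambda>z w. low.yo (S y) a t z (g z w)))"
  unfolding dual_far[OF yo_hom[OF F low.S_amod[OF y(1)] g a t]] U_far[OF a] by (rule nres_cong)
    (simp add: nres_apply low.yo_natl_comp[OF low.S_amod[OF y(1)] lower_functor[OF y(2)] L_natl[OF y] a t _ hom_closed[OF g]])
qed

lemma dual_yo_u:
 assumes a: "a \<in> obj C" and g: "g \<in> nat_hom R C F (S a)"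
 shows "nres C F (\<lambda>z w. low.yo (S a) a (uni a) z (g z w)) = g"
proof -
 have "nres C F (\<lambda>z w. low.yo (S a) a (uni a) z (g z w)) = nres C F g"
  by (rule nres_cong) (rule low.yo_id[OF a _ hom_closed[OF g]])
 then show ?thesis using g by (simp add: nat_hom_iff)
qed

lemma dual_amod: "up.amod (DD F)"
proof (rule up.amodI[OF dual_functor])
 fix a g assume "a \<in> obj (op_cat C)" "g \<in> el (DD F) a"
 then have a: "a \<in> obj C" and g: "g \<in> nat_hom R C F (S a)" by (simp_all add: dual_fob)
 show "\<exists>e. natl R (op_cat C) (U a) (DD F) e \<and> e a (uni a) = g"
  by (rule exI, rule conjI[OF dual_yo_natl[OF a g] dual_yo_u[OF a g]])
qed

lemma dual_yo:
 assumes a: "a \<in> obj C" and g: "g \<in> nat_hom R C F (S a)" and x: "x \<in> obj C" and t: "t \<in> el T (x, a)"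
 shows "up.yo (DD F) a g x t = nres C F (\<lambda>z w. low.yo (S x) a t z (g z w))"
 by (rule up.yo_eq[OF dual_functor _ dual_yo_natl[OF a g] dual_yo_u[OF a g]]) (use a x t in \<open>simp_all add: U_fob\<close>)

text \<open>Apply \<open>f\<close> to the dual basis identity: \<open>f w\<close> is the sum of the
  \<open>f (g i)\<close> acted on by \<open>q i w\<close>.\<close>

lemma fdb_hom:
 assumes Fa: "low.amod F" and d: "low.fdb F I a g q" and G: "low.amod G" and f: "f \<in> nat_hom R C F G"
 shows "finsum (hom_mod R C F G) (\<lambda>i. nres C F (\<lambda>z w. low.yo G (a i) (f (a i) (g i)) z (q i z w))) I = f" (is "?s = f")
proof (rule nat_hom_ext[OF _ f])
 note Gf = low.amod_functor[OF G]
 note m = hom_mod_module[OF cR F Gf]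
 interpret H: module R "hom_mod R C F G" by (rule m)
 have I: "finite I" and di: "!!i. i \<in> I ==> a i \<in> obj C" "!!i. i \<in> I ==> g i \<in> el F (a i)"
  "!!i. i \<in> I ==> natl R C F (S (a i)) (q i)"
  and ds: "!!x w. x \<in> obj C ==> w \<in> el F x ==> finsum (fob F x) (\<lambda>i. low.yo F (a i) (g i) x (q i x w)) I = w"
  using d by (auto simp: low.fdb_def)
 have c: "nres C F (\<lambda>z w. low.yo G (a i) (f (a i) (g i)) z (q i z w)) \<in> nat_hom R C F G" if i: "i \<in> I" for i
  by (rule nres_hom[OF F natl_compose[OF di(3)[OF i] low.yo_natl[OF G di(1)[OF i] hom_closed[OF f di(1,2)[OF i]]]]])
 then show "?s \<in> nat_hom R C F G" using H.finsum_closed[of _ I] by (auto simp: Pi_iff)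
 fix z w assume z: "z \<in> obj C" and w: "w \<in> el F z"
 have e: "low.yo G (a i) (f (a i) (g i)) z (q i z w) = f z (low.yo F (a i) (g i) z (q i z w))"
  and e': "low.yo F (a i) (g i) z (q i z w) \<in> el F z" if i: "i \<in> I" for i
 proof -
  note qc = natl_closed[OF di(3)[OF i] z w]
  show "low.yo G (a i) (f (a i) (g i)) z (q i z w) = f z (low.yo F (a i) (g i) z (q i z w))"
   by (rule low.yo_natl_comp[OF Fa Gf nat_hom_natl[OF f] di(1,2)[OF i] z qc])
  show "low.yo F (a i) (g i) z (q i z w) \<in> el F z" by (rule low.yo_closed[OF Fa di(1,2)[OF i] z qc])
 qed
 have "?s z w = finsum (fob G z) (\<lambda>i. nres C F (\<lambda>z w. low.yo G (a i) (f (a i) (g i)) z (q i z w)) z w) I"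
  by (rule lin_finsum[OF m mf_mod[OF Gf z] hom_eval_lin[where F = F, OF Gf z w] I]) (simp add: c)
 also have "\<dots> = finsum (fob G z) (\<lambda>i. f z (low.yo F (a i) (g i) z (q i z w))) I"
  by (rule finsum_eq[OF mf_mod[OF Gf z]]) (simp_all add: nres_apply z w e hom_closed[OF f z e'])
 also have "\<dots> = f z (finsum (fob F z) (\<lambda>i. low.yo F (a i) (g i) z (q i z w)) I)"
  by (rule lin_finsum[OF mf_mod[OF F z] mf_mod[OF Gf z] natl_lin[OF nat_hom_natl[OF f] z] I e', symmetric])
 finally show "?s z w = f z w" using ds[OF z w] by simp
qed

end

text \<open>Elements and functionals exchange roles: the \<open>q i\<close> become elements of the
  dual, evaluation at \<open>g i\<close> becomes a functional, and the identity to check is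
  \<open>fdb_hom\<close> for \<open>S x\<close>.\<close>

lemma fdb_dual:
 assumes Q: "low.amod Q" and d: "low.fdb Q I a g q"
 shows "up.fdb (DD Q) I a (\<lambda>i. nres C Q (q i)) (\<lambda>i x h. h (a i) (g i))"
 unfolding up.fdb_def
proof (intro conjI ballI)
 note Qf = low.amod_functor[OF Q]
 have I: "finite I" and di: "!!i. i \<in> I ==> a i \<in> obj C" "!!i. i \<in> I ==> g i \<in> el Q (a i)"
  "!!i. i \<in> I ==> natl R C Q (S (a i)) (q i)" using d by (auto simp: low.fdb_def)
 show "finite I" by (rule I)
 show "a i \<in> obj (op_cat C)" if "i \<in> I" for i using di(1)[OF that] by simp
 show qc: "nres C Q (q i) \<in> el (DD Q) (a i)" if "i \<in> I" for i
  unfolding dual_fob hom_mod_simps by (rule nres_hom[OF Qf di(3)[OF that]])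
 show "natl R (op_cat C) (DD Q) (U (a i)) (\<lambda>x h. h (a i) (g i))" if i: "i \<in> I" for i
 proof (rule natlI)
  show "lin R (fob (DD Q) x) (fob (U (a i)) x) (\<lambda>h. h (a i) (g i))" if "x \<in> obj (op_cat C)" for x
   using hom_eval_lin[where F = Q, OF lower_functor di(1,2)[OF i], of x] that by (simp add: dual_fob U_fob S_fob)
  show "far (DD Q) x y f h (a i) (g i) = far (U (a i)) x y f (h (a i) (g i))"
   if "x \<in> obj (op_cat C)" "y \<in> obj (op_cat C)" "f \<in> arr (op_cat C) x y" "h \<in> el (DD Q) x" for x y f h
   using that di[OF i] by (simp add: dual_fob dual_far nres_apply U_far)
 qed
 fix x h assume "x \<in> obj (op_cat C)" "h \<in> el (DD Q) x"
 then have x: "x \<in> obj C" and h: "h \<in> nat_hom R C Q (S x)" by (simp_all add: dual_fob)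
 have c: "nres C Q (\<lambda>z w. low.yo (S x) (a i) (h (a i) (g i)) z (q i z w)) \<in> el (DD Q) x" if i: "i \<in> I" for i
  unfolding dual_fob hom_mod_simps
  by (rule nres_hom[OF Qf natl_compose[OF di(3)[OF i] low.yo_natl[OF low.S_amod[OF x] di(1)[OF i] hom_closed[OF h di(1,2)[OF i]]]]])
 have e: "up.yo (DD Q) (a i) (nres C Q (q i)) x (h (a i) (g i)) = nres C Q (\<lambda>z w. low.yo (S x) (a i) (h (a i) (g i)) z (q i z w))"
  if i: "i \<in> I" for i
 proof -
  have "up.yo (DD Q) (a i) (nres C Q (q i)) x (h (a i) (g i)) =
    nres C Q (\<lambda>z w. low.yo (S x) (a i) (h (a i) (g i)) z (nres C Q (q i) z w))"
   using dual_yo[OF Qf di(1)[OF i] _ x] qc[OF i] hom_closed[OF h di(1,2)[OF i]] by (simp add: dual_fob S_fob)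
  then show ?thesis by (simp add: nres_apply cong: nres_cong)
 qed
 have "finsum (fob (DD Q) x) (\<lambda>i. up.yo (DD Q) (a i) (nres C Q (q i)) x (h (a i) (g i))) I =
   finsum (fob (DD Q) x) (\<lambda>i. nres C Q (\<lambda>z w. low.yo (S x) (a i) (h (a i) (g i)) z (q i z w))) I"
  by (rule finsum_eq[OF _ e c]) (use mf_mod[OF dual_functor[OF Qf]] x in simp_all)
 also have "\<dots> = h" unfolding dual_fob by (rule fdb_hom[OF Qf Q d low.S_amod[OF x] h])
 finally show "finsum (fob (DD Q) x) (\<lambda>i. up.yo (DD Q) (a i) (nres C Q (q i)) x (h (a i) (g i))) I = h" .
qed

lemma dual_map_apply: "x \<in> obj C ==> h \<in> nat_hom R C F' (S x) ==> dual_map R C T F F' d x h = nres C F (\<lambda>z w. h z (d z w))"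
 by (simp add: dual_map_def hom_map_def nat_cmp_nres)

lemma dual_map_natl:
 assumes F: "modf R C F" and F': "modf R C F'" and d: "natl R C F F' d"
 shows "natl R (op_cat C) (DD F') (DD F) (dual_map R C T F F' d)"
proof (rule natlI)
 fix x assume "x \<in> obj (op_cat C)"
 then have x: "x \<in> obj C" by simp
 show "lin R (fob (DD F') x) (fob (DD F) x) (dual_map R C T F F' d x)"
  unfolding dual_fob
  by (rule lin_cong[OF precomp_lin[OF F F' lower_functor[OF x] d] hom_mod_module[OF cR F' lower_functor[OF x]]])
    (simp add: dual_map_apply x nat_cmp_nres)
next
 fix x y f h assume "x \<in> obj (op_cat C)" "y \<in> obj (op_cat C)" "f \<in> arr (op_cat C) x y" "h \<in> el (DD F') x"
 then have x: "x \<in> obj C" and y: "y \<in> obj C" and f: "f \<in> arr C y x" and h: "h \<in> nat_hom R C F' (S x)" by (simp_all add: dual_fob)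
 have dh: "nres C F (\<lambda>z w. h z (d z w)) \<in> nat_hom R C F (S x)" by (rule nres_hom[OF F natl_compose[OF d nat_hom_natl[OF h]]])
 have lh: "nres C F' (\<lambda>z w. L x y f z (h z w)) \<in> nat_hom R C F' (S y)" by (rule nat_cmp_natl_hom[OF F' h L_natl[OF x y f]])
 show "dual_map R C T F F' d y (far (DD F') x y f h) = far (DD F) x y f (dual_map R C T F F' d x h)"
  unfolding dual_far[OF h] dual_map_apply[OF x h] dual_map_apply[OF y lh] dual_far[OF dh]
  by (rule nres_cong) (simp add: nres_apply natl_closed[OF d])
qed

lemma dual_map_hom:
 assumes F: "modf R C F" and F': "modf R C F'" and d: "natl R C F F' d"
 shows "dual_map R C T F F' d \<in> nat_hom R (op_cat C) (DD F') (DD F)"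
proof -
 have "nres (op_cat C) (DD F') (dual_map R C T F F' d) = dual_map R C T F F' d"
  by (simp add: nres_def dual_map_def hom_map_def dual_fob fun_eq_iff restrict_def)
 then show ?thesis unfolding nat_hom_iff using dual_map_natl[OF F F' d] by blast
qed

text \<open>\<open>D\<close> applied degreewise. \<open>RD\<close> is the case of the chosen
  resolution, and evaluation at \<open>x\<close> returns exactly the Hom complex into
  \<open>S x\<close>.\<close>

definition DK :: "('o, 'a, 'k, 'm) funcx => ('o, 'a, 'k, ('o, 'm, 'm) nat_trans) funcx" where
 "DK K = \<lparr>chob = (\<lambda>i. DD (chob K (- i))),
   chd = (\<lambda>i. dual_map R C T (chob K (- i - 1)) (chob K (- i)) (chd K (- i - 1)))\<rparr>"

lemma DK_simps [simp]: "chob (DK K) i = DD (chob K (- i))"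
 "chd (DK K) i = dual_map R C T (chob K (- i - 1)) (chob K (- i)) (chd K (- i - 1))" by (simp_all add: DK_def)

lemma RD_DK: "RD R C T F = DK (some_resolution R C (CT_mod R C T) F)" by (simp add: RD_def DK_def Let_def)

lemma eval_DK: "x \<in> obj C ==> eval_cx (DK K) x = hom_cx R C K (S x)"
 by (simp add: eval_cx_def hom_cx_def DK_def dual_map_def dual_fob)

lemma DK_hom:
 assumes K: "fcx R C K"
 shows "chd (DK K) i \<in> nat_hom R (op_cat C) (chob (DK K) i) (chob (DK K) (i + 1))"
proof -
 have e: "- (i + 1) = - i - 1" by simp
 show ?thesis unfolding DK_simps e using fcxD(3)[OF K, of "- i"] by (intro dual_map_hom fcxD(1)[OF K])
qed

lemma DK_fcx:
 assumes K: "fcx R C K"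
 shows "fcx R (op_cat C) (DK K)"
 unfolding fcx_def
proof (intro conjI allI ballI)
 show "modf R (op_cat C) (chob (DK K) i)" for i by (simp add: dual_functor[OF fcxD(1)[OF K]])
 show "natl R (op_cat C) (chob (DK K) i) (chob (DK K) (i + 1)) (chd (DK K) i)" for i
  by (rule nat_hom_natl[OF DK_hom[OF K]])
 fix i x w assume "x \<in> obj (op_cat C)" and w: "w \<in> el (chob (DK K) i) x"
 then have x: "x \<in> obj C" by simp
 have "mcx R (eval_cx (DK K) x)" unfolding eval_DK[OF x] by (rule hom_cx_mcx[OF cR lower_functor[OF x] K])
 then show "chd (DK K) (i + 1) x (chd (DK K) i x w) = 0[fob (chob (DK K) (i + 1 + 1)) x]"
  using w unfolding mcx_def eval_cx_simps by blast
qed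

end

section \<open>Tensor products with duals and with standard functors\<close>

context yoneda_bif
begin

lemma dual_pair: "modf R C Q ==> modf R C G ==> tensor_pair R C (DD Q) G" by (intro tensor_pair.intro cR dual_functor)

text \<open>The canonical map \<open>DQ \<otimes> G \<rightarrow> Hom(Q, G)\<close>:
  \<open>h \<otimes> b\<close> goes to \<open>h\<close> followed by the transformation
  \<open>S x \<rightarrow> G\<close> that \<open>b\<close> determines.\<close>

definition theta ::
 "('o, 'a, 'k, 'm) modfun => ('o, 'a, 'k, 'v) modfun => ('o \<times> ('o, 'm, 'm) nat_trans \<times> 'v => 'k) => ('o, 'm, 'v) nat_trans"
where
 "theta Q G = (SOME \<phi>. lin R (tensor R C (DD Q) G) (hom_mod R C Q G) \<phi> \<and>
   (\<forall>x \<in> obj C. \<forall>h \<in> el (DD Q) x. \<forall>b \<in> el G x.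
    \<phi> (tensor_pair.tn R C (DD Q) G x h b) = nres C Q (\<lambda>z w. low.yo G x b z (h z w))))"

lemma L_far: "x \<in> obj C ==> y \<in> obj C ==> f \<in> arr C x y ==> far (S x) x y f (uni x) \<in> el (S x) y"
 by (rule mf_closed[OF lower_functor _ _ _ low.u_closed])

context
 fixes Q :: "('o, 'a, 'k, 'm) modfun" and G :: "('o, 'a, 'k, 'v) modfun"
 assumes Q: "modf R C Q" and G: "low.amod G"
begin

lemmas Gf = low.amod_functor[OF G]
lemmas tp_dual = dual_pair[OF Q Gf]

lemma theta_ex:
 "\<exists>\<phi>. lin R (tensor R C (DD Q) G) (hom_mod R C Q G) \<phi> \<and>
   (\<forall>x \<in> obj C. \<forall>h \<in> el (DD Q) x. \<forall>b \<in> el G x.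
    \<phi> (tensor_pair.tn R C (DD Q) G x h b) = nres C Q (\<lambda>z w. low.yo G x b z (h z w)))"
proof (rule tensor_pair.tensor_lift[OF tp_dual hom_mod_module[OF cR Q Gf]])
 fix x h b assume x: "x \<in> obj C" and "h \<in> el (DD Q) x" and b: "b \<in> el G x"
 then have h: "h \<in> nat_hom R C Q (S x)" by (simp add: dual_fob)
 show "nres C Q (\<lambda>z w. low.yo G x b z (h z w)) \<in> carrier (hom_mod R C Q G)"
  unfolding hom_mod_simps by (rule yo_hom[OF Q G h x b])
 show "nres C Q (\<lambda>z w. low.yo G x b z ((r *[fob (DD Q) x] h) z w)) = r *[hom_mod R C Q G] nres C Q (\<lambda>z w. low.yo G x b z (h z w))"
  if "r \<in> carrier R" for r
  unfolding dual_fob hom_mod_simps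
  by (rule nres_cong) (simp add: nres_apply lin_smult[OF natl_lin[OF low.yo_natl[OF G x b]] that hom_closed[OF h]])
 show "nres C Q (\<lambda>z w. low.yo G x (r *[fob G x] b) z (h z w)) = r *[hom_mod R C Q G] nres C Q (\<lambda>z w. low.yo G x b z (h z w))"
  if "r \<in> carrier R" for r
  unfolding hom_mod_simps by (rule nres_cong) (simp add: nres_apply low.yo_smult[OF G x b that _ hom_closed[OF h]])
 show "nres C Q (\<lambda>z w. low.yo G x (b +[fob G x] b') z (h z w)) =
   nres C Q (\<lambda>z w. low.yo G x b z (h z w)) +[hom_mod R C Q G] nres C Q (\<lambda>z w. low.yo G x b' z (h z w))"
  if "b' \<in> el G x" for b'
  unfolding hom_mod_simps by (rule nres_cong) (simp add: nres_apply low.yo_add[OF G x b that _ hom_closed[OF h]])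
 show "nres C Q (\<lambda>z w. low.yo G x b z ((h +[fob (DD Q) x] h') z w)) =
   nres C Q (\<lambda>z w. low.yo G x b z (h z w)) +[hom_mod R C Q G] nres C Q (\<lambda>z w. low.yo G x b z (h' z w))"
  if "h' \<in> el (DD Q) x" for h'
 proof -
  have h': "h' \<in> nat_hom R C Q (S x)" using that by (simp add: dual_fob)
  show ?thesis unfolding dual_fob hom_mod_simps
   by (rule nres_cong) (simp add: nres_apply lin_add[OF natl_lin[OF low.yo_natl[OF G x b]] hom_closed[OF h] hom_closed[OF h']])
 qed
next
 fix x y f h b assume x: "x \<in> obj C" and y: "y \<in> obj C" and f: "f \<in> arr C x y" and "h \<in> el (DD Q) y"
  and b: "b \<in> el G x"
 then have h: "h \<in> nat_hom R C Q (S y)" by (simp add: dual_fob)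
 show "nres C Q (\<lambda>z w. low.yo G x b z (far (DD Q) y x f h z w)) = nres C Q (\<lambda>z w. low.yo G y (far G x y f b) z (h z w))"
  unfolding dual_far[OF h]
 proof (rule nres_cong)
  fix z w assume z: "z \<in> obj C" and w: "w \<in> el Q z"
  have "low.yo G y (low.yo G x b y (far (S x) x y f (uni x))) z (h z w) =
    low.yo G x b z (low.yo (S x) y (far (S x) x y f (uni x)) z (h z w))"
   by (rule low.yo_yo[OF G x b y L_far[OF x y f] z hom_closed[OF h z w]])
  then show "low.yo G x b z (nres C Q (\<lambda>z w. L y x f z (h z w)) z w) = low.yo G y (far G x y f b) z (h z w)"
   unfolding low.yo_far[OF G x b y f] L_yo[OF x y f z hom_closed[OF h z w]] by (simp add: nres_apply z w)
 qed
qed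

lemma theta_lin: "lin R (tensor R C (DD Q) G) (hom_mod R C Q G) (theta Q G)"
 and theta_tn: "[|x \<in> obj C; h \<in> nat_hom R C Q (S x); b \<in> el G x|] ==>
   theta Q G (tensor_pair.tn R C (DD Q) G x h b) = nres C Q (\<lambda>z w. low.yo G x b z (h z w))"
 using someI_ex[OF theta_ex] unfolding theta_def[symmetric] by (simp_all add: dual_fob)

text \<open>Elements of \<open>T(x, a)\<close> move across the tensor sign, since the arrows span.\<close>

lemma tn_yo:
 assumes x: "x \<in> obj C" and a: "a \<in> obj C" and b: "b \<in> el G x" and q: "q \<in> nat_hom R C Q (S a)"
  and t: "t \<in> el (S x) a"
 shows "tensor_pair.tn R C (DD Q) G a q (low.yo G x b a t) =
  tensor_pair.tn R C (DD Q) G x (nres C Q (\<lambda>z w. low.yo (S x) a t z (q z w))) b"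
proof -
 let ?tn = "tensor_pair.tn R C (DD Q) G" and ?T = "tensor R C (DD Q) G"
 let ?l = "\<lambda>t. ?tn a q (low.yo G x b a t)" and ?r = "\<lambda>t. ?tn x (nres C Q (\<lambda>z w. low.yo (S x) a t z (q z w))) b"
 note m = tensor_pair.tensor_module[OF tp_dual]
 have q': "q \<in> el (DD Q) a" using q by (simp add: dual_fob)
 have x': "x \<in> obj (op_cat C)" using x by simp
 have r1: "lin R (fob (DD Q) x) ?T (\<lambda>h. ?tn x h b)"
  by (rule linI) (simp_all add: tensor_pair.tn_closed[OF tp_dual x _ b] tensor_pair.tn_add_l[OF tp_dual x _ _ b]
    tensor_pair.tn_smult_l[OF tp_dual x _ _ b])
 have l1: "lin R (fob G a) ?T (\<lambda>c. ?tn a q c)"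
  by (rule linI) (simp_all add: tensor_pair.tn_closed[OF tp_dual a q'] tensor_pair.tn_add_r[OF tp_dual a q']
    tensor_pair.tn_smult_r[OF tp_dual a _ q'])
 have l: "lin R (fob (S x) a) ?T ?l" by (rule lin_compose[OF natl_lin[OF low.yo_natl[OF G x b] a] l1])
 have "lin R (fob (U a) x) ?T ?r" by (rule lin_compose[OF natl_lin[OF dual_yo_natl[OF Q a q] x'] r1])
 then have r: "lin R (fob (S x) a) ?T ?r" by (simp add: U_fob S_fob)
 have "submodule {t \<in> el (S x) a. ?l t = ?r t} R (fob (S x) a)"
 proof -
  note sm = mf_mod[OF lower_functor[OF x] a]
  interpret M: module R "fob (S x) a" by (rule sm)
  show ?thesis by (rule submoduleI'[OF sm])
     (auto simp: lin_zero[OF sm m l] lin_zero[OF sm m r] lin_add[OF l] lin_add[OF r] lin_smult[OF l] lin_smult[OF r])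
 qed
 then have "el (S x) a \<subseteq> {t \<in> el (S x) a. ?l t = ?r t}"
 proof (rule low.spanning[OF x a])
  fix f assume f: "f \<in> arr C x a"
  have "?l (far (S x) x a f (uni x)) = ?tn a q (far G x a f b)" by (simp add: low.yo_far[OF G x b a f])
  also have "\<dots> = ?tn x (far (DD Q) a x f q) b" by (rule tensor_pair.tn_bal[OF tp_dual x a f q' b, symmetric])
  also have "far (DD Q) a x f q = nres C Q (\<lambda>z w. low.yo (S x) a (far (S x) x a f (uni x)) z (q z w))"
   unfolding dual_far[OF q] by (rule nres_cong) (rule L_yo[OF x a f _ hom_closed[OF q], symmetric])
  finally show "far (S x) x a f (uni x) \<in> {t \<in> el (S x) a. ?l t = ?r t}" using L_far[OF x a f] by simp
 qed
 then show ?thesis using t by blast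
qed

text \<open>The inverse sends \<open>f\<close> to the sum of the tensors
  \<open>q i \<otimes> f (g i)\<close>. That \<open>theta\<close> takes this sum back to
  \<open>f\<close> is \<open>fdb_hom\<close>.\<close>

lemma theta_bij:
 assumes Qa: "low.amod Q" and d: "low.fdb Q I a g q"
 shows "bij_betw (theta Q G) (carrier (tensor R C (DD Q) G)) (nat_hom R C Q G)"
proof -
 let ?tn = "tensor_pair.tn R C (DD Q) G" and ?T = "tensor R C (DD Q) G"
 let ?q = "\<lambda>i. nres C Q (q i)"
 let ?z = "\<lambda>f. finsum ?T (\<lambda>i. ?tn (a i) (?q i) (f (a i) (g i))) I"
 note m = tensor_pair.tensor_module[OF tp_dual] and hm = hom_mod_module[OF cR Q Gf]
 have I: "finite I" and di: "!!i. i \<in> I ==> a i \<in> obj C" "!!i. i \<in> I ==> g i \<in> el Q (a i)"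
  "!!i. i \<in> I ==> natl R C Q (S (a i)) (q i)" using d by (auto simp: low.fdb_def)
 have qh: "?q i \<in> nat_hom R C Q (S (a i))" if "i \<in> I" for i by (rule nres_hom[OF Q di(3)[OF that]])
 then have qd: "?q i \<in> el (DD Q) (a i)" if "i \<in> I" for i using that by (simp add: dual_fob)
 have sl: "lin R (hom_mod R C Q G) ?T (\<lambda>f. ?tn (a i) (?q i) (f (a i) (g i)))" if i: "i \<in> I" for i
 proof (rule lin_compose[OF hom_eval_lin[where F = Q, OF Gf di(1,2)[OF i]]])
  show "lin R (fob G (a i)) ?T (?tn (a i) (?q i))"
   by (rule linI) (simp_all add: tensor_pair.tn_closed[OF tp_dual di(1)[OF i] qd[OF i]]
     tensor_pair.tn_add_r[OF tp_dual di(1)[OF i] qd[OF i]] tensor_pair.tn_smult_r[OF tp_dual di(1)[OF i] _ qd[OF i]])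
 qed
 have zl: "lin R (hom_mod R C Q G) ?T ?z" by (rule lin_finsum_maps[OF hm m I sl])
 have qr: "nres C Q (\<lambda>z w. low.yo H (a i) c z (?q i z w)) = nres C Q (\<lambda>z w. low.yo H (a i) c z (q i z w))"
  for H :: "('o, 'a, 'k, 'w) modfun" and i c by (rule nres_cong) (simp add: nres_apply)
 have tz: "theta Q G (?z f) = f" if f: "f \<in> nat_hom R C Q G" for f
 proof -
  note fc = hom_closed[OF f di(1,2)]
  have tc: "?tn (a i) (?q i) (f (a i) (g i)) \<in> carrier ?T" if "i \<in> I" for i
   by (rule tensor_pair.tn_closed[OF tp_dual di(1)[OF that] qd[OF that] fc[OF that that]])
  have e: "theta Q G (?tn (a i) (?q i) (f (a i) (g i))) = nres C Q (\<lambda>z w. low.yo G (a i) (f (a i) (g i)) z (q i z w))"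
   if i: "i \<in> I" for i unfolding theta_tn[OF di(1)[OF i] qh[OF i] fc[OF i i]] by (rule qr)
  have "theta Q G (?z f) = finsum (hom_mod R C Q G) (\<lambda>i. theta Q G (?tn (a i) (?q i) (f (a i) (g i)))) I"
   by (rule lin_finsum[OF m hm theta_lin I tc])
  also have "\<dots> = finsum (hom_mod R C Q G) (\<lambda>i. nres C Q (\<lambda>z w. low.yo G (a i) (f (a i) (g i)) z (q i z w))) I"
   by (rule finsum_eq[OF hm e])
     (simp_all only: hom_mod_simps nres_hom[OF Q natl_compose[OF di(3) low.yo_natl[OF G di(1) fc]]])
  also have "\<dots> = f" by (rule fdb_hom[OF Q Qa d G f])
  finally show ?thesis .
 qed
 \<comment> \<open>On \<open>h \<otimes> b\<close>, the factor \<open>h (g i)\<close> is moved by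
   \<open>tn_yo\<close> from the right of the tensor sign to the left; the left entries then add up
   to \<open>h\<close> by \<open>fdb_hom\<close>.\<close>
 have zt: "?z (theta Q G v) = v" if v: "v \<in> carrier ?T" for v
 proof (rule tensor_pair.tensor_unique[OF tp_dual m lin_compose[OF theta_lin zl] lin_id _ v])
  fix x h b assume x: "x \<in> obj C" and h': "h \<in> el (DD Q) x" and b: "b \<in> el G x"
  then have h: "h \<in> nat_hom R C Q (S x)" by (simp add: dual_fob)
  have x': "x \<in> obj (op_cat C)" using x by simp
  let ?h = "\<lambda>i. nres C Q (\<lambda>z w. low.yo (S x) (a i) (h (a i) (g i)) z (q i z w))"
  note hc = hom_closed[OF h di(1,2)]
  have hd: "?h i \<in> el (DD Q) x" if i: "i \<in> I" for i
   unfolding dual_fob hom_mod_simps by (rule nres_hom[OF Q natl_compose[OF di(3)[OF i] low.yo_natl[OF low.S_amod[OF x] di(1)[OF i] hc[OF i i]]]])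
  have tl: "lin R (fob (DD Q) x) ?T (\<lambda>h. ?tn x h b)"
   by (rule linI) (simp_all add: tensor_pair.tn_closed[OF tp_dual x _ b] tensor_pair.tn_add_l[OF tp_dual x _ _ b]
     tensor_pair.tn_smult_l[OF tp_dual x _ _ b])
  have "?z (theta Q G (?tn x h b)) = finsum ?T (\<lambda>i. ?tn x (?h i) b) I"
  proof (rule finsum_eq[OF m])
   fix i assume i: "i \<in> I"
   show "?tn (a i) (?q i) (theta Q G (?tn x h b) (a i) (g i)) = ?tn x (?h i) b"
    unfolding theta_tn[OF x h b] nres_apply[OF di(1,2)[OF i]] tn_yo[OF x di(1)[OF i] b qh[OF i] hc[OF i i]] qr ..
   show "?tn x (?h i) b \<in> carrier ?T" by (rule tensor_pair.tn_closed[OF tp_dual x hd[OF i] b])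
  qed
  also have "\<dots> = ?tn x (finsum (fob (DD Q) x) ?h I) b"
   by (rule lin_finsum[OF mf_mod[OF dual_functor[OF Q] x'] m tl I hd, symmetric])
  also have "finsum (fob (DD Q) x) ?h I = h" unfolding dual_fob by (rule fdb_hom[OF Q Qa d low.S_amod[OF x] h])
  finally show "?z (theta Q G (?tn x h b)) = ?tn x h b" .
 qed
 show ?thesis by (rule bij_betw_byWitness[where f' = ?z])
    (use tz zt lin_closed[OF theta_lin] lin_closed[OF zl] in \<open>auto simp: image_subset_iff\<close>)
qed

end

lemma theta_precomp:
 fixes Q Q' :: "('o, 'a, 'k, 'm) modfun" and G :: "('o, 'a, 'k, 'v) modfun"
 assumes Q: "modf R C Q" and Q': "modf R C Q'" and G: "low.amod G"
  and d: "natl R C Q Q' d" and v: "v \<in> carrier (tensor R C (DD Q') G)"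
 shows "theta Q G (tensor_map R C (DD Q') G (DD Q) G (dual_map R C T Q Q' d) (nat_id C G) v) = nat_cmp C Q (theta Q' G v) d"
proof -
 note Gf = low.amod_functor[OF G]
 note dm = dual_map_natl[OF Q Q' d]
 note D = dual_functor[OF Q] and D' = dual_functor[OF Q']
 show ?thesis
 proof (rule tensor_pair.tensor_unique[OF dual_pair[OF Q' Gf] hom_mod_module[OF cR Q Gf]
    lin_compose[OF tmap_lin[OF cR Gf D' D dm] theta_lin[OF Q G]]
    lin_compose[OF theta_lin[OF Q' G] precomp_lin[OF Q Q' Gf d]] _ v])
  fix x h b assume x: "x \<in> obj C" and h': "h \<in> el (DD Q') x" and b: "b \<in> el G x"
  then have h: "h \<in> nat_hom R C Q' (S x)" by (simp add: dual_fob)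
  have dh: "nres C Q (\<lambda>z w. h z (d z w)) \<in> nat_hom R C Q (S x)" by (rule nres_hom[OF Q natl_compose[OF d nat_hom_natl[OF h]]])
  show "theta Q G (tensor_map R C (DD Q') G (DD Q) G (dual_map R C T Q Q' d) (nat_id C G) (tensor_pair.tn R C (DD Q') G x h b)) =
    nat_cmp C Q (theta Q' G (tensor_pair.tn R C (DD Q') G x h b)) d"
   unfolding tmap_tn[OF cR Gf D' D dm x h' b] dual_map_apply[OF x h] theta_tn[OF Q G x dh b] theta_tn[OF Q' G x h b] nat_cmp_nres
   by (rule nres_cong) (simp add: nres_apply natl_closed[OF d])
 qed
qed

lemma theta_postcomp:
 fixes Q :: "('o, 'a, 'k, 'm) modfun" and G :: "('o, 'a, 'k, 'v) modfun" and G' :: "('o, 'a, 'k, 'w) modfun"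
 assumes Q: "modf R C Q" and G: "low.amod G" and G': "low.amod G'"
  and p: "natl R C G G' p" and v: "v \<in> carrier (tensor R C (DD Q) G)"
 shows "theta Q G' (tensor_map R C (DD Q) G (DD Q) G' (nat_id C (DD Q)) p v) = nat_cmp C Q p (theta Q G v)"
proof -
 note Gf = low.amod_functor[OF G] and Gf' = low.amod_functor[OF G']
 note D = dual_functor[OF Q]
 have i: "natl R (op_cat C) (DD Q) (DD Q) (nat_id C (DD Q))"
  by (rule natl_cong[OF D natl_id]) (simp add: nat_id_apply)
 note tm = tensor_map_props[OF dual_pair[OF Q Gf] dual_pair[OF Q Gf'] i p]
 show ?thesis
 proof (rule tensor_pair.tensor_unique[OF dual_pair[OF Q Gf] hom_mod_module[OF cR Q Gf']
    lin_compose[OF tm(1) theta_lin[OF Q G']] lin_compose[OF theta_lin[OF Q G] postcomp_lin[OF Q Gf Gf' p]] _ v])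
  fix x h b assume x: "x \<in> obj C" and h': "h \<in> el (DD Q) x" and b: "b \<in> el G x"
  then have h: "h \<in> nat_hom R C Q (S x)" by (simp add: dual_fob)
  show "theta Q G' (tensor_map R C (DD Q) G (DD Q) G' (nat_id C (DD Q)) p (tensor_pair.tn R C (DD Q) G x h b)) =
    nat_cmp C Q p (theta Q G (tensor_pair.tn R C (DD Q) G x h b))"
   unfolding tm(2)[OF x h' b] nat_id_apply[OF x h'] theta_tn[OF Q G' x h natl_closed[OF p x b]] theta_tn[OF Q G x h b] nat_cmp_nres
   by (rule nres_cong) (simp add: nres_apply low.yo_natl_comp[OF G Gf' p x b _ hom_closed[OF h]])
 qed
qed

lemma theta_coh_iso:
 fixes K :: "('o, 'a, 'k, 'm) funcx" and G :: "('o, 'a, 'k, 'v) modfun"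
 assumes K: "fcx R C K" and Ka: "!!i. low.amod (chob K i)" and G: "low.amod G"
  and d: "!!i. \<exists>(I :: nat set) a g q. low.fdb (chob K i) I a g q"
 shows "coh_iso_at R (tensor_cx R C (DK K) G) (hom_cx R C K G) i (theta (chob K (- i)) G)"
proof -
 note Kf = fcxD(1)[OF K] and Gf = low.amod_functor[OF G]
 show ?thesis
 proof (rule bij_chain_coh_iso[where f = "\<lambda>i. theta (chob K (- i)) G", OF tensor_cx_mcx[OF cR Gf DK_fcx[OF K]] hom_cx_mcx[OF cR Gf K]])
  fix i
  show "lin R (chob (tensor_cx R C (DK K) G) i) (chob (hom_cx R C K G) i) (theta (chob K (- i)) G)"
   by (simp add: hom_cx_chob theta_lin[OF Kf G])
  obtain I :: "nat set" and a g q where "low.fdb (chob K (- i)) I a g q" using d by blast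
  then show "bij_betw (theta (chob K (- i)) G) (carrier (chob (tensor_cx R C (DK K) G) i)) (carrier (chob (hom_cx R C K G) i))"
   using theta_bij[OF Kf G Ka] by (simp add: hom_cx_chob)
  fix v assume v: "v \<in> carrier (chob (tensor_cx R C (DK K) G) i)"
  then have v': "v \<in> carrier (tensor R C (DD (chob K (- i))) G)" by simp
  have e: "- (i + 1) = - i - 1" by simp
  have dn: "natl R C (chob K (- i - 1)) (chob K (- i)) (chd K (- i - 1))" by (rule fcxD(3)[OF K])
  have c: "theta (chob K (- i)) G v \<in> nat_hom R C (chob K (- i)) G" using lin_closed[OF theta_lin[OF Kf G] v'] by simp
  show "chd (hom_cx R C K G) i (theta (chob K (- i)) G v) = theta (chob K (- (i + 1))) G (chd (tensor_cx R C (DK K) G) i v)"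
   unfolding hom_cx_chd[OF c] tensor_cx_simps DK_simps e by (rule theta_precomp[OF Kf Kf G dn v', symmetric])
 qed
qed

text \<open>The class of an arrow \<open>y \<rightarrow> z\<close> acts on \<open>T(x, y)\<close> in
  the same way whether it is read in the covariant or the contravariant variable, since both
  transformations agree on \<open>uni y\<close>.\<close>

lemma up_yo_S:
 assumes y: "y \<in> obj C" and z: "z \<in> obj C" and f: "f \<in> arr C y z" and x: "x \<in> obj C" and t: "t \<in> el T (x, y)"
 shows "up.yo (U z) y (far (U z) z y f (uni z)) x t = far (S x) y z f t"
proof (rule up.yo_eq[OF upper_functor[OF z]])
 show "natl R (op_cat C) (U y) (U z) (\<lambda>x. far (S x) y z f)"
 proof (rule natlI)
  show "lin R (fob (U y) x) (fob (U z) x) (far (S x) y z f)" if "x \<in> obj (op_cat C)" for x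
   using mf_lin[OF lower_functor y z f, of x] that by (simp add: S_fob U_fob)
  show "far (S w') y z f (far (U y) w w' g s) = far (U z) w w' g (far (S w) y z f s)"
   if "w \<in> obj (op_cat C)" "w' \<in> obj (op_cat C)" "g \<in> arr (op_cat C) w w'" "s \<in> el (U y) w" for w w' g s
   using T_swap[of w w' y z g f s] that y z f by (simp add: T_lower_def T_upper_def)
 qed
 show "far (S y) y z f (uni y) = far (U z) z y f (uni z)"
  using mu_basis[OF y z f] by (simp add: T_lower_def T_upper_def)
qed (use x y t in \<open>simp_all add: U_fob\<close>)

text \<open>The map sends \<open>a \<otimes> t\<close> to \<open>a\<close> acted on by
  \<open>t\<close>, its inverse sends \<open>a\<close> to \<open>a \<otimes> uni x\<close>. One
  composite is the identity by \<open>up.yo_u\<close>; for the other it suffices to take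
  \<open>t\<close> the class of an arrow, where the claim is the balancing relation.\<close>

lemma tensor_standard:
 assumes F: "up.amod F" and x: "x \<in> obj C"
 shows "\<exists>e. lin R (tensor R C F (S x)) (fob F x) e \<and> bij_betw e (carrier (tensor R C F (S x))) (el F x) \<and>
  (\<forall>y \<in> obj C. \<forall>a \<in> el F y. \<forall>t \<in> el (S x) y. e (tensor_pair.tn R C F (S x) y a t) = up.yo F y a x t)"
proof -
 note Ff = up.amod_functor[OF F]
 have tpF: "tensor_pair R C F (S x)" by (intro tensor_pair.intro cR Ff lower_functor x)
 let ?tn = "tensor_pair.tn R C F (S x)" and ?T = "tensor R C F (S x)"
 have x': "x \<in> obj (op_cat C)" using x by simp
 note Fm = mf_mod[OF Ff x'] and m = tensor_pair.tensor_module[OF tpF]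
 have "\<exists>\<phi>. lin R ?T (fob F x) \<phi> \<and> (\<forall>y \<in> obj C. \<forall>a \<in> el F y. \<forall>t \<in> el (S x) y. \<phi> (?tn y a t) = up.yo F y a x t)"
 proof (rule tensor_pair.tensor_lift[OF tpF Fm])
  fix y a t assume "y \<in> obj C" and a: "a \<in> el F y" and t: "t \<in> el (S x) y"
  then have y: "y \<in> obj (op_cat C)" by simp
  have U: "fob (S x) y = fob (U y) x" by (simp add: S_fob U_fob)
  note l = natl_lin[OF up.yo_natl[OF F y a] x']
  show "up.yo F y a x t \<in> el F x" using lin_closed[OF l] t U by simp
  show "up.yo F y a x (t +[fob (S x) y] t') = up.yo F y a x t +[fob F x] up.yo F y a x t'" if "t' \<in> el (S x) y" for t'
   using lin_add[OF l] t that U by simp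
  show "up.yo F y a x (r *[fob (S x) y] t) = r *[fob F x] up.yo F y a x t" if "r \<in> carrier R" for r
   using lin_smult[OF l that] t U by simp
  show "up.yo F y (a +[fob F y] a') x t = up.yo F y a x t +[fob F x] up.yo F y a' x t" if "a' \<in> el F y" for a'
   using up.yo_add[OF F y a that x'] t U by simp
  show "up.yo F y (r *[fob F y] a) x t = r *[fob F x] up.yo F y a x t" if "r \<in> carrier R" for r
   using up.yo_smult[OF F y a that x'] t U by simp
 next
  fix y z f a t assume y: "y \<in> obj C" and z: "z \<in> obj C" and f: "f \<in> arr C y z" and a: "a \<in> el F z"
   and t: "t \<in> el (S x) y"
  have o: "y \<in> obj (op_cat C)" "z \<in> obj (op_cat C)" "f \<in> arr (op_cat C) z y" using y z f by simp_all
  have s: "far (U z) z y f (uni z) \<in> el (U z) y" by (rule mf_closed[OF upper_functor[OF z] o(2,1,3) up.u_closed[OF o(2)]])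
  have t': "t \<in> el T (x, y)" "t \<in> el (U y) x" using t by (simp_all add: S_fob U_fob)
  have "up.yo F y (up.yo F z a y (far (U z) z y f (uni z))) x t = up.yo F z a x (up.yo (U z) y (far (U z) z y f (uni z)) x t)"
   by (rule up.yo_yo[OF F o(2) a o(1) s x' t'(2)])
  then show "up.yo F y (far F z y f a) x t = up.yo F z a x (far (S x) y z f t)"
   unfolding up.yo_far[OF F o(2) a o(1,3)] up_yo_S[OF y z f x t'(1)] .
 qed
 then obtain e where e: "lin R ?T (fob F x) e"
  "!!y a t. y \<in> obj C ==> a \<in> el F y ==> t \<in> el (S x) y ==> e (?tn y a t) = up.yo F y a x t" by blast
 have ux: "uni x \<in> el (S x) x" by (rule low.u_closed[OF x])
 have gl: "lin R (fob F x) ?T (\<lambda>a. ?tn x a (uni x))"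
  by (rule linI) (simp_all add: tensor_pair.tn_closed[OF tpF x _ ux] tensor_pair.tn_add_l[OF tpF x _ _ ux] tensor_pair.tn_smult_l[OF tpF x _ _ ux])
 have eg: "e (?tn x a (uni x)) = a" if "a \<in> el F x" for a unfolding e(2)[OF x that ux] by (rule up.yo_u[OF F x' that])
 have ge: "?tn x (e v) (uni x) = v" if v: "v \<in> carrier ?T" for v
 proof (rule tensor_pair.tensor_unique[OF tpF m lin_compose[OF e(1) gl] lin_id _ v])
  fix y a t assume y: "y \<in> obj C" and a: "a \<in> el F y" and t: "t \<in> el (S x) y"
  have y': "y \<in> obj (op_cat C)" using y by simp
  let ?l = "\<lambda>t. ?tn x (up.yo F y a x t) (uni x)"
  have U: "fob (U y) x = fob (S x) y" by (simp add: S_fob U_fob)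
  have l: "lin R (fob (S x) y) ?T ?l" using lin_compose[OF natl_lin[OF up.yo_natl[OF F y' a] x'] gl] unfolding U .
  have r: "lin R (fob (S x) y) ?T (?tn y a)"
   by (rule linI) (simp_all add: tensor_pair.tn_closed[OF tpF y a] tensor_pair.tn_add_r[OF tpF y a] tensor_pair.tn_smult_r[OF tpF y _ a])
  note sm = mf_mod[OF lower_functor[OF x] y]
  interpret M: module R "fob (S x) y" by (rule sm)
  have "submodule {t \<in> el (S x) y. ?l t = ?tn y a t} R (fob (S x) y)" by (rule submoduleI'[OF sm])
     (auto simp: lin_zero[OF sm m l] lin_zero[OF sm m r] lin_add[OF l] lin_add[OF r] lin_smult[OF l] lin_smult[OF r])
  then have "el (S x) y \<subseteq> {t \<in> el (S x) y. ?l t = ?tn y a t}"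
  proof (rule low.spanning[OF x y])
   fix f assume f: "f \<in> arr C x y"
   have s: "far (S x) x y f (uni x) = far (U y) y x f (uni y)"
    using mu_basis[OF x y f] by (simp add: T_lower_def T_upper_def)
   have f': "f \<in> arr (op_cat C) y x" using f by simp
   have "?l (far (S x) x y f (uni x)) = ?tn x (far F y x f a) (uni x)" unfolding s up.yo_far[OF F y' a x' f'] ..
   also have "\<dots> = ?tn y a (far (S x) x y f (uni x))" by (rule tensor_pair.tn_bal[OF tpF x y f a ux])
   finally show "far (S x) x y f (uni x) \<in> {t \<in> el (S x) y. ?l t = ?tn y a t}" using L_far[OF x y f] by simp
  qed
  then show "?tn x (e (?tn y a t)) (uni x) = ?tn y a t" using t e(2)[OF y a t] by auto
 qed
 have "bij_betw e (carrier ?T) (el F x)" by (rule bij_betw_byWitness[where f' = "\<lambda>a. ?tn x a (uni x)"])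
    (use eg ge lin_closed[OF e(1)] lin_closed[OF gl] in \<open>auto simp: image_subset_iff\<close>)
 then show ?thesis using e by blast
qed

lemma tensor_standard_coh_iso:
 assumes K: "fcx R (op_cat C) K" and Ka: "!!i. up.amod (chob K i)" and x: "x \<in> obj C"
 shows "\<exists>e. coh_iso_at R (tensor_cx R C K (S x)) (eval_cx K x) i e"
proof -
 note Kf = fcxD(1)[OF K] and G = lower_functor[OF x]
 have x': "x \<in> obj (op_cat C)" using x by simp
 have "\<forall>i. \<exists>e. lin R (tensor R C (chob K i) (S x)) (fob (chob K i) x) e \<and>
   bij_betw e (carrier (tensor R C (chob K i) (S x))) (el (chob K i) x) \<and>
   (\<forall>y \<in> obj C. \<forall>a \<in> el (chob K i) y. \<forall>t \<in> el (S x) y.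
    e (tensor_pair.tn R C (chob K i) (S x) y a t) = up.yo (chob K i) y a x t)" using tensor_standard[OF Ka x] by blast
 then obtain e where e: "!!i. lin R (tensor R C (chob K i) (S x)) (fob (chob K i) x) (e i)"
  "!!i. bij_betw (e i) (carrier (tensor R C (chob K i) (S x))) (el (chob K i) x)"
  "!!i y a t. y \<in> obj C ==> a \<in> el (chob K i) y ==> t \<in> el (S x) y ==>
   e i (tensor_pair.tn R C (chob K i) (S x) y a t) = up.yo (chob K i) y a x t" by metis
 have "coh_iso_at R (tensor_cx R C K (S x)) (eval_cx K x) i (e i)"
 proof (rule bij_chain_coh_iso[OF tensor_cx_mcx[OF cR G K] fcx_mcx[OF K x']])
  show "lin R (chob (tensor_cx R C K (S x)) i) (chob (eval_cx K x) i) (e i)" for i using e(1) by simp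
  show "bij_betw (e i) (carrier (chob (tensor_cx R C K (S x)) i)) (carrier (chob (eval_cx K x) i))" for i using e(2) by simp
  fix i v assume "v \<in> carrier (chob (tensor_cx R C K (S x)) i)"
  then have v: "v \<in> carrier (tensor R C (chob K i) (S x))" by simp
  note tpi = tp[OF cR G Kf]
  note dn = fcxD(2)[OF K]
  note ml = tmap_lin[OF cR G Kf Kf dn]
  show "chd (eval_cx K x) i (e i v) = e (i + 1) (chd (tensor_cx R C K (S x)) i v)"
   unfolding eval_cx_simps tensor_cx_simps
  proof (rule tensor_pair.tensor_unique[OF tpi mf_mod[OF Kf x'] lin_compose[OF e(1) natl_lin[OF dn x']] lin_compose[OF ml e(1)] _ v])
   fix y a t assume y: "y \<in> obj C" and a: "a \<in> el (chob K i) y" and t: "t \<in> el (S x) y"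
   have y': "y \<in> obj (op_cat C)" using y by simp
   have t': "t \<in> el (U y) x" using t by (simp add: S_fob U_fob)
   show "chd K i x (e i (tensor_pair.tn R C (chob K i) (S x) y a t)) =
    e (i + 1) (tensor_map R C (chob K i) (S x) (chob K (i + 1)) (S x) (chd K i) (nat_id C (S x)) (tensor_pair.tn R C (chob K i) (S x) y a t))"
    unfolding tmap_tn[OF cR G Kf Kf dn y a t] e(3)[OF y a t] e(3)[OF y natl_closed[OF dn y' a] t]
    by (rule up.yo_natl_comp[OF Ka Kf dn y' a x' t', symmetric])
  qed
 qed
 then show ?thesis by (rule exI[of _ "e i"])
qed

end

section \<open>Comparison of Ext and Tor\<close>

lemma coh_iso_compose:
 assumes K: "mcx R K" and L: "mcx R L" and M: "mcx R M" and f: "coh_iso_at R K L i f" and g: "coh_iso_at R L M i g"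
 shows "coh_iso_at R K M i (\<lambda>u. g (f u))"
 unfolding coh_iso_at_def coh_map_at_def
proof (intro conjI ballI impI)
 have fl: "lin R (Zmod K i) (Zmod L i) f" and gl: "lin R (Zmod L i) (Zmod M i) g"
  using f g by (auto simp: coh_iso_at_def coh_map_at_def)
 have fz: "f u \<in> cocycles L i" if "u \<in> cocycles K i" for u using lin_closed[OF fl] that by simp
 have gz: "g u \<in> cocycles M i" if "u \<in> cocycles L i" for u using lin_closed[OF gl] that by simp
 show "lin R (Zmod K i) (Zmod M i) (\<lambda>u. g (f u))" by (rule lin_compose[OF fl gl])
 show "g (f u) \<in> coboundaries M i" if "u \<in> coboundaries K i" for u
  using f g that by (auto simp: coh_iso_at_def coh_map_at_def)
 show "u \<in> coboundaries K i" if "u \<in> cocycles K i" "g (f u) \<in> coboundaries M i" for u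
  using f g that fz by (auto simp: coh_iso_at_def)
 fix v assume v: "v \<in> cocycles M i"
 then obtain w where w: "w \<in> cocycles L i" "v -[chob M i] g w \<in> coboundaries M i" using g by (auto simp: coh_iso_at_def)
 obtain u where u: "u \<in> cocycles K i" "w -[chob L i] f u \<in> coboundaries L i" using f w by (auto simp: coh_iso_at_def)
 note ZL = submodule_module[OF mcxD(1)[OF L] cocycles_submodule[OF L]]
 note ZM = submodule_module[OF mcxD(1)[OF M] cocycles_submodule[OF M]]
 have "g (w -[chob L i] f u) = g w -[chob M i] g (f u)"
  using lin_minus[OF ZL ZM gl, of w "f u"] w(1) fz[OF u(1)] gz[OF fz[OF u(1)]]
  by (simp add: minus_restrict[OF mcxD(1)[OF L] cocycles_submodule[OF L]] minus_restrict[OF mcxD(1)[OF M] cocycles_submodule[OF M]])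
 moreover have "g (w -[chob L i] f u) \<in> coboundaries M i" using g u(2) by (auto simp: coh_iso_at_def coh_map_at_def)
 ultimately have b: "g w -[chob M i] g (f u) \<in> coboundaries M i" by simp
 interpret M: module R "chob M i" by (rule mcxD(1)[OF M])
 have c: "v \<in> carrier (chob M i)" "g w \<in> carrier (chob M i)" "g (f u) \<in> carrier (chob M i)"
  using v gz[OF w(1)] gz[OF fz[OF u(1)]] by (auto dest: cocycles_carrier)
 have "(v -[chob M i] g w) +[chob M i] (g w -[chob M i] g (f u)) = v -[chob M i] g (f u)"
  using c by (simp add: M.minus_eq M.a_assoc M.a_ac M.r_neg1 M.r_neg2 M.l_neg M.r_neg)
 then have "v -[chob M i] g (f u) \<in> coboundaries M i"
  using submoduleD(3)[OF mcxD(1)[OF M] coboundaries_submodule[OF M] w(2) b] by simp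
 then show "\<exists>u \<in> cocycles K i. v -[chob M i] g (f u) \<in> coboundaries M i" using u(1) by blast
qed

lemma coh_iso_cong:
 assumes K: "mcx R K" and f: "coh_iso_at R K L i f" and e: "!!w. w \<in> cocycles K i ==> g w = f w"
 shows "coh_iso_at R K L i g"
proof -
 have l: "lin R (Zmod K i) (Zmod L i) g"
  by (rule lin_cong[OF _ submodule_module[OF mcxD(1)[OF K] cocycles_submodule[OF K]]])
    (use f e in \<open>auto simp: coh_iso_at_def coh_map_at_def\<close>)
 have "g w = f w" if "w \<in> coboundaries K i" for w using e that coboundaries_cocycles[OF K] by blast
 then show ?thesis using f l e by (simp add: coh_iso_at_def coh_map_at_def)
qed

lemma coh_iso_trivial:
 assumes K: "mcx R K" and L: "mcx R L" and f: "coh_iso_at R K L i f"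
 shows "trivial_mod (cohom K i) \<longleftrightarrow> trivial_mod (cohom L i)"
 unfolding trivial_cohom_iff[OF K] trivial_cohom_iff[OF L]
proof
 have fl: "lin R (Zmod K i) (Zmod L i) f" using f by (auto simp: coh_iso_at_def coh_map_at_def)
 have fz: "f u \<in> cocycles L i" if "u \<in> cocycles K i" for u using lin_closed[OF fl] that by simp
 show "cocycles K i \<subseteq> coboundaries K i" if "cocycles L i \<subseteq> coboundaries L i"
  using that f fz by (auto simp: coh_iso_at_def)
 assume t: "cocycles K i \<subseteq> coboundaries K i"
 show "cocycles L i \<subseteq> coboundaries L i"
 proof
  fix v assume v: "v \<in> cocycles L i"
  then obtain u where u: "u \<in> cocycles K i" "v -[chob L i] f u \<in> coboundaries L i" using f by (auto simp: coh_iso_at_def)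
  have fu: "f u \<in> coboundaries L i" using u t f by (auto simp: coh_iso_at_def coh_map_at_def)
  interpret L: module R "chob L i" by (rule mcxD(1)[OF L])
  have "(v -[chob L i] f u) +[chob L i] f u = v"
   using cocycles_carrier[OF v] cocycles_carrier[OF fz[OF u(1)]] by (simp add: L.minus_eq L.a_assoc L.l_neg)
  then show "v \<in> coboundaries L i" using submoduleD(3)[OF mcxD(1)[OF L] coboundaries_submodule[OF L] u(2) fu] by simp
 qed
qed

lemma cohom_map_square:
 assumes c: "mcx R K" "mcx R L" "mcx R K'" "mcx R L'" and f: "coh_map_at R K L i f" and f': "coh_map_at R K' L' i f'"
  and t: "coh_map_at R K K' i t" and g: "coh_map_at R L L' i g"
  and e: "!!w. w \<in> cocycles K i ==> f' (t w) = g (f w)" and w: "w \<in> carrier (cohom K i)"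
 shows "cohom_map K' L' i f' (cohom_map K K' i t w) = cohom_map L L' i g (cohom_map K L i f w)"
proof -
 have wz: "w \<in> cocycles K i" by (rule cohom_carrier[OF c(1) w])
 have z: "t w \<in> cocycles K' i" "f w \<in> cocycles L i" using f t wz by (auto simp: coh_map_at_def dest: lin_closed)
 show ?thesis
  unfolding cohom_map_apply[OF w] cohom_map_crep[OF c(3,4) f' z(1)] cohom_map_crep[OF c(2,4) g z(2)] e[OF wz] ..
qed

lemma nat_isomorphic_span:
 assumes u: "!!G. G \<in> obj D ==> u G \<in> mod_iso R (A G) (fob E G)"
  and v: "!!G. G \<in> obj D ==> v G \<in> mod_iso R (A G) (fob E' G)" and A: "!!G. G \<in> obj D ==> module R (A G)"
  and E: "!!G. G \<in> obj D ==> module R (fob E G)"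
  and a: "!!G G' p w. G \<in> obj D ==> G' \<in> obj D ==> p \<in> arr D G G' ==> w \<in> carrier (A G) ==>
   a G G' p w \<in> carrier (A G') \<and> u G' (a G G' p w) = far E G G' p (u G w) \<and> v G' (a G G' p w) = far E' G G' p (v G w)"
 shows "nat_isomorphic R D E E'"
proof -
 define i where "i G = inv_into (carrier (A G)) (u G)" for G
 define e where "e = (\<lambda>G \<in> obj D. \<lambda>s \<in> el E G. v G (i G s))"
 have ub: "bij_betw (u G) (carrier (A G)) (el E G)" and ul: "lin R (A G) (fob E G) (u G)"
  and vb: "bij_betw (v G) (carrier (A G)) (el E' G)" and vl: "lin R (A G) (fob E' G) (v G)" if "G \<in> obj D" for G
  using u[OF that] v[OF that] by (auto simp: mod_iso_def mod_hom_iff)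
 have iu: "i G (u G w) = w" if "G \<in> obj D" "w \<in> carrier (A G)" for G w
  unfolding i_def by (rule inv_into_f_f[OF bij_betw_imp_inj_on[OF ub[OF that(1)]] that(2)])
 have ib: "bij_betw (i G) (el E G) (carrier (A G))" if "G \<in> obj D" for G
  unfolding i_def by (rule bij_betw_inv_into[OF ub[OF that]])
 have il: "lin R (fob E G) (A G) (i G)" if G: "G \<in> obj D" for G
  by (rule lin_inverse[OF A[OF G] ul[OF G] ub[OF G] iu[OF G]])
 have eu: "e G (u G w) = v G w" if "G \<in> obj D" "w \<in> carrier (A G)" for G w
  using lin_closed[OF ul[OF that(1)] that(2)] that by (simp add: e_def iu)
 have us: "\<exists>w \<in> carrier (A G). s = u G w" if "G \<in> obj D" "s \<in> el E G" for G s
  using ub[OF that(1)] that(2) by (auto simp: bij_betw_def)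
 have em: "e G \<in> mod_hom R (fob E G) (fob E' G)" if G: "G \<in> obj D" for G
  using restrict_mod_hom[OF lin_compose[OF il[OF G] vl[OF G]] E[OF G]] G by (simp add: e_def)
 show ?thesis unfolding nat_isomorphic_def
 proof (intro bexI ballI)
  show "e G \<in> mod_iso R (fob E G) (fob E' G)" if G: "G \<in> obj D" for G
  proof -
   have "bij_betw (\<lambda>s. v G (i G s)) (el E G) (el E' G)"
    using bij_betw_trans[OF ib[OF G] vb[OF G]] by (simp add: comp_def)
   then have "bij_betw (e G) (el E G) (el E' G)" by (rule bij_betw_cong[THEN iffD1, rotated]) (simp add: e_def G)
   then show ?thesis using em[OF G] by (simp add: mod_iso_def)
  qed
  have "e G' (far E G G' p s) = far E' G G' p (e G s)"
   if o: "G \<in> obj D" "G' \<in> obj D" "p \<in> arr D G G'" "s \<in> el E G" for G G' p s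
  proof -
   obtain w where w: "w \<in> carrier (A G)" "s = u G w" using us[OF o(1,4)] by blast
   have aw: "a G G' p w \<in> carrier (A G')" "u G' (a G G' p w) = far E G G' p (u G w)" "v G' (a G G' p w) = far E' G G' p (v G w)"
    using a[OF o(1-3) w(1)] by blast+
   show ?thesis unfolding w(2) eu[OF o(1) w(1)] aw(2)[symmetric] eu[OF o(2) aw(1)] aw(3) ..
  qed
  then show "e \<in> nat_hom R D E E'" using em by (auto simp: nat_hom_def e_def)
 qed
qed

section \<open>Naturality in the module argument\<close>

context
 fixes R :: "'k ring" and C :: "('o, 'a) category_data" and G :: "('o, 'a, 'k, 'v) modfun" and G' :: "('o, 'a, 'k, 'w) modfun" and p
 assumes cR: "cring R" and G: "modf R C G" and G': "modf R C G'" and p: "natl R C G G' p"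
begin

lemma hom_cx_postcomp:
 assumes K: "fcx R C K"
 shows "coh_map_at R (hom_cx R C K G) (hom_cx R C K G') i (\<lambda>h. nat_cmp C (chob K (- i)) p h)"
proof (rule chain_map_coh_map_at[where f = "\<lambda>i h. nat_cmp C (chob K (- i)) p h", OF hom_cx_mcx[OF cR G K] hom_cx_mcx[OF cR G' K]])
 note Kf = fcxD(1)[OF K]
 show "lin R (chob (hom_cx R C K G) i) (chob (hom_cx R C K G') i) (nat_cmp C (chob K (- i)) p)" for i
  unfolding hom_cx_chob by (rule postcomp_lin[OF Kf G G' p])
 fix i u assume "u \<in> carrier (chob (hom_cx R C K G) i)"
 then have u: "u \<in> nat_hom R C (chob K (- i)) G" by (simp add: hom_cx_chob)
 have v: "nat_cmp C (chob K (- i)) p u \<in> nat_hom R C (chob K (- i)) G'"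
  unfolding nat_cmp_nres by (rule nat_cmp_natl_hom[OF Kf u p])
 have e: "- (i + 1) = - i - 1" by simp
 show "chd (hom_cx R C K G') i (nat_cmp C (chob K (- i)) p u) = nat_cmp C (chob K (- (i + 1))) p (chd (hom_cx R C K G) i u)"
  unfolding hom_cx_chd[OF u] hom_cx_chd[OF v] e
  unfolding nat_cmp_nres by (rule nres_cong) (simp add: nres_apply natl_closed[OF fcxD(3)[OF K]])
qed

lemma tensor_cx_postcomp:
 assumes K: "fcx R (op_cat C) K"
 shows "coh_map_at R (tensor_cx R C K G) (tensor_cx R C K G') i
  (tensor_map R C (chob K i) G (chob K i) G' (nat_id C (chob K i)) p)"
proof (rule chain_map_coh_map_at[where f = "\<lambda>i. tensor_map R C (chob K i) G (chob K i) G' (nat_id C (chob K i)) p",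
   OF tensor_cx_mcx[OF cR G K] tensor_cx_mcx[OF cR G' K]])
 note Kf = fcxD(1)[OF K] and Kd = fcxD(2)[OF K]
 note tG = tp[OF cR G Kf] and tG' = tp[OF cR G' Kf]
 have i: "natl R (op_cat C) (chob K i) (chob K i) (nat_id C (chob K i))" for i
  by (rule natl_cong[OF Kf natl_id]) (simp add: nat_id_apply)
 note tm = tensor_map_props[OF tG tG' i p]
 show "lin R (chob (tensor_cx R C K G) i) (chob (tensor_cx R C K G') i)
   (tensor_map R C (chob K i) G (chob K i) G' (nat_id C (chob K i)) p)" for i using tm(1) by simp
 fix i u assume "u \<in> carrier (chob (tensor_cx R C K G) i)"
 then have u: "u \<in> carrier (tensor R C (chob K i) G)" by simp
 show "chd (tensor_cx R C K G') i (tensor_map R C (chob K i) G (chob K i) G' (nat_id C (chob K i)) p u) =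
  tensor_map R C (chob K (i + 1)) G (chob K (i + 1)) G' (nat_id C (chob K (i + 1))) p (chd (tensor_cx R C K G) i u)"
  unfolding tensor_cx_simps
 proof (rule tensor_pair.tensor_unique[OF tG tensor_pair.tensor_module[OF tG'] lin_compose[OF tm(1) tmap_lin[OF cR G' Kf Kf Kd]]
    lin_compose[OF tmap_lin[OF cR G Kf Kf Kd] tm(1)] _ u])
  fix x a b assume x: "x \<in> obj C" and a: "a \<in> el (chob K i) x" and b: "b \<in> el G x"
  have x': "x \<in> obj (op_cat C)" using x by simp
  note da = natl_closed[OF Kd x' a]
  show "tensor_map R C (chob K i) G' (chob K (i + 1)) G' (chd K i) (nat_id C G')
    (tensor_map R C (chob K i) G (chob K i) G' (nat_id C (chob K i)) p (tensor_pair.tn R C (chob K i) G x a b)) =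
   tensor_map R C (chob K (i + 1)) G (chob K (i + 1)) G' (nat_id C (chob K (i + 1))) p
    (tensor_map R C (chob K i) G (chob K (i + 1)) G (chd K i) (nat_id C G) (tensor_pair.tn R C (chob K i) G x a b))"
   unfolding tm(2)[OF x a b] nat_id_apply[OF x a] tmap_tn[OF cR G' Kf Kf Kd x a natl_closed[OF p x b]]
    tmap_tn[OF cR G Kf Kf Kd x a b] tm(2)[OF x da b] nat_id_apply[OF x da] ..
 qed
qed

lemma tensor_map_exchange:
 assumes F: "modf R (op_cat C) F" and F': "modf R (op_cat C) F'" and q: "natl R (op_cat C) F F' q"
  and v: "v \<in> carrier (tensor R C F G)"
 shows "tensor_map R C F G' F' G' q (nat_id C G') (tensor_map R C F G F G' (nat_id C F) p v) =
  tensor_map R C F' G F' G' (nat_id C F') p (tensor_map R C F G F' G q (nat_id C G) v)"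
proof -
 note t = tp[OF cR G F] tp[OF cR G' F] tp[OF cR G F'] tp[OF cR G' F']
 have i: "natl R (op_cat C) F F (nat_id C F)" and i': "natl R (op_cat C) F' F' (nat_id C F')"
  by (rule natl_cong[OF F natl_id] natl_cong[OF F' natl_id], simp add: nat_id_apply)+
 note tm = tensor_map_props[OF t(1,2) i p] and tm' = tensor_map_props[OF t(3,4) i' p]
 show ?thesis
 proof (rule tensor_pair.tensor_unique[OF t(1) tensor_pair.tensor_module[OF t(4)] lin_compose[OF tm(1) tmap_lin[OF cR G' F F' q]]
    lin_compose[OF tmap_lin[OF cR G F F' q] tm'(1)] _ v])
  fix x a b assume x: "x \<in> obj C" and a: "a \<in> el F x" and b: "b \<in> el G x"
  have x': "x \<in> obj (op_cat C)" using x by simp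
  note qa = natl_closed[OF q x' a]
  show "tensor_map R C F G' F' G' q (nat_id C G') (tensor_map R C F G F G' (nat_id C F) p (tensor_pair.tn R C F G x a b)) =
   tensor_map R C F' G F' G' (nat_id C F') p (tensor_map R C F G F' G q (nat_id C G) (tensor_pair.tn R C F G x a b))"
   unfolding tm(2)[OF x a b] nat_id_apply[OF x a] tmap_tn[OF cR G' F F' q x a natl_closed[OF p x b]]
    tmap_tn[OF cR G F F' q x a b] tm'(2)[OF x qa b] nat_id_apply[OF x qa] ..
 qed
qed

end

section \<open>Ext, Tor and the duality isomorphism\<close>

locale yoneda_large = yoneda_bif R C T \<mu>
 for R :: "'k ring" and C :: "('o, 'a) category_data" and T :: "('o \<times> 'o, 'a \<times> 'a, 'k, 'm) modfun"
  and \<mu> :: "('o \<times> 'o, 'a => 'k, 'm) nat_trans" +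
 fixes prm :: "'m \<times> 'm => 'm" and skm :: "'o => 'm"
 assumes inj_prm: "inj prm" and inf_m: "infinite (UNIV :: 'm set)"
  and skm: "[|x \<in> obj C; y \<in> obj C; skm x = skm y|] ==> isomorphic C x y"
begin

sublocale low: large_yoneda R C S uni "\<lambda>m. m" prm skm
proof (intro large_yoneda.intro large_yoneda_axioms.intro low.yoneda_system_axioms)
 show "inj (\<lambda>m :: 'm. m)" by (rule inj_on_id2)
qed (rule inj_prm inf_m skm, assumption?)+

text \<open>Contravariant functors have carriers in \<open>'o => 'm => 'm\<close>, the type of the
  values of \<open>D\<close>. Constant functions embed \<open>'m\<close> into it, and pairing is
  done pointwise.\<close>

sublocale up: large_yoneda R "op_cat C" U uni "\<lambda>m (_ :: 'o) (_ :: 'm). m" "\<lambda>(f, g) x m. prm (f x m, g x m)" "\<lambda>x _ _. skm x"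
proof (intro large_yoneda.intro large_yoneda_axioms.intro up.yoneda_system_axioms)
 show i: "inj (\<lambda>m (_ :: 'o) (_ :: 'm). m :: 'm)" by (auto simp: inj_def fun_eq_iff)
 show "infinite (UNIV :: ('o => 'm => 'm) set)"
 proof
  assume "finite (UNIV :: ('o => 'm => 'm) set)"
  then have "finite (range (\<lambda>m (_ :: 'o) (_ :: 'm). m :: 'm))" by (rule finite_subset[OF subset_UNIV])
  then show False using finite_imageD[OF _ i] inf_m by blast
 qed
 show "inj (\<lambda>(f, g) (x :: 'o) (m :: 'm). prm (f x m, g x m))"
  by (rule injI) (auto simp: fun_eq_iff inj_eq[OF inj_prm])
 fix x y assume "x \<in> obj (op_cat C)" "y \<in> obj (op_cat C)" "(\<lambda>(_ :: 'o) (_ :: 'm). skm x) = (\<lambda>_ _. skm y)"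
 then have "isomorphic C x y" using skm by (simp add: fun_eq_iff)
 then show "isomorphic (op_cat C) x y" by (auto simp: isomorphic_def)
qed

lemma CT_iff: "G \<in> CT_mod R C T \<longleftrightarrow> low.amod G" unfolding CT_mod_def by (rule low.gen_mod_iff)

abbreviation resolution where "resolution F \<equiv> some_resolution R C (CT_mod R C T) F"
abbreviation resolution_op where "resolution_op F \<equiv> some_resolution R (op_cat C) (CTop_mod R C T) F"

lemma resolution_proj: "low.amod F ==> \<exists>e. proj_resolution R C (gen_mod R C S) (resolution F) e F"
 unfolding CT_mod_def some_resolution_def by (rule someI_ex[OF low.resolution_exists])

lemma resolution_op_proj: "up.amod F ==> \<exists>e. proj_resolution R (op_cat C) (gen_mod R (op_cat C) U) (resolution_op F) e F"
 unfolding CTop_mod_def some_resolution_def by (rule someI_ex[OF up.resolution_exists])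

lemma resolution_aug0: "low.amod F ==> \<exists>e s. low.aug (resolution F) 0 F e s"
 using resolution_proj[of F] low.resolution_aug[of "resolution F" _ F 0] unfolding shift_cx_0 by blast

lemma Ext_fob: "fob (Ext_T R C T i F) G = cohom (hom_cx R C (resolution F) G) i"
 and Ext_far: "far (Ext_T R C T i F) G G' p = cohom_map (hom_cx R C (resolution F) G) (hom_cx R C (resolution F) G') i
   (\<lambda>h. nat_cmp C (chob (resolution F) (- i)) p h)" by (simp_all add: Ext_T_def Ext_def Let_def)

lemma Tor_fob: "fob (Tor_T R C T j F) G = cohom (tensor_cx R C (resolution_op F) G) (- j)"
 and Tor_far: "far (Tor_T R C T j F) G G' q = cohom_map (tensor_cx R C (resolution_op F) G) (tensor_cx R C (resolution_op F) G') (- j)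
   (tensor_map R C (chob (resolution_op F) (- j)) G (chob (resolution_op F) (- j)) G' (nat_id C (chob (resolution_op F) (- j))) q)"
 by (simp_all add: Tor_T_def Tor_def Let_def)

lemma hom_zero_functor:
 assumes K: "modf R C K" and z: "zero_functor C K" and G: "modf R C G"
 shows "trivial_mod (hom_mod R C K G)"
proof -
 have "e = 0[hom_mod R C K G]" if e: "e \<in> nat_hom R C K G" for e
 proof (rule nat_hom_ext[OF e])
  show "0[hom_mod R C K G] \<in> nat_hom R C K G" unfolding hom_mod_simps by (rule nres_hom[OF K natl_zero[OF G]])
  fix x w assume x: "x \<in> obj C" and w: "w \<in> el K x"
  then have "w = 0[fob K x]" using z by (auto simp: zero_functor_def trivial_mod_def)
  then show "e x w = 0[hom_mod R C K G] x w"
   using lin_zero[OF mf_mod[OF K x] mf_mod[OF G x] natl_lin[OF nat_hom_natl[OF e] x]] x w by (simp add: nres_apply)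
 qed
 moreover have "0[hom_mod R C K G] \<in> nat_hom R C K G" unfolding hom_mod_simps by (rule nres_hom[OF K natl_zero[OF G]])
 ultimately show ?thesis unfolding trivial_mod_def hom_mod_simps(1) by blast
qed

lemma dual_zero: "modf R C K ==> zero_functor C K ==> zero_functor (op_cat C) (DD K)"
 unfolding zero_functor_def[of "op_cat C"] dual_fob op_cat_simps by (intro ballI hom_zero_functor lower_functor)

lemma sqf_Dn: "Dn R C T n F = sqf (chob (DK (resolution F)) n) (Zc (DK (resolution F)) n) (Bc (DK (resolution F)) n)"
 by (simp only: Dn_def RD_DK cohom_fun_sqf)

context
 fixes F :: "('o, 'a, 'k, 'm) modfun"
 assumes F: "low.amod F"
begin

lemma resolution_props: "fcx R C (resolution F)" "modf R C (chob (resolution F) i)" "low.amod (chob (resolution F) i)"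
proof -
 obtain e s where "low.aug (resolution F) 0 F e s" using resolution_aug0[OF F] by blast
 note a = low.augD(1,3)[OF this]
 show "fcx R C (resolution F)" "modf R C (chob (resolution F) i)" "low.amod (chob (resolution F) i)"
  using a fcxD(1)[OF a(1)] by blast+
qed

lemma Dn_amod: "up.amod (Dn R C T n F)"
proof -
 note K = DK_fcx[OF resolution_props(1)]
 have a: "up.amod (chob (DK (resolution F)) n)" by (simp add: dual_amod[OF resolution_props(2)])
 show ?thesis unfolding sqf_Dn by (rule up.amod_sqf[OF a Zc_stable[OF K] Bc_stable[OF K] Bc_Zc[OF K]])
qed

lemma resolution_op_props:
 shows "fcx R (op_cat C) (resolution_op (Dn R C T n F))" "up.amod (chob (resolution_op (Dn R C T n F)) i)"
  and "\<exists>e s. up.aug (shift_cx (resolution_op (Dn R C T n F)) m) m (Dn R C T n F) e s"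
proof -
 let ?R = "resolution_op (Dn R C T n F)"
 obtain e where e: "proj_resolution R (op_cat C) (gen_mod R (op_cat C) U) ?R e (Dn R C T n F)"
  using resolution_op_proj[OF Dn_amod] by blast
 show "\<exists>e s. up.aug (shift_cx ?R m) m (Dn R C T n F) e s" for m using up.resolution_aug[OF e Dn_amod] by blast
 from this[of 0] obtain e s where "up.aug ?R 0 (Dn R C T n F) e s" unfolding shift_cx_0 by blast
 note a = up.augD(1,3)[OF this]
 show "fcx R (op_cat C) ?R" "up.amod (chob ?R i)" using a by blast+
qed

lemma Ext_mcx: "low.amod G ==> mcx R (hom_cx R C (resolution F) G)"
 by (rule hom_cx_mcx[OF cR low.amod_functor resolution_props(1)])

lemma Tor_mcx: "low.amod G ==> mcx R (tensor_cx R C (resolution_op (Dn R C T n F)) G)"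
 by (rule tensor_cx_mcx[OF cR low.amod_functor resolution_op_props(1)])

lemma trivial_iso: "f \<in> mod_iso R M N ==> trivial_mod N ==> module R M ==> module R N ==> trivial_mod M"
proof -
 assume f: "f \<in> mod_iso R M N" and t: "trivial_mod N" and M: "module R M" and N: "module R N"
 interpret M: module R M by (rule M)
 have "inj_on f (carrier M)" "!!x. x \<in> carrier M ==> f x = 0[N]"
  using f t by (auto simp: mod_iso_def bij_betw_def trivial_mod_def)
 then have "x = 0[M]" if "x \<in> carrier M" for x using that by (metis inj_onD M.zero_closed)
 then show "trivial_mod M" by (auto simp: trivial_mod_def)
qed

lemma duality_trivial:
 assumes d: "ext_tor_duality R C T F n" and G: "low.amod (G :: ('o, 'a, 'k, 'm) modfun)"
  and t: "trivial_mod (cohom (tensor_cx R C (resolution_op (Dn R C T n F)) G) (i - n))"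
 shows "trivial_mod (fob (Ext_T R C T i F) G)"
proof -
 have "G \<in> obj (gen_modcat R C S)"
  using G low.amod_functor[OF G] by (simp add: gen_modcat_def full_subcat_def modcat_def low.gen_mod_iff)
 then obtain f where f: "f \<in> mod_iso R (fob (Ext_T R C T i F) G) (fob (Tor_T R C T (n - i) (Dn R C T n F)) G)"
  using d by (auto simp: ext_tor_duality_def nat_isomorphic_def)
 have e: "- (n - i) = i - n" by simp
 show ?thesis using f t unfolding Ext_fob Tor_fob e
  by (rule trivial_iso[OF _ _ cohom_module[OF Ext_mcx[OF G]] cohom_module[OF Tor_mcx[OF G]]])
qed

lemma duality_vanishing:
 assumes d: "ext_tor_duality R C T F n"
 shows "ext_vanishing R C T F n"
 unfolding ext_vanishing_def
proof (intro allI impI ballI)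
 fix i x assume i: "i \<noteq> n" and x: "x \<in> obj C"
 let ?R = "resolution_op (Dn R C T n F)"
 have x': "x \<in> obj (op_cat C)" using x by simp
 note Rp = resolution_op_props[of n]
 obtain e where e: "proj_resolution R (op_cat C) (gen_mod R (op_cat C) U) ?R e (Dn R C T n F)"
  using resolution_op_proj[OF Dn_amod] by blast
 obtain f where f: "coh_iso_at R (tensor_cx R C ?R (S x)) (eval_cx ?R x) (i - n) f"
  using tensor_standard_coh_iso[OF Rp(1,2) x] by blast
 note m = fcx_mcx[OF Rp(1) x']
 have "trivial_mod (cohom (eval_cx ?R x) (i - n))"
 \<comment> \<open>In degree \<open>i - n\<close> the resolution of \<open>Dn R C T n F\<close> is
   exact if the degree is negative and zero if it is positive.\<close>
 proof (cases "i < n")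
  case True
  then have "cocycles (eval_cx ?R x) (i - n) = coboundaries (eval_cx ?R x) (i - n)"
   using e x' unfolding proj_resolution_def by auto
  then show ?thesis unfolding trivial_cohom_iff[OF m] by simp
 next
  case False
  then have "zero_functor (op_cat C) (chob ?R (i - n))" using e i unfolding proj_resolution_def by auto
  then have "trivial_mod (chob (eval_cx ?R x) (i - n))" using x' unfolding zero_functor_def eval_cx_simps by blast
  then show ?thesis by (rule trivial_cohom[OF m])
 qed
 then have "trivial_mod (cohom (tensor_cx R C ?R (S x)) (i - n))"
  using coh_iso_trivial[OF Tor_mcx[OF low.S_amod[OF x]] m f] by simp
 then show "trivial_mod (fob (Ext_T R C T i F) (S x))" by (rule duality_trivial[OF d low.S_amod[OF x]])
qed

context
 assumes FP: "type_FP R C S F"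
begin

text \<open>The chosen resolution and the finite one are both augmented over \<open>F\<close> in
  degree 0, so \<open>comparison\<close> applies. Finite type enters in the form of dual
  bases.\<close>

lemma finite_resolution:
 "\<exists>(Q :: ('o, 'a, 'k, 'm) funcx) \<phi> \<psi> h k N. heq R C (resolution F) Q \<phi> \<psi> h k \<and> fcx R C Q \<and> (\<forall>i. low.amod (chob Q i)) \<and>
   (\<forall>i. \<exists>(I :: nat set) a g q. low.fdb (chob Q i) I a g q) \<and> (\<forall>i < N. zero_functor C (chob Q i))"
proof -
 obtain Q e N where Q: "proj_resolution R C (gen_mod R C S) Q e F" and ft: "!!i. finite_type R C S (chob Q i)"
  and N: "\<forall>i < N. zero_functor C (chob Q i)" using FP unfolding type_FP_def by blast
 obtain s where "low.aug (shift_cx Q 0) 0 F e s" using low.resolution_aug[OF Q F] by blast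
 then have a: "low.aug Q 0 F e s" by simp
 obtain e' s' where "low.aug (resolution F) 0 F e' s'" using resolution_aug0[OF F] by blast
 then obtain \<phi> \<psi> h k where "heq R C (resolution F) Q \<phi> \<psi> h k" using low.comparison[OF _ a] by blast
 moreover have "\<exists>(I :: nat set) a g q. low.fdb (chob Q i) I a g q" for i
  by (rule low.finite_type_fdb[OF low.augD(2)[OF a] ft])
 ultimately have "heq R C (resolution F) Q \<phi> \<psi> h k \<and> fcx R C Q \<and> (\<forall>i. low.amod (chob Q i)) \<and>
   (\<forall>i. \<exists>(I :: nat set) a g q. low.fdb (chob Q i) I a g q) \<and> (\<forall>i < N. zero_functor C (chob Q i))"
  using low.augD(1,3)[OF a] N by (intro conjI allI) auto
 then show ?thesis by (intro exI)
qed

text \<open>For each \<open>G\<close> the cohomology of \<open>DQ \<otimes> G\<close> is the apex of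
  a span: one leg leads through \<open>Hom(Q, G)\<close> to \<open>Ext\<close>, the other through a
  shifted resolution to \<open>Tor\<close>. Naturality in \<open>G\<close> is checked leg by
  leg.\<close>

lemma vanishing_duality:
 assumes v: "ext_vanishing R C T F n"
 shows "ext_tor_duality R C T F n"
proof -
 let ?P = "resolution F" and ?Dn = "Dn R C T n F"
 let ?R = "resolution_op ?Dn"
 obtain Q :: "('o, 'a, 'k, 'm) funcx" and \<phi> \<psi> h k N where hq: "heq R C ?P Q \<phi> \<psi> h k" and Q: "fcx R C Q" and Qa: "!!i. low.amod (chob Q i)"
  and Qd: "!!i. \<exists>(I :: nat set) a g q. low.fdb (chob Q i) I a g q" and N: "!!i. i < N ==> zero_functor C (chob Q i)"
  using finite_resolution by blast
 note P = resolution_props(1) and Pf = resolution_props(2) and Qf = fcxD(1)[OF Q]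
 have \<phi>: "natl R C (chob ?P i) (chob Q i) (\<phi> i)" for i using hq by (auto simp: heq_def cmap_def)
 note DP = DK_fcx[OF P] and DQ = DK_fcx[OF Q]
 have iso: "coh_iso_at R (hom_cx R C Q G) (hom_cx R C ?P G) i (\<lambda>f. nat_cmp C (chob ?P (- i)) f (\<phi> (- i)))"
  if "modf R C G" for G :: "('o, 'a, 'k, 'm) modfun" and i by (rule hom_cx_heq[OF cR that P Q hq])
 \<comment> \<open>\<open>Dn\<close> is defined with the chosen resolution, not with
   \<open>Q\<close>; a cocycle of \<open>DQ\<close> is therefore first carried over by the dual of
   \<open>\<phi>\<close>, and then its class is taken.\<close>
 let ?\<epsilon> = "\<lambda>x h. sqrep (chob (DK ?P) n) (Zc (DK ?P) n) (Bc (DK ?P) n) x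
  (dual_map R C T (chob ?P (- n)) (chob Q (- n)) (\<phi> (- n)) x h)"
 have dm: "natl R (op_cat C) (chob (DK Q) n) (chob (DK ?P) n) (dual_map R C T (chob ?P (- n)) (chob Q (- n)) (\<phi> (- n)))"
  unfolding DK_simps by (rule dual_map_natl[OF Pf Qf \<phi>])
 have isox: "coh_iso_at R (eval_cx (DK Q) x) (eval_cx (DK ?P) x) n (dual_map R C T (chob ?P (- n)) (chob Q (- n)) (\<phi> (- n)) x)"
  if x: "x \<in> obj C" for x
 proof -
  note c = iso[OF lower_functor[OF x], of n]
  have eq: "dual_map R C T (chob ?P (- n)) (chob Q (- n)) (\<phi> (- n)) x w = nat_cmp C (chob ?P (- n)) w (\<phi> (- n))"
   if "w \<in> cocycles (hom_cx R C Q (S x)) n" for w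
   using cocycles_carrier[OF that] by (simp add: hom_cx_chob dual_map_apply[OF x] nat_cmp_nres)
  show ?thesis unfolding eval_DK[OF x] by (rule coh_iso_cong[OF hom_cx_mcx[OF cR lower_functor[OF x] Q] c eq])
 qed
 have \<epsilon>n: "natl R (op_cat C) (subf (chob (DK Q) n) (Zc (DK Q) n)) ?Dn ?\<epsilon>"
  unfolding sqf_Dn
 proof (rule natl_compose[OF natl_subf_target sqf_proj])
  show "natl R (op_cat C) (subf (chob (DK Q) n) (Zc (DK Q) n)) (chob (DK ?P) n)
    (dual_map R C T (chob ?P (- n)) (chob Q (- n)) (\<phi> (- n)))"
   by (rule natl_subf_source[OF fcxD(1)[OF DQ] Zc_stable[OF DQ] dm])
  show "dual_map R C T (chob ?P (- n)) (chob Q (- n)) (\<phi> (- n)) x w \<in> Zc (DK ?P) n x"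
   if "x \<in> obj (op_cat C)" "w \<in> el (subf (chob (DK Q) n) (Zc (DK Q) n)) x" for x w
   using isox[of x] that lin_closed[of R "Zmod (eval_cx (DK Q) x) n" "Zmod (eval_cx (DK ?P) x) n" _ w]
   by (auto simp: coh_iso_at_def coh_map_at_def)
 qed (rule op_cat_category[OF cC] fcxD(1)[OF DP] Zc_stable[OF DP] Bc_stable[OF DP] Bc_Zc[OF DP], assumption?)+
 have mx: "mcx R (eval_cx (DK ?P) x)" if "x \<in> obj C" for x by (rule fcx_mcx[OF DP]) (simp add: that)
 have dz: "dual_map R C T (chob ?P (- n)) (chob Q (- n)) (\<phi> (- n)) x w \<in> Zc (DK ?P) n x" if "x \<in> obj C" "w \<in> Zc (DK Q) n x" for x w
  using isox[OF that(1)] that(2) lin_closed[of R "Zmod (eval_cx (DK Q) x) n" "Zmod (eval_cx (DK ?P) x) n" _ w]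
  by (auto simp: coh_iso_at_def coh_map_at_def)
 have \<epsilon>c: "?\<epsilon> x w = crep (eval_cx (DK ?P) x) n (dual_map R C T (chob ?P (- n)) (chob Q (- n)) (\<phi> (- n)) x w)" for x w by simp
 have Dc: "fob ?Dn x = cohom (eval_cx (DK ?P) x) n" for x by (simp add: Dn_def RD_DK cohom_fun_def)
 have "\<exists>\<epsilon>' s. up.aug (DK Q) n ?Dn \<epsilon>' s"
 \<comment> \<open>Duality reverses degrees: \<open>Q\<close> vanishes below \<open>N\<close>, so
   \<open>DQ\<close> vanishes above \<open>- N\<close>.\<close>
 proof (rule up.aug_of_exact[where N = "- N" and \<epsilon> = ?\<epsilon>, OF DQ _ _ _ Dn_amod \<epsilon>n])
  show "projective_in R (op_cat C) (gen_mod R (op_cat C) U) (chob (DK Q) i)" for i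
  proof -
   obtain I :: "nat set" and a g q where "low.fdb (chob Q (- i)) I a g q" using Qd by blast
   then show ?thesis unfolding DK_simps by (rule up.fdb_projective[OF dual_amod[OF Qf] fdb_dual[OF Qa]])
  qed
  show "zero_functor (op_cat C) (chob (DK Q) i)" if "i > - N" for i
   unfolding DK_simps using that by (intro dual_zero[OF Qf] N) simp
  show "w \<in> Bc (DK Q) i x" if i: "i \<noteq> n" and "x \<in> obj (op_cat C)" and w: "w \<in> Zc (DK Q) i x" for i x w
  proof -
   have x: "x \<in> obj C" using that by simp
   have "trivial_mod (cohom (hom_cx R C ?P (S x)) i)" using v i x unfolding ext_vanishing_def Ext_fob by blast
   then have "trivial_mod (cohom (hom_cx R C Q (S x)) i)"
    using coh_iso_trivial[OF hom_cx_mcx[OF cR lower_functor[OF x] Q] hom_cx_mcx[OF cR lower_functor[OF x] P] iso[OF lower_functor[OF x]]] by simp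
   then show ?thesis using w unfolding eval_DK[OF x] trivial_cohom_iff[OF hom_cx_mcx[OF cR lower_functor[OF x] Q]] by blast
  qed
  show "?\<epsilon> x w = 0[fob ?Dn x] \<longleftrightarrow> w \<in> Bc (DK Q) n x" if "x \<in> obj (op_cat C)" "w \<in> Zc (DK Q) n x" for x w
  proof -
   have x: "x \<in> obj C" using that by simp
   show ?thesis unfolding Dc \<epsilon>c crep_zero_iff[OF mx[OF x] dz[OF x that(2)]]
    using isox[OF x] that(2) by (auto simp: coh_iso_at_def coh_map_at_def)
  qed
  fix x w assume "x \<in> obj (op_cat C)" and "w \<in> el ?Dn x"
  then have x: "x \<in> obj C" and w: "w \<in> carrier (cohom (eval_cx (DK ?P) x) n)" by (simp_all add: Dc)
  have wz: "w \<in> Zc (DK ?P) n x" by (rule cohom_carrier[OF mx[OF x] w])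
  obtain u where u: "u \<in> Zc (DK Q) n x"
   "w -[chob (eval_cx (DK ?P) x) n] dual_map R C T (chob ?P (- n)) (chob Q (- n)) (\<phi> (- n)) x u \<in> Bc (DK ?P) n x"
   using isox[OF x] wz unfolding coh_iso_at_def by blast
  then have "crep (eval_cx (DK ?P) x) n w = ?\<epsilon> x u" unfolding \<epsilon>c crep_eq_iff[OF mx[OF x] wz dz[OF x u(1)]] by blast
  then show "\<exists>u \<in> Zc (DK Q) n x. ?\<epsilon> x u = w" using u(1) crep_fixed[OF mx[OF x] w] by auto
 qed
 moreover obtain e s where "up.aug (shift_cx ?R n) n ?Dn e s" using resolution_op_props(3) by blast
 ultimately obtain \<alpha> \<beta> h' k' where hq': "heq R (op_cat C) (DK Q) (shift_cx ?R n) \<alpha> \<beta> h' k'"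
  using up.comparison by blast
 have R: "fcx R (op_cat C) ?R" by (rule resolution_op_props(1))
 note Rs = fcx_shift[OF R, of n]
 have \<alpha>n: "natl R (op_cat C) (chob (DK Q) i) (chob (shift_cx ?R n) i) (\<alpha> i)" for i using hq' by (auto simp: heq_def cmap_def)
 show ?thesis unfolding ext_tor_duality_def
 proof
  fix i
  have ei: "- (n - i) = i - n" by simp
  \<comment> \<open>\<open>?A\<close> is the apex of the span, \<open>?E\<close> computes
    \<open>Ext\<close>, and \<open>?B\<close> computes \<open>Tor\<close> from the shifted
    resolution.\<close>
  let ?A = "\<lambda>G :: ('o, 'a, 'k, 'm) modfun. tensor_cx R C (DK Q) G"
  let ?E = "\<lambda>G :: ('o, 'a, 'k, 'm) modfun. hom_cx R C ?P G"
  let ?B = "\<lambda>G :: ('o, 'a, 'k, 'm) modfun. tensor_cx R C (shift_cx ?R n) G"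
  let ?f = "\<lambda>G w. nat_cmp C (chob ?P (- i)) (theta (chob Q (- i)) G w) (\<phi> (- i))"
  let ?g = "\<lambda>G. tensor_map R C (chob (DK Q) i) G (chob (shift_cx ?R n) i) G (\<alpha> i) (nat_id C G)"
  let ?t = "\<lambda>G G' p. tensor_map R C (chob (DK Q) i) G (chob (DK Q) i) G' (nat_id C (chob (DK Q) i)) p"
  \<comment> \<open>Tensoring commutes with the shift, so degree \<open>i\<close> of
    \<open>?B\<close> is degree \<open>i - n\<close> of the unshifted complex, which is homological
    degree \<open>n - i\<close>.\<close>
  have sh: "tensor_cx R C (shift_cx ?R n) G = shift_cx (tensor_cx R C ?R G) n" for G :: "('o, 'a, 'k, 'm) modfun"
   by (simp add: tensor_cx_def shift_cx_def algebra_simps)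
  have B: "cohom (?B G) i = cohom (tensor_cx R C ?R G) (i - n)" for G unfolding sh cohom_shift ..
  have cm: "cohom_map (?B G) (?B G') i = cohom_map (tensor_cx R C ?R G) (tensor_cx R C ?R G') (i - n)" for G G'
   by (simp add: fun_eq_iff cohom_map_def sh cohom_shift cocycles_shift coboundaries_shift)
  have ob: "low.amod G" "modf R C G" if "G \<in> obj (gen_modcat R C S)" for G :: "('o, 'a, 'k, 'm) modfun"
   using that by (simp_all add: gen_modcat_def full_subcat_def modcat_def low.gen_mod_iff)
  have m: "mcx R (?A G)" "mcx R (?E G)" "mcx R (?B G)" if "modf R C G" for G
   by (rule tensor_cx_mcx[OF cR that DQ] hom_cx_mcx[OF cR that P] tensor_cx_mcx[OF cR that Rs])+
  have f: "coh_iso_at R (?A G) (?E G) i (?f G)" if G: "G \<in> obj (gen_modcat R C S)" for G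
   by (rule coh_iso_compose[OF m(1)[OF ob(2)[OF G]] hom_cx_mcx[OF cR ob(2)[OF G] Q] m(2)[OF ob(2)[OF G]]
      theta_coh_iso[OF Q Qa ob(1)[OF G] Qd] iso[OF ob(2)[OF G]]])
  have g: "coh_iso_at R (?A G) (?B G) i (?g G)" if G: "G \<in> obj (gen_modcat R C S)" for G
   by (rule tensor_cx_heq[OF cR ob(2)[OF G] DQ Rs hq'])
  show "nat_isomorphic R (gen_modcat R C S) (Ext_T R C T i F) (Tor_T R C T (n - i) ?Dn)"
  proof (rule nat_isomorphic_span[where A = "\<lambda>G. cohom (?A G) i" and u = "\<lambda>G. cohom_map (?A G) (?E G) i (?f G)"
     and v = "\<lambda>G. cohom_map (?A G) (?B G) i (?g G)" and a = "\<lambda>G G' p. cohom_map (?A G) (?A G') i (?t G G' p)"])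
   fix G G' :: "('o, 'a, 'k, 'm) modfun"
   assume G: "G \<in> obj (gen_modcat R C S)"
   note Gf = ob(2)[OF G]
   show "module R (cohom (?A G) i)" by (rule cohom_module[OF m(1)[OF Gf]])
   show "module R (fob (Ext_T R C T i F) G)" unfolding Ext_fob by (rule cohom_module[OF m(2)[OF Gf]])
   show "cohom_map (?A G) (?E G) i (?f G) \<in> mod_iso R (cohom (?A G) i) (fob (Ext_T R C T i F) G)"
    unfolding Ext_fob by (rule cohom_map_iso[OF m(1,2)[OF Gf] f[OF G]])
   show "cohom_map (?A G) (?B G) i (?g G) \<in> mod_iso R (cohom (?A G) i) (fob (Tor_T R C T (n - i) ?Dn) G)"
    unfolding Tor_fob ei B[symmetric] by (rule cohom_map_iso[OF m(1,3)[OF Gf] g[OF G]])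
   fix p w assume G': "G' \<in> obj (gen_modcat R C S)" and "p \<in> arr (gen_modcat R C S) G G'" and w: "w \<in> carrier (cohom (?A G) i)"
   then have p: "natl R C G G' p" by (simp add: gen_modcat_def full_subcat_def modcat_def nat_hom_natl)
   note Gf' = ob(2)[OF G']
   have t: "coh_map_at R (?A G) (?A G') i (?t G G' p)" by (rule tensor_cx_postcomp[OF cR Gf Gf' p DQ])
   have fm: "coh_map_at R (?A G) (?E G) i (?f G)" "coh_map_at R (?A G') (?E G') i (?f G')"
    and gm: "coh_map_at R (?A G) (?B G) i (?g G)" "coh_map_at R (?A G') (?B G') i (?g G')"
    using f[OF G] f[OF G'] g[OF G] g[OF G'] by (simp_all add: coh_iso_at_def)
   show "cohom_map (?A G) (?A G') i (?t G G' p) w \<in> carrier (cohom (?A G') i) \<and>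
    cohom_map (?A G') (?E G') i (?f G') (cohom_map (?A G) (?A G') i (?t G G' p) w) =
     far (Ext_T R C T i F) G G' p (cohom_map (?A G) (?E G) i (?f G) w) \<and>
    cohom_map (?A G') (?B G') i (?g G') (cohom_map (?A G) (?A G') i (?t G G' p) w) =
     far (Tor_T R C T (n - i) ?Dn) G G' p (cohom_map (?A G) (?B G) i (?g G) w)"
   proof (intro conjI)
    show "cohom_map (?A G) (?A G') i (?t G G' p) w \<in> carrier (cohom (?A G') i)"
     by (rule lin_closed[OF conjunct1[OF cohom_map_hom[OF m(1)[OF Gf] m(1)[OF Gf'] t, unfolded mod_hom_iff]] w])
    show "cohom_map (?A G') (?E G') i (?f G') (cohom_map (?A G) (?A G') i (?t G G' p) w) =
      far (Ext_T R C T i F) G G' p (cohom_map (?A G) (?E G) i (?f G) w)"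
     unfolding Ext_far
    proof (rule cohom_map_square[OF m(1,2)[OF Gf] m(1,2)[OF Gf'] fm t hom_cx_postcomp[OF cR Gf Gf' p P] _ w])
     fix w assume "w \<in> cocycles (?A G) i"
     then have w: "w \<in> carrier (tensor R C (DD (chob Q (- i))) G)" by (auto dest: cocycles_carrier)
     have c: "theta (chob Q (- i)) G w \<in> nat_hom R C (chob Q (- i)) G" using lin_closed[OF theta_lin[OF Qf ob(1)[OF G]] w] by simp
     show "?f G' (?t G G' p w) = nat_cmp C (chob ?P (- i)) p (?f G w)"
      unfolding DK_simps theta_postcomp[OF Qf ob(1)[OF G] ob(1)[OF G'] p w] nat_cmp_nres
      by (rule nres_cong) (simp add: nres_apply natl_closed[OF \<phi>])
    qed
    show "cohom_map (?A G') (?B G') i (?g G') (cohom_map (?A G) (?A G') i (?t G G' p) w) =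
      far (Tor_T R C T (n - i) ?Dn) G G' p (cohom_map (?A G) (?B G) i (?g G) w)"
     unfolding Tor_far ei cm[symmetric] shift_cx_simps(1)[symmetric]
    proof (rule cohom_map_square[OF m(1,3)[OF Gf] m(1,3)[OF Gf'] gm t tensor_cx_postcomp[OF cR Gf Gf' p Rs] _ w])
     fix w assume "w \<in> cocycles (?A G) i"
     then have w: "w \<in> carrier (tensor R C (chob (DK Q) i) G)" by (auto dest: cocycles_carrier)
     show "?g G' (?t G G' p w) = tensor_map R C (chob (shift_cx ?R n) i) G (chob (shift_cx ?R n) i) G' (nat_id C (chob (shift_cx ?R n) i)) p (?g G w)"
      by (rule tensor_map_exchange[OF cR Gf Gf' p fcxD(1)[OF DQ] fcxD(1)[OF Rs] \<alpha>n w])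
    qed
   qed
  qed
 qed
qed

end

end

end

section \<open>Localizations\<close>

context
 fixes D :: "('x, 'f) category_data" and W :: "'x => 'x => 'f set"
begin

lemma zigzag_obj: "zigzag D W x p y ==> x \<in> obj D \<and> y \<in> obj D" by (induction rule: zigzag.induct) auto

lemma zigzag_append: "zigzag D W x p y ==> zigzag D W y q z ==> zigzag D W x (p @ q) z"
 by (induction rule: zigzag.induct) (auto intro: zigzag.intros)

lemma zigzag_eq_zigzag:
 assumes "!!x. x \<in> obj D ==> category_data.idn D x \<in> arr D x x" "!!x y. W x y \<subseteq> arr D x y"
  and "!!x y z f g. x \<in> obj D ==> y \<in> obj D ==> z \<in> obj D ==> f \<in> arr D x y ==> g \<in> arr D y z ==>
   category_data.cmp D x y z g f \<in> arr D x z"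
 shows "zigzag_eq D W x y p q ==> zigzag D W x p y \<and> zigzag D W x q y"
proof (induction rule: zigzag_eq.induct)
 case (cong x u x' y' p q v y)
 then show ?case by (auto intro: zigzag_append)
qed (use assms in \<open>auto intro!: zigzag.intros\<close>)

text \<open>\<open>H\<close> and \<open>m\<close> form a functor to sets that inverts the arrows in \<open>W\<close>.\<close>

context
 fixes H :: "'x => 'v set" and m :: "'x => 'x => 'f => 'v => 'v"
 assumes m_closed: "!!x y f u. x \<in> obj D ==> y \<in> obj D ==> f \<in> arr D x y ==> u \<in> H x ==> m x y f u \<in> H y"
  and m_id: "!!x u. x \<in> obj D ==> u \<in> H x ==> m x x (category_data.idn D x) u = u"
  and m_cmp: "!!x y z f g u. x \<in> obj D ==> y \<in> obj D ==> z \<in> obj D ==> f \<in> arr D x y ==> g \<in> arr D y z ==> u \<in> H x ==>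
   m x z (category_data.cmp D x y z g f) u = m y z g (m x y f u)"
  and m_W: "!!x y s. x \<in> obj D ==> y \<in> obj D ==> s \<in> W x y ==> bij_betw (m x y s) (H x) (H y)"
begin

text \<open>The action of zigzags induced by a functor that inverts \<open>W\<close>: formal
  inverses act by the inverse bijection. By \<open>act_eq\<close> it depends only on the class of
  the zigzag.\<close>

fun act :: "('x, 'f) step list => 'v => 'v" where
 "act [] u = u"
| "act (Fwd x f y # p) u = act p (m x y f u)"
| "act (Bwd x s y # p) u = act p (inv_into (H y) (m y x s) u)"

lemma inv_closed: "x \<in> obj D ==> y \<in> obj D ==> s \<in> W y x ==> u \<in> H x ==> inv_into (H y) (m y x s) u \<in> H y"
 using m_W[of y x s] by (metis bij_betw_imp_surj_on inv_into_into)

lemma act_closed: "zigzag D W x p y ==> u \<in> H x ==> act p u \<in> H y"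
 by (induction arbitrary: u rule: zigzag.induct) (auto dest: zigzag_obj intro: m_closed inv_closed)

lemma act_append: "act (p @ q) u = act q (act p u)" by (induction p u rule: act.induct) auto

lemma act_eq: "zigzag_eq D W x y p q ==> u \<in> H x ==> act p u = act q u"
proof (induction arbitrary: u rule: zigzag_eq.induct)
 case (cong x v x' y' p q w y)
 then show ?case by (simp add: act_append act_closed)
next
 case (inv_right x y s)
 then show ?case using m_W[of x y s] by (simp add: bij_betw_inv_into_left)
next
 case (inv_left x y s)
 then show ?case using m_W[of x y s] by (simp add: bij_betw_inv_into_right)
qed (simp_all add: m_id m_cmp)

text \<open>Representatives of the two inverse classes act by mutually inverse maps. A bijection of
  sets is all that is extracted, enough to detect trivial modules.\<close>

lemma localization_iso_bij:
 assumes "isomorphic (localization D W) x y"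
 shows "\<exists>\<phi>. bij_betw \<phi> (H x) (H y)"
proof -
 obtain A B where A: "A \<in> {p. zigzag D W x p y} // {(p, q). zigzag_eq D W x y p q}"
  and B: "B \<in> {p. zigzag D W y p x} // {(p, q). zigzag_eq D W y x p q}"
  and AB: "{r. \<exists>p \<in> A. \<exists>q \<in> B. zigzag_eq D W x x (p @ q) r} = {q. zigzag_eq D W x x [] q}"
  and BA: "{r. \<exists>p \<in> B. \<exists>q \<in> A. zigzag_eq D W y y (p @ q) r} = {q. zigzag_eq D W y y [] q}"
  using assms unfolding isomorphic_def localization_def by auto
 obtain p where p: "p \<in> A" "zigzag D W x p y" using A by (elim quotientE) (auto intro: zigzag_eq.refl)
 obtain q where q: "q \<in> B" "zigzag D W y q x" using B by (elim quotientE) (auto intro: zigzag_eq.refl)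
 have "zigzag_eq D W x x [] (p @ q)" using AB p q zigzag_eq.refl[OF zigzag_append[OF p(2) q(2)]] by blast
 then have 1: "act q (act p u) = u" if "u \<in> H x" for u using act_eq[of x x "[]" "p @ q" u] that by (simp add: act_append)
 have "zigzag_eq D W y y [] (q @ p)" using BA p q zigzag_eq.refl[OF zigzag_append[OF q(2) p(2)]] by blast
 then have 2: "act p (act q u) = u" if "u \<in> H y" for u using act_eq[of y y "[]" "q @ p" u] that by (simp add: act_append)
 have "bij_betw (act p) (H x) (H y)" by (rule bij_betw_byWitness[where f' = "act q"]) (use 1 2 act_closed p q in auto)
 then show ?thesis by blast
qed

end

text \<open>Two arrows of \<open>W\<close> with a common source give the zigzag that goes back along
  \<open>s\<close> and forth along \<open>t\<close>; its inverse is the same zigzag read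
  backwards.\<close>

lemma localization_roof:
 assumes cat: "!!x. x \<in> obj D ==> category_data.idn D x \<in> arr D x x" "!!x y. W x y \<subseteq> arr D x y"
   "!!x y z f g. x \<in> obj D ==> y \<in> obj D ==> z \<in> obj D ==> f \<in> arr D x y ==> g \<in> arr D y z ==>
    category_data.cmp D x y z g f \<in> arr D x z"
  and o: "x \<in> obj D" "y \<in> obj D" "z \<in> obj D" and s: "s \<in> W z x" and t: "t \<in> W z y"
 shows "isomorphic (localization D W) x y"
proof -
 note zz = zigzag.intros zigzag_eq.refl
 \<comment> \<open>In the composite the inner steps \<open>t\<close> and its formal inverse cancel
   first, then the two outer steps along \<open>s\<close>.\<close>
 have roof: "zigzag_eq D W x x [] ([Bwd x s z, Fwd z t y] @ [Bwd y t z, Fwd z s x])"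
  if o: "x \<in> obj D" "y \<in> obj D" and s: "s \<in> W z x" and t: "t \<in> W z y" for x y s t
 proof -
  have "zigzag_eq D W x x ([Bwd x s z] @ [Fwd z t y, Bwd y t z] @ [Fwd z s x]) ([Bwd x s z] @ [] @ [Fwd z s x])"
   by (rule zigzag_eq.cong[OF _ zigzag_eq.inv_right]) (use o s t \<open>z \<in> obj D\<close> cat(2) in \<open>auto intro!: zz\<close>)
  moreover have "zigzag_eq D W x x ([Bwd x s z] @ [] @ [Fwd z s x]) []"
   using zigzag_eq.inv_left[of z D x s W] o s \<open>z \<in> obj D\<close> by simp
  ultimately show ?thesis using zigzag_eq.trans zigzag_eq.sym by fastforce
 qed
 define cl where "cl a b p = {q. zigzag_eq D W a b p q}" for a b p
 have cl: "cl a b p \<in> {p. zigzag D W a p b} // {(p, q). zigzag_eq D W a b p q}" if "zigzag D W a p b" for a b p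
  using quotientI[of p "{p. zigzag D W a p b}" "{(p, q). zigzag_eq D W a b p q}"] that by (simp add: cl_def Image_def)
 have cmp: "{r. \<exists>p' \<in> cl a b p. \<exists>q' \<in> cl b a q. zigzag_eq D W a a (p' @ q') r} = {r. zigzag_eq D W a a [] r}"
  if p: "zigzag D W a p b" and q: "zigzag D W b q a" and e: "zigzag_eq D W a a [] (p @ q)" for a b p q
 proof -
  have "zigzag_eq D W a a (p @ q) (p' @ q')" if "p' \<in> cl a b p" "q' \<in> cl b a q" for p' q'
  proof -
   have p': "zigzag_eq D W a b p p'" and q': "zigzag_eq D W b a q q'" using that by (simp_all add: cl_def)
   note a = zigzag.nil[of a D W] and ob = zigzag_obj[OF p]
   have 1: "zigzag_eq D W a a ([] @ p @ q) ([] @ p' @ q)" by (rule zigzag_eq.cong[OF _ p' q]) (use ob in \<open>simp add: zigzag.nil\<close>)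
   have 2: "zigzag_eq D W a a (p' @ q @ []) (p' @ q' @ [])"
    by (rule zigzag_eq.cong[OF _ q']) (use ob zigzag_eq_zigzag[OF cat p'] in \<open>simp_all add: zigzag.nil\<close>)
   show ?thesis using zigzag_eq.trans[OF 1] 2 by simp
  qed
  then have 1: "zigzag_eq D W a a [] (p' @ q')" if "p' \<in> cl a b p" "q' \<in> cl b a q" for p' q'
   using zigzag_eq.trans[OF e] that by blast
  have 2: "p \<in> cl a b p" "q \<in> cl b a q" using zigzag_eq.refl[OF p] zigzag_eq.refl[OF q] by (simp_all add: cl_def)
  show ?thesis using zigzag_eq.trans[OF 1] zigzag_eq.trans[OF zigzag_eq.sym[OF 1]] 2 by blast
 qed
 let ?p = "[Bwd x s z, Fwd z t y]" and ?q = "[Bwd y t z, Fwd z s x]"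
 have p: "zigzag D W x ?p y" and q: "zigzag D W y ?q x" using o s t cat(2) by (auto intro!: zz)
 show ?thesis unfolding isomorphic_def
 proof (intro conjI bexI)
  show "cl x y ?p \<in> arr (localization D W) x y" "cl y x ?q \<in> arr (localization D W) y x"
   using cl[OF p] cl[OF q] by (simp_all add: localization_def)
  show "category_data.cmp (localization D W) x y x (cl y x ?q) (cl x y ?p) = category_data.idn (localization D W) x"
   using cmp[OF p q roof[OF o(1,2) s t]] by (simp add: localization_def)
  show "category_data.cmp (localization D W) y x y (cl x y ?p) (cl y x ?q) = category_data.idn (localization D W) y"
   using cmp[OF q p roof[OF o(2,1) t s]] by (simp add: localization_def)
 qed (use o in \<open>simp_all add: localization_def\<close>)
qed

end

section \<open>The bounded below derived category\<close>

lemma coh_map_cocycle: "coh_map_at R K L i f ==> u \<in> cocycles K i ==> f u \<in> cocycles L i"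
 using lin_closed[of R "Zmod K i" "Zmod L i" f u] by (simp add: coh_map_at_def)

text \<open>Where both cohomology modules vanish any chain map will do: every cocycle of
  \<open>L\<close> is a coboundary, so the cocycle 0 serves as preimage.\<close>

lemma coh_iso_trivial_both:
 assumes K: "mcx R K" and L: "mcx R L" and f: "coh_map_at R K L i f"
  and t: "cocycles K i \<subseteq> coboundaries K i" "cocycles L i \<subseteq> coboundaries L i"
 shows "coh_iso_at R K L i f"
proof -
 have "\<exists>u \<in> cocycles K i. v -[chob L i] f u \<in> coboundaries L i" if v: "v \<in> cocycles L i" for v
 proof
  show z: "0[chob K i] \<in> cocycles K i" by (rule submoduleD(2)[OF mcxD(1)[OF K] cocycles_submodule[OF K]])
  then have "f 0[chob K i] \<in> cocycles L i" by (rule coh_map_cocycle[OF f])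
  then show "v -[chob L i] f 0[chob K i] \<in> coboundaries L i"
   using submoduleD(4)[OF mcxD(1)[OF L] cocycles_submodule[OF L] v] t(2) by blast
 qed
 then show ?thesis using f t by (auto simp: coh_iso_at_def)
qed

lemma zero_fun_simps [simp]: "el zero_fun x = {undefined}" "zero (fob zero_fun x) = undefined"
 by (simp_all add: zero_fun_def)

context
 fixes R :: "'k ring" and C :: "('o, 'a) category_data" and K :: "('o, 'a, 'k, 'u) funcx" and L :: "('o, 'a, 'k, 'u) funcx"
  and p x
 assumes K: "fcx R C K" and L: "fcx R C L" and p: "p \<in> chain_maps R C K L" and x: "x \<in> obj C"
begin

lemma chain_maps_coh_map: "coh_map_at R (eval_cx K x) (eval_cx L x) i (p i x)"
proof (rule chain_map_coh_map_at[where f = "\<lambda>i. p i x", OF fcx_mcx[OF K x] fcx_mcx[OF L x]])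
 have n: "natl R C (chob K i) (chob L i) (p i)" for i using p by (simp add: chain_maps_def nat_hom_natl)
 then show "lin R (chob (eval_cx K x) i) (chob (eval_cx L x) i) (p i x)" for i using natl_lin[OF n x] by simp
 fix i u assume "u \<in> carrier (chob (eval_cx K x) i)"
 then have u: "u \<in> el (chob K i) x" by simp
 have "nat_cmp C (chob K i) (chd L i) (p i) x u = nat_cmp C (chob K i) (p (i + 1)) (chd K i) x u"
  using p by (simp add: chain_maps_def)
 then show "chd (eval_cx L x) i (p i x u) = p (i + 1) x (chd (eval_cx K x) i u)" by (simp add: nat_cmp_apply x u)
qed

end

lemma quasi_isosI:
 assumes K: "fcx R C K" and L: "fcx R C L" and p: "p \<in> chain_maps R C K L"
  and i: "!!i x. x \<in> obj C ==> coh_iso_at R (eval_cx K x) (eval_cx L x) i (p i x)"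
 shows "p \<in> quasi_isos R C K L"
 unfolding quasi_isos_def using p i cohom_map_iso[OF fcx_mcx[OF K] fcx_mcx[OF L]] by blast

context large_yoneda
begin

abbreviation "cplus \<equiv> cx_plus R C (gen_mod R C S) :: (('o, 'a, 'k, 'u) funcx, int => ('o, 'u, 'u) nat_trans) category_data"

lemma cplus_fcx: "K \<in> obj cplus ==> fcx R C K" by (rule is_complex_fcx) (simp add: cx_plus_def)

text \<open>Cohomology in degree \<open>i\<close> at \<open>x\<close> inverts quasi-isomorphisms, so
  an isomorphism in the localization gives a bijection; the cohomology of \<open>K\<close> then has
  a single element.\<close>

lemma derived_iso_trivial:
 fixes K L :: "('o, 'a, 'k, 'u) funcx"
 assumes iso: "isomorphic (derived_plus R C (gen_mod R C S)) K L" and x: "x \<in> obj C"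
  and t: "trivial_mod (cohom (eval_cx L x) i)"
 shows "trivial_mod (cohom (eval_cx K x) i)"
proof -
 have o: "K \<in> obj cplus" using iso by (auto simp: isomorphic_def derived_plus_def localization_def)
 note m = fcx_mcx[OF cplus_fcx x]
 note cm = chain_maps_coh_map[OF cplus_fcx cplus_fcx _ x]
 have "\<exists>\<phi>. bij_betw \<phi> (carrier (cohom (eval_cx K x) i)) (carrier (cohom (eval_cx L x) i))"
 proof (rule localization_iso_bij[where H = "\<lambda>K. carrier (cohom (eval_cx K x) i)" and D = cplus
    and m = "\<lambda>K L p. cohom_map (eval_cx K x) (eval_cx L x) i (p i x)", OF _ _ _ _ iso[unfolded derived_plus_def]])
  fix K L :: "('o, 'a, 'k, 'u) funcx" and p u
  assume K: "K \<in> obj cplus" and L: "L \<in> obj cplus"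
  show "bij_betw (cohom_map (eval_cx K x) (eval_cx L x) i (p i x)) (carrier (cohom (eval_cx K x) i)) (carrier (cohom (eval_cx L x) i))"
   if "p \<in> quasi_isos R C K L" using that x by (auto simp: quasi_isos_def mod_iso_def)
  assume u: "u \<in> carrier (cohom (eval_cx K x) i)"
  have uz: "u \<in> cocycles (eval_cx K x) i" by (rule cohom_carrier[OF m[OF K] u])
  show "cohom_map (eval_cx K x) (eval_cx K x) i (category_data.idn cplus K i x) u = u"
  proof -
   have "category_data.idn cplus K i x u = u" using uz by (simp add: cx_plus_def Zc_iff nat_id_apply x)
   then show ?thesis unfolding cohom_map_apply[OF u] by (simp only: crep_fixed[OF m[OF K] u])
  qed
  assume "p \<in> arr cplus K L"
  then have p: "p \<in> chain_maps R C K L" by (simp add: cx_plus_def)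
  show "cohom_map (eval_cx K x) (eval_cx L x) i (p i x) u \<in> carrier (cohom (eval_cx L x) i)"
   by (rule lin_closed[OF conjunct1[OF cohom_map_hom[OF m[OF K] m[OF L] cm[OF K L p], unfolded mod_hom_iff]] u])
  fix M q assume M: "M \<in> obj cplus" and "q \<in> arr cplus L M"
  then have q: "q \<in> chain_maps R C L M" by (simp add: cx_plus_def)
  have z: "p i x u \<in> cocycles (eval_cx L x) i" by (rule coh_map_cocycle[OF cm[OF K L p] uz])
  have "category_data.cmp cplus K L M q p i x u = q i x (p i x u)"
   using uz by (simp add: cx_plus_def nat_cmp_apply x Zc_iff)
  then show "cohom_map (eval_cx K x) (eval_cx M x) i (category_data.cmp cplus K L M q p i x) u =
    cohom_map (eval_cx L x) (eval_cx M x) i (q i x) (cohom_map (eval_cx K x) (eval_cx L x) i (p i x) u)"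
   unfolding cohom_map_apply[OF u] cohom_map_crep[OF m[OF L] m[OF M] cm[OF L M q] z] by simp
 qed
 then obtain \<phi> where "inj_on \<phi> (carrier (cohom (eval_cx K x) i))" "\<forall>u \<in> carrier (cohom (eval_cx K x) i). \<phi> u = 0[cohom (eval_cx L x) i]"
  using t by (auto simp: bij_betw_def trivial_mod_def)
 note \<phi> = this
 interpret H: module R "cohom (eval_cx K x) i" by (rule cohom_module[OF m[OF o]])
 have "u = 0[cohom (eval_cx K x) i]" if "u \<in> carrier (cohom (eval_cx K x) i)" for u
  using that \<phi> by (metis inj_onD H.zero_closed)
 then show ?thesis by (auto simp: trivial_mod_def)
qed

lemma cplus_I:
 assumes "fcx R C (L :: ('o, 'a, 'k, 'u) funcx)" "!!i. amod (chob L i)" "!!i. chd L i \<in> nat_hom R C (chob L i) (chob L (i + 1))"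
  and "!!i. i < N ==> zero_functor C (chob L i)"
 shows "L \<in> obj cplus" using fcx_is_complex[OF assms(1-3)] assms(4) by (auto simp: cx_plus_def)

lemma concentrated_simps [simp]: "chob (concentrated R C F n) i = (if i = n then F else zero_fun)"
 "chd (concentrated R C F n) i = nres C (if i = n then F else zero_fun) (\<lambda>x u. 0[fob (if i + 1 = n then F else zero_fun) x])"
 by (simp_all add: concentrated_def)

text \<open>
 If \<open>K\<close> has cohomology in degree \<open>n\<close> only, its truncation \<open>\<dots> \<rightarrow> K\<^sup>n\<^sup>-\<^sup>1 \<rightarrow> Z\<^sup>n \<rightarrow> 0\<close> is
 quasi-isomorphic both to \<open>K\<close> and to \<open>H\<^sup>n(K)[n]\<close>.
\<close>

definition trunc :: "('o, 'a, 'k, 'u) funcx => int => ('o, 'a, 'k, 'u) funcx" where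
 "trunc K n = (let X = (\<lambda>i. if i < n then chob K i else if i = n then subf (chob K n) (Zc K n) else zero_fun) in
   \<lparr>chob = X, chd = (\<lambda>i. if i < n then chd K i else nres C (X i) (\<lambda>x u. undefined))\<rparr>)"

lemma trunc_simps: "i < n ==> chob (trunc K n) i = chob K i" "chob (trunc K n) n = subf (chob K n) (Zc K n)"
 "i > n ==> chob (trunc K n) i = zero_fun" "i < n ==> chd (trunc K n) i = chd K i"
 "i \<ge> n ==> chd (trunc K n) i = nres C (chob (trunc K n) i) (\<lambda>x u. undefined)" by (simp_all add: trunc_def Let_def)

lemma zero_fun_lin: "lin R M (fob (zero_fun :: ('o, 'a, 'k, 'u) modfun) x) (\<lambda>u. undefined)"
 by (rule linI) (simp_all add: zero_fun_def)

text \<open>\<open>undefined\<close> is the only element of \<open>zero_fun\<close>, so the constant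
  family is the zero map; it is the differential of \<open>trunc\<close> from degree
  \<open>n\<close> on.\<close>

lemma natl_zero_fun: "natl R C F (zero_fun :: ('o, 'a, 'k, 'u) modfun) (\<lambda>x u. undefined)"
 by (rule natlI[OF zero_fun_lin]) (simp add: zero_fun_def)

lemma concentrated_fcx:
 assumes F: "modf R C (F :: ('o, 'a, 'k, 'u) modfun)"
 shows "fcx R C (concentrated R C F n)" "chd (concentrated R C F n) i \<in> nat_hom R C (chob (concentrated R C F n) i) (chob (concentrated R C F n) (i + 1))"
proof -
 have X: "modf R C (if i = n then F else zero_fun)" for i by (cases "i = n") (simp_all add: F zero_fun_functor)
 show h: "chd (concentrated R C F n) i \<in> nat_hom R C (chob (concentrated R C F n) i) (chob (concentrated R C F n) (i + 1))" for i
  unfolding concentrated_simps by (rule nres_hom[OF X natl_zero[OF X]])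
 show "fcx R C (concentrated R C F n)" unfolding fcx_def
 proof (intro conjI allI ballI)
  show "modf R C (chob (concentrated R C F n) i)" for i unfolding concentrated_simps by (rule X)
  show "natl R C (chob (concentrated R C F n) i) (chob (concentrated R C F n) (i + 1)) (chd (concentrated R C F n) i)" for i
   by (rule nat_hom_natl[OF h])
  show "chd (concentrated R C F n) (i + 1) x (chd (concentrated R C F n) i x w) = 0[fob (chob (concentrated R C F n) (i + 1 + 1)) x]"
   if "x \<in> obj C" "w \<in> el (chob (concentrated R C F n) i) x" for i x w
   unfolding concentrated_simps using that mf_zero[OF F that(1)] by (auto simp: nres_apply)
 qed
qed

lemma concentrated_trivial:
 assumes F: "modf R C (F :: ('o, 'a, 'k, 'u) modfun)" and i: "i \<noteq> n" and x: "x \<in> obj C"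
 shows "trivial_mod (cohom (eval_cx (concentrated R C F n) x) i)"
 by (rule trivial_cohom[OF fcx_mcx[OF concentrated_fcx(1)[OF F] x]]) (simp add: i trivial_mod_def)

context
 fixes K :: "('o, 'a, 'k, 'u) funcx" and n :: int
 assumes K: "K \<in> obj cplus"
  and ex: "!!i x. i \<noteq> n ==> x \<in> obj C ==> trivial_mod (cohom (eval_cx K x) i)"
begin

lemma K_props: "fcx R C K" "amod (chob K i)" "chd K i \<in> nat_hom R C (chob K i) (chob K (i + 1))"
 using K cplus_fcx[OF K] by (auto simp: cx_plus_def is_complex_def gen_mod_iff)

lemmas Kf = fcxD(1)[OF K_props(1)] and Kn = fcxD(2)[OF K_props(1)] and KZ = Zc_stable[OF K_props(1), of n] and KB = Bc_stable[OF K_props(1), of n]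

lemma trunc_functor: "modf R C (chob (trunc K n) i)" and trunc_amod: "amod (chob (trunc K n) i)"
 by (cases i n rule: linorder_cases;
   simp add: trunc_simps Kf K_props(2) subf_functor[OF ct Kf KZ] zero_fun_functor zero_fun_amod amod_subf[OF K_props(2) KZ])+

lemma trunc_hom: "chd (trunc K n) i \<in> nat_hom R C (chob (trunc K n) i) (chob (trunc K n) (i + 1))"
proof -
 consider "i + 1 < n" | "i + 1 = n" | "i \<ge> n" by linarith
 then show ?thesis
 proof cases
  case 1
  then show ?thesis using K_props(3)[of i] by (simp add: trunc_simps)
 next
  case 2
  then have i: "i = n - 1" by simp
  have "natl R C (chob K (n - 1)) (subf (chob K n) (Zc K n)) (chd K (n - 1))"
   by (rule natl_subf_target[OF fcxD(3)[OF K_props(1)]])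
     (use fcxD(4)[OF K_props(1)] natl_closed[OF fcxD(3)[OF K_props(1)]] in \<open>simp add: Zc_iff\<close>)
  then show ?thesis using K_props(3)[of "n - 1"] unfolding i by (simp add: trunc_simps nat_hom_iff)
 next
  case 3
  then show ?thesis using nres_hom[OF trunc_functor natl_zero_fun] by (simp add: trunc_simps)
 qed
qed

lemma trunc_fcx: "fcx R C (trunc K n)"
 unfolding fcx_def
proof (intro conjI allI ballI trunc_functor nat_hom_natl[OF trunc_hom])
 fix i x w assume x: "x \<in> obj C" and w: "w \<in> el (chob (trunc K n) i) x"
 have c: "chd (trunc K n) i x w \<in> el (chob (trunc K n) (i + 1)) x"
  by (rule natl_closed[OF nat_hom_natl[OF trunc_hom] x w])
 show "chd (trunc K n) (i + 1) x (chd (trunc K n) i x w) = 0[fob (chob (trunc K n) (i + 1 + 1)) x]"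
 proof (cases "i + 1 < n")
  case True
  then have "chd K (i + 1) x (chd K i x w) = 0[fob (chob K (i + 1 + 1)) x]"
   using fcxD(4)[OF K_props(1) x, of w "i + 1"] w by (simp add: trunc_simps)
  then show ?thesis using True by (cases "i + 1 + 1 = n") (auto simp: trunc_simps)
 next
  case False
  then show ?thesis using c x by (simp add: trunc_simps nres_apply)
 qed
qed

abbreviation "Hn \<equiv> cohom_fun K n"

lemma Hn_amod: "amod Hn" unfolding cohom_fun_sqf by (rule amod_sqf[OF K_props(2) KZ KB Bc_Zc[OF K_props(1)]])

lemmas Hnf = amod_functor[OF Hn_amod]
lemmas sq = ct Kf KZ KB Bc_Zc[OF K_props(1)]

lemma Hn_zero_iff:
 assumes x: "x \<in> obj C" and w: "w \<in> Zc K n x"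
 shows "sqrep (chob K n) (Zc K n) (Bc K n) x w = 0[fob Hn x] \<longleftrightarrow> w \<in> Bc K n x"
 using crep_zero_iff[OF fcx_mcx[OF K_props(1) x] w] by (simp add: cohom_fun_def)

lemma trunc_Zc: "i \<le> n ==> x \<in> obj C ==> Zc (trunc K n) i x = Zc K i x" and trunc_Bc: "i \<le> n ==> x \<in> obj C ==> Bc (trunc K n) i x = Bc K i x"
proof -
 assume i: "i \<le> n" and x: "x \<in> obj C"
 show "Zc (trunc K n) i x = Zc K i x"
 proof (cases "i = n")
  case True
  then show ?thesis using x by (auto simp: Zc_iff trunc_simps nres_apply)
 next
  case False
  then show ?thesis using i by (cases "i + 1 = n") (auto simp: Zc_iff trunc_simps)
 qed
 show "Bc (trunc K n) i x = Bc K i x" using i by (simp add: Bc_eq trunc_simps)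
qed

lemma trunc_Zc_above: "i > n ==> x \<in> obj C ==> Zc (trunc K n) i x \<subseteq> Bc (trunc K n) i x"
proof -
 assume i: "i > n" and x: "x \<in> obj C"
 have "0[fob (chob (trunc K n) i) x] \<in> Bc (trunc K n) i x"
  using submoduleD(2)[OF mcxD(1) coboundaries_submodule, OF fcx_mcx[OF trunc_fcx x] fcx_mcx[OF trunc_fcx x], of i] by simp
 then show ?thesis using i by (auto simp: Zc_iff trunc_simps)
qed

lemma K_exact: "i \<noteq> n ==> x \<in> obj C ==> Zc K i x \<subseteq> Bc K i x"
 using ex trivial_cohom_iff[OF fcx_mcx[OF K_props(1)]] by blast

text \<open>Up to degree \<open>n\<close> the truncation has the same cocycles and coboundaries as
  \<open>K\<close>; above \<open>n\<close> neither complex has cohomology.\<close>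

lemma trunc_incl: "(\<lambda>i. nres C (chob (trunc K n) i) (\<lambda>x u. if i \<le> n then u else 0[fob (chob K i) x])) \<in> quasi_isos R C (trunc K n) K" (is "?s \<in> _")
proof (rule quasi_isosI[OF trunc_fcx K_props(1)])
 have h: "?s i \<in> nat_hom R C (chob (trunc K n) i) (chob K i)" for i
 proof (rule nres_hom[OF trunc_functor])
  show "natl R C (chob (trunc K n) i) (chob K i) (\<lambda>x u. if i \<le> n then u else 0[fob (chob K i) x])"
   using natl_id[of R C "chob K i"] subf_incl[OF Kf KZ] natl_zero[OF Kf[of i]]
   by (cases i n rule: linorder_cases) (simp_all add: trunc_simps)
 qed
 note dc = natl_closed[OF nat_hom_natl[OF trunc_hom]]
 have cs: "chd K i x (?s i x u) = ?s (i + 1) x (chd (trunc K n) i x u)"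
  if x: "x \<in> obj C" and u: "u \<in> el (chob (trunc K n) i) x" for i x u
 proof (cases i n rule: linorder_cases)
  case less
  then show ?thesis using u x dc[OF x u] by (simp add: nres_apply trunc_simps)
 next
  case equal
  then show ?thesis using u x dc[OF x u] by (simp add: nres_apply trunc_simps Zc_iff)
 next
  case greater
  then show ?thesis using u x dc[OF x u] lin_zero[OF mf_mod[OF Kf x] mf_mod[OF Kf x] natl_lin[OF Kn x]] by (simp add: nres_apply)
 qed
 show c: "?s \<in> chain_maps R C (trunc K n) K"
  unfolding chain_maps_def using h cs by (auto simp: nat_cmp_nres intro!: nres_cong)
 fix i x assume x: "x \<in> obj C"
 note cm = chain_maps_coh_map[OF trunc_fcx K_props(1) c x, of i]
 note m = fcx_mcx[OF trunc_fcx x] fcx_mcx[OF K_props(1) x]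
 show "coh_iso_at R (eval_cx (trunc K n) x) (eval_cx K x) i (?s i x)"
 proof (cases "i \<le> n")
  case True
  have s: "?s i x u = u" if "u \<in> Zc K i x" for u
   using that True cocycles_carrier[of u "eval_cx (trunc K n) x" i] trunc_Zc[OF True x] x by (simp add: nres_apply)
  have z: "v -[chob (eval_cx K x) i] v \<in> Bc K i x" if "v \<in> Zc K i x" for v
   using minus_eq_zero_iff[OF mcxD(1)[OF m(2)] cocycles_carrier[OF that] cocycles_carrier[OF that]]
    submoduleD(2)[OF mcxD(1)[OF m(2)] coboundaries_submodule[OF m(2)]] by simp
  show ?thesis unfolding coh_iso_at_def trunc_Zc[OF True x] trunc_Bc[OF True x] using cm s z by metis
 next
  case False
  then show ?thesis by (intro coh_iso_trivial_both[OF m cm] trunc_Zc_above K_exact x) auto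
 qed
qed

text \<open>In degree \<open>n\<close> this is the projection of the cocycles onto cohomology, whose
  kernel is exactly the coboundaries; in other degrees neither complex has cohomology.\<close>

lemma trunc_proj:
 "(\<lambda>i. nres C (chob (trunc K n) i) (\<lambda>x u. if i = n then sqrep (chob K n) (Zc K n) (Bc K n) x u else undefined))
   \<in> quasi_isos R C (trunc K n) (concentrated R C Hn n)" (is "?s \<in> quasi_isos R C _ ?C")
proof (rule quasi_isosI[OF trunc_fcx concentrated_fcx(1)[OF Hnf]])
 have h: "?s i \<in> nat_hom R C (chob (trunc K n) i) (chob ?C i)" for i
 proof (rule nres_hom[OF trunc_functor])
  show "natl R C (chob (trunc K n) i) (chob ?C i) (\<lambda>x u. if i = n then sqrep (chob K n) (Zc K n) (Bc K n) x u else undefined)"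
   using sqf_proj[OF sq] natl_zero_fun by (cases "i = n") (simp_all add: trunc_simps cohom_fun_sqf)
 qed
 note dc = natl_closed[OF nat_hom_natl[OF trunc_hom]]
 have Z: "chd K (n - 1) x u \<in> Bc K n x" if "u \<in> el (chob K (n - 1)) x" for u x using that by (simp add: Bc_eq)
 have cs: "chd ?C i x (?s i x u) = ?s (i + 1) x (chd (trunc K n) i x u)"
  if x: "x \<in> obj C" and u: "u \<in> el (chob (trunc K n) i) x" for i x u
 proof -
  have "chd ?C i x (?s i x u) = 0[fob (if i + 1 = n then Hn else zero_fun) x]"
   using natl_closed[OF nat_hom_natl[OF h] x u] x by (simp add: nres_apply)
  also have "\<dots> = ?s (i + 1) x (chd (trunc K n) i x u)"
  proof (cases "i + 1 = n")
   case True
   then have i: "i = n - 1" by simp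
   have b: "chd K i x u \<in> Bc K n x" using Z[of u x] u unfolding i by (simp add: trunc_simps)
   have "sqrep (chob K n) (Zc K n) (Bc K n) x (chd K i x u) = 0[fob Hn x]"
    using Hn_zero_iff[OF x, of "chd K i x u"] b Bc_Zc[OF K_props(1) x, of n] by blast
   then show ?thesis using True dc[OF x u] x by (simp add: nres_apply trunc_simps)
  next
   case False
   then show ?thesis using dc[OF x u] x by (simp add: nres_apply)
  qed
  finally show ?thesis .
 qed
 show c: "?s \<in> chain_maps R C (trunc K n) ?C"
  unfolding chain_maps_def using h cs by (auto simp: nat_cmp_nres intro!: nres_cong simp del: concentrated_simps)
 fix i x assume x: "x \<in> obj C"
 note cm = chain_maps_coh_map[OF trunc_fcx concentrated_fcx(1)[OF Hnf] c x, of i]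
 note m = fcx_mcx[OF trunc_fcx x] fcx_mcx[OF concentrated_fcx(1)[OF Hnf] x]
 show "coh_iso_at R (eval_cx (trunc K n) x) (eval_cx ?C x) i (?s i x)"
 proof (cases "i = n")
  case True
  \<comment> \<open>All differentials of the concentrated complex are zero, so zero is its only
    coboundary.\<close>
  have zB: "v \<in> Bc ?C n x \<longleftrightarrow> v = 0[fob Hn x]" for v using x by (auto simp: Bc_eq nres_apply image_iff)
  have s: "?s n x u = sqrep (chob K n) (Zc K n) (Bc K n) x u" if "u \<in> Zc K n x" for u
   using that x by (simp add: nres_apply trunc_simps)
  have "\<exists>u \<in> Zc K n x. v -[chob (eval_cx ?C x) n] ?s n x u \<in> Bc ?C n x" if "v \<in> Zc ?C n x" for v
  proof
   have v: "v \<in> el Hn x" using cocycles_carrier[OF that] by simp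
   then have v': "v \<in> carrier (cohom (eval_cx K x) n)" by (simp add: cohom_fun_def)
   note mK = fcx_mcx[OF K_props(1) x]
   show vz: "v \<in> Zc K n x" by (rule cohom_carrier[OF mK v'])
   have "?s n x v = v" unfolding s[OF vz] using crep_fixed[OF mK v'] by simp
   then show "v -[chob (eval_cx ?C x) n] ?s n x v \<in> Bc ?C n x"
    unfolding zB using minus_eq_zero_iff[OF mf_mod[OF Hnf x] v v] by simp
  qed
  moreover have "u \<in> Bc K n x" if "u \<in> Zc K n x" "?s n x u \<in> Bc ?C n x" for u
   using that(2) Hn_zero_iff[OF x that(1)] unfolding zB s[OF that(1)] by blast
  ultimately show ?thesis using cm unfolding True coh_iso_at_def trunc_Zc[OF order_refl x] trunc_Bc[OF order_refl x] by blast
 next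
  case False
  have "Zc (trunc K n) i x \<subseteq> Bc (trunc K n) i x"
   using trunc_Zc_above[of i x] K_exact[OF False x] trunc_Zc[of i x] trunc_Bc[of i x] x by (cases "i \<le> n") auto
  then show ?thesis
   using concentrated_trivial[OF Hnf False x] unfolding trivial_cohom_iff[OF m(2)] by (intro coh_iso_trivial_both[OF m cm])
 qed
qed

lemma exact_iso_concentrated: "isomorphic (derived_plus R C (gen_mod R C S)) K (concentrated R C Hn n)"
 unfolding derived_plus_def
proof (rule localization_roof[where D = cplus and W = "quasi_isos R C" and z = "trunc K n", OF _ _ _ K _ _ trunc_incl trunc_proj])
 obtain N where N: "!!i. i < N ==> zero_functor C (chob K i)" using K by (auto simp: cx_plus_def)
 show "concentrated R C Hn n \<in> obj cplus"
  by (rule cplus_I[where N = n, OF concentrated_fcx(1)[OF Hnf] _ concentrated_fcx(2)[OF Hnf]])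
    (auto simp: Hn_amod zero_fun_amod zero_functor_zero_fun)
 show "trunc K n \<in> obj cplus"
  by (rule cplus_I[where N = "min N n", OF trunc_fcx trunc_amod trunc_hom]) (simp add: trunc_simps N)
 show "quasi_isos R C K L \<subseteq> arr cplus K L" for K L by (auto simp: quasi_isos_def cx_plus_def)
 show "category_data.idn cplus L \<in> arr cplus L L" if "L \<in> obj cplus" for L
 proof -
  note Lf = fcxD[OF cplus_fcx[OF that]]
  show ?thesis
   using nat_id_hom[OF Lf(1)] natl_closed[OF Lf(2)]
   by (auto simp: cx_plus_def chain_maps_def nat_cmp_nres nat_id_nres nres_apply intro!: nres_cong)
 qed
 fix A B L f g assume o: "A \<in> obj cplus" "B \<in> obj cplus" "L \<in> obj cplus" and "f \<in> arr cplus A B" "g \<in> arr cplus B L"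
 then have f: "f \<in> chain_maps R C A B" and g: "g \<in> chain_maps R C B L" by (simp_all add: cx_plus_def)
 note Af = fcxD[OF cplus_fcx[OF o(1)]]
 have fh: "f i \<in> nat_hom R C (chob A i) (chob B i)" and gh: "g i \<in> nat_hom R C (chob B i) (chob L i)" for i
  using f g by (simp_all add: chain_maps_def)
 have fe: "chd B i x (f i x u) = f (i + 1) x (chd A i x u)" if "x \<in> obj C" "u \<in> el (chob A i) x" for i x u
 proof -
  have "nat_cmp C (chob A i) (chd B i) (f i) x u = nat_cmp C (chob A i) (f (i + 1)) (chd A i) x u" using f by (simp add: chain_maps_def)
  then show ?thesis by (simp add: nat_cmp_apply that)
 qed
 have ge: "chd L i x (g i x u) = g (i + 1) x (chd B i x u)" if "x \<in> obj C" "u \<in> el (chob B i) x" for i x u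
 proof -
  have "nat_cmp C (chob B i) (chd L i) (g i) x u = nat_cmp C (chob B i) (g (i + 1)) (chd B i) x u" using g by (simp add: chain_maps_def)
  then show ?thesis by (simp add: nat_cmp_apply that)
 qed
 show "category_data.cmp cplus A B L g f \<in> arr cplus A L"
  using nat_cmp_hom[OF Af(1) fh gh] natl_closed[OF Af(2)] natl_closed[OF nat_hom_natl[OF fh]] fe ge
  by (auto simp: cx_plus_def chain_maps_def nat_cmp_nres nres_apply intro!: nres_cong)
qed

end

end

section \<open>The equivalence of the three conditions, and projective dimension\<close>

context yoneda_large
begin

lemma tensor_zero:
 assumes F: "modf R (op_cat C) F" and z: "zero_functor (op_cat C) F" and G: "modf R C G"
 shows "trivial_mod (tensor R C F G)"
proof -
 note t = tp[OF cR G F]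
 interpret M: module R "tensor R C F G" by (rule tensor_pair.tensor_module[OF t])
 have "submodule {0[tensor R C F G]} R (tensor R C F G)"
  by (rule submoduleI'[OF tensor_pair.tensor_module[OF t]]) auto
 then have "carrier (tensor R C F G) \<subseteq> {0[tensor R C F G]}"
 proof (rule tensor_pair.tensor_induct[OF t])
  fix x a b assume x: "x \<in> obj C" and a: "a \<in> el F x" and b: "b \<in> el G x"
  then have "a = 0[fob F x]" using z by (auto simp: zero_functor_def trivial_mod_def)
  then show "tensor_pair.tn R C F G x a b \<in> {0[tensor R C F G]}" using tensor_pair.tn_zero_l[OF t x b] by simp
 qed
 then show ?thesis by (auto simp: trivial_mod_def)
qed

context
 fixes F :: "('o, 'a, 'k, 'm) modfun"
 assumes F: "low.amod F"
begin

lemma Ext_RD: "x \<in> obj C ==> fob (Ext_T R C T i F) (S x) = cohom (eval_cx (DK (resolution F)) x) i"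
 by (simp only: Ext_fob eval_DK)

lemma RD_cplus: "DK (resolution F) \<in> obj up.cplus"
proof (rule up.cplus_I[where N = 0])
 note P = resolution_props[OF F]
 show "fcx R (op_cat C) (DK (resolution F))" by (rule DK_fcx[OF P(1)])
 show "up.amod (chob (DK (resolution F)) i)" for i unfolding DK_simps by (rule dual_amod[OF P(2)])
 show "chd (DK (resolution F)) i \<in> nat_hom R (op_cat C) (chob (DK (resolution F)) i) (chob (DK (resolution F)) (i + 1))" for i
  by (rule DK_hom[OF P(1)])
 show "zero_functor (op_cat C) (chob (DK (resolution F)) i)" if "i < 0" for i
  unfolding DK_simps using resolution_proj[OF F] that by (intro dual_zero[OF P(2)]) (auto simp: proj_resolution_def)
qed

lemma eilenberg_maclane_iff: "eilenberg_maclane R C T F n \<longleftrightarrow> ext_vanishing R C T F n"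
proof -
 have e: "eilenberg_maclane R C T F n \<longleftrightarrow> isomorphic (derived_plus R (op_cat C) (gen_mod R (op_cat C) U))
   (DK (resolution F)) (concentrated R (op_cat C) (cohom_fun (DK (resolution F)) n) n)"
  by (simp only: eilenberg_maclane_def CTop_mod_def Dn_def RD_DK)
 have v: "ext_vanishing R C T F n \<longleftrightarrow> (\<forall>i x. i \<noteq> n \<longrightarrow> x \<in> obj (op_cat C) \<longrightarrow> trivial_mod (cohom (eval_cx (DK (resolution F)) x) i))"
  unfolding ext_vanishing_def by (auto simp: Ext_RD)
 have Dn: "modf R (op_cat C) (cohom_fun (DK (resolution F)) n)"
  using up.amod_functor[OF Dn_amod[OF F, of n]] by (simp only: Dn_def RD_DK)
 show ?thesis unfolding e v
  using up.exact_iso_concentrated[OF RD_cplus, of n] up.derived_iso_trivial up.concentrated_trivial[OF Dn] by blast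
qed

text \<open>The index \<open>n - m\<close> of \<open>Tor\<close> is negative, and a resolution is
  zero in the corresponding degree \<open>m - n > 0\<close>.\<close>

lemma duality_above:
 assumes d: "ext_tor_duality R C T F n" and m: "m > n" and G: "low.amod (G :: ('o, 'a, 'k, 'm) modfun)"
 shows "trivial_mod (fob (Ext_T R C T m F) G)"
proof (rule duality_trivial[OF F d G])
 let ?R = "resolution_op (Dn R C T n F)"
 obtain e where e: "proj_resolution R (op_cat C) (gen_mod R (op_cat C) U) ?R e (Dn R C T n F)"
  using resolution_op_proj[OF Dn_amod[OF F]] by blast
 have "zero_functor (op_cat C) (chob ?R (m - n))" using e m by (auto simp: proj_resolution_def)
 then have "trivial_mod (chob (tensor_cx R C ?R G) (m - n))"
  unfolding tensor_cx_simps by (rule tensor_zero[OF fcxD(1)[OF resolution_op_props(1)[OF F]] _ low.amod_functor[OF G]])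
 then show "trivial_mod (cohom (tensor_cx R C ?R G) (m - n))" by (rule trivial_cohom[OF Tor_mcx[OF F G]])
qed

text \<open>The augmentation is a cocycle in degree 0 of the Hom complex into \<open>F\<close>; it
  represents the identity of \<open>F\<close>. If it is a coboundary, it factors through the term of
  degree 1 of the resolution, which is zero; being surjective as well, it forces
  \<open>F = 0\<close>.\<close>

lemma Ext0_trivial:
 assumes t: "trivial_mod (fob (Ext_T R C T 0 F) F)"
 shows "zero_functor C F"
proof -
 let ?P = "resolution F"
 note Ff = low.amod_functor[OF F]
 note P = resolution_props[OF F] and m = Ext_mcx[OF F F]
 obtain e where e: "proj_resolution R C (gen_mod R C S) ?P e F" using resolution_proj[OF F] by blast
 then have eh: "e \<in> nat_hom R C (chob ?P 0) F" and es: "nat_surj C (chob ?P 0) F e"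
  and ek: "!!x. x \<in> obj C ==> ker_in (fob (chob ?P 0) x) (e x) (fob F x) = coboundaries (eval_cx ?P x) 0"
  and z: "zero_functor C (chob ?P 1)" by (auto simp: proj_resolution_def)
 have "nat_cmp C (chob ?P (- 1)) e (chd ?P (- 1)) = nres C (chob ?P (- 1)) (\<lambda>x u. 0[fob F x])"
  unfolding nat_cmp_nres
 proof (rule nres_cong)
  fix x u assume x: "x \<in> obj C" and "u \<in> el (chob ?P (- 1)) x"
  then have "chd ?P (- 1) x u \<in> ker_in (fob (chob ?P 0) x) (e x) (fob F x)" unfolding ek[OF x] by (simp add: Bc_eq)
  then show "e x (chd ?P (- 1) x u) = 0[fob F x]" by (simp add: ker_in_def)
 qed
 then have "e \<in> cocycles (hom_cx R C ?P F) 0"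
  using eh hom_cx_chd[of e R C ?P 0 F] by (simp add: cocycles_def ker_in_def hom_cx_chob)
 then have "e \<in> coboundaries (hom_cx R C ?P F) 0" using t unfolding Ext_fob trivial_cohom_iff[OF m] by blast
 then obtain u where u: "u \<in> nat_hom R C (chob ?P 1) F" and "e = chd (hom_cx R C ?P F) (- 1) u"
  by (auto simp: coboundaries_def hom_cx_chob)
 then have eu: "e = nat_cmp C (chob ?P 0) u (chd ?P 0)" using hom_cx_chd[of u R C ?P "- 1" F] by simp
 have ez: "e x w = 0[fob F x]" if x: "x \<in> obj C" and w: "w \<in> el (chob ?P 0) x" for x w
 proof -
  have "chd ?P 0 x w \<in> el (chob ?P 1) x" using natl_closed[OF fcxD(2)[OF P(1), of 0] x w] by simp
  then have "chd ?P 0 x w = 0[fob (chob ?P 1) x]" using z x by (auto simp: zero_functor_def trivial_mod_def)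
  then show ?thesis
   unfolding eu nat_cmp_apply[OF x w] using lin_zero[OF mf_mod[OF P(2) x] mf_mod[OF Ff x] natl_lin[OF nat_hom_natl[OF u] x]] by simp
 qed
 have "el F x \<subseteq> {0[fob F x]}" if x: "x \<in> obj C" for x
 proof -
  have "el F x = e x ` el (chob ?P 0) x" using es x by (simp add: nat_surj_def)
  then show ?thesis using ez[OF x] by auto
 qed
 then show ?thesis using mf_zero[OF Ff] unfolding zero_functor_def trivial_mod_def by blast
qed

context
 assumes FP: "type_FP R C S F"
begin

lemma ext_tor_duality_iff: "ext_tor_duality R C T F n \<longleftrightarrow> ext_vanishing R C T F n"
 using duality_vanishing[OF F] vanishing_duality[OF F FP] by blast

text \<open>
 If \<open>Ext\<^sup>i(F, T\<^sub>x)\<close> also vanishes for \<open>i = n\<close>, duality holds in degree \<open>-1\<close> as well, and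
 \<open>Hom(F, F) = Tor\<^sub>-\<^sub>1(D\<^sup>-\<^sup>1(F), F) = 0\<close>.
\<close>

lemma duality_proj_dim:
 assumes d: "ext_tor_duality R C T F n" and nz: "\<not> zero_functor C F"
 shows "has_proj_dim R C (CT_mod R C T) F n"
 unfolding has_proj_dim_def Ext_T_def[symmetric]
proof (intro conjI allI impI ballI)
 show "trivial_mod (fob (Ext_T R C T m F) G)" if "m > n" "G \<in> CT_mod R C T" for m G
  using duality_above[OF d] that by (simp add: CT_iff)
 show "\<exists>G \<in> CT_mod R C T. \<not> trivial_mod (fob (Ext_T R C T n F) G)"
 proof (rule ccontr)
  assume "\<not> ?thesis"
  then have "trivial_mod (fob (Ext_T R C T n F) (S x))" if "x \<in> obj C" for x
   using low.S_amod[OF that] by (auto simp: CT_iff)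
  \<comment> \<open>Duality in degree \<open>n\<close> gives vanishing for
    \<open>i \<noteq> n\<close> and the assumption covers \<open>i = n\<close>. The degree -1 is
    chosen because it lies below 0, so that \<open>duality_above\<close> reaches \<open>Ext\<close>
    in degree 0.\<close>
  then have "ext_vanishing R C T F (- 1)" using d unfolding ext_tor_duality_iff ext_vanishing_def by metis
  then have "trivial_mod (fob (Ext_T R C T 0 F) F)"
   unfolding ext_tor_duality_iff[symmetric] by (rule duality_above) (simp_all add: F)
  then show False using Ext0_trivial nz by blast
 qed
qed

end

end

end


text \<open>For \<open>F = 0\<close> all three conditions hold with every \<open>n\<close> while no
  integer is a projective dimension; this is why the last clause speaks of nonzero
  \<open>F\<close>.\<close>

theorem theorem5p5:
  fixes R :: "'k ring"
    and C :: "('o, 'a) category_data"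
    and T :: "('o \<times> 'o, 'a \<times> 'a, 'k, 'm) modfun"
    and \<mu> :: "('o \<times> 'o, 'a => 'k, 'm) nat_trans"
    and F :: "('o, 'a, 'k, 'm) modfun"
  assumes "cring R"
    and "category C"
    and "large_type TYPE('m) R"
    and "essentially_small TYPE('m) C"
    and "yoneda_bifunctor R C T \<mu>"
    and "F \<in> CT_mod R C T"
    and "type_FP R C (T_lower C T) F"
  shows "((\<exists>n. eilenberg_maclane R C T F n) \<longleftrightarrow> (\<exists>n. ext_vanishing R C T F n))
       \<and> ((\<exists>n. ext_vanishing R C T F n) \<longleftrightarrow> (\<exists>n. ext_tor_duality R C T F n))
       \<and> (\<not> zero_functor C F \<longrightarrow>
            (\<forall>n. eilenberg_maclane R C T F n \<or> ext_vanishing R C T F n \<or> ext_tor_duality R C T F n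
               \<longrightarrow> has_proj_dim R C (CT_mod R C T) F n))"
proof -
 have inf: "infinite (UNIV :: 'm set)" using assms(3) by (simp add: large_type_def)
 \<comment> \<open>An infinite type is in bijection with its square; the bijection serves as the
   pairing used to code free functors.\<close>
 obtain prm :: "'m \<times> 'm => 'm" where "bij_betw prm (UNIV \<times> UNIV) UNIV"
  using card_of_Times_same_infinite[OF inf] unfolding card_of_ordIso[symmetric] by blast
 then have prm: "inj prm" by (simp add: bij_betw_def)
 obtain skm :: "'o => 'm" where skm: "\<forall>x \<in> obj C. \<forall>y \<in> obj C. skm x = skm y \<longrightarrow> isomorphic C x y"
  using assms(4) by (auto simp: essentially_small_def)
 interpret yoneda_large R C T \<mu> prm skm
  by (intro yoneda_large.intro yoneda_bif.intro yoneda_large_axioms.intro assms(1,2,5) prm inf) (use skm in blast)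
 have F: "low.amod F" using assms(6) by (simp add: CT_iff)
 note iff = eilenberg_maclane_iff[OF F] ext_tor_duality_iff[OF F assms(7)]
 show ?thesis unfolding iff using duality_proj_dim[OF F assms(7)] unfolding iff by blast
qed

end
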